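(* Let $k$ be a positive integer. There is an algorithm that solves the following problem in time bounded by a polynomial in $n^k$. The input consists of finite groups $G$ and $G_0$ of order $n$ given by their Cayley tables, abelian normal subgroups $A \unlhd G$ and $A_0 \unlhd G_0$, and an isomorphism $\psi : G/A \to G_0/A_0$, where $G/A$ is $k$-generated. The algorithm decides whether there exists an isomorphism $\Phi : G \to G_0$ such that $\Phi(A) = A_0$ and $\Phi$ induces $\psi$ between $G/A$ and $G_0/A_0$ (that is, $\Phi(g)A_0 = \psi(gA)$ for all $g \in G$). If such an isomorphism exists, then the algorithm also computes, in the same time, the coset of all such isomorphisms.
   Context: A group of order $n$ is given by its Cayley table if its elements are numbered $1,\dots,n$ and its $n\times n$ multiplication table is given. Subgroups are specified as lists of their elements, and homomorphisms between groups given by Cayley tables are specified as lists of element-image pairs (a quotient $G/A$ is given by the Cayley table computed from that of $G$ and the natural homomorphism). A group is $k$-generated if it can be generated by $k$ (not necessarily distinct) elements. The polynomial in the time bound does not depend on $k$. Let $\mathrm{Aut}_0(G,A)$ be the subgroup of $\mathrm{Aut}(G)$ consisting of all automorphisms which stabilize $A$ (as a set) and act trivially on $G/A$. If $\Phi_1 : G \to G_0$ is one isomorphism with $\Phi_1(A)=A_0$ inducing $\psi$, then the set of all such isomorphisms is the coset $\{\Phi_1\circ\alpha : \alpha \in \mathrm{Aut}_0(G,A)\}$. Computing the coset of isomorphisms means computing one such $\Phi_1$ together with a generating set of $\mathrm{Aut}_0(G,A)$, as permutations of the set $G$. *)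

theory Defs
  imports
    "HOL-Algebra.Coset"
    "HOL-Algebra.Bij"
    "HOL-Algebra.Generated_Groups"
    "HOL-Computational_Algebra.Polynomial"
begin

section \<open>Machine model\<close>

text \<open>
  A random access machine, presented as a structured while language over finitely many named
  arrays of natural numbers; a scalar variable is cell 0 of an array. The only unit-cost
  arithmetic is addition and truncated subtraction (no multiplication), so a number grows by at
  most a bounded number of bits per step and polynomial time on this machine agrees with
  polynomial time on Turing machines. Every node of an evaluated expression is charged, so a
  long expression hides no computation.
\<close>

type_synonym state = "string \<Rightarrow> nat \<Rightarrow> nat"

datatype aexp = Lit nat | Cell string aexp | Add aexp aexp | Sub aexp aexp

datatype bexp = Less aexp aexp | Equal aexp aexp | Neg bexp | Conj bexp bexp

datatype com =
    Skip
  | Assign string aexp aexp  \<comment> \<open>\<open>Assign x a e\<close> stores the value of \<open>e\<close> in cell number \<open>a\<close> of array \<open>x\<close>\<close>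
  | Seq com com
  | Cond bexp com com
  | While bexp com

fun aval :: "aexp \<Rightarrow> state \<Rightarrow> nat" where
  "aval (Lit m) s = m"
| "aval (Cell x a) s = s x (aval a s)"
| "aval (Add a b) s = aval a s + aval b s"
| "aval (Sub a b) s = aval a s - aval b s"

fun bval :: "bexp \<Rightarrow> state \<Rightarrow> bool" where
  "bval (Less a b) s \<longleftrightarrow> aval a s < aval b s"
| "bval (Equal a b) s \<longleftrightarrow> aval a s = aval b s"
| "bval (Neg b) s \<longleftrightarrow> \<not> bval b s"
| "bval (Conj b c) s \<longleftrightarrow> bval b s \<and> bval c s"

fun acost :: "aexp \<Rightarrow> nat" where
  "acost (Lit m) = 1"
| "acost (Cell x a) = acost a + 1"
| "acost (Add a b) = acost a + acost b + 1"
| "acost (Sub a b) = acost a + acost b + 1"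

fun bcost :: "bexp \<Rightarrow> nat" where
  "bcost (Less a b) = acost a + acost b + 1"
| "bcost (Equal a b) = acost a + acost b + 1"
| "bcost (Neg b) = bcost b + 1"
| "bcost (Conj b c) = bcost b + bcost c + 1"

text \<open>
  \<open>exec c s t s'\<close>: started in state \<open>s\<close>, the program \<open>c\<close> halts in state \<open>s'\<close> after \<open>t\<close> steps.
\<close>

inductive exec :: "com \<Rightarrow> state \<Rightarrow> nat \<Rightarrow> state \<Rightarrow> bool" where
  Skip: "exec Skip s 1 s"
| Assign: "exec (Assign x a e) s (acost a + acost e + 1) (s(x := (s x)(aval a s := aval e s)))"
| Seq: "exec c1 s t1 s1 \<Longrightarrow> exec c2 s1 t2 s2 \<Longrightarrow> exec (Seq c1 c2) s (t1 + t2) s2"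
| CondTrue: "bval b s \<Longrightarrow> exec c1 s t s' \<Longrightarrow> exec (Cond b c1 c2) s (bcost b + t) s'"
| CondFalse: "\<not> bval b s \<Longrightarrow> exec c2 s t s' \<Longrightarrow> exec (Cond b c1 c2) s (bcost b + t) s'"
| WhileFalse: "\<not> bval b s \<Longrightarrow> exec (While b c) s (bcost b) s"
| WhileTrue: "bval b s \<Longrightarrow> exec c s t1 s1 \<Longrightarrow> exec (While b c) s1 t2 s2 \<Longrightarrow>
    exec (While b c) s (bcost b + t1 + t2) s2"

inductive_cases SkipE: "exec Skip s t s'"
  and AssignE: "exec (Assign x a e) s t s'"
  and SeqE: "exec (Seq c1 c2) s t s'"
  and CondE: "exec (Cond b c1 c2) s t s'"
  and WhileE: "exec (While b c) s t s'"

lemma exec_deterministic: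
  "exec c s t s' \<Longrightarrow> exec c s u s'' \<Longrightarrow> u = t \<and> s'' = s'"
proof (induction arbitrary: u s'' rule: exec.induct)
  case (Seq c1 s t1 s1 c2 t2 s2)
  from Seq.prems obtain u1 u2 r where "exec c1 s u1 r" "exec c2 r u2 s''" "u = u1 + u2"
    by (rule SeqE)
  then show ?case using Seq.IH by blast
next
  case (WhileTrue b s c t1 s1 t2 s2)
  from WhileTrue.prems WhileTrue.hyps(1) obtain u1 u2 r
    where "exec c s u1 r" "exec (While b c) r u2 s''" "u = bcost b + u1 + u2"
    by (rule_tac WhileE) blast+
  then show ?case using WhileTrue.IH by blast
qed (erule SkipE AssignE CondE WhileE; (blast | simp))+

text \<open>
  Input and output words are stored with their length in cell 0 and their letters in the cells
  \<open>1, 2, \<dots>\<close>; all other cells are initially 0.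
\<close>

definition input_state :: "nat list \<Rightarrow> state" where
  "input_state w = (\<lambda>x i. if x = ''input'' \<and> i \<le> length w then (length w # w) ! i else 0)"

definition output_word :: "state \<Rightarrow> nat list" where
  "output_word s = map (s ''output'') [1..<Suc (s ''output'' 0)]"


section \<open>Encoding of groups, subgroups and maps\<close>

text \<open>All encodings are self-delimiting.\<close>

text \<open>The order, then the rows of the multiplication table, for a group with carrier \<open>{1..n}\<close>.\<close>

definition cayley_word :: "nat monoid \<Rightarrow> nat list" where
  "cayley_word G =
    (let els = [1..<Suc (card (carrier G))]
     in length els # concat (map (\<lambda>i. map (\<lambda>j. i \<otimes>\<^bsub>G\<^esub> j) els) els))"

definition list_word :: "nat list \<Rightarrow> nat list" where
  "list_word xs = length xs # xs"

definition pairs_word :: "(nat \<times> nat) list \<Rightarrow> nat list" where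
  "pairs_word ps = length ps # concat (map (\<lambda>(x, y). [x, y]) ps)"

definition lists_set :: "'a list \<Rightarrow> 'a set \<Rightarrow> bool" where
  "lists_set xs S \<longleftrightarrow> distinct xs \<and> set xs = S"

definition lists_map :: "(nat \<times> nat) list \<Rightarrow> nat set \<Rightarrow> (nat \<Rightarrow> nat) \<Rightarrow> bool" where
  "lists_map ps D f \<longleftrightarrow> lists_set ps ((\<lambda>x. (x, f x)) ` D)"

text \<open>
  The quotient \<open>G/A\<close> is given by the Cayley table of a copy \<open>Q\<close> of \<open>G Mod A\<close> whose elements are
  \<open>1, \<dots>, m\<close>, in the numbering \<open>\<nu>\<close> of the cosets, and by the natural homomorphism as a map to
  these numbers. The numbering is arbitrary.
\<close>

definition quotient_given_by ::
    "nat monoid \<Rightarrow> nat set \<Rightarrow> (nat set \<Rightarrow> nat) \<Rightarrow> nat list \<Rightarrow> bool" where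
  "quotient_given_by G A \<nu> w \<longleftrightarrow>
    (\<exists>(Q :: nat monoid) ps.
      group Q \<and> carrier Q = {1..card (carrier (G Mod A))} \<and> \<nu> \<in> iso (G Mod A) Q \<and>
      lists_map ps (carrier G) (\<lambda>g. \<nu> (g <#\<^bsub>G\<^esub> A)) \<and>
      w = cayley_word Q @ pairs_word ps)"

definition k_generated :: "nat \<Rightarrow> ('a, 'b) monoid_scheme \<Rightarrow> bool" where
  "k_generated k H \<longleftrightarrow>
    (\<exists>xs. length xs = k \<and> set xs \<subseteq> carrier H \<and> generate H (set xs) = carrier H)"


section \<open>The computational problem\<close>

text \<open>The word \<open>w\<close> is an input presenting the two groups, the two subgroups and \<open>\<psi>\<close>.\<close>

definition instance_given_by ::
    "nat monoid \<Rightarrow> nat monoid \<Rightarrow> nat set \<Rightarrow> nat set \<Rightarrow> (nat set \<Rightarrow> nat set) \<Rightarrow> nat list \<Rightarrow> bool" where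
  "instance_given_by G G\<^sub>0 A A\<^sub>0 \<psi> w \<longleftrightarrow>
    (\<exists>as as\<^sub>0 \<nu> \<nu>\<^sub>0 q q\<^sub>0 ps.
      lists_set as A \<and> lists_set as\<^sub>0 A\<^sub>0 \<and>
      quotient_given_by G A \<nu> q \<and> quotient_given_by G\<^sub>0 A\<^sub>0 \<nu>\<^sub>0 q\<^sub>0 \<and>
      lists_set ps ((\<lambda>C. (\<nu> C, \<nu>\<^sub>0 (\<psi> C))) ` carrier (G Mod A)) \<and>
      w = cayley_word G @ cayley_word G\<^sub>0 @ list_word as @ list_word as\<^sub>0 @
          q @ q\<^sub>0 @ pairs_word ps)"

definition inducing_isos ::
    "nat monoid \<Rightarrow> nat monoid \<Rightarrow> nat set \<Rightarrow> nat set \<Rightarrow> (nat set \<Rightarrow> nat set) \<Rightarrow> (nat \<Rightarrow> nat) set" where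
  "inducing_isos G G\<^sub>0 A A\<^sub>0 \<psi> =
    {\<Phi> \<in> iso G G\<^sub>0. \<Phi> ` A = A\<^sub>0 \<and> (\<forall>g\<in>carrier G. \<Phi> g <#\<^bsub>G\<^sub>0\<^esub> A\<^sub>0 = \<psi> (g <#\<^bsub>G\<^esub> A))}"

definition Aut0 :: "nat monoid \<Rightarrow> nat set \<Rightarrow> (nat \<Rightarrow> nat) set" where
  "Aut0 G A = {\<alpha> \<in> auto G. \<alpha> ` A = A \<and> (\<forall>g\<in>carrier G. \<alpha> g <#\<^bsub>G\<^esub> A = g <#\<^bsub>G\<^esub> A)}"

text \<open>
  The output \<open>[0]\<close> means that no isomorphism exists. Otherwise the output is 1, followed by one
  isomorphism \<open>\<Phi>\<^sub>1\<close>, the number of generators of \<open>Aut0 G A\<close> and the generators themselves, all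
  maps being given by their element-image pairs.
\<close>

definition iso_coset_given_by ::
    "nat monoid \<Rightarrow> nat monoid \<Rightarrow> nat set \<Rightarrow> nat set \<Rightarrow> (nat set \<Rightarrow> nat set) \<Rightarrow> nat list \<Rightarrow> bool" where
  "iso_coset_given_by G G\<^sub>0 A A\<^sub>0 \<psi> w \<longleftrightarrow>
    (\<exists>\<Phi>\<^sub>1 ps \<alpha>s pss.
      \<Phi>\<^sub>1 \<in> inducing_isos G G\<^sub>0 A A\<^sub>0 \<psi> \<and> lists_map ps (carrier G) \<Phi>\<^sub>1 \<and>
      generate (AutoGroup G) (set \<alpha>s) = Aut0 G A \<and>
      list_all2 (\<lambda>\<alpha> qs. lists_map qs (carrier G) \<alpha>) \<alpha>s pss \<and>
      w = 1 # pairs_word ps @ length pss # concat (map pairs_word pss))"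

definition correct_output ::
    "nat monoid \<Rightarrow> nat monoid \<Rightarrow> nat set \<Rightarrow> nat set \<Rightarrow> (nat set \<Rightarrow> nat set) \<Rightarrow> nat list \<Rightarrow> bool" where
  "correct_output G G\<^sub>0 A A\<^sub>0 \<psi> w \<longleftrightarrow>
    (if inducing_isos G G\<^sub>0 A A\<^sub>0 \<psi> = {} then w = [0] else iso_coset_given_by G G\<^sub>0 A A\<^sub>0 \<psi> w)"

end

theory Submission
  imports Defs "HOL-Algebra.Product_Groups" "HOL-Algebra.Multiplicative_Group"
begin

text \<open>
  Say that \<open>g \<in> G\<close> and \<open>h \<in> H\<close> are compatible, \<open>C g h\<close>, if \<open>\<psi>\<close> maps the coset of \<open>g\<close> to the
  coset of \<open>h\<close>. The isomorphisms to be found are exactly the isomorphisms \<open>f\<close> with \<open>C g (f g)\<close>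
  for all \<open>g\<close>; below they are called isomorphisms over \<open>C\<close>. As a set of pairs, \<open>C\<close> is the fibre
  product of \<open>G\<close> and \<open>H\<close> over their common quotient: a subgroup of \<open>G \<times> H\<close> that projects onto
  both factors and meets both of them in an abelian group. The argument uses only these
  properties, which are symmetric in \<open>G\<close> and \<open>H\<close>.

  Homomorphisms over \<open>C\<close> are easy to find. Take any map \<open>s\<close> with \<open>C g (s g)\<close> for all \<open>g\<close>, with
  prescribed values where there are any. Its defect, the family of all \<open>s(g)s(h)s(gh)\<inverse>\<close>, is a
  vector with entries in an abelian group. The defects of all admissible \<open>s\<close> form a coset of a
  subgroup generated by explicitly known vectors, at most one for each pair in \<open>G \<times> H\<close>
  (\<open>solvable_iff\<close>). So a homomorphism with the prescribed values exists iff one given vector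
  lies in the span of others. A table of sifted vectors that is closed under products decides
  this (\<open>membership\<close>); it plays the role of an echelon form and needs the abelian group only as
  a multiplication table.

  Isomorphisms are reduced to homomorphisms by \<open>extension\<close>: if there is any isomorphism over
  \<open>C\<close>, then a partial map \<open>\<phi>\<close> extends to one as soon as \<open>\<phi>\<close> extends to a homomorphism \<open>G \<rightarrow> H\<close>
  over \<open>C\<close> and \<open>\<phi>\<inverse>\<close> extends to a homomorphism \<open>H \<rightarrow> G\<close> over the converse of \<open>C\<close>. The proof counts
  homomorphisms in the style of Lovasz. For a set \<open>X\<close>, compare the extensions \<open>u : G \<rightarrow> H\<close> of \<open>\<phi>\<close>
  that are trivial on \<open>X\<close> with the endomorphisms \<open>v : G \<rightarrow> G\<close> that are trivial on \<open>X\<close>, fix the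
  domain of \<open>\<phi>\<close> and act trivially on the quotient. Composition with the two given homomorphisms
  shows that both families are empty or neither is. In the second case each is a torsor under
  crossed homomorphisms into an abelian kernel, and the isomorphism assumed to exist identifies
  these. Hence the families are equinumerous for every \<open>X\<close>, and by inclusion-exclusion as many
  \<open>u\<close> as \<open>v\<close> have trivial kernel; the identity is such a \<open>v\<close>.

  This makes a greedy search correct (\<open>run_COMPLETE\<close>): go through all pairs \<open>(g, h)\<close>, and define
  the map at \<open>g\<close> to be \<open>h\<close> whenever it is undefined there and the extended map passes the
  two-sided test. If the initial partial map extends to an isomorphism over \<open>C\<close>, every map kept
  does so as well and the final one is total. Conversely a total map passing the test is an
  isomorphism, because it is a homomorphism with a left inverse. For generators of \<open>Aut0 G A\<close>
  the same search is run with \<open>H = G\<close> and \<open>\<psi>\<close> the identity, starting from each partial map that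
  fixes \<open>1, \<dots>, i - 1\<close> and sends \<open>i\<close> to \<open>h\<close>. The automorphisms found contain a transversal for
  every step of the chain of pointwise stabilisers, so they generate (\<open>generate_Aut0\<close>).

  The algorithm is written with counted loops only, whose bounds \<open>n\<close> and \<open>N = n * n\<close> never
  change while the loops that they bound are running. A polynomial bound on its running time can
  then be read off from its syntax (\<open>exec_compile\<close>), and \<open>n \<le> n ^ k\<close> turns it into a polynomial
  in \<open>n ^ k\<close>.
\<close>

section \<open>Extending isomorphisms by counting homomorphisms\<close>

text \<open>
  Inclusion-exclusion in the form of a downward induction: the sets containing \<open>X\<close> are \<open>X\<close>
  itself and strictly larger ones, so the number of indices with value exactly \<open>X\<close> is determined
  by the numbers of indices with value containing \<open>Y\<close>, for all \<open>Y\<close>.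
\<close>

lemma card_exact_eq:
  fixes p :: "'u \<Rightarrow> 'x set" and q :: "'v \<Rightarrow> 'x set"
  assumes "finite A" "finite U" "finite V"
    and pA: "\<And>u. u \<in> U \<Longrightarrow> p u \<subseteq> A" and qA: "\<And>v. v \<in> V \<Longrightarrow> q v \<subseteq> A"
    and eq: "\<And>X. X \<subseteq> A \<Longrightarrow> card {u\<in>U. X \<subseteq> p u} = card {v\<in>V. X \<subseteq> q v}"
    and "X \<subseteq> A"
  shows "card {u\<in>U. p u = X} = card {v\<in>V. q v = X}"
  using \<open>X \<subseteq> A\<close>
proof (induction "card (A - X)" arbitrary: X rule: less_induct)
  case less
  have split: "card {w\<in>W. X \<subseteq> r w} = (\<Sum>Y\<in>{Y. X \<subseteq> Y \<and> Y \<subseteq> A}. card {w\<in>W. r w = Y})"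
    if "finite W" "\<And>w. w \<in> W \<Longrightarrow> r w \<subseteq> A" for W and r :: "'w \<Rightarrow> 'x set"
  proof -
    have "{w\<in>W. X \<subseteq> r w} = (\<Union>Y\<in>{Y. X \<subseteq> Y \<and> Y \<subseteq> A}. {w\<in>W. r w = Y})"
      using that by auto
    moreover have "finite {Y. X \<subseteq> Y \<and> Y \<subseteq> A}"
      using \<open>finite A\<close> by (rule_tac finite_subset[of _ "Pow A"]) auto
    ultimately show ?thesis
      using that by (simp add: card_UN_disjoint[OF _ _, of "{Y. X \<subseteq> Y \<and> Y \<subseteq> A}" "\<lambda>Y. {w\<in>W. r w = Y}"] disjoint_iff)
  qed
  let ?S = "{Y. X \<subseteq> Y \<and> Y \<subseteq> A}"
  have fin: "finite ?S" using \<open>finite A\<close> by (rule_tac finite_subset[of _ "Pow A"]) auto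
  have XS: "X \<in> ?S" using less.prems by auto
  have "(\<Sum>Y\<in>?S. card {u\<in>U. p u = Y}) = (\<Sum>Y\<in>?S. card {v\<in>V. q v = Y})"
    using split[OF \<open>finite U\<close> pA] split[OF \<open>finite V\<close> qA] eq[OF less.prems] by simp
  moreover have "(\<Sum>Y\<in>?S - {X}. card {u\<in>U. p u = Y}) = (\<Sum>Y\<in>?S - {X}. card {v\<in>V. q v = Y})"
  proof (rule sum.cong[OF refl])
    fix Y assume "Y \<in> ?S - {X}"
    then have "A - Y \<subset> A - X" "Y \<subseteq> A" using less.prems by auto
    then show "card {u\<in>U. p u = Y} = card {v\<in>V. q v = Y}"
      using less.hyps[of Y] \<open>finite A\<close> by (simp add: psubset_card_mono)
  qed
  ultimately show ?case
    using sum.remove[OF fin XS, of "\<lambda>Y. card {u\<in>U. p u = Y}"]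
      sum.remove[OF fin XS, of "\<lambda>Y. card {v\<in>V. q v = Y}"] by linarith
qed

text \<open>
  The relation \<open>C\<close> is a subgroup of \<open>G \<times> H\<close> that projects onto \<open>G\<close> and meets \<open>H\<close> in an abelian
  group. The symmetric situation is expressed by two instances of this locale, one for \<open>C\<close> and
  one for its converse.
\<close>

locale fibre = G: group G + H: group H
  for G :: "('a, 'c) monoid_scheme" (structure) and H :: "('b, 'd) monoid_scheme" (structure) +
  fixes C :: "'a \<Rightarrow> 'b \<Rightarrow> bool"
  assumes C_one: "C \<one>\<^bsub>G\<^esub> \<one>\<^bsub>H\<^esub>"
    and C_mult: "\<lbrakk>g \<in> carrier G; g' \<in> carrier G; h \<in> carrier H; h' \<in> carrier H; C g h; C g' h'\<rbrakk>
       \<Longrightarrow> C (g \<otimes>\<^bsub>G\<^esub> g') (h \<otimes>\<^bsub>H\<^esub> h')"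
    and C_inv: "\<lbrakk>g \<in> carrier G; h \<in> carrier H; C g h\<rbrakk> \<Longrightarrow> C (inv\<^bsub>G\<^esub> g) (inv\<^bsub>H\<^esub> h)"
    and C_comm: "\<lbrakk>h \<in> carrier H; h' \<in> carrier H; C \<one>\<^bsub>G\<^esub> h; C \<one>\<^bsub>G\<^esub> h'\<rbrakk>
       \<Longrightarrow> h \<otimes>\<^bsub>H\<^esub> h' = h' \<otimes>\<^bsub>H\<^esub> h"
    and C_total: "g \<in> carrier G \<Longrightarrow> \<exists>h\<in>carrier H. C g h"
begin

definition ker where "ker = {h \<in> carrier H. C \<one>\<^bsub>G\<^esub> h}"

lemma ker_div:
  assumes "g \<in> carrier G" "h \<in> carrier H" "h' \<in> carrier H" "C g h" "C g h'"
  shows "h \<otimes>\<^bsub>H\<^esub> inv\<^bsub>H\<^esub> h' \<in> ker"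
  using C_mult[of g "inv\<^bsub>G\<^esub> g" h "inv\<^bsub>H\<^esub> h'"] C_inv[of g h'] assms by (simp add: ker_def)

lemma ker_conj:
  assumes "g \<in> carrier G" "h \<in> carrier H" "C g h" "x \<in> ker"
  shows "h \<otimes>\<^bsub>H\<^esub> x \<otimes>\<^bsub>H\<^esub> inv\<^bsub>H\<^esub> h \<in> ker"
  using C_mult[of "g" "inv\<^bsub>G\<^esub> g" "h \<otimes>\<^bsub>H\<^esub> x" "inv\<^bsub>H\<^esub> h"] C_inv[of g h] C_mult[of g "\<one>\<^bsub>G\<^esub>" h x] assms
  by (simp add: ker_def)

lemma ker_carrier: "x \<in> ker \<Longrightarrow> x \<in> carrier H"
  by (simp add: ker_def)

lemma ker_comm: "x \<in> ker \<Longrightarrow> y \<in> ker \<Longrightarrow> x \<otimes>\<^bsub>H\<^esub> y = y \<otimes>\<^bsub>H\<^esub> x"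
  by (simp add: ker_def C_comm)

lemma subgroup_ker: "subgroup ker H"
  using C_mult[of "\<one>\<^bsub>G\<^esub>" "\<one>\<^bsub>G\<^esub>"] C_inv[of "\<one>\<^bsub>G\<^esub>"] C_one
  by unfold_locales (auto simp: ker_def)

definition homs where "homs = {f \<in> hom G H. \<forall>g\<in>carrier G. C g (f g)}"

lemma homsD:
  assumes "f \<in> homs"
  shows "g \<in> carrier G \<Longrightarrow> f g \<in> carrier H" "g \<in> carrier G \<Longrightarrow> C g (f g)"
    "\<lbrakk>g \<in> carrier G; g' \<in> carrier G\<rbrakk> \<Longrightarrow> f (g \<otimes>\<^bsub>G\<^esub> g') = f g \<otimes>\<^bsub>H\<^esub> f g'"
  using assms by (auto simp: homs_def hom_def)

end

text \<open>
  With \<open>d g = u(g) u\<^sub>0(g)\<inverse>\<close> for two homomorphisms \<open>u\<close> and \<open>u\<^sub>0\<close> this is the law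
  \<open>d(gh) = d(g) \<cdot> u\<^sub>0(g) d(h) u\<^sub>0(g)\<inverse>\<close> of a crossed homomorphism.
\<close>

lemma (in group) twist_eq:
  assumes "a \<in> carrier G" "b \<in> carrier G" "x \<in> carrier G" "y \<in> carrier G" "z \<in> carrier G"
  shows "(a \<otimes> b) \<otimes> inv (x \<otimes> y) = (a \<otimes> inv x) \<otimes> (x \<otimes> (b \<otimes> inv y) \<otimes> inv x)"
  using assms by (simp add: m_assoc inv_mult_group inv_solve_left)

text \<open>
  Two homomorphisms over \<open>C1\<close> differ by a crossed homomorphism into the kernel of \<open>H1\<close>. That
  kernel is abelian, so conjugation by a compatible element depends only on the element of \<open>G\<close>,
  and \<open>\<theta>\<close> is equivariant for these actions. Hence \<open>\<theta>\<close> carries the difference of \<open>u\<close> and \<open>u0\<close> to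
  a crossed homomorphism by which \<open>v0\<close> may be multiplied.
\<close>

lemma hom_transfer:
  fixes G (structure) and H1 (structure) and H2 (structure)
  assumes F1: "fibre G H1 C1" and F2: "fibre G H2 C2"
    and th: "\<theta> \<in> hom H1 H2" and thC: "\<And>g h. g \<in> carrier G \<Longrightarrow> h \<in> carrier H1 \<Longrightarrow> C1 g h \<Longrightarrow> C2 g (\<theta> h)"
    and u0: "u0 \<in> fibre.homs G H1 C1" and v0: "v0 \<in> fibre.homs G H2 C2" and u: "u \<in> fibre.homs G H1 C1"
  shows "(\<lambda>g\<in>carrier G. \<theta> (u g \<otimes>\<^bsub>H1\<^esub> inv\<^bsub>H1\<^esub> u0 g) \<otimes>\<^bsub>H2\<^esub> v0 g) \<in> fibre.homs G H2 C2"
proof -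
  interpret F1: fibre G H1 C1 by fact
  interpret F2: fibre G H2 C2 by fact
  interpret th: group_hom H1 H2 \<theta> by unfold_locales (rule th)
  define d where "d g = u g \<otimes>\<^bsub>H1\<^esub> inv\<^bsub>H1\<^esub> u0 g" for g
  have dK: "d g \<in> F1.ker" if "g \<in> carrier G" for g
    unfolding d_def using F1.ker_div that F1.homsD u u0 by blast
  have dc: "d g \<in> carrier H1" if "g \<in> carrier G" for g using dK[OF that] by (rule F1.ker_carrier)
  have tK: "\<theta> x \<in> F2.ker" if "x \<in> F1.ker" for x
    using that thC[of "\<one>" x] by (auto simp: F1.ker_def F2.ker_def)
  note [simp] = F1.homsD[OF u] F1.homsD[OF u0] F2.homsD[OF v0]
  show ?thesis
    unfolding F2.homs_def
  proof (intro CollectI conjI ballI homI)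
    fix g assume g: "g \<in> carrier G"
    show "(\<lambda>g\<in>carrier G. \<theta> (u g \<otimes>\<^bsub>H1\<^esub> inv\<^bsub>H1\<^esub> u0 g) \<otimes>\<^bsub>H2\<^esub> v0 g) g \<in> carrier H2"
      using g by simp
    have "C2 (\<one> \<otimes> g) (\<theta> (d g) \<otimes>\<^bsub>H2\<^esub> v0 g)"
      using g tK[OF dK[OF g]] dc by (intro F2.C_mult) (auto simp: F2.ker_def)
    then show "C2 g ((\<lambda>g\<in>carrier G. \<theta> (u g \<otimes>\<^bsub>H1\<^esub> inv\<^bsub>H1\<^esub> u0 g) \<otimes>\<^bsub>H2\<^esub> v0 g) g)"
      using g by (simp add: d_def)
  next
    fix g g' assume g: "g \<in> carrier G" "g' \<in> carrier G"
    have 1: "d (g \<otimes> g') = d g \<otimes>\<^bsub>H1\<^esub> (u0 g \<otimes>\<^bsub>H1\<^esub> d g' \<otimes>\<^bsub>H1\<^esub> inv\<^bsub>H1\<^esub> u0 g)"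
      unfolding d_def F1.homsD(3)[OF u g] F1.homsD(3)[OF u0 g]
      by (rule F1.H.twist_eq) (use g in auto)
    define k where "k = \<theta> (u0 g) \<otimes>\<^bsub>H2\<^esub> inv\<^bsub>H2\<^esub> v0 g"
    have k: "k \<in> F2.ker"
      unfolding k_def using g by (intro F2.ker_div[of g]) (auto intro: thC)
    then have kc: "k \<in> carrier H2" by (rule F2.ker_carrier)
    define c where "c = v0 g \<otimes>\<^bsub>H2\<^esub> \<theta> (d g') \<otimes>\<^bsub>H2\<^esub> inv\<^bsub>H2\<^esub> v0 g"
    have c: "c \<in> F2.ker"
      unfolding c_def using g dK tK by (intro F2.ker_conj[of g]) auto
    then have cc: "c \<in> carrier H2" by (rule F2.ker_carrier)
    have u0k: "\<theta> (u0 g) = k \<otimes>\<^bsub>H2\<^esub> v0 g"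
      using g by (simp add: k_def F2.H.m_assoc)
    have "\<theta> (u0 g) \<otimes>\<^bsub>H2\<^esub> \<theta> (d g') \<otimes>\<^bsub>H2\<^esub> inv\<^bsub>H2\<^esub> \<theta> (u0 g) = k \<otimes>\<^bsub>H2\<^esub> c \<otimes>\<^bsub>H2\<^esub> inv\<^bsub>H2\<^esub> k"
      using g kc dc unfolding u0k c_def by (simp add: F2.H.m_assoc F2.H.inv_mult_group)
    also have "\<dots> = c"
      using F2.ker_comm[OF k c] kc cc by (simp add: F2.H.m_assoc)
    finally have "\<theta> (d (g \<otimes> g')) = \<theta> (d g) \<otimes>\<^bsub>H2\<^esub> c"
      using g dc by (simp add: 1)
    then have "\<theta> (d (g \<otimes> g')) \<otimes>\<^bsub>H2\<^esub> v0 (g \<otimes> g') = (\<theta> (d g) \<otimes>\<^bsub>H2\<^esub> v0 g) \<otimes>\<^bsub>H2\<^esub> (\<theta> (d g') \<otimes>\<^bsub>H2\<^esub> v0 g')"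
      using g dc by (simp add: c_def F2.H.m_assoc F2.H.inv_solve_left')
    then show "(\<lambda>g\<in>carrier G. \<theta> (u g \<otimes>\<^bsub>H1\<^esub> inv\<^bsub>H1\<^esub> u0 g) \<otimes>\<^bsub>H2\<^esub> v0 g) (g \<otimes> g') =
      (\<lambda>g\<in>carrier G. \<theta> (u g \<otimes>\<^bsub>H1\<^esub> inv\<^bsub>H1\<^esub> u0 g) \<otimes>\<^bsub>H2\<^esub> v0 g) g \<otimes>\<^bsub>H2\<^esub>
      (\<lambda>g\<in>carrier G. \<theta> (u g \<otimes>\<^bsub>H1\<^esub> inv\<^bsub>H1\<^esub> u0 g) \<otimes>\<^bsub>H2\<^esub> v0 g) g'"
      using g by (simp add: d_def)
  qed
qed

definition iso_over where
  "iso_over G H C = {f \<in> iso G H. \<forall>g\<in>carrier G. C g (f g)}"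

text \<open>
  The counting argument: \<open>U\<close> and \<open>V\<close> collect the homomorphisms \<open>G \<rightarrow> H\<close> and \<open>G \<rightarrow> G\<close> that restrict
  to \<open>\<phi>\<close> and to the identity on \<open>D\<close>, and it is shown that as many members of \<open>U\<close> as of \<open>V\<close> have
  trivial kernel.
\<close>

theorem extension:
  fixes G (structure) and H (structure)
  assumes F: "fibre G H C" and F': "fibre H G (\<lambda>h g. C g h)"
    and fin: "finite (carrier G)" "finite (carrier H)"
    and I: "iso_over G H C \<noteq> {}"
    and D: "D \<subseteq> carrier G"
    and f: "f \<in> fibre.homs G H C" "\<And>d. d \<in> D \<Longrightarrow> f d = \<phi> d"
    and f': "f' \<in> fibre.homs H G (\<lambda>h g. C g h)" "\<And>d. d \<in> D \<Longrightarrow> f' (\<phi> d) = d"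
  shows "\<exists>\<Phi>\<in>iso_over G H C. \<forall>d\<in>D. \<Phi> d = \<phi> d"
proof -
  interpret F: fibre G H C by fact
  interpret F': fibre H G "\<lambda>h g. C g h" by fact
  obtain \<Theta> where \<Theta>: "\<Theta> \<in> iso G H" "\<And>g. g \<in> carrier G \<Longrightarrow> C g (\<Theta> g)"
    using I by (auto simp: iso_over_def)
  define \<Theta>' where "\<Theta>' = inv_into (carrier G) \<Theta>"
  have \<Theta>'iso: "\<Theta>' \<in> iso H G" unfolding \<Theta>'_def by (rule F.G.iso_set_sym[OF \<Theta>(1)])
  have \<Theta>': "\<Theta>' h \<in> carrier G" "\<Theta> (\<Theta>' h) = h" if "h \<in> carrier H" for h
    using that \<Theta>(1) unfolding \<Theta>'_def iso_def bij_betw_def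
    by (auto simp: inv_into_into f_inv_into_f)
  \<comment> \<open>the elements \<open>g\<close> and \<open>g'\<close> have the same image in the quotient\<close>
  define C0 where "C0 g g' \<longleftrightarrow> C (inv\<^bsub>G\<^esub> g \<otimes>\<^bsub>G\<^esub> g') \<one>\<^bsub>H\<^esub>" for g g'
  have C0I: "C0 g g'" if "g \<in> carrier G" "g' \<in> carrier G" "h \<in> carrier H" "C g h" "C g' h" for g g' h
    using F.C_mult[of "inv\<^bsub>G\<^esub> g" g' "inv\<^bsub>H\<^esub> h" h] F.C_inv[of g h] that by (simp add: C0_def)
  have C0D: "C g' h" if "g \<in> carrier G" "g' \<in> carrier G" "h \<in> carrier H" "C g h" "C0 g g'" for g g' h
    using F.C_mult[of g "inv\<^bsub>G\<^esub> g \<otimes>\<^bsub>G\<^esub> g'" h "\<one>\<^bsub>H\<^esub>"] that 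
    by (simp add: C0_def flip: F.G.m_assoc)
  have C0E: "\<exists>h\<in>carrier H. C g h \<and> C g' h" if "g \<in> carrier G" "g' \<in> carrier G" "C0 g g'" for g g'
    using F.C_total[OF that(1)] C0D that by blast
  interpret F0: fibre G G C0
  proof unfold_locales
    show "C0 \<one>\<^bsub>G\<^esub> \<one>\<^bsub>G\<^esub>" by (simp add: C0_def F.C_one)
  next
    fix g g' h h' assume a: "g \<in> carrier G" "g' \<in> carrier G" "h \<in> carrier G" "h' \<in> carrier G" "C0 g h" "C0 g' h'"
    obtain x x' where "x \<in> carrier H" "C g x" "C h x" "x' \<in> carrier H" "C g' x'" "C h' x'"
      using C0E a by meson
    then show "C0 (g \<otimes>\<^bsub>G\<^esub> g') (h \<otimes>\<^bsub>G\<^esub> h')"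
      using a by (intro C0I[of _ _ "x \<otimes>\<^bsub>H\<^esub> x'"]) (auto intro: F.C_mult)
  next
    fix g h assume a: "g \<in> carrier G" "h \<in> carrier G" "C0 g h"
    then obtain x where "x \<in> carrier H" "C g x" "C h x" using C0E by meson
    then show "C0 (inv\<^bsub>G\<^esub> g) (inv\<^bsub>G\<^esub> h)"
      using a by (intro C0I[of _ _ "inv\<^bsub>H\<^esub> x"]) (auto intro: F.C_inv)
  next
    fix h h' assume "h \<in> carrier G" "h' \<in> carrier G" "C0 \<one>\<^bsub>G\<^esub> h" "C0 \<one>\<^bsub>G\<^esub> h'"
    then show "h \<otimes>\<^bsub>G\<^esub> h' = h' \<otimes>\<^bsub>G\<^esub> h" using F'.C_comm[of h h'] by (simp add: C0_def)
  next
    fix g assume "g \<in> carrier G"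
    then show "\<exists>h\<in>carrier G. C0 g h" by (auto simp: C0_def F.C_one intro!: bexI[of _ g])
  qed
  have Fi: "fibre G G C0" ..
  define A where "A = {g \<in> carrier G. C g \<one>\<^bsub>H\<^esub>}"
  define U where "U = {u \<in> F.homs. u \<in> extensional (carrier G) \<and> (\<forall>d\<in>D. u d = \<phi> d)}"
  define V where "V = {v \<in> F0.homs. v \<in> extensional (carrier G) \<and> (\<forall>d\<in>D. v d = d)}"
  \<comment> \<open>the kernels; compatibility forces them into the finite group \<open>A\<close>\<close>
  define p where "p u = {g \<in> carrier G. u g = \<one>\<^bsub>H\<^esub>}" for u
  define q where "q v = {g \<in> carrier G. v g = \<one>\<^bsub>G\<^esub>}" for v
  have finA: "finite A" using fin by (simp add: A_def)
  have "U \<subseteq> carrier G \<rightarrow>\<^sub>E carrier H" by (auto simp: U_def PiE_def F.homs_def hom_def)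
  then have finU: "finite U" using fin by (meson finite_PiE finite_subset)
  have "V \<subseteq> carrier G \<rightarrow>\<^sub>E carrier G" by (auto simp: V_def PiE_def F0.homs_def hom_def)
  then have finV: "finite V" using fin by (meson finite_PiE finite_subset)
  have pA: "p u \<subseteq> A" if "u \<in> U" for u
  proof
    fix g assume g: "g \<in> p u"
    then show "g \<in> A" using that F.homsD(2)[of u g] by (simp add: p_def A_def U_def)
  qed
  have qA: "q v \<subseteq> A" if "v \<in> V" for v
  proof
    fix g assume g: "g \<in> q v"
    then have "C0 g \<one>\<^bsub>G\<^esub>" "g \<in> carrier G" using that F0.homsD(2)[of v g] by (auto simp: q_def V_def)
    then show "g \<in> A" using F.C_inv[of "inv\<^bsub>G\<^esub> g" "\<one>\<^bsub>H\<^esub>"] by (simp add: A_def C0_def)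
  qed
  \<comment> \<open>\<open>f\<close> and \<open>f'\<close> lead from one family to the other and never shrink the kernel, so for
    each \<open>X\<close> the families of homomorphisms trivial on \<open>X\<close> are empty together\<close>
  have compV: "(\<lambda>g\<in>carrier G. f (v g)) \<in> U \<and> q v \<subseteq> p (\<lambda>g\<in>carrier G. f (v g))" if v: "v \<in> V" for v
  proof -
    have v': "v \<in> F0.homs" "\<And>d. d \<in> D \<Longrightarrow> v d = d" using v by (auto simp: V_def)
    note [simp] = F0.homsD[OF v'(1)] F.homsD[OF f(1)]
    have one: "f \<one>\<^bsub>G\<^esub> = \<one>\<^bsub>H\<^esub>"
      using f(1) by (intro hom_one[of f G H]) (auto simp: F.homs_def F.G.group_axioms F.H.group_axioms)
    have rel: "C g (f (v g))" if g: "g \<in> carrier G" for g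
    proof -
      obtain x where "x \<in> carrier H" "C g x" "C (v g) x" using C0E[of g "v g"] g by auto
      moreover have "C (v g) (f (v g))" using g by simp
      ultimately have "C0 (v g) g" using C0I[of "v g" g x] g by simp
      then show ?thesis using C0D[of "v g" g "f (v g)"] g by simp
    qed
    show ?thesis
      using D by (auto simp: U_def F.homs_def hom_def rel f(2) v'(2) q_def p_def one subset_eq)
  qed
  have compU: "(\<lambda>g\<in>carrier G. f' (u g)) \<in> V \<and> p u \<subseteq> q (\<lambda>g\<in>carrier G. f' (u g))" if u: "u \<in> U" for u
  proof -
    have u': "u \<in> F.homs" "\<And>d. d \<in> D \<Longrightarrow> u d = \<phi> d" using u by (auto simp: U_def)
    note [simp] = F.homsD[OF u'(1)] F'.homsD[OF f'(1)]
    have one: "f' \<one>\<^bsub>H\<^esub> = \<one>\<^bsub>G\<^esub>"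
      using f'(1) by (intro hom_one[of f' H G]) (auto simp: F'.homs_def F.G.group_axioms F.H.group_axioms)
    have rel: "C0 g (f' (u g))" if g: "g \<in> carrier G" for g
      using g by (intro C0I[of _ _ "u g"]) auto
    show ?thesis
      using D by (auto simp: V_def F0.homs_def hom_def rel f'(2) u'(2) q_def p_def one subset_eq)
  qed
  have \<Theta>homU: "\<Theta>' \<in> hom H G" "inj_on \<Theta>' (carrier H)"
    using \<Theta>'iso by (auto simp: iso_def bij_betw_def)
  have \<Theta>homV: "\<Theta> \<in> hom G H" "inj_on \<Theta> (carrier G)"
    using \<Theta> by (auto simp: iso_def bij_betw_def)
  have eq: "card {u\<in>U. X \<subseteq> p u} = card {v\<in>V. X \<subseteq> q v}" if "X \<subseteq> A" for X
  proof (cases "{u\<in>U. X \<subseteq> p u} = {}")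
    case True
    then have "{v\<in>V. X \<subseteq> q v} = {}" using compV by blast
    then show ?thesis unfolding True by (simp only: card.empty)
  next
    case False
    then obtain u0 where u0: "u0 \<in> U" "X \<subseteq> p u0" by blast
    obtain v0 where v0: "v0 \<in> V" "X \<subseteq> q v0" using compU[OF u0(1)] u0(2) by blast
    have u0h: "u0 \<in> F.homs" and v0h: "v0 \<in> F0.homs" using u0 v0 by (auto simp: U_def V_def)
    have X: "X \<subseteq> carrier G" using that by (auto simp: A_def)
    show ?thesis
    proof (rule antisym)
      \<comment> \<open>\<open>u\<close> and \<open>u0\<close> agree on \<open>D\<close> and on \<open>X\<close>, so their difference is trivial there and
        so is its transport; injectivity of the isomorphism makes the transport of
        differences injective\<close>
      define t where "t u = (\<lambda>g\<in>carrier G. \<Theta>' (u g \<otimes>\<^bsub>H\<^esub> inv\<^bsub>H\<^esub> u0 g) \<otimes>\<^bsub>G\<^esub> v0 g)" for u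
      interpret h: group_hom H G \<Theta>' by unfold_locales (rule \<Theta>homU)
      note [simp] = F.homsD(1)[OF u0h] F0.homsD(1)[OF v0h]
      have Crel: "C0 g (\<Theta>' h)" if "g \<in> carrier G" "h \<in> carrier H" "C g h" for g h
        using C0I[of g "\<Theta>' h" h] \<Theta>'[of h] \<Theta>(2)[of "\<Theta>' h"] that by simp
      have "t u \<in> {v\<in>V. X \<subseteq> q v}" if u: "u \<in> {u\<in>U. X \<subseteq> p u}" for u
      proof -
        have uh: "u \<in> F.homs" using u by (auto simp: U_def)
        have "t u \<in> F0.homs" unfolding t_def
          by (intro hom_transfer[OF F Fi \<Theta>homU(1) Crel u0h v0h uh])
        moreover have "t u \<in> extensional (carrier G)" by (simp add: t_def)
        moreover have "t u g = v0 g" if "g \<in> carrier G" "u g = u0 g" for g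
          using that by (simp add: t_def)
        moreover have "u d = u0 d" if "d \<in> D \<union> X" for d
          using that u u0 X by (auto simp: U_def p_def subset_eq)
        ultimately show ?thesis
          using D X v0 by (auto simp: V_def q_def subset_eq)
      qed
      moreover have "inj_on t {u\<in>U. X \<subseteq> p u}"
      proof (rule inj_onI)
        fix u u' assume uu: "u \<in> {u\<in>U. X \<subseteq> p u}" "u' \<in> {u\<in>U. X \<subseteq> p u}" "t u = t u'"
        then have uh: "u \<in> F.homs" "u' \<in> F.homs" and ext: "u \<in> extensional (carrier G)" "u' \<in> extensional (carrier G)"
          by (auto simp: U_def)
        note [simp] = F.homsD(1)[OF uh(1)] F.homsD(1)[OF uh(2)]
        show "u = u'"
        proof (rule extensionalityI[OF ext])
          fix g assume g: "g \<in> carrier G"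
          have "\<Theta>' (u g \<otimes>\<^bsub>H\<^esub> inv\<^bsub>H\<^esub> u0 g) = \<Theta>' (u' g \<otimes>\<^bsub>H\<^esub> inv\<^bsub>H\<^esub> u0 g)"
            using fun_cong[OF uu(3), of g] g by (simp add: t_def del: h.hom_mult)
          then have "u g \<otimes>\<^bsub>H\<^esub> inv\<^bsub>H\<^esub> u0 g = u' g \<otimes>\<^bsub>H\<^esub> inv\<^bsub>H\<^esub> u0 g"
            using \<Theta>homU(2) g by (subst (asm) inj_on_eq_iff[OF \<Theta>homU(2)]) auto
          then show "u g = u' g" using g by simp
        qed
      qed
      ultimately show "card {u\<in>U. X \<subseteq> p u} \<le> card {v\<in>V. X \<subseteq> q v}"
        using finV by (intro card_inj_on_le[of t]) auto
    next
      define t where "t v = (\<lambda>g\<in>carrier G. \<Theta> (v g \<otimes>\<^bsub>G\<^esub> inv\<^bsub>G\<^esub> v0 g) \<otimes>\<^bsub>H\<^esub> u0 g)" for v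
      interpret h: group_hom G H \<Theta> by unfold_locales (rule \<Theta>homV)
      note [simp] = F.homsD(1)[OF u0h] F0.homsD(1)[OF v0h]
      have Crel: "C g (\<Theta> h)" if "g \<in> carrier G" "h \<in> carrier G" "C0 g h" for g h
      proof -
        from C0E[OF that] obtain x where "x \<in> carrier H" "C g x" "C h x" by meson
        then have "C0 h g" using C0I that by blast
        then show ?thesis using C0D[of h g "\<Theta> h"] \<Theta>(2) that by simp
      qed
      have "t v \<in> {u\<in>U. X \<subseteq> p u}" if v: "v \<in> {v\<in>V. X \<subseteq> q v}" for v
      proof -
        have vh: "v \<in> F0.homs" using v by (auto simp: V_def)
        have "t v \<in> F.homs" unfolding t_def
          by (intro hom_transfer[OF Fi F \<Theta>homV(1) Crel v0h u0h vh])
        moreover have "t v \<in> extensional (carrier G)" by (simp add: t_def)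
        moreover have "t v g = u0 g" if "g \<in> carrier G" "v g = v0 g" for g
          using that by (simp add: t_def)
        moreover have "v d = v0 d" if "d \<in> D \<union> X" for d
          using that v v0 X by (auto simp: V_def q_def subset_eq)
        ultimately show ?thesis
          using D X u0 by (auto simp: U_def p_def subset_eq)
      qed
      moreover have "inj_on t {v\<in>V. X \<subseteq> q v}"
      proof (rule inj_onI)
        fix u u' assume uu: "u \<in> {v\<in>V. X \<subseteq> q v}" "u' \<in> {v\<in>V. X \<subseteq> q v}" "t u = t u'"
        then have uh: "u \<in> F0.homs" "u' \<in> F0.homs" and ext: "u \<in> extensional (carrier G)" "u' \<in> extensional (carrier G)"
          by (auto simp: V_def)
        note [simp] = F0.homsD(1)[OF uh(1)] F0.homsD(1)[OF uh(2)]
        show "u = u'"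
        proof (rule extensionalityI[OF ext])
          fix g assume g: "g \<in> carrier G"
          have "\<Theta> (u g \<otimes>\<^bsub>G\<^esub> inv\<^bsub>G\<^esub> v0 g) = \<Theta> (u' g \<otimes>\<^bsub>G\<^esub> inv\<^bsub>G\<^esub> v0 g)"
            using fun_cong[OF uu(3), of g] g by (simp add: t_def del: h.hom_mult)
          then have "u g \<otimes>\<^bsub>G\<^esub> inv\<^bsub>G\<^esub> v0 g = u' g \<otimes>\<^bsub>G\<^esub> inv\<^bsub>G\<^esub> v0 g"
            using g by (subst (asm) inj_on_eq_iff[OF \<Theta>homV(2)]) auto
          then show "u g = u' g" using g by simp
        qed
      qed
      ultimately show "card {v\<in>V. X \<subseteq> q v} \<le> card {u\<in>U. X \<subseteq> p u}"
        using finU by (intro card_inj_on_le[of t]) auto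
    qed
  qed
  have oneA: "{\<one>\<^bsub>G\<^esub>} \<subseteq> A" by (simp add: A_def F.C_one)
  have "card {u\<in>U. p u = {\<one>\<^bsub>G\<^esub>}} = card {v\<in>V. q v = {\<one>\<^bsub>G\<^esub>}}"
    by (rule card_exact_eq[OF finA finU finV pA qA eq oneA])
  moreover have "card {v\<in>V. q v = {\<one>\<^bsub>G\<^esub>}} > 0"
  proof -
    \<comment> \<open>the identity has trivial kernel\<close>
    have "(\<lambda>g\<in>carrier G. g) \<in> {v\<in>V. q v = {\<one>\<^bsub>G\<^esub>}}"
      using D by (auto simp: V_def q_def F0.homs_def hom_def C0_def F.C_one)
    moreover have "finite {v\<in>V. q v = {\<one>\<^bsub>G\<^esub>}}" using finV by simp
    ultimately show ?thesis by (subst card_gt_0_iff) blast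
  qed
  ultimately have "card {u\<in>U. p u = {\<one>\<^bsub>G\<^esub>}} > 0" by simp
  then have "{u\<in>U. p u = {\<one>\<^bsub>G\<^esub>}} \<noteq> {}" by (subst (asm) card_gt_0_iff) blast
  then obtain u where u: "u \<in> U" "p u = {\<one>\<^bsub>G\<^esub>}" by blast
  then have uh: "u \<in> F.homs" by (auto simp: U_def)
  interpret h: group_hom G H u by unfold_locales (use uh in \<open>simp add: F.homs_def\<close>)
  have "inj_on u (carrier G)"
    using u(2) by (intro h.inj_on_one_iff[THEN iffD2]) (auto simp: p_def)
  moreover have "card (carrier G) = card (carrier H)"
    using \<Theta>(1) by (auto simp: iso_def bij_betw_same_card)
  ultimately have "u ` carrier G = carrier H"
    using fin by (intro card_subset_eq) (auto simp: card_image)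
  then have "u \<in> iso G H" using \<open>inj_on u (carrier G)\<close> uh by (auto simp: iso_def bij_betw_def F.homs_def)
  then show ?thesis using u(1) uh by (auto simp: iso_over_def U_def F.homs_def)
qed

section \<open>Membership in subgroups of powers of an abelian group\<close>

text \<open>
  Intervals and the number 1 stay folded, so that the loops \<open>[1..<Suc m]\<close> keep the shape in
  which the lemmas on loops are stated.
\<close>

declare One_nat_def [simp del] upt_Suc [simp del]

text \<open>
  Slot \<open>(j, a)\<close> of a table is empty or holds a vector whose first entry that may be nontrivial
  is entry number \<open>j\<close>, with value \<open>a\<close>.
\<close>

type_synonym 'a table = "nat \<times> 'a \<Rightarrow> (nat \<Rightarrow> 'a) option"

lemma (in comm_group) cancel_products:
  assumes "x \<in> carrier G" "y \<in> carrier G" "a \<in> carrier G" "b \<in> carrier G" "c \<in> carrier G"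
  shows "((a \<otimes> b) \<otimes> inv c) \<otimes> ((x \<otimes> inv a) \<otimes> (y \<otimes> inv b)) = (x \<otimes> y) \<otimes> inv c"
proof -
  have "((a \<otimes> b) \<otimes> inv c) \<otimes> ((x \<otimes> inv a) \<otimes> (y \<otimes> inv b)) =
    ((x \<otimes> y) \<otimes> inv c) \<otimes> ((a \<otimes> inv a) \<otimes> (b \<otimes> inv b))"
    using assms by (simp only: m_ac m_closed inv_closed)
  then show ?thesis using assms by simp
qed

text \<open>
  Vectors of length \<open>N\<close> over a finite abelian group \<open>K\<close>. The structure of \<open>K\<close> is unknown, so
  there are no pivots in the usual sense; instead a table keeps one vector for every pair of a
  position and a leading entry that has been met.
\<close>

locale echelon = comm_group K for K (structure) +
  fixes N :: nat
  assumes fin: "finite (carrier K)"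
begin

definition V where "V = product_group {1..N} (\<lambda>_. K)"

sublocale V: comm_group V
proof -
  interpret V: group V unfolding V_def by (rule product_group) (rule group_axioms)
  show "comm_group V"
    by (rule V.group_comm_groupI) (auto simp: V_def intro!: restrict_ext m_comm)
qed

lemma V_nth [simp]: "u \<in> carrier V \<Longrightarrow> j \<in> {1..N} \<Longrightarrow> u j \<in> carrier K"
  by (auto simp: V_def)

lemma V_mult_nth [simp]: "j \<in> {1..N} \<Longrightarrow> (u \<otimes>\<^bsub>V\<^esub> v) j = u j \<otimes> v j"
  by (simp add: V_def)

lemma V_inv_nth [simp]: "u \<in> carrier V \<Longrightarrow> j \<in> {1..N} \<Longrightarrow> (inv\<^bsub>V\<^esub> u) j = inv (u j)"
  unfolding V_def by (subst inv_product_group) (auto simp: group_axioms)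

lemma V_one_nth [simp]: "j \<in> {1..N} \<Longrightarrow> \<one>\<^bsub>V\<^esub> j = \<one>"
  by (simp add: V_def)

lemma V_eqI: "u \<in> carrier V \<Longrightarrow> v \<in> carrier V \<Longrightarrow> (\<And>j. j \<in> {1..N} \<Longrightarrow> u j = v j) \<Longrightarrow> u = v"
  unfolding V_def carrier_product_group by (rule PiE_ext)

lemma finite_V: "finite (carrier V)"
  using fin by (auto simp: V_def intro: finite_PiE)

text \<open>
  At position \<open>j\<close> the vector is divided by the table entry with the same leading entry, which
  makes its entry \<open>j\<close> trivial; if the slot is empty, the vector is stored there first, so that
  the remainder becomes trivial.
\<close>

definition sift_step :: "nat \<Rightarrow> 'a table \<times> (nat \<Rightarrow> 'a) \<Rightarrow> 'a table \<times> (nat \<Rightarrow> 'a)" where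
  "sift_step j = (\<lambda>(T, u). let T' = (if T (j, u j) = None then T((j, u j) \<mapsto> u) else T)
     in (T', u \<otimes>\<^bsub>V\<^esub> inv\<^bsub>V\<^esub> the (T' (j, u j))))"

definition insert_vec :: "'a table \<Rightarrow> (nat \<Rightarrow> 'a) \<Rightarrow> 'a table" where
  "insert_vec T u = fst (fold sift_step [1..<Suc N] (T, u))"

text \<open>The vector can be divided by table entries all the way down: the search of a slot never fails.\<close>

primrec sifts :: "'a table \<Rightarrow> nat list \<Rightarrow> (nat \<Rightarrow> 'a) \<Rightarrow> bool" where
  "sifts T [] u \<longleftrightarrow> True"
| "sifts T (j # js) u \<longleftrightarrow> (\<exists>t. T (j, u j) = Some t \<and> sifts T js (u \<otimes>\<^bsub>V\<^esub> inv\<^bsub>V\<^esub> t))"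

definition tail :: "nat \<Rightarrow> (nat \<Rightarrow> 'a) set" where
  "tail i = {u \<in> carrier V. \<forall>l\<in>{1..<i}. u l = \<one>}"

text \<open>
  The slots with trivial leading entry hold the trivial vector from the start. So sifting a
  vector of \<open>tail i\<close> from position 1 does nothing before it reaches position \<open>i\<close>.
\<close>

definition table_ok :: "(nat \<Rightarrow> 'a) set \<Rightarrow> 'a table \<Rightarrow> bool" where
  "table_ok W T \<longleftrightarrow>
     (\<forall>j a t. T (j, a) = Some t \<longrightarrow> j \<in> {1..N} \<and> t \<in> W \<inter> tail j \<and> t j = a) \<and>
     (\<forall>j\<in>{1..N}. T (j, \<one>) = Some \<one>\<^bsub>V\<^esub>)"

lemma table_okD:
  assumes "table_ok W T" "T (j, a) = Some t"
  shows "j \<in> {1..N}" "t \<in> W" "t \<in> tail j" "t j = a" "t \<in> carrier V"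
  using assms unfolding table_ok_def tail_def by blast+

lemma sifts_mono: "sifts T js u \<Longrightarrow> T \<subseteq>\<^sub>m T' \<Longrightarrow> sifts T' js u"
  by (induction js arbitrary: u) (force simp: map_le_def dom_def)+

lemma tail_step:
  assumes "u \<in> tail i" "t \<in> tail i" "t i = u i" "i \<in> {1..N}"
  shows "u \<otimes>\<^bsub>V\<^esub> inv\<^bsub>V\<^esub> t \<in> tail (Suc i)"
  using assms by (auto simp: tail_def less_Suc_eq)

lemma tail_top: "u \<in> tail i \<Longrightarrow> N < i \<Longrightarrow> u = \<one>\<^bsub>V\<^esub>"
  by (rule V_eqI) (auto simp: tail_def)

text \<open>
  Entries are never overwritten, so after the insertion of \<open>u\<close> the path that \<open>u\<close> takes through
  the table is complete. If it was complete before, nothing is stored.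
\<close>

lemma fold_sift_step:
  assumes W: "subgroup W V"
    and "table_ok W T" "u \<in> W" "u \<in> tail i" "1 \<le> i"
    and "fold sift_step [i..<Suc N] (T, u) = (T', u')"
  shows "table_ok W T' \<and> T \<subseteq>\<^sub>m T' \<and> sifts T' [i..<Suc N] u \<and> (sifts T [i..<Suc N] u \<longrightarrow> T' = T)"
  using assms(2-)
proof (induction "Suc N - i" arbitrary: i T u)
  case 0
  then have "[i..<Suc N] = []" by simp
  then show ?case using 0 by (simp only: fold.simps sifts.simps) simp
next
  case (Suc k)
  then have i: "i \<in> {1..N}" and upt: "[i..<Suc N] = i # [Suc i..<Suc N]" by (auto simp: upt_rec)
  define T1 where "T1 = (if T (i, u i) = None then T((i, u i) \<mapsto> u) else T)"
  define t where "t = the (T1 (i, u i))"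
  have t: "T1 (i, u i) = Some t" by (auto simp: T1_def t_def)
  have le: "T \<subseteq>\<^sub>m T1" by (auto simp: T1_def map_le_def)
  have ok1: "table_ok W T1"
  proof -
    have "j \<in> {1..N} \<and> x \<in> W \<inter> tail j \<and> x j = a" if x: "T1 (j, a) = Some x" for j a x
    proof (cases "T (j, a) = Some x")
      case True
      then show ?thesis using Suc.prems(1) unfolding table_ok_def by blast
    next
      case False
      then have "j = i" "a = u i" "x = u" using x by (auto simp: T1_def split: if_splits)
      then show ?thesis using Suc.prems i by simp
    qed
    moreover have "T1 (j, \<one>) = Some \<one>\<^bsub>V\<^esub>" if "j \<in> {1..N}" for j
      using that Suc.prems(1) by (auto simp: T1_def table_ok_def)
    ultimately show ?thesis unfolding table_ok_def by blast
  qed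
  note t' = table_okD[OF ok1 t]
  have step: "u \<otimes>\<^bsub>V\<^esub> inv\<^bsub>V\<^esub> t \<in> tail (Suc i)"
    using Suc.prems t' i by (intro tail_step) auto
  have inW: "u \<otimes>\<^bsub>V\<^esub> inv\<^bsub>V\<^esub> t \<in> W"
    using W Suc.prems t' by (simp add: subgroup.m_closed subgroup.m_inv_closed)
  have "fold sift_step [Suc i..<Suc N] (T1, u \<otimes>\<^bsub>V\<^esub> inv\<^bsub>V\<^esub> t) = (T', u')"
    using Suc.prems(5) unfolding upt by (simp add: sift_step_def T1_def t_def Let_def)
  from Suc.hyps(1)[OF _ ok1 inW step _ this] Suc.hyps(2)
  have IH: "table_ok W T'" "T1 \<subseteq>\<^sub>m T'" "sifts T' [Suc i..<Suc N] (u \<otimes>\<^bsub>V\<^esub> inv\<^bsub>V\<^esub> t)"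
    "sifts T1 [Suc i..<Suc N] (u \<otimes>\<^bsub>V\<^esub> inv\<^bsub>V\<^esub> t) \<Longrightarrow> T' = T1" by auto
  have "T' (i, u i) = Some t" using IH(2) t by (force simp: map_le_def)
  moreover have "T' = T" if "sifts T [i..<Suc N] u"
    using that IH(4) t unfolding upt by (auto simp: T1_def)
  ultimately show ?case
    using IH le unfolding upt by (auto intro: map_le_trans)
qed

lemma insert_vec:
  assumes "subgroup W V" "table_ok W T" "u \<in> W"
  shows "table_ok W (insert_vec T u)" "T \<subseteq>\<^sub>m insert_vec T u" "sifts (insert_vec T u) [1..<Suc N] u"
    "insert_vec T u = T \<longleftrightarrow> sifts T [1..<Suc N] u"
proof -
  obtain T' u' where eq: "fold sift_step [1..<Suc N] (T, u) = (T', u')" by fastforce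
  have "u \<in> tail 1" using assms subgroup.subset by (auto simp: tail_def)
  from fold_sift_step[OF assms this _ eq]
  show "table_ok W (insert_vec T u)" "T \<subseteq>\<^sub>m insert_vec T u" "sifts (insert_vec T u) [1..<Suc N] u"
    "insert_vec T u = T \<longleftrightarrow> sifts T [1..<Suc N] u"
    unfolding insert_vec_def eq by auto
qed

text \<open>A vector that sifts is the product of the table entries met on the way, and they lie in \<open>W\<close>.\<close>

lemma sifts_in:
  assumes W: "subgroup W V" and T: "table_ok W T"
    and "u \<in> tail i" "1 \<le> i" "sifts T [i..<Suc N] u"
  shows "u \<in> W"
  using assms(3-)
proof (induction "Suc N - i" arbitrary: i u)
  case 0
  then show ?case using tail_top[of u i] subgroup.one_closed[OF W] by simp
next
  case (Suc k)
  then have i: "i \<in> {1..N}" and upt: "[i..<Suc N] = i # [Suc i..<Suc N]" by (auto simp: upt_rec)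
  obtain t where t: "T (i, u i) = Some t" "sifts T [Suc i..<Suc N] (u \<otimes>\<^bsub>V\<^esub> inv\<^bsub>V\<^esub> t)"
    using Suc.prems unfolding upt by auto
  note t' = table_okD[OF T t(1)]
  have "u \<otimes>\<^bsub>V\<^esub> inv\<^bsub>V\<^esub> t \<in> W"
    using Suc t' i t by (intro Suc.hyps(1)[of "Suc i"] tail_step) auto
  moreover have "u = (u \<otimes>\<^bsub>V\<^esub> inv\<^bsub>V\<^esub> t) \<otimes>\<^bsub>V\<^esub> t"
    using Suc.prems t' by (simp add: V.m_assoc tail_def)
  ultimately show ?case using t' W subgroup.m_closed by metis
qed

text \<open>
  A condition that makes the sifting vectors a subgroup. Only products of two entries of the
  same level, that is with the same \<open>j\<close>, have to be tested, which keeps the number of tests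
  small.
\<close>

definition level_closed :: "'a table \<Rightarrow> bool" where
  "level_closed T \<longleftrightarrow> (\<forall>j a b t t'. T (j, a) = Some t \<longrightarrow> T (j, b) = Some t' \<longrightarrow>
     sifts T [1..<Suc N] (t \<otimes>\<^bsub>V\<^esub> t'))"

lemma sifts_tail:
  assumes T: "table_ok W T" and "u \<in> tail i" "1 \<le> i" "i \<le> Suc N"
  shows "sifts T [1..<Suc N] u \<longleftrightarrow> sifts T [i..<Suc N] u"
  using \<open>1 \<le> i\<close> \<open>i \<le> Suc N\<close> \<open>u \<in> tail i\<close>
proof (induction i rule: dec_induct)
  case base
  then show ?case by simp
next
  case (step k)
  then have k: "k \<in> {1..N}" and upt: "[k..<Suc N] = k # [Suc k..<Suc N]" by (auto simp: upt_rec)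
  have u: "u \<in> tail k" "u k = \<one>" "u \<in> carrier V" using step by (auto simp: tail_def)
  then have "u \<otimes>\<^bsub>V\<^esub> inv\<^bsub>V\<^esub> \<one>\<^bsub>V\<^esub> = u" by simp
  then show ?case
    using step.IH[OF _ u(1)] step.prems T k u(2) unfolding upt by (auto simp: table_ok_def)
qed

text \<open>
  At level \<open>i\<close> the vectors \<open>u\<close> and \<open>v\<close> are divided by entries \<open>t\<close> and \<open>t'\<close>. The product \<open>t t'\<close>
  sifts, so the table has an entry \<open>t''\<close> with the leading entry of \<open>u v\<close>. By commutativity the
  remainder of \<open>u v\<close> modulo \<open>t''\<close> is the product of the three remainders of \<open>t t'\<close>, \<open>u\<close> and \<open>v\<close>,
  which all belong to the next level.
\<close>

lemma sifts_mult:
  assumes T: "table_ok W T" and closed: "level_closed T"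
    and "u \<in> tail i" "v \<in> tail i" "1 \<le> i" "i \<le> Suc N" "sifts T [i..<Suc N] u" "sifts T [i..<Suc N] v"
  shows "sifts T [i..<Suc N] (u \<otimes>\<^bsub>V\<^esub> v)"
  using assms(3-)
proof (induction "Suc N - i" arbitrary: i u v)
  case 0
  then show ?case by simp
next
  case (Suc k)
  then have i: "i \<in> {1..N}" and upt: "[i..<Suc N] = i # [Suc i..<Suc N]" by (auto simp: upt_rec)
  have IH: "sifts T [Suc i..<Suc N] (r \<otimes>\<^bsub>V\<^esub> r')"
    if "r \<in> tail (Suc i)" "r' \<in> tail (Suc i)" "sifts T [Suc i..<Suc N] r" "sifts T [Suc i..<Suc N] r'" for r r'
    using Suc.hyps(1)[of "Suc i" r r'] that Suc.hyps(2) i by simp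
  obtain t where t: "T (i, u i) = Some t" "sifts T [Suc i..<Suc N] (u \<otimes>\<^bsub>V\<^esub> inv\<^bsub>V\<^esub> t)"
    using Suc.prems unfolding upt by auto
  obtain t' where t': "T (i, v i) = Some t'" "sifts T [Suc i..<Suc N] (v \<otimes>\<^bsub>V\<^esub> inv\<^bsub>V\<^esub> t')"
    using Suc.prems unfolding upt by auto
  note ok = table_okD[OF T t(1)] table_okD[OF T t'(1)]
  have tt: "t \<otimes>\<^bsub>V\<^esub> t' \<in> tail i" using ok i by (auto simp: tail_def)
  have "sifts T [i..<Suc N] (t \<otimes>\<^bsub>V\<^esub> t')"
    using closed t t' sifts_tail[OF T tt] i unfolding level_closed_def by auto
  then obtain t'' where t'': "T (i, (t \<otimes>\<^bsub>V\<^esub> t') i) = Some t''"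
     "sifts T [Suc i..<Suc N] ((t \<otimes>\<^bsub>V\<^esub> t') \<otimes>\<^bsub>V\<^esub> inv\<^bsub>V\<^esub> t'')"
    unfolding upt by auto
  note ok'' = table_okD[OF T t''(1)]
  let ?r = "u \<otimes>\<^bsub>V\<^esub> inv\<^bsub>V\<^esub> t" and ?r' = "v \<otimes>\<^bsub>V\<^esub> inv\<^bsub>V\<^esub> t'" and ?r'' = "(t \<otimes>\<^bsub>V\<^esub> t') \<otimes>\<^bsub>V\<^esub> inv\<^bsub>V\<^esub> t''"
  have r: "?r \<in> tail (Suc i)" "?r' \<in> tail (Suc i)" "?r'' \<in> tail (Suc i)"
    using tail_step Suc.prems ok ok'' tt i by auto
  have rr: "?r \<otimes>\<^bsub>V\<^esub> ?r' \<in> tail (Suc i)"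
    using r i by (auto simp: tail_def)
  have cV: "u \<in> carrier V" "v \<in> carrier V" using Suc.prems by (auto simp: tail_def)
  have "sifts T [Suc i..<Suc N] (?r'' \<otimes>\<^bsub>V\<^esub> (?r \<otimes>\<^bsub>V\<^esub> ?r'))"
    by (intro IH r rr t t' t'')
  also have "?r'' \<otimes>\<^bsub>V\<^esub> (?r \<otimes>\<^bsub>V\<^esub> ?r') = (u \<otimes>\<^bsub>V\<^esub> v) \<otimes>\<^bsub>V\<^esub> inv\<^bsub>V\<^esub> t''"
    using cV ok ok'' by (intro V.cancel_products) auto
  finally show ?case
    using t'' ok cV i unfolding upt by auto
qed

text \<open>Inverses come for free in a finite group, where they are powers.\<close>

lemma sifts_subgroup:
  assumes "table_ok W T" "level_closed T" "1 \<le> N"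
  shows "subgroup {u \<in> carrier V. sifts T [1..<Suc N] u} V" (is "subgroup ?S V")
proof -
  have mult: "u \<otimes>\<^bsub>V\<^esub> v \<in> ?S" if "u \<in> ?S" "v \<in> ?S" for u v
    using that sifts_mult[OF assms(1,2), of u 1 v] assms(3) by (auto simp: tail_def)
  have one: "\<one>\<^bsub>V\<^esub> \<in> ?S"
    using sifts_tail[OF assms(1), of "\<one>\<^bsub>V\<^esub>" "Suc N"] by (auto simp: tail_def)
  have pow: "u [^]\<^bsub>V\<^esub> (m::nat) \<in> ?S" if "u \<in> ?S" for u m
    by (induction m) (use mult one that in auto)
  have inv: "inv\<^bsub>V\<^esub> u \<in> ?S" if "u \<in> ?S" for u
  proof -
    have u: "u \<in> carrier V" using that by simp
    have "Coset.order V > 0" using finite_V V.order_gt_0_iff_finite by blast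
    then have "u [^]\<^bsub>V\<^esub> (Coset.order V - 1) \<otimes>\<^bsub>V\<^esub> u = \<one>\<^bsub>V\<^esub>"
      using V.pow_order_eq_1[OF u] V.nat_pow_Suc[of u "Coset.order V - 1"] by simp
    then have "inv\<^bsub>V\<^esub> u = u [^]\<^bsub>V\<^esub> (Coset.order V - 1)"
      using u by (intro V.inv_equality) auto
    then show ?thesis using pow[OF that] by simp
  qed
  show ?thesis
    by (rule V.subgroupI) (use mult one inv in auto)
qed

definition close_step :: "nat \<Rightarrow> 'a \<Rightarrow> 'a \<Rightarrow> 'a table \<Rightarrow> 'a table" where
  "close_step j a b T = (case (T (j, a), T (j, b)) of
      (Some t, Some t') \<Rightarrow> insert_vec T (t \<otimes>\<^bsub>V\<^esub> t') | _ \<Rightarrow> T)"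

definition pass :: "'a list \<Rightarrow> 'a table \<Rightarrow> 'a table" where
  "pass es = fold (\<lambda>j. fold (\<lambda>a. fold (\<lambda>b. close_step j a b) es) es) [1..<Suc N]"

text \<open>Operations that only fill slots, and fill them with members of \<open>W\<close>.\<close>

definition inflationary :: "(nat \<Rightarrow> 'a) set \<Rightarrow> ('a table \<Rightarrow> 'a table) \<Rightarrow> bool" where
  "inflationary W f \<longleftrightarrow> (\<forall>T. table_ok W T \<longrightarrow> table_ok W (f T) \<and> T \<subseteq>\<^sub>m f T)"

lemma inflationary_fold:
  assumes "\<And>i. i \<in> set xs \<Longrightarrow> inflationary W (f i)"
  shows "inflationary W (fold f xs)"
  using assms
proof (induction xs)
  case Nil
  then show ?case by (simp add: inflationary_def)
next
  case (Cons x xs)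
  then have "inflationary W (f x)" "inflationary W (fold f xs)" by auto
  then show ?case unfolding inflationary_def by (auto intro: map_le_trans)
qed

lemma fold_fixpoint:
  assumes "\<And>i. i \<in> set xs \<Longrightarrow> inflationary W (f i)" "table_ok W T" "fold f xs T = T" "i \<in> set xs"
  shows "f i T = T"
  using assms
proof (induction xs)
  case (Cons x xs)
  have x: "inflationary W (f x)" and xs: "inflationary W (fold f xs)"
    using Cons.prems(1) inflationary_fold[of xs W f] by auto
  have "table_ok W (f x T)" "T \<subseteq>\<^sub>m f x T" using x Cons.prems(2) by (auto simp: inflationary_def)
  moreover from this have "f x T \<subseteq>\<^sub>m T"
    using xs Cons.prems(3) by (auto simp: inflationary_def)
  ultimately have fx: "f x T = T" by (simp add: map_le_antisym)
  then have "fold f xs T = T" using Cons.prems(3) by simp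
  then show ?case using fx Cons by auto
qed simp

lemma inflationary_insert:
  assumes "subgroup W V" "u \<in> W"
  shows "inflationary W (\<lambda>T. insert_vec T u)"
  using insert_vec[OF assms(1) _ assms(2)] by (simp add: inflationary_def)

lemma inflationary_close_step:
  assumes W: "subgroup W V"
  shows "inflationary W (close_step j a b)"
  unfolding inflationary_def
proof (intro allI impI)
  fix T assume T: "table_ok W T"
  show "table_ok W (close_step j a b T) \<and> T \<subseteq>\<^sub>m close_step j a b T"
  proof (cases "\<exists>t t'. T (j, a) = Some t \<and> T (j, b) = Some t'")
    case True
    then obtain t t' where t: "T (j, a) = Some t" "T (j, b) = Some t'" by blast
    then have "t \<otimes>\<^bsub>V\<^esub> t' \<in> W" using table_okD(2)[OF T] subgroup.m_closed[OF W] by blast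
    from insert_vec[OF W T this] show ?thesis by (simp add: close_step_def t)
  next
    case False
    then have "close_step j a b T = T" by (auto simp: close_step_def split: option.splits)
    then show ?thesis using T by simp
  qed
qed

lemma inflationary_pass:
  assumes W: "subgroup W V"
  shows "inflationary W (pass es)"
  unfolding pass_def by (intro inflationary_fold inflationary_close_step W)

text \<open>
  Since every single step of a pass can only enlarge the table, a pass that changes nothing
  consists of steps that change nothing. So each product of two entries on a level already
  sifts.
\<close>

lemma pass_fixpoint:
  assumes W: "subgroup W V" and T: "table_ok W T" and fixp: "pass es T = T" and es: "carrier K \<subseteq> set es"
  shows "level_closed T"
  unfolding level_closed_def
proof (intro allI impI)
  fix j a b t t' assume t: "T (j, a) = Some t" "T (j, b) = Some t'"
  note ok = table_okD[OF T t(1)] table_okD[OF T t(2)]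
  have j: "j \<in> set [1..<Suc N]" and a: "a \<in> set es" and b: "b \<in> set es"
    using ok es V_nth by auto
  have "fold (\<lambda>a. fold (\<lambda>b. close_step j a b) es) es T = T"
    by (rule fold_fixpoint[OF _ T _ j]) (use fixp W in \<open>auto simp: pass_def intro!: inflationary_fold inflationary_close_step\<close>)
  then have "fold (\<lambda>b. close_step j a b) es T = T"
    by (rule fold_fixpoint[OF _ T _ a, rotated]) (use W in \<open>auto intro!: inflationary_fold inflationary_close_step\<close>)
  then have "close_step j a b T = T"
    by (rule fold_fixpoint[OF _ T _ b, rotated]) (use W in \<open>auto intro!: inflationary_close_step\<close>)
  moreover have "t \<otimes>\<^bsub>V\<^esub> t' \<in> W" using ok subgroup.m_closed[OF W] by blast
  ultimately show "sifts T [1..<Suc N] (t \<otimes>\<^bsub>V\<^esub> t')"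
    using insert_vec(4)[OF W T] t by (simp add: close_step_def)
qed

lemma inflationary_funpow:
  assumes "inflationary W f"
  shows "inflationary W (f ^^ m)"
  using assms by (induction m) (auto simp: inflationary_def intro: map_le_trans)

text \<open>Every round that is not yet stationary fills one of the \<open>N * card (carrier K)\<close> slots.\<close>

lemma iterate_to_fixpoint:
  assumes f: "inflationary W f" and W: "W \<subseteq> carrier V" and T: "table_ok W T"
    and m: "N * card (carrier K) \<le> m"
  shows "f ((f ^^ m) T) = (f ^^ m) T"
proof (rule ccontr)
  assume no: "f ((f ^^ m) T) \<noteq> (f ^^ m) T"
  define D where "D = {1..N} \<times> carrier K"
  have D: "finite D" "card D = N * card (carrier K)" using fin by (auto simp: D_def)
  have ok: "table_ok W ((f ^^ i) T)" for i
    using inflationary_funpow[OF f] T by (auto simp: inflationary_def)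
  have dom: "dom ((f ^^ i) T) \<subseteq> D" for i
  proof
    fix x assume "x \<in> dom ((f ^^ i) T)"
    then obtain j a t where x: "x = (j, a)" "(f ^^ i) T (j, a) = Some t" by (cases x) auto
    from table_okD[OF ok x(2)] show "x \<in> D" using x by (auto simp: D_def)
  qed
  have grow: "f ((f ^^ i) T) \<noteq> (f ^^ i) T" if "i \<le> m" for i
  proof
    assume fixp: "f ((f ^^ i) T) = (f ^^ i) T"
    have "(f ^^ (k + i)) T = (f ^^ i) T" for k
      by (induction k) (simp_all add: fixp)
    from this[of "m - i"] this[of "Suc (m - i)"] that no show False by simp
  qed
  have "i \<le> card (dom ((f ^^ i) T))" if "i \<le> Suc m" for i
    using that
  proof (induction i)
    case (Suc i)
    let ?A = "(f ^^ i) T"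
    have le: "?A \<subseteq>\<^sub>m f ?A" using f ok[of i] by (auto simp: inflationary_def)
    have "dom ?A \<noteq> dom (f ?A)"
    proof
      assume "dom ?A = dom (f ?A)"
      then have "f ?A \<subseteq>\<^sub>m ?A" using le by (auto simp: map_le_def)
      then show False using grow[of i] Suc.prems map_le_antisym[OF le] by simp
    qed
    moreover have "dom ?A \<subseteq> dom (f ?A)" using le by (rule map_le_implies_dom_le)
    ultimately have "card (dom ?A) < card (dom (f ?A))"
      using finite_subset[OF dom[of "Suc i"] D(1)] by (intro psubset_card_mono) auto
    then show ?case using Suc by simp
  qed simp
  from this[of "Suc m"] have "Suc m \<le> card D"
    using card_mono[OF D(1) dom[of "Suc m"]] by linarith
  then show False using D m by simp
qed

definition trivial_table :: "'a table" where
  "trivial_table = (\<lambda>(j, a). if j \<in> {1..N} \<and> a = \<one> then Some \<one>\<^bsub>V\<^esub> else None)"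

lemma trivial_table_ok: "subgroup W V \<Longrightarrow> table_ok W trivial_table"
  by (auto simp: table_ok_def trivial_table_def tail_def subgroup.one_closed split: if_splits)

text \<open>
  The generators are inserted, the table is closed under products of entries on the same level,
  and the candidate is in the subgroup iff its insertion leaves the table unchanged. One
  inclusion holds because all entries lie in the subgroup, the other because the sifting vectors
  are a subgroup with the generators in it.
\<close>

theorem membership:
  assumes N: "1 \<le> N" and es: "carrier K \<subseteq> set es" and m: "N * card (carrier K) \<le> m"
    and gens: "\<And>x. x \<in> set xs \<Longrightarrow> w x \<in> carrier V" and zV: "z \<in> carrier V"
    and T: "T = (pass es ^^ m) (fold (\<lambda>x T. insert_vec T (w x)) xs trivial_table)"
  shows "insert_vec T z = T \<longleftrightarrow> z \<in> generate V (w ` set xs)"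
proof -
  let ?W = "generate V (w ` set xs)"
  have W: "subgroup ?W V" by (rule V.generate_is_subgroup) (use gens in auto)
  have wW: "w x \<in> ?W" if "x \<in> set xs" for x using that by (simp add: generate.incl)
  define T1 where "T1 = fold (\<lambda>x T. insert_vec T (w x)) xs trivial_table"
  have infl: "inflationary ?W (\<lambda>T. insert_vec T (w x))" if "x \<in> set xs" for x
    by (intro inflationary_insert W wW that)
  have T1: "table_ok ?W T1"
    using inflationary_fold[of xs ?W "\<lambda>x T. insert_vec T (w x)"] infl trivial_table_ok[OF W]
    by (auto simp: inflationary_def T1_def)
  have ins: "sifts T1 [1..<Suc N] (w x)" if "x \<in> set xs" for x
  proof -
    have "sifts (fold (\<lambda>x T. insert_vec T (w x)) ys T') [1..<Suc N] (w x)"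
      if "x \<in> set ys" "set ys \<subseteq> set xs" "table_ok ?W T'" for ys T'
      using that
    proof (induction ys arbitrary: T')
      case (Cons y ys)
      have y: "w y \<in> ?W" using Cons.prems wW by auto
      note iy = insert_vec[OF W Cons.prems(3) y]
      have "inflationary ?W (fold (\<lambda>x T. insert_vec T (w x)) ys)"
        using Cons.prems infl by (intro inflationary_fold) auto
      then have le: "insert_vec T' (w y) \<subseteq>\<^sub>m fold (\<lambda>x T. insert_vec T (w x)) ys (insert_vec T' (w y))"
        using iy(1) by (auto simp: inflationary_def)
      show ?case
      proof (cases "x = y")
        case True
        then show ?thesis using sifts_mono[OF iy(3) le] by simp
      next
        case False
        then show ?thesis using Cons.IH[OF _ _ iy(1)] Cons.prems by simp
      qed
    qed simp
    from this[OF that subset_refl trivial_table_ok[OF W]] show ?thesis by (simp add: T1_def)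
  qed
  have TT: "T = (pass es ^^ m) T1" by (simp add: T T1_def)
  have "inflationary ?W (pass es ^^ m)" by (intro inflationary_funpow inflationary_pass W)
  then have okT: "table_ok ?W T" and le: "T1 \<subseteq>\<^sub>m T" using T1 by (auto simp: inflationary_def TT)
  have "pass es T = T"
    unfolding TT using m T1 by (intro iterate_to_fixpoint[OF inflationary_pass[OF W]] subgroup.subset[OF W])
  then have closed: "level_closed T" by (rule pass_fixpoint[OF W okT _ es])
  have sub: "subgroup {u \<in> carrier V. sifts T [1..<Suc N] u} V" by (rule sifts_subgroup[OF okT closed N])
  have "w ` set xs \<subseteq> {u \<in> carrier V. sifts T [1..<Suc N] u}"
    using gens sifts_mono[OF ins le] by auto
  then have 1: "?W \<subseteq> {u \<in> carrier V. sifts T [1..<Suc N] u}"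
    using V.generate_subgroup_incl[OF _ sub] by simp
  have 2: "z \<in> ?W" if "sifts T [1..<Suc N] z"
    by (rule sifts_in[OF W okT _ _ that]) (use zV in \<open>auto simp: tail_def\<close>)
  have V: "subgroup (carrier V) V" by (rule V.subgroup_self)
  have "table_ok (carrier V) T" using okT subgroup.subset[OF W] unfolding table_ok_def by blast
  from insert_vec(4)[OF V this zV] 1 2 show ?thesis by auto
qed

end

section \<open>Homomorphisms as solutions of a linear system\<close>

text \<open>
  The relation \<open>c\<close> gives the values admitted at each \<open>g\<close>: a coset of a subgroup of the kernel,
  or nothing. A coset is described by closure under \<open>x y\<inverse> z\<close>, which avoids naming the subgroup.
  The functions \<open>P1\<close> and \<open>P2\<close> number the pairs of elements of \<open>G\<close>.
\<close>

locale row_system = fibre G H C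
  for G :: "('a, 'g) monoid_scheme" (structure) and H :: "('b, 'h) monoid_scheme" (structure) and C +
  fixes c :: "'a \<Rightarrow> 'b \<Rightarrow> bool" and N :: nat and P1 P2 :: "nat \<Rightarrow> 'a"
  assumes finG: "finite (carrier G)" and finH: "finite (carrier H)"
    and row: "\<lbrakk>g \<in> carrier G; c g h\<rbrakk> \<Longrightarrow> h \<in> carrier H \<and> C g h"
    and row_heap: "\<lbrakk>g \<in> carrier G; c g x; c g y; c g z\<rbrakk> \<Longrightarrow> c g (x \<otimes>\<^bsub>H\<^esub> inv\<^bsub>H\<^esub> y \<otimes>\<^bsub>H\<^esub> z)"
    and P12: "\<And>j. j \<in> {1..N} \<Longrightarrow> P1 j \<in> carrier G \<and> P2 j \<in> carrier G"
    and P12_surj: "\<lbrakk>g \<in> carrier G; g' \<in> carrier G\<rbrakk> \<Longrightarrow> \<exists>j\<in>{1..N}. P1 j = g \<and> P2 j = g'"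
begin

abbreviation K where "K \<equiv> H\<lparr>carrier := ker\<rparr>"

lemma comm_group_K: "comm_group K"
proof -
  interpret K: group K by (rule subgroup.subgroup_is_group[OF subgroup_ker H.group_axioms])
  show ?thesis by (rule K.group_comm_groupI) (simp add: ker_comm)
qed

sublocale E: echelon K N
  by (intro echelon.intro comm_group_K echelon_axioms.intro)
    (use finH in \<open>auto simp: ker_def intro: finite_subset\<close>)

lemma inv_K: "x \<in> ker \<Longrightarrow> inv\<^bsub>K\<^esub> x = inv\<^bsub>H\<^esub> x"
  by (rule H.m_inv_consistent[OF subgroup_ker])

definition sel where "sel = {s. \<forall>g\<in>carrier G. c g (s g)}"

definition defect where
  "defect s = (\<lambda>j\<in>{1..N}. s (P1 j) \<otimes>\<^bsub>H\<^esub> s (P2 j) \<otimes>\<^bsub>H\<^esub> inv\<^bsub>H\<^esub> s (P1 j \<otimes>\<^bsub>G\<^esub> P2 j))"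

lemma selD: "s \<in> sel \<Longrightarrow> g \<in> carrier G \<Longrightarrow> c g (s g) \<and> s g \<in> carrier H \<and> C g (s g)"
  using row by (auto simp: sel_def)

lemma defect_ker:
  assumes "s \<in> sel" "g \<in> carrier G" "h \<in> carrier G"
  shows "s g \<otimes>\<^bsub>H\<^esub> s h \<otimes>\<^bsub>H\<^esub> inv\<^bsub>H\<^esub> s (g \<otimes>\<^bsub>G\<^esub> h) \<in> ker"
  using assms selD[OF assms(1)] by (intro ker_div[of "g \<otimes>\<^bsub>G\<^esub> h"]) (auto intro: C_mult)

lemma defect_V: "s \<in> sel \<Longrightarrow> defect s \<in> carrier E.V"
  using P12 by (auto simp: E.V_def defect_def defect_ker)

definition heap where "heap s s' s'' = (\<lambda>g. s g \<otimes>\<^bsub>H\<^esub> inv\<^bsub>H\<^esub> s' g \<otimes>\<^bsub>H\<^esub> s'' g)"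

lemma heap_sel: "s \<in> sel \<Longrightarrow> s' \<in> sel \<Longrightarrow> s'' \<in> sel \<Longrightarrow> heap s s' s'' \<in> sel"
  by (auto simp: sel_def heap_def row_heap)

text \<open>
  Multiplying \<open>s\<close> by elements of the kernel changes its defect by a product in which each of
  them occurs once, conjugated by \<open>s g\<close> in one case.
\<close>

lemma defect_shift:
  assumes g: "g \<in> carrier G" "h \<in> carrier G" and s: "s \<in> sel"
    and k: "\<alpha> \<in> ker" "\<beta> \<in> ker" "\<delta> \<in> ker"
  shows "(\<alpha> \<otimes>\<^bsub>H\<^esub> s g) \<otimes>\<^bsub>H\<^esub> (\<beta> \<otimes>\<^bsub>H\<^esub> s h) \<otimes>\<^bsub>H\<^esub> inv\<^bsub>H\<^esub> (\<delta> \<otimes>\<^bsub>H\<^esub> s (g \<otimes>\<^bsub>G\<^esub> h)) =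
    \<alpha> \<otimes>\<^bsub>H\<^esub> (s g \<otimes>\<^bsub>H\<^esub> \<beta> \<otimes>\<^bsub>H\<^esub> inv\<^bsub>H\<^esub> s g) \<otimes>\<^bsub>H\<^esub> (s g \<otimes>\<^bsub>H\<^esub> s h \<otimes>\<^bsub>H\<^esub> inv\<^bsub>H\<^esub> s (g \<otimes>\<^bsub>G\<^esub> h)) \<otimes>\<^bsub>H\<^esub> inv\<^bsub>H\<^esub> \<delta>"
proof -
  have "s g \<in> carrier H" "s h \<in> carrier H" "s (g \<otimes>\<^bsub>G\<^esub> h) \<in> carrier H" using selD[OF s] g by auto
  then show ?thesis using k[THEN ker_carrier]
    by (simp add: H.m_assoc H.inv_mult_group) (simp add: H.inv_solve_left flip: H.m_assoc)
qed

text \<open>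
  The defect is an affine map: it preserves the operation \<open>x y\<inverse> z\<close>. Everything is written
  relative to \<open>s'\<close>; the factors \<open>p\<close> and \<open>q\<close> lie in the kernel, where they commute and
  conjugation by \<open>s' g\<close> is a homomorphism.
\<close>

lemma defect_heap:
  assumes s: "s \<in> sel" "s' \<in> sel" "s'' \<in> sel"
  shows "defect (heap s s' s'') = defect s \<otimes>\<^bsub>E.V\<^esub> inv\<^bsub>E.V\<^esub> defect s' \<otimes>\<^bsub>E.V\<^esub> defect s''"
proof (rule E.V_eqI)
  show "defect (heap s s' s'') \<in> carrier E.V" using s by (intro defect_V heap_sel)
  show "defect s \<otimes>\<^bsub>E.V\<^esub> inv\<^bsub>E.V\<^esub> defect s' \<otimes>\<^bsub>E.V\<^esub> defect s'' \<in> carrier E.V"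
    using s by (intro E.V.m_closed E.V.inv_closed defect_V)
next
  fix j assume j: "j \<in> {1..N}"
  define g h where "g = P1 j" and "h = P2 j"
  have gh: "g \<in> carrier G" "h \<in> carrier G" "g \<otimes>\<^bsub>G\<^esub> h \<in> carrier G" using P12[OF j] by (auto simp: g_def h_def)
  note sc = selD[OF s(1)] selD[OF s(2)] selD[OF s(3)]
  define p where "p x = s x \<otimes>\<^bsub>H\<^esub> inv\<^bsub>H\<^esub> s' x" for x
  define q where "q x = s'' x \<otimes>\<^bsub>H\<^esub> inv\<^bsub>H\<^esub> s' x" for x
  have pk: "p x \<in> ker" "q x \<in> ker" if "x \<in> carrier G" for x
    using sc that by (auto simp: p_def q_def intro!: ker_div[of x])
  note pc = pk[THEN ker_carrier]
  have ps: "s x = p x \<otimes>\<^bsub>H\<^esub> s' x" "s'' x = q x \<otimes>\<^bsub>H\<^esub> s' x"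
    "heap s s' s'' x = (p x \<otimes>\<^bsub>H\<^esub> q x) \<otimes>\<^bsub>H\<^esub> s' x" if "x \<in> carrier G" for x
    using sc that by (simp_all add: p_def q_def heap_def H.m_assoc)
  define y where "y = s' g \<otimes>\<^bsub>H\<^esub> s' h \<otimes>\<^bsub>H\<^esub> inv\<^bsub>H\<^esub> s' (g \<otimes>\<^bsub>G\<^esub> h)"
  have y: "y \<in> ker" unfolding y_def using s gh by (intro defect_ker)
  define cj where "cj x = s' g \<otimes>\<^bsub>H\<^esub> x \<otimes>\<^bsub>H\<^esub> inv\<^bsub>H\<^esub> s' g" for x
  have cj: "cj x \<in> ker" if "x \<in> ker" for x
    unfolding cj_def using that sc gh by (intro ker_conj[of g]) auto
  have cjm: "cj (x \<otimes>\<^bsub>H\<^esub> x') = cj x \<otimes>\<^bsub>H\<^esub> cj x'" if "x \<in> ker" "x' \<in> ker" for x x'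
    using that[THEN ker_carrier] sc gh unfolding cj_def
    by (simp add: H.m_assoc) (simp add: H.inv_solve_left flip: H.m_assoc)
  have km: "x \<otimes>\<^bsub>H\<^esub> x' \<in> ker" if "x \<in> ker" "x' \<in> ker" for x x'
    using that subgroup.m_closed[OF subgroup_ker] by blast
  have ki: "inv\<^bsub>H\<^esub> x \<in> ker" if "x \<in> ker" for x
    using that subgroup.m_inv_closed[OF subgroup_ker] by blast
  let ?gh = "g \<otimes>\<^bsub>G\<^esub> h"
  define a a' b b' d d' where "a = p g" and "a' = q g" and "b = cj (p h)" and "b' = cj (q h)"
    and "d = p ?gh" and "d' = q ?gh"
  have abd: "a \<in> ker" "a' \<in> ker" "b \<in> ker" "b' \<in> ker" "d \<in> ker" "d' \<in> ker"
    using pk gh cj by (auto simp: a_def a'_def b_def b'_def d_def d'_def)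
  have 1: "defect s j = a \<otimes>\<^bsub>H\<^esub> b \<otimes>\<^bsub>H\<^esub> y \<otimes>\<^bsub>H\<^esub> inv\<^bsub>H\<^esub> d"
    "defect s'' j = a' \<otimes>\<^bsub>H\<^esub> b' \<otimes>\<^bsub>H\<^esub> y \<otimes>\<^bsub>H\<^esub> inv\<^bsub>H\<^esub> d'" "defect s' j = y"
    "defect (heap s s' s'') j = (a \<otimes>\<^bsub>H\<^esub> a') \<otimes>\<^bsub>H\<^esub> (b \<otimes>\<^bsub>H\<^esub> b') \<otimes>\<^bsub>H\<^esub> y \<otimes>\<^bsub>H\<^esub> inv\<^bsub>H\<^esub> (d \<otimes>\<^bsub>H\<^esub> d')"
    using j gh pk km
    by (simp_all add: defect_def ps cjm y_def a_def a'_def b_def b'_def d_def d'_def defect_shift[OF _ _ s(2)]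
        flip: g_def h_def cj_def)
  have "(a \<otimes>\<^bsub>K\<^esub> a') \<otimes>\<^bsub>K\<^esub> (b \<otimes>\<^bsub>K\<^esub> b') \<otimes>\<^bsub>K\<^esub> y \<otimes>\<^bsub>K\<^esub> inv\<^bsub>K\<^esub> (d \<otimes>\<^bsub>K\<^esub> d') =
    ((a \<otimes>\<^bsub>K\<^esub> b \<otimes>\<^bsub>K\<^esub> y \<otimes>\<^bsub>K\<^esub> inv\<^bsub>K\<^esub> d) \<otimes>\<^bsub>K\<^esub> inv\<^bsub>K\<^esub> y) \<otimes>\<^bsub>K\<^esub> (a' \<otimes>\<^bsub>K\<^esub> b' \<otimes>\<^bsub>K\<^esub> y \<otimes>\<^bsub>K\<^esub> inv\<^bsub>K\<^esub> d')"
  proof -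
    have cK: "a \<in> carrier K" "a' \<in> carrier K" "b \<in> carrier K" "b' \<in> carrier K" "d \<in> carrier K" "d' \<in> carrier K" "y \<in> carrier K"
      using abd y by simp_all
    have "((a \<otimes>\<^bsub>K\<^esub> b \<otimes>\<^bsub>K\<^esub> y \<otimes>\<^bsub>K\<^esub> inv\<^bsub>K\<^esub> d) \<otimes>\<^bsub>K\<^esub> inv\<^bsub>K\<^esub> y) \<otimes>\<^bsub>K\<^esub> (a' \<otimes>\<^bsub>K\<^esub> b' \<otimes>\<^bsub>K\<^esub> y \<otimes>\<^bsub>K\<^esub> inv\<^bsub>K\<^esub> d') =
      (a \<otimes>\<^bsub>K\<^esub> a') \<otimes>\<^bsub>K\<^esub> (b \<otimes>\<^bsub>K\<^esub> b') \<otimes>\<^bsub>K\<^esub> y \<otimes>\<^bsub>K\<^esub> (inv\<^bsub>K\<^esub> d' \<otimes>\<^bsub>K\<^esub> inv\<^bsub>K\<^esub> d) \<otimes>\<^bsub>K\<^esub> (y \<otimes>\<^bsub>K\<^esub> inv\<^bsub>K\<^esub> y)"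
      by (simp only: E.m_ac E.m_closed E.inv_closed cK)
    also have "inv\<^bsub>K\<^esub> d' \<otimes>\<^bsub>K\<^esub> inv\<^bsub>K\<^esub> d = inv\<^bsub>K\<^esub> (d \<otimes>\<^bsub>K\<^esub> d')"
      by (rule E.inv_mult_group[symmetric]) (use abd in simp_all)
    also have "y \<otimes>\<^bsub>K\<^esub> inv\<^bsub>K\<^esub> y = \<one>\<^bsub>K\<^esub>" using cK by (intro E.r_inv)
    finally show ?thesis by (simp only: E.r_one E.m_closed E.inv_closed cK)
  qed
  then show "defect (heap s s' s'') j = (defect s \<otimes>\<^bsub>E.V\<^esub> inv\<^bsub>E.V\<^esub> defect s' \<otimes>\<^bsub>E.V\<^esub> defect s'') j"
    using j abd y km by (simp add: 1 defect_V s inv_K)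
qed

lemma homs_iff_defect:
  assumes "s \<in> sel"
  shows "s \<in> homs \<longleftrightarrow> defect s = \<one>\<^bsub>E.V\<^esub>"
proof
  assume h: "s \<in> homs"
  show "defect s = \<one>\<^bsub>E.V\<^esub>"
    by (rule E.V_eqI) (use assms P12 homsD[OF h] in \<open>simp_all add: defect_V\<close>, simp add: defect_def)
next
  assume d: "defect s = \<one>\<^bsub>E.V\<^esub>"
  note sc = selD[OF assms]
  show "s \<in> homs"
    unfolding homs_def
  proof (intro CollectI conjI homI ballI)
    fix g h assume gh: "g \<in> carrier G" "h \<in> carrier G"
    obtain j where j: "j \<in> {1..N}" "P1 j = g" "P2 j = h" using P12_surj gh by blast
    then have "s g \<otimes>\<^bsub>H\<^esub> s h \<otimes>\<^bsub>H\<^esub> inv\<^bsub>H\<^esub> s (g \<otimes>\<^bsub>G\<^esub> h) = \<one>\<^bsub>H\<^esub>"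
      using fun_cong[OF d, of j] by (simp add: defect_def)
    then show "s (g \<otimes>\<^bsub>G\<^esub> h) = s g \<otimes>\<^bsub>H\<^esub> s h"
      using sc gh by (simp add: H.inv_solve_right')
  qed (use sc in auto)
qed

lemma sel_upd: "s \<in> sel \<Longrightarrow> c x y \<Longrightarrow> s(x := y) \<in> sel"
  by (auto simp: sel_def)

text \<open>
  Affinity lets every admissible map be built from \<open>f0\<close> by changing one value at a time, so the
  differences \<open>w (x, y)\<close>, which belong to a single changed value, generate the direction of the
  coset of all defects. The trivial defect is in that coset iff the defect of \<open>f0\<close> is in the
  subgroup of directions.
\<close>

theorem solvable_iff:
  assumes f0: "f0 \<in> sel"
    and w: "\<And>x y. w (x, y) = defect (f0(x := y)) \<otimes>\<^bsub>E.V\<^esub> inv\<^bsub>E.V\<^esub> defect f0"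
    and R: "R = {(x, y). x \<in> carrier G \<and> c x y}"
  shows "(\<exists>f\<in>homs. \<forall>g\<in>carrier G. c g (f g)) \<longleftrightarrow> defect f0 \<in> generate E.V (w ` R)"
proof -
  let ?W = "generate E.V (w ` R)" and ?z = "defect f0"
  have wV: "w ` R \<subseteq> carrier E.V"
    using f0 by (auto simp: w R defect_V sel_upd)
  have W: "subgroup ?W E.V" by (rule E.V.generate_is_subgroup[OF wV])
  note WV = subgroup.mem_carrier[OF W]
  have zV: "?z \<in> carrier E.V" using f0 by (rule defect_V)
  \<comment> \<open>move from \<open>f0\<close> to \<open>s\<close> one value at a time\<close>
  have fwd: "defect s \<otimes>\<^bsub>E.V\<^esub> inv\<^bsub>E.V\<^esub> ?z \<in> ?W" if s: "s \<in> sel" for s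
  proof -
    have "(\<lambda>g. if g \<in> D then s g else f0 g) \<in> sel \<and> defect (\<lambda>g. if g \<in> D then s g else f0 g) \<otimes>\<^bsub>E.V\<^esub> inv\<^bsub>E.V\<^esub> ?z \<in> ?W"
      if "finite D" "D \<subseteq> carrier G" for D
      using that
    proof (induction D rule: finite_induct)
      case empty
      then show ?case using f0 zV subgroup.one_closed[OF W] by simp
    next
      case (insert x D)
      let ?s = "\<lambda>g. if g \<in> D then s g else f0 g" and ?t = "\<lambda>g. if g \<in> insert x D then s g else f0 g"
      have x: "x \<in> carrier G" "c x (s x)" using insert.prems selD[OF s] by auto
      have t: "?t \<in> sel" using s f0 by (auto simp: sel_def)
      have u: "f0(x := s x) \<in> sel" using f0 x by (auto intro: sel_upd)
      have IH: "?s \<in> sel" "defect ?s \<otimes>\<^bsub>E.V\<^esub> inv\<^bsub>E.V\<^esub> ?z \<in> ?W" using insert by auto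
      have eq: "heap ?s f0 (f0(x := s x)) g = ?t g" if "g \<in> carrier G" for g
        using that insert.hyps(2) selD[OF f0] selD[OF s] by (auto simp: heap_def H.m_assoc)
      have "defect ?t = defect (heap ?s f0 (f0(x := s x)))"
        unfolding defect_def by (rule restrict_ext) (use P12 in \<open>simp only: eq G.m_closed\<close>)
      also have "\<dots> = defect ?s \<otimes>\<^bsub>E.V\<^esub> inv\<^bsub>E.V\<^esub> ?z \<otimes>\<^bsub>E.V\<^esub> defect (f0(x := s x))"
        by (rule defect_heap[OF IH(1) f0 u])
      finally have eq_t: "defect ?t \<otimes>\<^bsub>E.V\<^esub> inv\<^bsub>E.V\<^esub> ?z = (defect ?s \<otimes>\<^bsub>E.V\<^esub> inv\<^bsub>E.V\<^esub> ?z) \<otimes>\<^bsub>E.V\<^esub> w (x, s x)"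
        using defect_V[OF IH(1)] defect_V[OF u] zV by (simp add: w E.V.m_assoc)
      have "w (x, s x) \<in> ?W" using x by (intro generate.incl) (auto simp: R)
      then have "defect ?t \<otimes>\<^bsub>E.V\<^esub> inv\<^bsub>E.V\<^esub> ?z \<in> ?W"
        unfolding eq_t by (rule subgroup.m_closed[OF W IH(2)])
      with t show ?case by (rule conjI)
    qed
    from this[of "carrier G"] finG have *: "defect (\<lambda>g. if g \<in> carrier G then s g else f0 g) \<otimes>\<^bsub>E.V\<^esub> inv\<^bsub>E.V\<^esub> ?z \<in> ?W" by auto
    have "defect (\<lambda>g. if g \<in> carrier G then s g else f0 g) = defect s"
      unfolding defect_def by (rule restrict_ext) (use P12 in auto)
    with * show ?thesis by simp
  qed
  \<comment> \<open>conversely, each direction is realised by an admissible map\<close>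
  have bwd: "\<exists>s\<in>sel. defect s = ?z \<otimes>\<^bsub>E.V\<^esub> u" if "u \<in> ?W" for u
    using that
  proof (induction u rule: generate.induct)
    case one
    then show ?case using f0 zV by auto
  next
    case (incl u)
    then obtain x y where xy: "x \<in> carrier G" "c x y" "u = w (x, y)" by (auto simp: R)
    have s: "f0(x := y) \<in> sel" using f0 xy by (intro sel_upd)
    have "defect (f0(x := y)) = ?z \<otimes>\<^bsub>E.V\<^esub> u"
      using zV defect_V[OF s] by (simp add: xy w E.V.m_comm[of ?z] E.V.m_assoc)
    then show ?case using s by blast
  next
    case (inv u)
    then obtain x y where xy: "x \<in> carrier G" "c x y" "u = w (x, y)" by (auto simp: R)
    have s: "f0(x := y) \<in> sel" using f0 xy by (intro sel_upd)
    have "defect (heap f0 (f0(x := y)) f0) = ?z \<otimes>\<^bsub>E.V\<^esub> inv\<^bsub>E.V\<^esub> u"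
      using zV defect_V[OF s] by (simp add: defect_heap[OF f0 s f0] xy w E.V.inv_mult_group E.V.m_assoc E.V.m_comm)
    then show ?case using heap_sel[OF f0 s f0] by blast
  next
    case (eng u v)
    then obtain s t where st: "s \<in> sel" "defect s = ?z \<otimes>\<^bsub>E.V\<^esub> u" "t \<in> sel" "defect t = ?z \<otimes>\<^bsub>E.V\<^esub> v" by blast
    have "defect (heap s f0 t) = ?z \<otimes>\<^bsub>E.V\<^esub> (u \<otimes>\<^bsub>E.V\<^esub> v)"
    proof -
      have uv: "u \<in> carrier E.V" "v \<in> carrier E.V" using eng WV by auto
      have "defect (heap s f0 t) = (?z \<otimes>\<^bsub>E.V\<^esub> u) \<otimes>\<^bsub>E.V\<^esub> (inv\<^bsub>E.V\<^esub> ?z \<otimes>\<^bsub>E.V\<^esub> (?z \<otimes>\<^bsub>E.V\<^esub> v))"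
        using zV uv by (simp add: defect_heap[OF st(1) f0 st(3)] st E.V.m_assoc)
      also have "inv\<^bsub>E.V\<^esub> ?z \<otimes>\<^bsub>E.V\<^esub> (?z \<otimes>\<^bsub>E.V\<^esub> v) = v" using zV uv by (simp flip: E.V.m_assoc)
      finally show ?thesis using zV uv by (simp add: E.V.m_assoc)
    qed
    then show ?case using heap_sel[OF st(1) f0 st(3)] by blast
  qed
  show ?thesis
  proof
    assume "\<exists>f\<in>homs. \<forall>g\<in>carrier G. c g (f g)"
    then obtain f where f: "f \<in> homs" "f \<in> sel" by (auto simp: sel_def)
    then have "inv\<^bsub>E.V\<^esub> ?z \<in> ?W" using fwd[OF f(2)] homs_iff_defect zV by simp
    then show "?z \<in> ?W" using subgroup.m_inv_closed[OF W, of "inv\<^bsub>E.V\<^esub> ?z"] zV by simp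
  next
    assume "?z \<in> ?W"
    then have "inv\<^bsub>E.V\<^esub> ?z \<in> ?W" using subgroup.m_inv_closed[OF W] by simp
    from bwd[OF this] obtain s where s: "s \<in> sel" "defect s = \<one>\<^bsub>E.V\<^esub>" using zV by auto
    then have "s \<in> homs" using homs_iff_defect by blast
    then show "\<exists>f\<in>homs. \<forall>g\<in>carrier G. c g (f g)" using s selD by blast
  qed
qed

end

section \<open>Programs with counted loops\<close>

text \<open>
  In \<open>For x b p\<close> the variable \<open>x\<close> runs through \<open>1, \<dots>, m\<close>, where \<open>m\<close> is the value of the scalar
  \<open>b\<close>. There is no other loop, so every program has a total semantics \<open>run\<close> by recursion.
\<close>

datatype prog =
    Nop
  | Do string aexp aexp
  | Then prog prog (infixr ";;" 60)
  | If bexp prog prog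
  | For string string prog

abbreviation Var :: "string \<Rightarrow> aexp" where "Var x \<equiv> Cell x (Lit 0)"

abbreviation set_var :: "state \<Rightarrow> string \<Rightarrow> nat \<Rightarrow> state" where
  "set_var s x i \<equiv> s(x := (s x)(0 := i))"

text \<open>
  The counter is cleared and then raised before each round, as in the compiled loop; with this
  choice the two final states are equal and not merely similar.
\<close>

fun run :: "prog \<Rightarrow> state \<Rightarrow> state" where
  "run Nop s = s"
| "run (Do x a e) s = s(x := (s x)(aval a s := aval e s))"
| "run (p ;; q) s = run q (run p s)"
| "run (If b p q) s = (if bval b s then run p s else run q s)"
| "run (For x b p) s = fold (\<lambda>i s. run p (set_var s x i)) [1..<Suc (s b 0)] (set_var s x 0)"

fun writes :: "prog \<Rightarrow> string set" where
  "writes Nop = {}"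
| "writes (Do x a e) = {x}"
| "writes (p ;; q) = writes p \<union> writes q"
| "writes (If b p q) = writes p \<union> writes q"
| "writes (For x b p) = insert x (writes p)"

fun bounds :: "prog \<Rightarrow> string set" where
  "bounds (p ;; q) = bounds p \<union> bounds q"
| "bounds (If b p q) = bounds p \<union> bounds q"
| "bounds (For x b p) = insert b (bounds p)"
| "bounds _ = {}"

text \<open>The body of a loop changes neither the counter nor the bound of the loop.\<close>

fun wf :: "prog \<Rightarrow> bool" where
  "wf (p ;; q) \<longleftrightarrow> wf p \<and> wf q"
| "wf (If b p q) \<longleftrightarrow> wf p \<and> wf q"
| "wf (For x b p) \<longleftrightarrow> x \<notin> writes p \<and> x \<notin> bounds p \<and> x \<noteq> b \<and> wf p"
| "wf _ \<longleftrightarrow> True"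

fun compile :: "prog \<Rightarrow> com" where
  "compile Nop = Skip"
| "compile (Do x a e) = Assign x a e"
| "compile (p ;; q) = Seq (compile p) (compile q)"
| "compile (If b p q) = Cond b (compile p) (compile q)"
| "compile (For x b p) = Seq (Assign x (Lit 0) (Lit 0)) (While (Less (Var x) (Var b))
     (Seq (Assign x (Lit 0) (Add (Var x) (Lit 1))) (compile p)))"

text \<open>
  The time as a polynomial in an upper bound \<open>B\<close> for all loop bounds. Setting up a loop and its
  last test cost 8 steps; in each round the test and the increment cost 11.
\<close>

fun time :: "prog \<Rightarrow> nat poly" where
  "time Nop = [:1:]"
| "time (Do x a e) = [:acost a + acost e + 1:]"
| "time (p ;; q) = time p + time q"
| "time (If b p q) = [:bcost b:] + time p + time q"
| "time (For x b p) = [:8:] + [:0, 1:] * ([:11:] + time p)"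

lemma run_frame: "x \<notin> writes p \<Longrightarrow> run p s x = s x"
proof (induction p arbitrary: s)
  case (For y b p)
  have "fold (\<lambda>i s. run p (set_var s y i)) is s' x = s' x" for "is" s'
    using For by (induction "is" arbitrary: s') auto
  then show ?case using For.prems by simp
qed auto

lemma fold_upt_Suc: "fold f [1..<Suc (Suc i)] a = f (Suc i) (fold f [1..<Suc i] a)"
  by (simp add: upt_Suc)

lemma run_For_inv:
  assumes "s b 0 = m" "I 0 (set_var s x 0)"
    and "\<And>i s. i < m \<Longrightarrow> I i s \<Longrightarrow> I (Suc i) (run p (set_var s x (Suc i)))"
  shows "I m (run (For x b p) s)"
proof -
  have "I i (fold (\<lambda>i s. run p (set_var s x i)) [1..<Suc i] (set_var s x 0))" if "i \<le> m" for i
    using that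
  proof (induction i)
    case (Suc i)
    have i: "i < m" "i \<le> m" using Suc.prems by auto
    show ?case unfolding fold_upt_Suc by (rule assms(3)[OF i(1) Suc.IH[OF i(2)]])
  qed (use assms(2) in simp)
  then show ?thesis unfolding run.simps assms(1) by blast
qed

text \<open>
  No loop bound is written, so each loop makes at most \<open>B\<close> rounds and costs at most \<open>B\<close> times as
  much as a round of its body.
\<close>

theorem exec_compile:
  assumes "wf p" "\<And>b. b \<in> bounds p \<Longrightarrow> b \<notin> writes p \<and> s b 0 \<le> B"
  shows "\<exists>t \<le> poly (time p) B. exec (compile p) s t (run p s)"
  using assms
proof (induction p arbitrary: s)
  case Nop
  then show ?case by (auto intro: exec.Skip)
next
  case (Do x a e)
  show ?case unfolding run.simps compile.simps time.simps
    by (intro exI[of _ "acost a + acost e + 1"] conjI exec.Assign) simp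
next
  case (Then p q)
  obtain t where t: "t \<le> poly (time p) B" "exec (compile p) s t (run p s)"
    using Then.IH(1)[of s] Then.prems by auto
  have "run p s b = s b" if "b \<in> bounds q" for b using run_frame Then.prems(2) that by simp
  then obtain u where u: "u \<le> poly (time q) B" "exec (compile q) (run p s) u (run q (run p s))"
    using Then.IH(2)[of "run p s"] Then.prems by auto
  have "exec (compile (p ;; q)) s (t + u) (run (p ;; q) s)" using exec.Seq[OF t(2) u(2)] by simp
  then show ?case using t(1) u(1) by (auto intro!: exI[of _ "t + u"])
next
  case (If b p q)
  show ?case
  proof (cases "bval b s")
    case True
    obtain t where t: "t \<le> poly (time p) B" "exec (compile p) s t (run p s)"
      using If.IH(1)[of s] If.prems by auto
    have "exec (compile (If b p q)) s (bcost b + t) (run (If b p q) s)"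
      using exec.CondTrue[OF True t(2)] True by simp
    then show ?thesis using t(1) by (auto intro!: exI[of _ "bcost b + t"])
  next
    case False
    obtain t where t: "t \<le> poly (time q) B" "exec (compile q) s t (run q s)"
      using If.IH(2)[of s] If.prems by auto
    have "exec (compile (If b p q)) s (bcost b + t) (run (If b p q) s)"
      using exec.CondFalse[OF False t(2)] False by simp
    then show ?thesis using t(1) by (auto intro!: exI[of _ "bcost b + t"])
  qed
next
  case (For x b p)
  define T where "T = poly (time p) B"
  define w where "w = While (Less (Var x) (Var b)) (Seq (Assign x (Lit 0) (Add (Var x) (Lit 1))) (compile p))"
  define m where "m = s b 0"
  have m: "m \<le> B" using For.prems by (simp add: m_def)
  have loop: "\<exists>t \<le> 5 + (m - i) * (11 + T). exec w r t
      (fold (\<lambda>i s. run p (set_var s x i)) [Suc i..<Suc m] r)"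
    if "i \<le> m" "r x 0 = i" "\<And>y. y \<in> insert b (bounds p) \<Longrightarrow> r y = s y" for i r
    using that
  proof (induction "m - i" arbitrary: i r)
    case 0
    then have "exec w r 5 r"
      using exec.WhileFalse[of "Less (Var x) (Var b)" r] by (simp add: w_def m_def)
    then show ?case using 0 by (auto intro!: exI[of _ 5])
  next
    case (Suc k)
    then have im: "i < m" and km: "k = m - Suc i" by simp_all
    let ?r = "set_var r x (Suc i)"
    have rx: "?r y = s y" if "y \<in> insert b (bounds p)" for y
      using Suc.prems(3)[OF that] For.prems(1) that by auto
    have "\<exists>t\<le>T. exec (compile p) ?r t (run p ?r)"
      unfolding T_def by (rule For.IH) (use For.prems rx in auto)
    then obtain t where t: "t \<le> T" "exec (compile p) ?r t (run p ?r)" by blast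
    have r': "run p ?r x 0 = Suc i" using run_frame[of x p] For.prems(1) by simp
    have r'': "run p ?r y = s y" if "y \<in> insert b (bounds p)" for y
      using rx[OF that] run_frame[of y p ?r] For.prems(2) that by auto
    obtain u where u: "u \<le> 5 + (m - Suc i) * (11 + T)"
      "exec w (run p ?r) u (fold (\<lambda>i s. run p (set_var s x i)) [Suc (Suc i)..<Suc m] (run p ?r))"
      using Suc.hyps(1)[of "Suc i" "run p ?r"] km im r' r'' by auto
    have "exec (Assign x (Lit 0) (Add (Var x) (Lit 1))) r 6 ?r"
      using exec.Assign[of x "Lit 0" "Add (Var x) (Lit 1)" r] Suc.prems(2) by (simp add: Suc_eq_plus1)
    from exec.Seq[OF this t(2)]
    have body: "exec (Seq (Assign x (Lit 0) (Add (Var x) (Lit 1))) (compile p)) r (6 + t) (run p ?r)" .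
    have test: "bval (Less (Var x) (Var b)) r" using im Suc.prems by (simp add: m_def)
    have "exec w r (bcost (Less (Var x) (Var b)) + (6 + t) + u)
        (fold (\<lambda>i s. run p (set_var s x i)) [Suc (Suc i)..<Suc m] (run p ?r))"
      unfolding w_def by (rule exec.WhileTrue[OF test body u(2)[unfolded w_def]])
    moreover have "bcost (Less (Var x) (Var b)) = 5" by simp
    ultimately have ex: "exec w r (5 + (6 + t) + u)
        (fold (\<lambda>i s. run p (set_var s x i)) [Suc (Suc i)..<Suc m] (run p ?r))" by simp
    have fe: "fold (\<lambda>i s. run p (set_var s x i)) [Suc i..<Suc m] r =
        fold (\<lambda>i s. run p (set_var s x i)) [Suc (Suc i)..<Suc m] (run p ?r)"
      using im by (subst upt_conv_Cons) auto
    have le: "5 + (6 + t) + u \<le> 5 + (m - i) * (11 + T)"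
    proof -
      have "m - i = Suc (m - Suc i)" using im by simp
      then show ?thesis using t(1) u(1) by simp
    qed
    show ?case unfolding fe using ex le by blast
  qed
  obtain t where t: "t \<le> 5 + m * (11 + T)" "exec w (set_var s x 0) t
      (fold (\<lambda>i s. run p (set_var s x i)) [1..<Suc m] (set_var s x 0))"
    using loop[of 0 "set_var s x 0"] For.prems by (auto simp: One_nat_def)
  have "exec (Assign x (Lit 0) (Lit 0)) s 3 (set_var s x 0)"
    using exec.Assign[of x "Lit 0" "Lit 0" s] by simp
  from exec.Seq[OF this t(2)]
  have "exec (compile (For x b p)) s (3 + t) (run (For x b p) s)"
    by (simp add: w_def m_def)
  moreover have "3 + t \<le> poly (time (For x b p)) B"
  proof -
    have "t \<le> 5 + B * (11 + T)" using t(1) mult_le_mono1[OF m, of "11 + T"] by linarith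
    then show ?thesis by (simp add: T_def)
  qed
  ultimately show ?case by blast
qed

text \<open>A loop simulates an abstract fold if each round preserves the abstraction relation.\<close>

lemma run_For_refine:
  assumes "s b 0 = m" "R (set_var s x 0) a"
    and "\<And>i s a. i \<in> {1..m} \<Longrightarrow> R s a \<Longrightarrow> R (run p (set_var s x i)) (f i a)"
  shows "R (run (For x b p) s) (fold f [1..<Suc m] a)"
proof -
  show ?thesis
  proof (rule run_For_inv[of s b m "\<lambda>i s. R s (fold f [1..<Suc i] a)"])
    show "R (set_var s x 0) (fold f [1..<Suc 0] a)" using assms(2) by simp
    show "R (run p (set_var s x (Suc i))) (fold f [1..<Suc (Suc i)] a)"
      if "i < m" "R s (fold f [1..<Suc i] a)" for i s
      unfolding fold_upt_Suc using that by (intro assms(3)) auto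
  qed (fact assms(1))
qed

text \<open>A state that differs from another one in the arrays of \<open>Y\<close> at most.\<close>

definition agree :: "string set \<Rightarrow> state \<Rightarrow> state \<Rightarrow> bool" where
  "agree Y s s' \<longleftrightarrow> (\<forall>y. y \<notin> Y \<longrightarrow> s' y = s y)"

lemma agreeI: "(\<And>y. y \<notin> Y \<Longrightarrow> s' y = s y) \<Longrightarrow> agree Y s s'"
  by (simp add: agree_def)

lemma agreeD: "agree Y s s' \<Longrightarrow> y \<notin> Y \<Longrightarrow> s' y = s y"
  by (simp add: agree_def)

text \<open>
  A loop that computes array cells one by one. The expression \<open>e\<close> may read the old content of
  the very cell that it replaces, since the addresses are distinct and no other round touches
  that cell.
\<close>

lemma run_fill:
  assumes m: "s b 0 = m" and xX: "x \<noteq> X"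
    and A: "\<And>i s'. \<lbrakk>i \<in> {1..m}; agree {x, X} s s'; s' x 0 = i\<rbrakk> \<Longrightarrow> aval a s' = A i"
    and E: "\<And>i s'. \<lbrakk>i \<in> {1..m}; agree {x, X} s s'; s' x 0 = i; s' X (A i) = s X (A i)\<rbrakk>
      \<Longrightarrow> aval e s' = E i"
    and inj: "inj_on A {1..m}"
  shows "i \<in> {1..m} \<Longrightarrow> run (For x b (Do X a e)) s X (A i) = E i"
    and "c \<notin> A ` {1..m} \<Longrightarrow> run (For x b (Do X a e)) s X c = s X c"
proof -
  define I where "I k s' \<longleftrightarrow> (\<forall>y. y \<noteq> x \<longrightarrow> y \<noteq> X \<longrightarrow> s' y = s y) \<and>
     (\<forall>i\<in>{1..k}. s' X (A i) = E i) \<and> (\<forall>c. c \<notin> A ` {1..k} \<longrightarrow> s' X c = s X c)" for k s'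
  have "I m (run (For x b (Do X a e)) s)"
  proof (rule run_For_inv[of s b m I])
    show "s b 0 = m" by fact
    show "I 0 (set_var s x 0)" using xX by (auto simp: I_def One_nat_def)
  next
    fix i s' assume i: "i < m" and I: "I i s'"
    let ?s = "set_var s' x (Suc i)"
    have fr: "?s y = s y" if "y \<noteq> x" "y \<noteq> X" for y using I that by (simp add: I_def)
    have ag: "agree {x, X} s ?s" using fr by (intro agreeI) auto
    have a: "aval a ?s = A (Suc i)" using i ag by (intro A) auto
    have new: "A (Suc i) \<notin> A ` {1..i}"
    proof
      assume "A (Suc i) \<in> A ` {1..i}"
      then obtain j where "j \<in> {1..i}" "A (Suc i) = A j" by blast
      then show False using inj_onD[OF inj, of "Suc i" j] i by simp
    qed
    have old: "?s X c = s X c" if "c \<notin> A ` {1..i}" for c using I xX that by (simp add: I_def)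
    have e: "aval e ?s = E (Suc i)"
    proof (rule E)
      show "agree {x, X} s ?s" by fact
      show "?s X (A (Suc i)) = s X (A (Suc i))" using old new by blast
    qed (use i in auto)
    have neq: "A j \<noteq> A (Suc i)" if "j \<in> {1..i}" for j
    proof
      assume "A j = A (Suc i)"
      then have "A (Suc i) \<in> A ` {1..i}" using that by (metis imageI)
      then show False using new by blast
    qed
    have set: "{1..Suc i} = insert (Suc i) {1..i}" by auto
    have r: "run (Do X a e) ?s X = (?s X)(A (Suc i) := E (Suc i))" by (simp add: a e)
    show "I (Suc i) (run (Do X a e) ?s)"
      unfolding I_def
    proof (intro conjI allI impI ballI)
      fix y assume y: "y \<noteq> x" "y \<noteq> X"
      then show "run (Do X a e) ?s y = s y" using fr[OF y] by simp
    next
      fix j assume "j \<in> {1..Suc i}"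
      then show "run (Do X a e) ?s X (A j) = E j"
        unfolding r set using I xX neq[of j] by (auto simp: I_def)
    next
      fix c assume "c \<notin> A ` {1..Suc i}"
      then have "c \<noteq> A (Suc i)" "c \<notin> A ` {1..i}" by (auto simp: set)
      then show "run (Do X a e) ?s X c = s X c" unfolding r using old[of c] by simp
    qed
  qed
  then show "i \<in> {1..m} \<Longrightarrow> run (For x b (Do X a e)) s X (A i) = E i"
    and "c \<notin> A ` {1..m} \<Longrightarrow> run (For x b (Do X a e)) s X c = s X c"
    by (auto simp: I_def simp del: run.simps)
qed

lemma run_fill2:
  assumes m: "s b 0 = m" "s b' 0 = m'" and names: "x \<noteq> X" "y \<noteq> X" "x \<noteq> y" "b' \<noteq> x" "b' \<noteq> X" "b' \<noteq> y"
    and A: "\<And>i k s'. \<lbrakk>i \<in> {1..m}; k \<in> {1..m'}; agree {x, y, X} s s'; s' x 0 = i; s' y 0 = k\<rbrakk>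
      \<Longrightarrow> aval a s' = A i k"
    and E: "\<And>i k s'. \<lbrakk>i \<in> {1..m}; k \<in> {1..m'}; agree {x, y, X} s s'; s' x 0 = i; s' y 0 = k;
        s' X (A i k) = s X (A i k)\<rbrakk> \<Longrightarrow> aval e s' = E i k"
    and inj: "\<And>i k i' k'. \<lbrakk>i \<in> {1..m}; k \<in> {1..m'}; i' \<in> {1..m}; k' \<in> {1..m'}; A i k = A i' k'\<rbrakk> \<Longrightarrow> i = i' \<and> k = k'"
  shows "i \<in> {1..m} \<Longrightarrow> k \<in> {1..m'} \<Longrightarrow> run (For x b (For y b' (Do X a e))) s X (A i k) = E i k"
    and "(\<And>i k. \<lbrakk>i \<in> {1..m}; k \<in> {1..m'}\<rbrakk> \<Longrightarrow> c \<noteq> A i k) \<Longrightarrow> run (For x b (For y b' (Do X a e))) s X c = s X c"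
proof -
  define I where "I r s' \<longleftrightarrow> (\<forall>z. z \<noteq> x \<longrightarrow> z \<noteq> y \<longrightarrow> z \<noteq> X \<longrightarrow> s' z = s z) \<and>
     (\<forall>i\<in>{1..r}. \<forall>k\<in>{1..m'}. s' X (A i k) = E i k) \<and>
     (\<forall>c. (\<forall>i\<in>{1..r}. \<forall>k\<in>{1..m'}. c \<noteq> A i k) \<longrightarrow> s' X c = s X c)" for r s'
  have "I m (run (For x b (For y b' (Do X a e))) s)"
  proof (rule run_For_inv[of s b m I])
    show "s b 0 = m" by fact
    show "I 0 (set_var s x 0)" using names by (auto simp: I_def One_nat_def)
  next
    fix i s' assume i: "i < m" and I: "I i s'"
    let ?s = "set_var s' x (Suc i)"
    let ?t = "run (For y b' (Do X a e)) ?s"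
    have fr: "?s z = s z" if "z \<noteq> x" "z \<noteq> y" "z \<noteq> X" for z using I that by (simp add: I_def)
    have si: "Suc i \<in> {1..m}" using i by auto
    have bm: "?s b' 0 = m'" using fr[of b'] names m by simp
    have old: "?s X (A (Suc i) k) = s X (A (Suc i) k)" if "k \<in> {1..m'}" for k
    proof -
      have "\<forall>i'\<in>{1..i}. \<forall>k'\<in>{1..m'}. A (Suc i) k \<noteq> A i' k'"
        using inj[OF si that] i by fastforce
      then show ?thesis using I names by (simp add: I_def)
    qed
    have injA: "inj_on (A (Suc i)) {1..m'}" using inj[OF si _ si] by (auto simp: inj_on_def)
    have ag: "agree {x, y, X} s r" if "agree {y, X} ?s r" for r
      using agreeD[OF that] fr by (intro agreeI) auto
    have val: "aval e r = E (Suc i) k"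
      if "k \<in> {1..m'}" "agree {y, X} ?s r" "r y 0 = k" "r X (A (Suc i) k) = ?s X (A (Suc i) k)" for k r
      using that(1,3,4) old[OF that(1)] ag[OF that(2)] agreeD[OF that(2), of x] names si by (intro E) auto
    have adr: "aval a r = A (Suc i) k"
      if "k \<in> {1..m'}" "agree {y, X} ?s r" "r y 0 = k" for k r
      using that(1,3) ag[OF that(2)] agreeD[OF that(2), of x] names si by (intro A) auto
    have fill1: "?t X (A (Suc i) k) = E (Suc i) k" if k: "k \<in> {1..m'}" for k
      by (rule run_fill(1)[where m=m' and A="A (Suc i)" and E="E (Suc i)" and s="?s" and x=y and X=X and b=b' and a=a and e=e, OF bm names(2) _ _ injA k]) (fact adr, fact val)
    have fill2: "?t X c = ?s X c" if c: "c \<notin> A (Suc i) ` {1..m'}" for c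
      by (rule run_fill(2)[where m=m' and A="A (Suc i)" and E="E (Suc i)" and s="?s" and x=y and X=X and b=b' and a=a and e=e, OF bm names(2) _ _ injA c]) (fact adr, fact val)
    show "I (Suc i) ?t"
      unfolding I_def
    proof (intro conjI allI impI ballI)
      fix z assume "z \<noteq> x" "z \<noteq> y" "z \<noteq> X"
      then show "?t z = s z" using fr[of z] run_frame[of z "For y b' (Do X a e)" ?s] by simp
    next
      fix i' k assume ik: "i' \<in> {1..Suc i}" "k \<in> {1..m'}"
      show "?t X (A i' k) = E i' k"
      proof (cases "i' = Suc i")
        case True
        then show ?thesis using fill1 ik by blast
      next
        case False
        then have i': "i' \<in> {1..i}" using ik by auto
        have "A i' k \<notin> A (Suc i) ` {1..m'}"
        proof
          assume "A i' k \<in> A (Suc i) ` {1..m'}"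
          then obtain k' where "k' \<in> {1..m'}" "A i' k = A (Suc i) k'" by blast
          then have "i' = Suc i" using inj[of i' k "Suc i" k'] i' i ik(2) si by auto
          then show False using False by simp
        qed
        then have "?t X (A i' k) = ?s X (A i' k)" by (rule fill2)
        also have "\<dots> = E i' k" using I i' ik names by (simp add: I_def)
        finally show ?thesis .
      qed
    next
      fix c assume c: "\<forall>i'\<in>{1..Suc i}. \<forall>k\<in>{1..m'}. c \<noteq> A i' k"
      then have "c \<notin> A (Suc i) ` {1..m'}" by auto
      then have "?t X c = ?s X c" by (rule fill2)
      also have "\<dots> = s X c" using I c names by (simp add: I_def)
      finally show "?t X c = s X c" .
    qed
  qed
  then show "i \<in> {1..m} \<Longrightarrow> k \<in> {1..m'} \<Longrightarrow> run (For x b (For y b' (Do X a e))) s X (A i k) = E i k"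
    and "(\<And>i k. \<lbrakk>i \<in> {1..m}; k \<in> {1..m'}\<rbrakk> \<Longrightarrow> c \<noteq> A i k) \<Longrightarrow> run (For x b (For y b' (Do X a e))) s X c = s X c"
    by (auto simp: I_def simp del: run.simps)
qed

section \<open>The sifting table on the machine\<close>

text \<open>
  There is no multiplication in one step, so the offsets of rows in a two- or three-dimensional
  array are looked up in the arrays \<open>row\<close> and \<open>row2\<close>, which hold the multiples of \<open>N\<close> and of
  \<open>N * N\<close>.
\<close>

abbreviation at2 :: "string \<Rightarrow> aexp \<Rightarrow> aexp \<Rightarrow> aexp" where
  "at2 X a b \<equiv> Cell X (Add (Cell ''row'' a) b)"
abbreviation adr2 :: "aexp \<Rightarrow> aexp \<Rightarrow> aexp" where
  "adr2 a b \<equiv> Add (Cell ''row'' a) b"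
abbreviation adr3 :: "aexp \<Rightarrow> aexp \<Rightarrow> aexp \<Rightarrow> aexp" where
  "adr3 a b d \<equiv> Add (Cell ''row2'' a) (Add (Cell ''row'' b) d)"

text \<open>
  The array \<open>sl\<close> marks the filled slots and \<open>tb\<close> holds their vectors; \<open>v\<close> is the vector being
  sifted. The flag \<open>added\<close> is raised when a slot is filled, that is if \<open>v\<close> did not sift.
\<close>

definition INSERT :: prog where
  "INSERT = For ''j'' ''N'' (
     Do ''a'' (Lit 0) (Cell ''v'' (Var ''j'')) ;;
     If (Equal (at2 ''sl'' (Var ''j'') (Var ''a'')) (Lit 1)) Nop
       (Do ''sl'' (adr2 (Var ''j'') (Var ''a'')) (Lit 1) ;;
        For ''l'' ''N'' (Do ''tb'' (adr3 (Var ''j'') (Var ''a'') (Var ''l'')) (Cell ''v'' (Var ''l''))) ;;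
        Do ''added'' (Lit 0) (Lit 1)) ;;
     For ''l'' ''N'' (Do ''v'' (Var ''l'')
       (at2 ''T'' (Cell ''v'' (Var ''l'')) (Cell ''iv'' (Cell ''tb'' (adr3 (Var ''j'') (Var ''a'') (Var ''l'')))))))"

text \<open>
  All matrices get rows of length \<open>N\<close>, also those indexed by group elements. Then the addresses
  of different index pairs in \<open>{1..N}\<close> are distinct for every array, and one table of row
  offsets is enough.
\<close>

locale grid =
  fixes n N :: nat
  assumes n1: "1 \<le> n" and N: "N = n * n"
begin

definition ad2 :: "nat \<Rightarrow> nat \<Rightarrow> nat" where "ad2 i j = i * N + j"
definition ad3 :: "nat \<Rightarrow> nat \<Rightarrow> nat \<Rightarrow> nat" where "ad3 i j k = i * N * N + (j * N + k)"

lemma nN: "n \<le> N" and N1: "1 \<le> N"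
  using n1 mult_le_mono[OF n1 n1] by (auto simp: N)

lemma ad2_inj:
  assumes "ad2 i j = ad2 i' j'" "j \<in> {1..N}" "j' \<in> {1..N}"
  shows "i = i' \<and> j = j'"
proof -
  have *: "i = (ad2 i j - 1) div N" "j - 1 = (ad2 i j - 1) mod N" if "j \<in> {1..N}" for i j
  proof -
    define k where "k = j - 1"
    have k: "j = Suc k" "k < N" using that by (auto simp: k_def)
    then have "ad2 i j - 1 = k + i * N" by (simp add: ad2_def)
    then show "i = (ad2 i j - 1) div N" "j - 1 = (ad2 i j - 1) mod N" using k by auto
  qed
  show ?thesis using *[OF assms(2), of i] *[OF assms(3), of i'] assms by auto
qed

lemma ad2_eq: "j \<in> {1..N} \<Longrightarrow> j' \<in> {1..N} \<Longrightarrow> ad2 i j = ad2 i' j' \<longleftrightarrow> i = i' \<and> j = j'"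
  using ad2_inj by blast

lemma ad3_inj:
  assumes "ad3 i j k = ad3 i' j' k'" "j \<in> {1..N}" "j' \<in> {1..N}" "k \<in> {1..N}" "k' \<in> {1..N}"
  shows "i = i' \<and> j = j' \<and> k = k'"
proof -
  have "ad2 (ad2 i j) k = ad2 (ad2 i' j') k'"
    using assms(1) by (simp add: ad2_def ad3_def add_mult_distrib)
  then have "ad2 i j = ad2 i' j'" "k = k'" using ad2_inj assms by blast+
  then show ?thesis using ad2_inj assms by blast
qed

definition ready :: "state \<Rightarrow> bool" where
  "ready s \<longleftrightarrow> s ''n'' 0 = n \<and> s ''N'' 0 = N \<and>
     (\<forall>i\<le>N. s ''row'' i = i * N) \<and> (\<forall>i\<le>N. s ''row2'' i = i * N * N)"

lemma readyD:
  assumes "ready s"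
  shows "s ''n'' 0 = n" "s ''N'' 0 = N" "i \<le> N \<Longrightarrow> s ''row'' i = i * N" "i \<le> N \<Longrightarrow> s ''row2'' i = i * N * N"
  using assms by (auto simp: ready_def)

lemma ready_cong: "\<forall>x\<in>{''n'', ''N'', ''row'', ''row2''}. s' x = s x \<Longrightarrow> ready s' = ready s"
  by (simp add: ready_def)

definition tab :: "state \<Rightarrow> string \<Rightarrow> nat monoid \<Rightarrow> bool" where
  "tab s X G \<longleftrightarrow> (\<forall>i\<in>{1..n}. \<forall>j\<in>{1..n}. s X (ad2 i j) = i \<otimes>\<^bsub>G\<^esub> j)"

end

text \<open>
  The question whether there is a homomorphism \<open>S \<rightarrow> T\<close> with values in the rows of \<open>c\<close>, for
  groups on \<open>{1..n}\<close>. As 0 is not a group element, it can stand for an undefined value.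
\<close>

locale ext = grid n N + row_system S T C c N P1 P2
  for n N and S :: "nat monoid" and T :: "nat monoid" and C c P1 P2 +
  assumes carS: "carrier S = {1..n}" and carT: "carrier T = {1..n}"
begin

definition env :: "state \<Rightarrow> bool" where
  "env s \<longleftrightarrow> ready s \<and> tab s ''S'' S \<and> tab s ''T'' T \<and>
     (\<forall>j\<in>{1..N}. s ''P1'' j = P1 j \<and> s ''P2'' j = P2 j) \<and>
     (\<forall>g\<in>{1..n}. \<forall>h\<in>{1..n}. s ''c'' (ad2 g h) = 1 \<longleftrightarrow> c g h)"

text \<open>In addition the neutral element and the inverses of \<open>T\<close> are known.\<close>

definition env2 :: "state \<Rightarrow> bool" where
  "env2 s \<longleftrightarrow> env s \<and> s ''e'' 0 = \<one>\<^bsub>T\<^esub> \<and> (\<forall>a\<in>{1..n}. s ''iv'' a = inv\<^bsub>T\<^esub> a)"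

lemma env_cong:
  "\<forall>x\<in>{''n'', ''N'', ''row'', ''row2'', ''S'', ''T'', ''P1'', ''P2'', ''c''}. s' x = s x \<Longrightarrow> env s' = env s"
  using ready_cong[of s' s] by (simp add: env_def tab_def)

lemma env2_cong:
  "\<forall>x\<in>{''n'', ''N'', ''row'', ''row2'', ''S'', ''T'', ''P1'', ''P2'', ''c'', ''e'', ''iv''}. s' x = s x
    \<Longrightarrow> env2 s' = env2 s"
  using env_cong[of s' s] by (simp add: env2_def)

lemma env2D:
  assumes "env2 s"
  shows "s ''n'' 0 = n" "s ''N'' 0 = N" "i \<le> N \<Longrightarrow> s ''row'' i = i * N" "i \<le> N \<Longrightarrow> s ''row2'' i = i * N * N"
    "a \<in> {1..n} \<Longrightarrow> b \<in> {1..n} \<Longrightarrow> s ''T'' (a * N + b) = a \<otimes>\<^bsub>T\<^esub> b"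
    "a \<in> {1..n} \<Longrightarrow> b \<in> {1..n} \<Longrightarrow> s ''S'' (a * N + b) = a \<otimes>\<^bsub>S\<^esub> b"
    "j \<in> {1..N} \<Longrightarrow> s ''P1'' j = P1 j" "j \<in> {1..N} \<Longrightarrow> s ''P2'' j = P2 j"
    "a \<in> {1..n} \<Longrightarrow> b \<in> {1..n} \<Longrightarrow> s ''c'' (a * N + b) = 1 \<longleftrightarrow> c a b"
    "s ''e'' 0 = \<one>\<^bsub>T\<^esub>" "a \<in> {1..n} \<Longrightarrow> s ''iv'' a = inv\<^bsub>T\<^esub> a"
  using assms by (auto simp: env2_def env_def ready_def tab_def ad2_def)

lemma kerD: "x \<in> ker \<Longrightarrow> x \<in> {1..n}" "x \<in> ker \<Longrightarrow> x \<le> N"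
  using ker_carrier[of x] carT nN by auto

lemma V_range: "u \<in> carrier E.V \<Longrightarrow> j \<in> {1..N} \<Longrightarrow> u j \<in> ker"
  using E.V_nth[of u j] by simp

definition table_of :: "state \<Rightarrow> nat table" where
  "table_of s = (\<lambda>(j, a). if j \<in> {1..N} \<and> a \<in> {1..n} \<and> s ''sl'' (ad2 j a) = 1
     then Some (\<lambda>l\<in>{1..N}. s ''tb'' (ad3 j a l)) else None)"

definition vec :: "state \<Rightarrow> nat \<Rightarrow> nat" where
  "vec s = (\<lambda>l\<in>{1..N}. s ''v'' l)"

text \<open>
  A weak form of \<open>table_ok\<close> that is preserved by every insertion of a vector over the kernel. It
  keeps all addresses and products in range; the finer properties are proved for the abstract
  table.
\<close>

definition tv :: "nat table \<Rightarrow> bool" where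
  "tv Tb \<longleftrightarrow> (\<forall>k t. Tb k = Some t \<longrightarrow> t \<in> carrier E.V \<and> fst k \<in> {1..N} \<and> snd k \<in> ker)"

lemma table_of_cong: "s' ''sl'' = s ''sl'' \<Longrightarrow> s' ''tb'' = s ''tb'' \<Longrightarrow> table_of s' = table_of s"
  unfolding table_of_def by (rule ext) (auto intro!: restrict_ext)

lemma vec_cong: "s' ''v'' = s ''v'' \<Longrightarrow> vec s' = vec s"
  by (simp add: vec_def)

lemma run_store:
  assumes e: "env2 s" and j: "j \<in> {1..N}" "s ''j'' 0 = j" and a: "a \<in> {1..n}" "s ''a'' 0 = a"
    and s': "s' = run (Do ''sl'' (adr2 (Var ''j'') (Var ''a'')) (Lit 1) ;;
        For ''l'' ''N'' (Do ''tb'' (adr3 (Var ''j'') (Var ''a'') (Var ''l'')) (Cell ''v'' (Var ''l''))) ;;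
        Do ''added'' (Lit 0) (Lit 1)) s"
  shows "table_of s' = (table_of s)((j, a) \<mapsto> vec s)" "s' ''added'' 0 = 1"
proof -
  have jN: "j \<le> N" "a \<le> N" "a \<in> {1..N}" using j a nN by auto
  define s1 where "s1 = s(''sl'' := (s ''sl'')(ad2 j a := 1))"
  have s1: "run (Do ''sl'' (adr2 (Var ''j'') (Var ''a'')) (Lit 1)) s = s1"
    using env2D(3)[OF e jN(1)] j a by (simp add: s1_def ad2_def)
  define s2 where "s2 = run (For ''l'' ''N'' (Do ''tb'' (adr3 (Var ''j'') (Var ''a'') (Var ''l'')) (Cell ''v'' (Var ''l'')))) s1"
  have s'2: "s' = s2(''added'' := (s2 ''added'')(0 := 1))" unfolding s' run.simps(3) s1 s2_def[symmetric] by simp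
  show "s' ''added'' 0 = 1" by (simp add: s'2)
  have N1: "s1 ''N'' 0 = N" using env2D(2)[OF e] by (simp add: s1_def)
  have A: "aval (adr3 (Var ''j'') (Var ''a'') (Var ''l'')) r = ad3 j a i"
    if "i \<in> {1..N}" "agree {''l'', ''tb''} s1 r" "r ''l'' 0 = i" for i r
    using that(1,3) agreeD[OF that(2)] env2D(3)[OF e jN(2)] env2D(4)[OF e jN(1)] j a by (simp add: s1_def ad3_def)
  have E: "aval (Cell ''v'' (Var ''l'')) r = vec s i"
    if "i \<in> {1..N}" "agree {''l'', ''tb''} s1 r" "r ''l'' 0 = i" "r ''tb'' (ad3 j a i) = s1 ''tb'' (ad3 j a i)" for i r
    using that(1,3) agreeD[OF that(2)] by (simp add: s1_def vec_def)
  have inj: "inj_on (ad3 j a) {1..N}"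
  proof (rule inj_onI)
    fix k k' assume "k \<in> {1..N}" "k' \<in> {1..N}" "ad3 j a k = ad3 j a k'"
    then show "k = k'" using ad3_inj[of j a k j a k'] jN(3) by blast
  qed
  have tb1: "s2 ''tb'' (ad3 j a l) = vec s l" if "l \<in> {1..N}" for l
    unfolding s2_def by (rule run_fill(1)[where s=s1 and m=N and A="ad3 j a" and E="vec s"])
      (fact N1, simp, fact A, fact E, fact inj, fact that)
  have tb2: "s2 ''tb'' k = s ''tb'' k" if "k \<notin> ad3 j a ` {1..N}" for k
  proof -
    have "s2 ''tb'' k = s1 ''tb'' k"
      unfolding s2_def by (rule run_fill(2)[where s=s1 and m=N and A="ad3 j a" and E="vec s"])
        (fact N1, simp, fact A, fact E, fact inj, fact that)
    then show ?thesis by (simp add: s1_def)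
  qed
  have sl: "s2 ''sl'' = (s ''sl'')(ad2 j a := 1)"
    using run_frame[of "''sl''" "For ''l'' ''N'' (Do ''tb'' (adr3 (Var ''j'') (Var ''a'') (Var ''l'')) (Cell ''v'' (Var ''l'')))" s1]
    by (simp add: s2_def s1_def del: run.simps)
  show "table_of s' = (table_of s)((j, a) \<mapsto> vec s)"
  proof (rule ext)
    fix k :: "nat \<times> nat"
    obtain i b where k: "k = (i, b)" by (cases k)
    show "table_of s' k = ((table_of s)((j, a) \<mapsto> vec s)) k"
    proof (cases "(i, b) = (j, a)")
      case True
      have "(\<lambda>l\<in>{1..N}. s2 ''tb'' (ad3 j a l)) = vec s"
        by (rule extensionalityI[of _ "{1..N}"]) (simp_all add: tb1, simp add: vec_def)
      then show ?thesis using True j a by (simp add: k table_of_def s'2 sl)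
    next
      case False
      have 1: "s2 ''sl'' (ad2 i b) = s ''sl'' (ad2 i b)" if "b \<in> {1..n}"
      proof -
        have "b \<in> {1..N}" using that nN by simp
        then show ?thesis using False jN(3) by (auto simp: sl ad2_eq)
      qed
      have 2: "s2 ''tb'' (ad3 i b l) = s ''tb'' (ad3 i b l)" if "b \<in> {1..n}" "l \<in> {1..N}" for l
      proof (rule tb2, rule notI)
        assume "ad3 i b l \<in> ad3 j a ` {1..N}"
        then obtain l' where "l' \<in> {1..N}" "ad3 i b l = ad3 j a l'" by blast
        moreover have "b \<in> {1..N}" using that nN by simp
        ultimately show False using ad3_inj[of i b l j a l'] False that jN(3) by simp
      qed
      have "(\<lambda>l\<in>{1..N}. s2 ''tb'' (ad3 i b l)) = (\<lambda>l\<in>{1..N}. s ''tb'' (ad3 i b l))" if "b \<in> {1..n}"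
        by (rule restrict_ext) (use 2 that in blast)
      then show ?thesis using False 1 by (auto simp: k table_of_def s'2)
    qed
  qed
qed

lemma run_vec:
  assumes N: "s ''N'' 0 = N"
    and E: "\<And>l r. \<lbrakk>l \<in> {1..N}; agree {''l'', ''v''} s r; r ''l'' 0 = l; r ''v'' l = s ''v'' l\<rbrakk>
       \<Longrightarrow> aval e r = E l"
    and s': "s' = run (For ''l'' ''N'' (Do ''v'' (Var ''l'') e)) s"
  shows "vec s' = (\<lambda>l\<in>{1..N}. E l)"
proof -
  have "s' ''v'' l = E l" if "l \<in> {1..N}" for l
    unfolding s' by (rule run_fill(1)[where s=s and m=N and A="\<lambda>l. l" and E=E]) (fact N, simp, simp, fact E, simp, fact that)
  then show ?thesis unfolding vec_def by (intro restrict_ext) simp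
qed

text \<open>
  The loop of \<open>INSERT\<close> simulates the fold of \<open>sift_step\<close>. Slots are never emptied, so the table
  differs from the initial one iff a slot has been filled.
\<close>

theorem run_INSERT:
  assumes e: "env2 s" and tvs: "tv (table_of s)" and v: "vec s \<in> carrier E.V"
    and s': "s' = run INSERT s"
  shows "env2 s'" "table_of s' = E.insert_vec (table_of s) (vec s)" "tv (table_of s')"
    "s' ''added'' 0 = (if table_of s' = table_of s then s ''added'' 0 else 1)"
proof -
  define R where "R r = (\<lambda>(Tb, u). env2 r \<and> table_of r = Tb \<and> vec r = u \<and> tv Tb \<and> u \<in> carrier E.V \<and>
     table_of s \<subseteq>\<^sub>m Tb \<and> r ''added'' 0 = (if Tb = table_of s then s ''added'' 0 else 1))" for r
  have "R s' (fold E.sift_step [1..<Suc N] (table_of s, vec s))"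
    unfolding s' INSERT_def
  proof (rule run_For_refine)
    show "s ''N'' 0 = N" using e by (rule env2D)
    have "env2 (set_var s ''j'' 0)" using e by (subst env2_cong[of _ s]) auto
    moreover have "table_of (set_var s ''j'' 0) = table_of s" "vec (set_var s ''j'' 0) = vec s"
      by (auto intro: table_of_cong vec_cong)
    ultimately show "R (set_var s ''j'' 0) (table_of s, vec s)"
      using tvs v by (simp add: R_def)
  next
    fix j r A assume j: "j \<in> {1..N}" and RA: "R r A"
    obtain Tb u where A: "A = (Tb, u)" by (cases A)
    have r: "env2 r" "table_of r = Tb" "vec r = u" "tv Tb" "u \<in> carrier E.V"
      "table_of s \<subseteq>\<^sub>m Tb" "r ''added'' 0 = (if Tb = table_of s then s ''added'' 0 else 1)"
      using RA by (auto simp: A R_def)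
    define a where "a = u j"
    have a: "a \<in> ker" "a \<in> {1..n}" using V_range[OF r(5) j] kerD by (auto simp: a_def)
    define r1 where "r1 = run (Do ''a'' (Lit 0) (Cell ''v'' (Var ''j''))) (set_var r ''j'' j)"
    have va: "r ''v'' j = a" using fun_cong[OF r(3), of j] j by (simp add: vec_def a_def)
    have r1: "r1 = set_var (set_var r ''j'' j) ''a'' a" by (simp add: r1_def va)
    have e1: "env2 r1" using r(1) by (subst env2_cong[of _ r]) (auto simp: r1)
    have t1: "table_of r1 = Tb" "vec r1 = u"
      using r(2,3) table_of_cong[of r1 r] vec_cong[of r1 r] by (simp_all add: r1)
    have ja: "r1 ''j'' 0 = j" "r1 ''a'' 0 = a" "r1 ''added'' = r ''added''" by (simp_all add: r1)
    define st where "st = (Do ''sl'' (adr2 (Var ''j'') (Var ''a'')) (Lit 1) ;;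
        For ''l'' ''N'' (Do ''tb'' (adr3 (Var ''j'') (Var ''a'') (Var ''l'')) (Cell ''v'' (Var ''l''))) ;;
        Do ''added'' (Lit 0) (Lit 1))"
    define r2 where "r2 = run (If (Equal (at2 ''sl'' (Var ''j'') (Var ''a'')) (Lit 1)) Nop st) r1"
    define Tb' where "Tb' = (if Tb (j, a) = None then Tb((j, a) \<mapsto> u) else Tb)"
    have cond: "bval (Equal (at2 ''sl'' (Var ''j'') (Var ''a'')) (Lit 1)) r1 \<longleftrightarrow> Tb (j, a) \<noteq> None"
    proof -
      have "table_of r1 (j, a) \<noteq> None \<longleftrightarrow> r1 ''sl'' (ad2 j a) = 1" using j a by (simp add: table_of_def)
      then show ?thesis using env2D(3)[OF e1, of j] j by (simp add: ja t1 ad2_def)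
    qed
    have fr2: "r2 x = r1 x" if "x \<notin> {''sl'', ''l'', ''tb'', ''added''}" for x
      using that run_frame[of x "If (Equal (at2 ''sl'' (Var ''j'') (Var ''a'')) (Lit 1)) Nop st" r1]
      by (simp add: r2_def st_def del: run.simps)
    have t2: "table_of r2 = Tb'" "r2 ''added'' 0 = (if Tb' = table_of s then s ''added'' 0 else 1)"
    proof -
      have "table_of r2 = Tb' \<and> r2 ''added'' 0 = (if Tb' = table_of s then s ''added'' 0 else 1)"
      proof (cases "Tb (j, a) = None")
        case True
        have r2: "r2 = run st r1" using True cond by (simp add: r2_def)
        have new: "Tb((j, a) \<mapsto> u) \<noteq> table_of s"
        proof
          assume "Tb((j, a) \<mapsto> u) = table_of s"
          then have "table_of s (j, a) = Some u" by (metis fun_upd_same)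
          then have "Tb (j, a) = Some u" using r(6) by (force simp: map_le_def)
          then show False using True by simp
        qed
        show ?thesis
          using run_store[OF e1 j ja(1) a(2) ja(2) r2[unfolded st_def]] new True t1 by (simp add: Tb'_def)
      next
        case False
        then have "r2 = r1" using cond by (simp add: r2_def)
        moreover have "Tb' = Tb" unfolding Tb'_def by (rule if_not_P[OF False])
        ultimately show ?thesis using t1 r(7) ja(3) by simp
      qed
      then show "table_of r2 = Tb'" "r2 ''added'' 0 = (if Tb' = table_of s then s ''added'' 0 else 1)" by auto
    qed
    have e2: "env2 r2" using e1 by (subst env2_cong[of _ r1]) (auto simp: fr2)
    have v2: "vec r2 = u" using t1(2) vec_cong[of r2 r1] fr2[of "''v''"] by simp
    have tv': "tv Tb'" using r(4,5) j a by (auto simp: tv_def Tb'_def)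
    have le': "table_of s \<subseteq>\<^sub>m Tb'"
      using r(6) by (force simp: Tb'_def map_le_def dom_def)
    define t where "t = the (Tb' (j, a))"
    have t: "Tb' (j, a) = Some t" by (auto simp: t_def Tb'_def)
    have tV: "t \<in> carrier E.V" using tv' t unfolding tv_def by blast
    define r3 where "r3 = run (For ''l'' ''N'' (Do ''v'' (Var ''l'')
       (at2 ''T'' (Cell ''v'' (Var ''l'')) (Cell ''iv'' (Cell ''tb'' (adr3 (Var ''j'') (Var ''a'') (Var ''l''))))))) r2"
    have tbl: "r2 ''tb'' (ad3 j a l) = t l" if "l \<in> {1..N}" for l
      using fun_cong[OF t2(1), of "(j, a)"] t that by (auto simp: table_of_def split: if_splits)
    have vl: "r2 ''v'' l = u l" if "l \<in> {1..N}" for l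
      using fun_cong[OF v2, of l] that by (simp add: vec_def)
    have "vec r3 = (\<lambda>l\<in>{1..N}. u l \<otimes>\<^bsub>T\<^esub> inv\<^bsub>T\<^esub> t l)"
    proof (rule run_vec[OF _ _ r3_def])
      show "r2 ''N'' 0 = N" using e2 by (rule env2D)
      fix l q assume l: "l \<in> {1..N}" and q: "agree {''l'', ''v''} r2 q" "q ''l'' 0 = l" "q ''v'' l = r2 ''v'' l"
      have ker: "u l \<in> ker" "t l \<in> ker" using V_range r(5) tV l by auto
      have inv: "inv\<^bsub>T\<^esub> t l \<in> {1..n}" using H.inv_closed ker_carrier[OF ker(2)] carT by blast
      have jj: "r2 ''j'' 0 = j" "r2 ''a'' 0 = a" using fr2 ja by auto
      have "q ''tb'' (aval (adr3 (Var ''j'') (Var ''a'') (Var ''l'')) q) = t l"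
        using agreeD[OF q(1)] q(2) jj env2D(3)[OF e2, of a] env2D(4)[OF e2, of j] kerD(2)[OF a(1)] j tbl[OF l] by (simp add: ad3_def)
      then show "aval (at2 ''T'' (Cell ''v'' (Var ''l'')) (Cell ''iv'' (Cell ''tb'' (adr3 (Var ''j'') (Var ''a'') (Var ''l''))))) q
          = u l \<otimes>\<^bsub>T\<^esub> inv\<^bsub>T\<^esub> t l"
        using agreeD[OF q(1)] q(2,3) vl[OF l] env2D(3)[OF e2, of "u l"] env2D(5)[OF e2, of "u l" "inv\<^bsub>T\<^esub> t l"] env2D(11)[OF e2, of "t l"]
          kerD ker inv by simp
    qed
    also have "\<dots> = u \<otimes>\<^bsub>E.V\<^esub> inv\<^bsub>E.V\<^esub> t"
    proof (rule extensionalityI[of _ "{1..N}"])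
      have "u \<otimes>\<^bsub>E.V\<^esub> inv\<^bsub>E.V\<^esub> t \<in> carrier E.V" using r(5) tV by simp
      then show "u \<otimes>\<^bsub>E.V\<^esub> inv\<^bsub>E.V\<^esub> t \<in> extensional {1..N}" unfolding E.V_def by (simp add: PiE_def)
    qed (use V_range tV in \<open>simp_all add: inv_K\<close>)
    finally have v3: "vec r3 = u \<otimes>\<^bsub>E.V\<^esub> inv\<^bsub>E.V\<^esub> t" .
    have fr3: "r3 x = r2 x" if "x \<notin> {''l'', ''v''}" for x
      using that run_frame[of x "For ''l'' ''N'' (Do ''v'' (Var ''l'')
       (at2 ''T'' (Cell ''v'' (Var ''l'')) (Cell ''iv'' (Cell ''tb'' (adr3 (Var ''j'') (Var ''a'') (Var ''l''))))))" r2]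
      by (simp add: r3_def del: run.simps)
    have e3: "env2 r3" using e2 by (subst env2_cong[of _ r2]) (auto simp: fr3)
    have t3: "table_of r3 = Tb'" using t2(1) table_of_cong[of r3 r2] fr3 by simp
    have "E.sift_step j A = (Tb', u \<otimes>\<^bsub>E.V\<^esub> inv\<^bsub>E.V\<^esub> t)"
      by (simp add: A E.sift_step_def Tb'_def t_def a_def Let_def)
    moreover have "R r3 (Tb', u \<otimes>\<^bsub>E.V\<^esub> inv\<^bsub>E.V\<^esub> t)"
      using e3 t3 v3 tv' le' t2(2) r(5) tV fr3[of "''added''"] by (simp add: R_def)
    ultimately show "R (run (Do ''a'' (Lit 0) (Cell ''v'' (Var ''j'')) ;;
     If (Equal (at2 ''sl'' (Var ''j'') (Var ''a'')) (Lit 1)) Nop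
       (Do ''sl'' (adr2 (Var ''j'') (Var ''a'')) (Lit 1) ;;
        For ''l'' ''N'' (Do ''tb'' (adr3 (Var ''j'') (Var ''a'') (Var ''l'')) (Cell ''v'' (Var ''l''))) ;;
        Do ''added'' (Lit 0) (Lit 1)) ;;
     For ''l'' ''N'' (Do ''v'' (Var ''l'')
       (at2 ''T'' (Cell ''v'' (Var ''l'')) (Cell ''iv'' (Cell ''tb'' (adr3 (Var ''j'') (Var ''a'') (Var ''l'')))))))
       (set_var r ''j'' j)) (E.sift_step j A)"
      by (simp only: run.simps(3) r1_def[symmetric] r2_def[unfolded st_def, symmetric] r3_def[symmetric])
  qed
  then show "env2 s'" "table_of s' = E.insert_vec (table_of s) (vec s)" "tv (table_of s')"
    "s' ''added'' 0 = (if table_of s' = table_of s then s ''added'' 0 else 1)"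
    by (auto simp: R_def E.insert_vec_def split: prod.splits)
qed

end

section \<open>Neutral element, inverses, admissible maps and defects\<close>

text \<open>
  A loop that records each index satisfying \<open>P\<close> and so ends with the last one. If there is none,
  the cell keeps its old content.
\<close>

lemma run_search:
  assumes m: "s b 0 = m" and xX: "x \<noteq> X"
    and C: "\<And>i r. \<lbrakk>i \<in> {1..m}; agree {x, X} s r; r x 0 = i\<rbrakk> \<Longrightarrow> bval d r \<longleftrightarrow> P i"
    and A: "\<And>i r. \<lbrakk>i \<in> {1..m}; agree {x, X} s r; r x 0 = i\<rbrakk> \<Longrightarrow> aval a r = k"
    and s': "s' = run (For x b (If d (Do X a (Var x)) Nop)) s"
  shows "\<exists>i\<in>{1..m}. P i \<Longrightarrow> s' X k \<in> {1..m} \<and> P (s' X k)"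
    and "\<not> (\<exists>i\<in>{1..m}. P i) \<Longrightarrow> s' X k = s X k"
    and "k' \<noteq> k \<Longrightarrow> s' X k' = s X k'"
proof -
  define I where "I l r \<longleftrightarrow> agree {x, X} s r \<and> (\<forall>k'. k' \<noteq> k \<longrightarrow> r X k' = s X k') \<and>
    (\<forall>i\<in>{1..l}. P i \<longrightarrow> r X k \<in> {1..l} \<and> P (r X k)) \<and> ((\<forall>i\<in>{1..l}. \<not> P i) \<longrightarrow> r X k = s X k)" for l r
  have "I m s'"
    unfolding s'
  proof (rule run_For_inv[of s b m I])
    show "s b 0 = m" by fact
    show "I 0 (set_var s x 0)" using xX by (auto simp: I_def One_nat_def agree_def)
  next
    fix i r assume i: "i < m" and I: "I i r"
    let ?r = "set_var r x (Suc i)"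
    have ag: "agree {x, X} s ?r" using I by (auto simp: I_def agree_def)
    have d: "bval d ?r \<longleftrightarrow> P (Suc i)" using i ag by (intro C) auto
    have a: "aval a ?r = k" using i ag by (intro A) auto
    have set: "{1..Suc i} = insert (Suc i) {1..i}" by auto
    have eq: "run (If d (Do X a (Var x)) Nop) ?r = (if P (Suc i) then ?r(X := (r X)(k := Suc i)) else ?r)"
      using a d xX by simp
    show "I (Suc i) (run (If d (Do X a (Var x)) Nop) ?r)"
      unfolding eq using I xX by (auto simp: I_def set agree_def)
  qed
  note I = this[unfolded I_def, THEN conjunct2]
  show "s' X k \<in> {1..m} \<and> P (s' X k)" if "\<exists>i\<in>{1..m}. P i"
    using that I[THEN conjunct2, THEN conjunct1] by (elim bexE) (drule (1) bspec, simp)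
  show "s' X k = s X k" if "\<not> (\<exists>i\<in>{1..m}. P i)"
    by (rule I[THEN conjunct2, THEN conjunct2, THEN mp]) (use that in simp)
  show "s' X k' = s X k'" if "k' \<noteq> k"
    by (rule I[THEN conjunct1, THEN spec, THEN mp, OF that])
qed

lemma run_search2:
  assumes m: "s b 0 = m" "s b' 0 = m'" and names: "x \<noteq> X" "y \<noteq> X" "x \<noteq> y" "b' \<noteq> x" "b' \<noteq> X" "b' \<noteq> y"
    and C: "\<And>i k r. \<lbrakk>i \<in> {1..m}; k \<in> {1..m'}; agree {x, y, X} s r; r x 0 = i; r y 0 = k\<rbrakk> \<Longrightarrow> bval d r \<longleftrightarrow> P i k"
    and s': "s' = run (For x b (For y b' (If d (Do X (Var x) (Var y)) Nop))) s"
    and i: "i \<in> {1..m}"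
  shows "\<exists>k\<in>{1..m'}. P i k \<Longrightarrow> s' X i \<in> {1..m'} \<and> P i (s' X i)"
    and "\<not> (\<exists>k\<in>{1..m'}. P i k) \<Longrightarrow> s' X i = s X i"
proof -
  define J where "J r i \<longleftrightarrow> ((\<exists>k\<in>{1..m'}. P i k) \<longrightarrow> r X i \<in> {1..m'} \<and> P i (r X i)) \<and>
    (\<not> (\<exists>k\<in>{1..m'}. P i k) \<longrightarrow> r X i = s X i)" for r i
  define I where "I l r \<longleftrightarrow> agree {x, y, X} s r \<and> (\<forall>i. i \<notin> {1..l} \<longrightarrow> r X i = s X i) \<and> (\<forall>i\<in>{1..l}. J r i)" for l r
  have "I m s'"
    unfolding s'
  proof (rule run_For_inv[of s b m I])
    show "s b 0 = m" by fact
    show "I 0 (set_var s x 0)" using names by (auto simp: I_def One_nat_def agree_def)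
  next
    fix i r assume i: "i < m" and I: "I i r"
    let ?r = "set_var r x (Suc i)"
    define r' where "r' = run (For y b' (If d (Do X (Var x) (Var y)) Nop)) ?r"
    have ag: "agree {x, y, X} s ?r" using I by (auto simp: I_def agree_def)
    have bm: "?r b' 0 = m'" using agreeD[OF ag] names m by simp
    have C': "bval d q \<longleftrightarrow> P (Suc i) k" if "k \<in> {1..m'}" "agree {y, X} ?r q" "q y 0 = k" for k q
    proof (rule C)
      show "agree {x, y, X} s q" using ag that(2) by (auto simp: agree_def)
      show "q x 0 = Suc i" using agreeD[OF that(2), of x] names by simp
    qed (use that i in auto)
    have A': "aval (Var x) q = Suc i" if "k \<in> {1..m'}" "agree {y, X} ?r q" "q y 0 = k" for k q
      using agreeD[OF that(2), of x] names by simp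
    have found: "r' X (Suc i) \<in> {1..m'} \<and> P (Suc i) (r' X (Suc i))" if "\<exists>k\<in>{1..m'}. P (Suc i) k"
      by (rule run_search(1)[where s="?r" and P="P (Suc i)" and k="Suc i" and b=b' and x=y and m=m'])
        (fact bm, fact names(2), fact C', fact A', fact r'_def, fact that)
    have missing: "r' X (Suc i) = ?r X (Suc i)" if "\<not> (\<exists>k\<in>{1..m'}. P (Suc i) k)"
      by (rule run_search(2)[where s="?r" and P="P (Suc i)" and k="Suc i" and b=b' and x=y and m=m'])
        (fact bm, fact names(2), fact C', fact A', fact r'_def, fact that)
    have other: "r' X l = ?r X l" if "l \<noteq> Suc i" for l
      by (rule run_search(3)[where s="?r" and P="P (Suc i)" and k="Suc i" and b=b' and x=y and m=m'])
        (fact bm, fact names(2), fact C', fact A', fact r'_def, fact that)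
    have old: "?r X l = r X l" for l using names by simp
    have rX: "r X l = s X l" if "l \<notin> {1..i}" for l using I that unfolding I_def by blast
    show "I (Suc i) (run (For y b' (If d (Do X (Var x) (Var y)) Nop)) ?r)"
      unfolding r'_def[symmetric] I_def
    proof (intro conjI allI impI ballI)
      show "agree {x, y, X} s r'"
      proof (rule agreeI)
        fix z assume z: "z \<notin> {x, y, X}"
        then have "r' z = ?r z" unfolding r'_def by (intro run_frame) simp
        then show "r' z = s z" using agreeD[OF ag z] by simp
      qed
    next
      fix l assume l: "l \<notin> {1..Suc i}"
      then have "l \<noteq> Suc i" "l \<notin> {1..i}" by auto
      then show "r' X l = s X l" using other[of l] old[of l] rX[of l] by metis
    next
      fix l assume l: "l \<in> {1..Suc i}"
      show "J r' l"
      proof (cases "l = Suc i")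
        case True
        then show ?thesis unfolding J_def using found missing old[of l] rX[of "Suc i"] names by simp
      next
        case False
        then have "J r l" using I l unfolding I_def by simp
        then show ?thesis unfolding J_def using other[OF False] old[of l] by simp
      qed
    qed
  qed
  then have J: "J s' i" using i by (simp add: I_def)
  show "s' X i \<in> {1..m'} \<and> P i (s' X i)" if "\<exists>k\<in>{1..m'}. P i k"
    by (rule J[unfolded J_def, THEN conjunct1, THEN mp, OF that])
  show "s' X i = s X i" if "\<not> (\<exists>k\<in>{1..m'}. P i k)"
    by (rule J[unfolded J_def, THEN conjunct2, THEN mp, OF that])
qed

lemma run_flag:
  assumes m: "s b 0 = m" and xX: "x \<noteq> X"
    and C: "\<And>i r. \<lbrakk>i \<in> {1..m}; agree {x, X} s r; r x 0 = i\<rbrakk> \<Longrightarrow> bval d r \<longleftrightarrow> P i"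
    and s': "s' = run (For x b (If d (Do X (Lit 0) (Lit v)) Nop)) s"
  shows "s' X 0 = (if \<exists>i\<in>{1..m}. P i then v else s X 0)"
proof -
  define I where "I l r \<longleftrightarrow> agree {x, X} s r \<and> r X 0 = (if \<exists>i\<in>{1..l}. P i then v else s X 0)" for l r
  have "I m s'"
    unfolding s'
  proof (rule run_For_inv[of s b m I])
    show "s b 0 = m" by fact
    show "I 0 (set_var s x 0)" using xX by (auto simp: I_def One_nat_def agree_def)
  next
    fix i r assume i: "i < m" and I: "I i r"
    let ?r = "set_var r x (Suc i)"
    have ag: "agree {x, X} s ?r" using I by (auto simp: I_def agree_def)
    have d: "bval d ?r \<longleftrightarrow> P (Suc i)" using i ag by (intro C) auto
    have set: "{1..Suc i} = insert (Suc i) {1..i}" by auto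
    have eq: "run (If d (Do X (Lit 0) (Lit v)) Nop) ?r = (if P (Suc i) then ?r(X := (r X)(0 := v)) else ?r)"
      using d xX by simp
    show "I (Suc i) (run (If d (Do X (Lit 0) (Lit v)) Nop) ?r)"
      unfolding eq using I xX by (auto simp: I_def set agree_def)
  qed
  then show ?thesis by (simp add: I_def)
qed

definition IDENTITY :: prog where
  "IDENTITY = For ''a1'' ''n'' (If (Equal (at2 ''T'' (Var ''a1'') (Var ''a1'')) (Var ''a1'')) (Do ''e'' (Lit 0) (Var ''a1'')) Nop)"

definition INVERSES :: prog where
  "INVERSES = For ''a1'' ''n'' (For ''b1'' ''n''
     (If (Equal (at2 ''T'' (Var ''a1'') (Var ''b1'')) (Var ''e'')) (Do ''iv'' (Var ''a1'') (Var ''b1'')) Nop))"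

text \<open>
  The map \<open>f0\<close> picks an admissible value for each element. The flag \<open>ok\<close> is lowered if some
  element has none, in which case no homomorphism is possible.
\<close>

definition SELECT :: prog where
  "SELECT = For ''a1'' ''n'' (Do ''f0'' (Var ''a1'') (Lit 0)) ;;
     For ''a1'' ''n'' (For ''b1'' ''n'' (If (Equal (at2 ''c'' (Var ''a1'') (Var ''b1'')) (Lit 1)) (Do ''f0'' (Var ''a1'') (Var ''b1'')) Nop)) ;;
     Do ''ok'' (Lit 0) (Lit 1) ;;
     For ''a1'' ''n'' (If (Equal (Cell ''f0'' (Var ''a1'')) (Lit 0)) (Do ''ok'' (Lit 0) (Lit 0)) Nop)"

text \<open>This builds \<open>trivial_table\<close>: the slots of the neutral element \<open>e\<close> are filled.\<close>

definition CLEAR :: prog where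
  "CLEAR = For ''j'' ''N'' (For ''a1'' ''n'' (Do ''sl'' (adr2 (Var ''j'') (Var ''a1'')) (Lit 0))) ;;
     For ''j'' ''N'' (Do ''sl'' (adr2 (Var ''j'') (Var ''e'')) (Lit 1)) ;;
     For ''j'' ''N'' (For ''l'' ''N'' (Do ''tb'' (adr3 (Var ''j'') (Var ''e'') (Var ''l'')) (Var ''e'')))"

definition DEFECT :: "string \<Rightarrow> prog" where
  "DEFECT f = For ''l'' ''N'' (Do ''v'' (Var ''l'')
     (at2 ''T'' (at2 ''T'' (Cell f (Cell ''P1'' (Var ''l''))) (Cell f (Cell ''P2'' (Var ''l''))))
       (Cell ''iv'' (Cell f (at2 ''S'' (Cell ''P1'' (Var ''l'')) (Cell ''P2'' (Var ''l'')))))))"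

context ext
begin

lemma run_IDENTITY:
  assumes "env s" "s' = run IDENTITY s"
  shows "env s'" "s' ''e'' 0 = \<one>\<^bsub>T\<^esub>"
proof -
  have fr: "s' x = s x" if "x \<notin> {''a1'', ''e''}" for x
    using that run_frame[of x IDENTITY s] by (simp add: assms(2) IDENTITY_def del: run.simps)
  show "env s'" using assms(1) by (subst env_cong[of _ s]) (simp_all add: fr)
  have e: "s ''n'' 0 = n" "\<And>i. i \<le> N \<Longrightarrow> s ''row'' i = i * N"
    "\<And>a. a \<in> {1..n} \<Longrightarrow> s ''T'' (a * N + a) = a \<otimes>\<^bsub>T\<^esub> a"
    using assms(1) by (auto simp: env_def ready_def tab_def ad2_def)
  have C: "bval (Equal (at2 ''T'' (Var ''a1'') (Var ''a1'')) (Var ''a1'')) r \<longleftrightarrow> i \<otimes>\<^bsub>T\<^esub> i = i"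
    if "i \<in> {1..n}" "agree {''a1'', ''e''} s r" "r ''a1'' 0 = i" for i r
    using that(1,3) agreeD[OF that(2)] e nN by simp
  have one: "\<one>\<^bsub>T\<^esub> \<in> {1..n}" using carT H.one_closed by blast
  have "s' ''e'' 0 \<in> {1..n} \<and> s' ''e'' 0 \<otimes>\<^bsub>T\<^esub> s' ''e'' 0 = s' ''e'' 0"
    by (rule run_search(1)[where s=s and b="''n''" and x="''a1''" and X="''e''" and P="\<lambda>i. i \<otimes>\<^bsub>T\<^esub> i = i" and k=0 and m=n
       and d="Equal (at2 ''T'' (Var ''a1'') (Var ''a1'')) (Var ''a1'')" and a="Lit 0"])
      (fact e, simp, fact C, simp, simp add: assms(2) IDENTITY_def, use one H.r_one in fastforce)
  then show "s' ''e'' 0 = \<one>\<^bsub>T\<^esub>" using H.l_cancel_one[of "s' ''e'' 0" "s' ''e'' 0"] carT by simp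
qed

lemma run_INVERSES:
  assumes "env s" "s ''e'' 0 = \<one>\<^bsub>T\<^esub>" "s' = run INVERSES s"
  shows "env2 s'"
proof -
  have fr: "s' x = s x" if "x \<notin> {''a1'', ''b1'', ''iv''}" for x
    using that run_frame[of x INVERSES s] by (simp add: assms(3) INVERSES_def del: run.simps)
  have env: "env s'" using assms(1) by (subst env_cong[of _ s]) (simp_all add: fr)
  have e: "s ''n'' 0 = n" "\<And>i. i \<le> N \<Longrightarrow> s ''row'' i = i * N"
    "\<And>a b. a \<in> {1..n} \<Longrightarrow> b \<in> {1..n} \<Longrightarrow> s ''T'' (a * N + b) = a \<otimes>\<^bsub>T\<^esub> b"
    using assms(1) by (auto simp: env_def ready_def tab_def ad2_def)
  have C: "bval (Equal (at2 ''T'' (Var ''a1'') (Var ''b1'')) (Var ''e'')) r \<longleftrightarrow> i \<otimes>\<^bsub>T\<^esub> k = \<one>\<^bsub>T\<^esub>"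
    if "i \<in> {1..n}" "k \<in> {1..n}" "agree {''a1'', ''b1'', ''iv''} s r" "r ''a1'' 0 = i" "r ''b1'' 0 = k" for i k r
    using that(1,2,4,5) agreeD[OF that(3)] e nN assms(2) by simp
  have "s' ''iv'' a = inv\<^bsub>T\<^esub> a" if a: "a \<in> {1..n}" for a
  proof -
    have "inv\<^bsub>T\<^esub> a \<in> {1..n}" "a \<otimes>\<^bsub>T\<^esub> inv\<^bsub>T\<^esub> a = \<one>\<^bsub>T\<^esub>" using a carT H.inv_closed H.r_inv by blast+
    then have ex: "\<exists>k\<in>{1..n}. a \<otimes>\<^bsub>T\<^esub> k = \<one>\<^bsub>T\<^esub>" by blast
    have "s' ''iv'' a \<in> {1..n} \<and> a \<otimes>\<^bsub>T\<^esub> s' ''iv'' a = \<one>\<^bsub>T\<^esub>"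
      by (rule run_search2(1)[where s=s and b="''n''" and b'="''n''" and x="''a1''" and y="''b1''" and X="''iv''"
        and P="\<lambda>i k. i \<otimes>\<^bsub>T\<^esub> k = \<one>\<^bsub>T\<^esub>" and m=n and d="Equal (at2 ''T'' (Var ''a1'') (Var ''b1'')) (Var ''e'')"])
        (fact e, fact e, simp, simp, simp, simp, simp, simp, fact C, simp add: assms(3) INVERSES_def, fact a, fact ex)
    then have "inv\<^bsub>T\<^esub> (s' ''iv'' a) = a" using H.inv_equality[of a "s' ''iv'' a"] a carT by simp
    then show ?thesis using H.inv_inv[of "s' ''iv'' a"] \<open>s' ''iv'' a \<in> {1..n} \<and> _\<close> carT by simp
  qed
  then show ?thesis using env assms(2) fr by (simp add: env2_def)
qed

lemma run_SELECT:
  assumes "env2 s" "s' = run SELECT s"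
  shows "env2 s'" "s' ''ok'' 0 = (if \<forall>g\<in>{1..n}. \<exists>h. c g h then 1 else 0)"
    "\<forall>g\<in>{1..n}. \<exists>h. c g h \<Longrightarrow> s' ''f0'' \<in> sel"
proof -
  define s1 where "s1 = run (For ''a1'' ''n'' (Do ''f0'' (Var ''a1'') (Lit 0))) s"
  define s2 where "s2 = run (For ''a1'' ''n'' (For ''b1'' ''n'' (If (Equal (at2 ''c'' (Var ''a1'') (Var ''b1'')) (Lit 1)) (Do ''f0'' (Var ''a1'') (Var ''b1'')) Nop))) s1"
  define s3 where "s3 = set_var s2 ''ok'' 1"
  have s3: "s3 = run (Do ''ok'' (Lit 0) (Lit 1)) s2" by (simp add: s3_def)
  have s': "s' = run (For ''a1'' ''n'' (If (Equal (Cell ''f0'' (Var ''a1'')) (Lit 0)) (Do ''ok'' (Lit 0) (Lit 0)) Nop)) s3"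
    unfolding assms(2) SELECT_def s3 s2_def s1_def by (simp only: run.simps(3))
  have fr1: "s1 x = s x" if "x \<notin> {''a1'', ''f0''}" for x
    unfolding s1_def by (rule run_frame) (use that in simp)
  have fr2: "s2 x = s1 x" if "x \<notin> {''a1'', ''b1'', ''f0''}" for x
    unfolding s2_def by (rule run_frame) (use that in simp)
  have fr3: "s' x = s2 x" if "x \<notin> {''a1'', ''ok''}" for x
    unfolding s' by (subst run_frame) (use that in \<open>simp_all add: s3_def\<close>)
  show env': "env2 s'" using assms(1) by (subst env2_cong[of _ s]) (simp_all add: fr1 fr2 fr3)
  have n: "s ''n'' 0 = n" using assms(1) by (rule env2D)
  have f1: "s1 ''f0'' g = 0" if "g \<in> {1..n}" for g
    unfolding s1_def by (rule run_fill(1)[where A="\<lambda>i. i" and E="\<lambda>_. 0" and m=n]) (use n that in simp_all)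
  have C: "bval (Equal (at2 ''c'' (Var ''a1'') (Var ''b1'')) (Lit 1)) r \<longleftrightarrow> c i k"
    if "i \<in> {1..n}" "k \<in> {1..n}" "agree {''a1'', ''b1'', ''f0''} s1 r" "r ''a1'' 0 = i" "r ''b1'' 0 = k" for i k r
    using that(1,2,4,5) agreeD[OF that(3)] nN fr1 env2D(3)[OF assms(1), of i] env2D(9)[OF assms(1), of i k] by simp
  have n1: "s1 ''n'' 0 = n" using n fr1 by simp
  note search = run_search2[where s=s1 and b="''n''" and b'="''n''" and x="''a1''" and y="''b1''" and X="''f0''"
        and P=c and m=n and m'=n and d="Equal (at2 ''c'' (Var ''a1'') (Var ''b1'')) (Lit 1)" and s'=s2]
  have crange: "h \<in> {1..n}" if "g \<in> {1..n}" "c g h" for g h using row[of g h] that carS carT by simp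
  have s1': "s2 ''f0'' g \<in> {1..n} \<and> c g (s2 ''f0'' g)" if "g \<in> {1..n}" "\<exists>h. c g h" for g
  proof (rule search(1))
    show "\<exists>k\<in>{1..n}. c g k" using that crange by blast
  qed (fact n1, fact n1, simp, simp, simp, simp, simp, simp, fact C, fact s2_def, fact that)
  have s2': "s2 ''f0'' g = 0" if "g \<in> {1..n}" "\<not> (\<exists>h. c g h)" for g
  proof -
    have "s2 ''f0'' g = s1 ''f0'' g"
    proof (rule search(2))
      show "\<not> (\<exists>k\<in>{1..n}. c g k)" using that by blast
    qed (fact n1, fact n1, simp, simp, simp, simp, simp, simp, fact C, fact s2_def, fact that)
    then show ?thesis using f1[OF that(1)] by simp
  qed
  have n3: "s3 ''n'' 0 = n" using n fr1 fr2 by (simp add: s3_def)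
  have C3: "bval (Equal (Cell ''f0'' (Var ''a1'')) (Lit 0)) r \<longleftrightarrow> s2 ''f0'' i = 0"
    if "i \<in> {1..n}" "agree {''a1'', ''ok''} s3 r" "r ''a1'' 0 = i" for i r
    using that(1,3) agreeD[OF that(2)] by (simp add: s3_def)
  have ok: "s' ''ok'' 0 = (if \<exists>i\<in>{1..n}. s2 ''f0'' i = 0 then 0 else s3 ''ok'' 0)"
    by (rule run_flag[where P="\<lambda>i. s2 ''f0'' i = 0", OF n3 _ C3 s']) simp
  have "(\<exists>i\<in>{1..n}. s2 ''f0'' i = 0) \<longleftrightarrow> \<not> (\<forall>g\<in>{1..n}. \<exists>h. c g h)"
  proof
    assume "\<exists>i\<in>{1..n}. s2 ''f0'' i = 0"
    then obtain i where "i \<in> {1..n}" "s2 ''f0'' i = 0" by blast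
    then have "\<not> (\<exists>h. c i h)" using s1'[of i] by auto
    then show "\<not> (\<forall>g\<in>{1..n}. \<exists>h. c g h)" using \<open>i \<in> {1..n}\<close> by blast
  next
    assume "\<not> (\<forall>g\<in>{1..n}. \<exists>h. c g h)"
    then obtain i where "i \<in> {1..n}" "\<not> (\<exists>h. c i h)" by blast
    then show "\<exists>i\<in>{1..n}. s2 ''f0'' i = 0" using s2'[of i] by blast
  qed
  then show "s' ''ok'' 0 = (if \<forall>g\<in>{1..n}. \<exists>h. c g h then 1 else 0)" using ok by (simp add: s3_def)
  show "s' ''f0'' \<in> sel" if "\<forall>g\<in>{1..n}. \<exists>h. c g h"
    using s1' that fr3 carS by (auto simp: sel_def)
qed

lemma run_CLEAR:
  assumes "env2 s" "s' = run CLEAR s"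
  shows "env2 s'" "table_of s' = E.trivial_table"
proof -
  define s1 where "s1 = run (For ''j'' ''N'' (For ''a1'' ''n'' (Do ''sl'' (adr2 (Var ''j'') (Var ''a1'')) (Lit 0)))) s"
  define s2 where "s2 = run (For ''j'' ''N'' (Do ''sl'' (adr2 (Var ''j'') (Var ''e'')) (Lit 1))) s1"
  have s': "s' = run (For ''j'' ''N'' (For ''l'' ''N'' (Do ''tb'' (adr3 (Var ''j'') (Var ''e'') (Var ''l'')) (Var ''e'')))) s2"
    unfolding assms(2) CLEAR_def s2_def s1_def by (simp only: run.simps(3))
  have fr1: "s1 x = s x" if "x \<notin> {''j'', ''a1'', ''sl''}" for x
    unfolding s1_def by (rule run_frame) (use that in simp)
  have fr2: "s2 x = s1 x" if "x \<notin> {''j'', ''sl''}" for x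
    unfolding s2_def by (rule run_frame) (use that in simp)
  have fr3: "s' x = s2 x" if "x \<notin> {''j'', ''l'', ''tb''}" for x
    unfolding s' by (rule run_frame) (use that in simp)
  show env': "env2 s'" using assms(1) by (subst env2_cong[of _ s]) (simp_all add: fr1 fr2 fr3)
  define e where "e = \<one>\<^bsub>T\<^esub>"
  have e: "e \<in> {1..n}" "e \<in> {1..N}" "e \<le> N" using carT H.one_closed nN by (auto simp: e_def)
  have es: "s ''e'' 0 = e" using env2D(10)[OF assms(1)] by (simp add: e_def)
  have N: "s ''N'' 0 = N" "s1 ''N'' 0 = N" "s2 ''N'' 0 = N" and n: "s ''n'' 0 = n"
    using env2D(1,2)[OF assms(1)] fr1 fr2 by auto
  have row: "s ''row'' i = i * N" "s ''row2'' i = i * N * N" if "i \<le> N" for i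
    using env2D(3,4)[OF assms(1) that] .
  have A1: "aval (adr2 (Var ''j'') (Var ''a1'')) r = ad2 i k"
    if "i \<in> {1..N}" "k \<in> {1..n}" "agree {''j'', ''a1'', ''sl''} s r" "r ''j'' 0 = i" "r ''a1'' 0 = k" for i k r
    using that(1,2,4,5) agreeD[OF that(3)] row by (simp add: ad2_def)
  have inj2: "i = i' \<and> k = k'"
    if "i \<in> {1..N}" "k \<in> {1..n}" "i' \<in> {1..N}" "k' \<in> {1..n}" "ad2 i k = ad2 i' k'" for i i' k k'
    using ad2_inj[of i k i' k'] that nN by auto
  have sl1: "s1 ''sl'' (ad2 i k) = 0" if "i \<in> {1..N}" "k \<in> {1..n}" for i k
    unfolding s1_def by (rule run_fill2(1)[where A=ad2 and E="\<lambda>_ _. 0" and m=N and m'=n])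
      (fact N, fact n, simp, simp, simp, simp, simp, simp, fact A1, simp, fact inj2, fact that, fact that)
  have A2: "aval (adr2 (Var ''j'') (Var ''e'')) r = ad2 i e"
    if "i \<in> {1..N}" "agree {''j'', ''sl''} s1 r" "r ''j'' 0 = i" for i r
    using that(1,3) agreeD[OF that(2)] fr1 row es by (simp add: ad2_def)
  have injA2: "inj_on (\<lambda>i. ad2 i e) {1..N}" using e by (auto simp: inj_on_def ad2_eq)
  have sl2: "s2 ''sl'' (ad2 i e) = 1" if "i \<in> {1..N}" for i
    unfolding s2_def by (rule run_fill(1)[where A="\<lambda>i. ad2 i e" and E="\<lambda>_. 1" and m=N])
      (fact N, simp, fact A2, simp, fact injA2, fact that)
  have sl3: "s2 ''sl'' k = s1 ''sl'' k" if "k \<notin> (\<lambda>i. ad2 i e) ` {1..N}" for k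
    unfolding s2_def by (rule run_fill(2)[where A="\<lambda>i. ad2 i e" and E="\<lambda>_. 1" and m=N])
      (fact N, simp, fact A2, simp, fact injA2, fact that)
  have A3: "aval (adr3 (Var ''j'') (Var ''e'') (Var ''l'')) r = ad3 i e k"
    if "i \<in> {1..N}" "k \<in> {1..N}" "agree {''j'', ''l'', ''tb''} s2 r" "r ''j'' 0 = i" "r ''l'' 0 = k" for i k r
    using that(1,2,4,5) agreeD[OF that(3)] fr1 fr2 row es e by (simp add: ad3_def)
  have E3: "aval (Var ''e'') r = e"
    if "i \<in> {1..N}" "k \<in> {1..N}" "agree {''j'', ''l'', ''tb''} s2 r" "r ''j'' 0 = i" "r ''l'' 0 = k"
      "r ''tb'' (ad3 i e k) = s2 ''tb'' (ad3 i e k)" for i k r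
    using agreeD[OF that(3)] fr1 fr2 es by simp
  have inj3: "i = i' \<and> k = k'"
    if "i \<in> {1..N}" "k \<in> {1..N}" "i' \<in> {1..N}" "k' \<in> {1..N}" "ad3 i e k = ad3 i' e k'" for i i' k k'
    using ad3_inj[of i e k i' e k'] that e by auto
  have tb: "s' ''tb'' (ad3 i e k) = e" if "i \<in> {1..N}" "k \<in> {1..N}" for i k
    unfolding s' by (rule run_fill2(1)[where A="\<lambda>i k. ad3 i e k" and E="\<lambda>_ _. e" and m=N and m'=N])
      (fact N, fact N, simp, simp, simp, simp, simp, simp, fact A3, fact E3, fact inj3, fact that, fact that)
  show "table_of s' = E.trivial_table"
  proof (rule HOL.ext)
    fix k :: "nat \<times> nat"
    obtain i b where k: "k = (i, b)" by (cases k)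
    show "table_of s' k = E.trivial_table k"
    proof (cases "i \<in> {1..N} \<and> b = e")
      case True
      have "(\<lambda>l\<in>{1..N}. s' ''tb'' (ad3 i e l)) = \<one>\<^bsub>E.V\<^esub>"
        using True by (auto simp: E.V_def tb simp flip: e_def intro!: restrict_ext)
      then show ?thesis using True e sl2 fr3
        by (simp add: k table_of_def E.trivial_table_def e_def[symmetric])
    next
      case False
      have "s' ''sl'' (ad2 i b) = 0" if "i \<in> {1..N}" "b \<in> {1..n}"
      proof -
        have "ad2 i b \<notin> (\<lambda>i. ad2 i e) ` {1..N}"
          using False that e nN by (auto simp: ad2_eq)
        then show ?thesis using sl3 sl1[OF that] fr3 by simp
      qed
      then have "table_of s' k = None" by (simp add: k table_of_def)
      moreover have "E.trivial_table k = None" using False by (auto simp: k E.trivial_table_def e_def)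
      ultimately show ?thesis by simp
    qed
  qed
qed

lemma run_DEFECT:
  assumes s: "env2 s" and f: "f \<noteq> ''l''" "f \<noteq> ''v''" and fn: "\<And>g. g \<in> {1..n} \<Longrightarrow> s f g = fn g" "fn \<in> sel"
    and s': "s' = run (DEFECT f) s"
  shows "vec s' = defect fn"
proof -
  have "vec s' = (\<lambda>j\<in>{1..N}. fn (P1 j) \<otimes>\<^bsub>T\<^esub> fn (P2 j) \<otimes>\<^bsub>T\<^esub> inv\<^bsub>T\<^esub> fn (P1 j \<otimes>\<^bsub>S\<^esub> P2 j))"
  proof (rule run_vec[OF _ _ s'[unfolded DEFECT_def]])
    show "s ''N'' 0 = N" using s by (rule env2D)
    fix l r assume l: "l \<in> {1..N}" and r: "agree {''l'', ''v''} s r" "r ''l'' 0 = l" "r ''v'' l = s ''v'' l"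
    have P: "P1 l \<in> {1..n}" "P2 l \<in> {1..n}" "P1 l \<otimes>\<^bsub>S\<^esub> P2 l \<in> {1..n}"
      using P12[OF l] G.m_closed[of "P1 l" "P2 l"] by (auto simp: carS)
    have F: "fn g \<in> {1..n}" "fn g \<le> N" if "g \<in> {1..n}" for g
      using selD[OF fn(2), of g] that nN by (auto simp: carS carT)
    have FF: "fn (P1 l) \<otimes>\<^bsub>T\<^esub> fn (P2 l) \<in> {1..n}" using H.m_closed F P unfolding carT by blast
    then have FF': "fn (P1 l) \<otimes>\<^bsub>T\<^esub> fn (P2 l) \<le> N" using nN by simp
    have I: "inv\<^bsub>T\<^esub> fn (P1 l \<otimes>\<^bsub>S\<^esub> P2 l) \<in> {1..n}" using H.inv_closed F P unfolding carT by blast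
    have PN: "P1 l \<le> N" using P nN by simp
    have rf: "r f = s f" using agreeD[OF r(1)] f by simp
    show "aval (at2 ''T'' (at2 ''T'' (Cell f (Cell ''P1'' (Var ''l''))) (Cell f (Cell ''P2'' (Var ''l''))))
       (Cell ''iv'' (Cell f (at2 ''S'' (Cell ''P1'' (Var ''l'')) (Cell ''P2'' (Var ''l'')))))) r =
       fn (P1 l) \<otimes>\<^bsub>T\<^esub> fn (P2 l) \<otimes>\<^bsub>T\<^esub> inv\<^bsub>T\<^esub> fn (P1 l \<otimes>\<^bsub>S\<^esub> P2 l)"
      using env2D(7,8)[OF s l] env2D(3)[OF s PN] env2D(6)[OF s P(1,2)] env2D(3)[OF s F(2)[OF P(1)]]
        env2D(5)[OF s F(1)[OF P(1)] F(1)[OF P(2)]] env2D(11)[OF s F(1)[OF P(3)]] env2D(3)[OF s FF']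
        env2D(5)[OF s FF I] fn(1)[OF P(1)] fn(1)[OF P(2)] fn(1)[OF P(3)] rf r(2) agreeD[OF r(1)] by simp
  qed
  then show ?thesis by (simp add: defect_def)
qed

end

section \<open>Deciding the existence of a homomorphism\<close>

text \<open>The array \<open>z\<close> holds the defect of \<open>f0\<close>.\<close>

definition SUBZ :: prog where
  "SUBZ = For ''l'' ''N'' (Do ''v'' (Var ''l'') (at2 ''T'' (Cell ''v'' (Var ''l'')) (Cell ''iv'' (Cell ''z'' (Var ''l'')))))"

text \<open>This inserts \<open>w (x, y)\<close>, the change of the defect when \<open>f0\<close> gets the value \<open>y\<close> at \<open>x\<close>.\<close>

definition GEN :: prog where
  "GEN = For ''g'' ''n'' (Do ''f1'' (Var ''g'') (Cell ''f0'' (Var ''g''))) ;; Do ''f1'' (Var ''x'') (Var ''y'') ;;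
     DEFECT ''f1'' ;; SUBZ ;; INSERT"

definition GENS :: prog where
  "GENS = For ''x'' ''n'' (For ''y'' ''n'' (If (Equal (at2 ''c'' (Var ''x'') (Var ''y'')) (Lit 1)) GEN Nop))"

definition PRODUCT :: prog where
  "PRODUCT = For ''l'' ''N'' (Do ''v'' (Var ''l'') (at2 ''T'' (Cell ''tb'' (adr3 (Var ''jj'') (Var ''aa'') (Var ''l'')))
      (Cell ''tb'' (adr3 (Var ''jj'') (Var ''bb'') (Var ''l'')))))"

definition PASS :: prog where
  "PASS = For ''jj'' ''N'' (For ''aa'' ''n'' (For ''bb'' ''n''
     (If (Conj (Equal (at2 ''sl'' (Var ''jj'') (Var ''aa'')) (Lit 1)) (Equal (at2 ''sl'' (Var ''jj'') (Var ''bb'')) (Lit 1)))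
       (PRODUCT ;; INSERT) Nop)))"

text \<open>
  There are \<open>N\<close> positions and at most \<open>n \<le> N\<close> leading entries, so \<open>N * N\<close> passes reach a fixed
  point.
\<close>

definition CLOSE :: prog where
  "CLOSE = For ''u1'' ''N'' (For ''u2'' ''N'' PASS)"

text \<open>The answer is negative iff inserting the defect of \<open>f0\<close> fills a slot.\<close>

definition TESTZ :: prog where
  "TESTZ = For ''l'' ''N'' (Do ''v'' (Var ''l'') (Cell ''z'' (Var ''l''))) ;; Do ''added'' (Lit 0) (Lit 0) ;; INSERT ;;
     If (Equal (Var ''added'') (Lit 1)) (Do ''ok'' (Lit 0) (Lit 0)) Nop"

definition SAVEZ :: prog where
  "SAVEZ = For ''l'' ''N'' (Do ''z'' (Var ''l'') (Cell ''v'' (Var ''l'')))"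

definition EXT :: prog where
  "EXT = IDENTITY ;; INVERSES ;; SELECT ;;
     If (Equal (Var ''ok'') (Lit 1)) (CLEAR ;; DEFECT ''f0'' ;; SAVEZ ;; GENS ;; CLOSE ;; TESTZ) Nop"

lemma writes_INSERT: "writes INSERT = {''j'', ''a'', ''sl'', ''l'', ''tb'', ''added'', ''v''}"
  by (auto simp: INSERT_def)

lemma writes_DEFECT: "writes (DEFECT f) = {''l'', ''v''}"
  by (auto simp: DEFECT_def)

lemma writes_GEN: "writes GEN = {''g'', ''f1'', ''j'', ''a'', ''sl'', ''l'', ''tb'', ''added'', ''v''}"
  by (auto simp: GEN_def SUBZ_def writes_INSERT writes_DEFECT)

lemma writes_CLOSE: "writes CLOSE = {''u1'', ''u2'', ''jj'', ''aa'', ''bb'', ''j'', ''a'', ''sl'', ''l'', ''tb'', ''added'', ''v''}"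
  by (auto simp: CLOSE_def PASS_def PRODUCT_def writes_INSERT)

lemma fold_const: "fold (\<lambda>_. f) xs = f ^^ length xs"
  by (induction xs) (auto simp: funpow_swap1 fun_eq_iff)

context ext
begin

text \<open>What stays true while vectors are inserted into the table.\<close>

definition st :: "(nat \<Rightarrow> nat) \<Rightarrow> state \<Rightarrow> bool" where
  "st fn s \<longleftrightarrow> env2 s \<and> tv (table_of s) \<and> s ''f0'' = fn \<and> (\<forall>l\<in>{1..N}. s ''z'' l = defect fn l)"

lemma st_cong:
  assumes "st fn s"
    "\<forall>x\<in>{''n'', ''N'', ''row'', ''row2'', ''S'', ''T'', ''P1'', ''P2'', ''c'', ''e'', ''iv'', ''sl'', ''tb'', ''f0'', ''z''}. s' x = s x"
  shows "st fn s'" "table_of s' = table_of s"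
proof -
  have 1: "env2 s'" using assms(1) by (subst env2_cong[of _ s]) (use assms(2) in \<open>simp_all add: st_def\<close>)
  show 2: "table_of s' = table_of s" using assms(2) by (intro table_of_cong) simp_all
  show "st fn s'" using assms 1 2 by (simp add: st_def)
qed

lemma st_size: "st fn s \<Longrightarrow> s ''n'' 0 = n" "st fn s \<Longrightarrow> s ''N'' 0 = N"
  using env2D(1,2) by (simp_all add: st_def)

lemma run_INSERT_st:
  assumes s: "st fn s" and v: "vec s = u" "u \<in> carrier E.V" and s': "s' = run INSERT s"
  shows "st fn s'" "table_of s' = E.insert_vec (table_of s) u"
proof -
  have e: "env2 s" "tv (table_of s)" "vec s \<in> carrier E.V" using s v by (simp_all add: st_def)
  note ri = run_INSERT[OF e s']
  show "table_of s' = E.insert_vec (table_of s) u" using ri(2) v(1) by simp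
  have "s' ''f0'' = s ''f0''" "s' ''z'' = s ''z''" unfolding s' by (rule run_frame, simp add: writes_INSERT)+
  then show "st fn s'" using s ri(1,3) by (simp add: st_def)
qed

definition w :: "(nat \<Rightarrow> nat) \<Rightarrow> nat \<times> nat \<Rightarrow> nat \<Rightarrow> nat" where
  "w fn = (\<lambda>(x, y). defect (fn(x := y)) \<otimes>\<^bsub>E.V\<^esub> inv\<^bsub>E.V\<^esub> defect fn)"

lemma V_ext: "u \<in> carrier E.V \<Longrightarrow> (\<And>l. l \<in> {1..N} \<Longrightarrow> u l = F l) \<Longrightarrow> (\<lambda>l\<in>{1..N}. F l) = u"
  by (rule extensionalityI[of _ "{1..N}"]) (auto simp: E.V_def PiE_def)

lemma run_GEN:
  assumes s: "st fn s" and fn: "fn \<in> sel" and x: "s ''x'' 0 = x" "x \<in> {1..n}" and y: "s ''y'' 0 = y" "c x y"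
    and s': "s' = run GEN s"
  shows "st fn s'" "table_of s' = E.insert_vec (table_of s) (w fn (x, y))"
proof -
  define s1 where "s1 = run (For ''g'' ''n'' (Do ''f1'' (Var ''g'') (Cell ''f0'' (Var ''g'')))) s"
  define s2 where "s2 = run (Do ''f1'' (Var ''x'') (Var ''y'')) s1"
  define s3 where "s3 = run (DEFECT ''f1'') s2"
  define s4 where "s4 = run SUBZ s3"
  have s'4: "s' = run INSERT s4" unfolding s' GEN_def s4_def s3_def s2_def s1_def by (simp only: run.simps(3))
  have e: "env2 s" and f0: "s ''f0'' = fn" and z: "\<And>l. l \<in> {1..N} \<Longrightarrow> s ''z'' l = defect fn l"
    using s by (auto simp: st_def)
  have fr1: "s1 q = s q" if "q \<notin> {''g'', ''f1''}" for q
    unfolding s1_def by (rule run_frame) (use that in simp)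
  have fr2: "s2 q = s1 q" if "q \<notin> {''f1''}" for q
    unfolding s2_def by (rule run_frame) (use that in simp)
  have fr3: "s3 q = s2 q" if "q \<notin> {''l'', ''v''}" for q
    unfolding s3_def by (rule run_frame) (use that in \<open>simp add: writes_DEFECT\<close>)
  have fr4: "s4 q = s3 q" if "q \<notin> {''l'', ''v''}" for q
    unfolding s4_def by (rule run_frame) (use that in \<open>simp add: SUBZ_def\<close>)
  have fr: "s4 q = s q" if "q \<notin> {''l'', ''v'', ''g'', ''f1''}" for q
    using that fr1 fr2 fr3 fr4 by simp
  have e2: "env2 s2" using e by (subst env2_cong[of _ s]) (simp_all add: fr1 fr2)
  have e3: "env2 s3" using e2 by (subst env2_cong[of _ s2]) (simp_all add: fr3)
  have f1: "s1 ''f1'' g = fn g" if g: "g \<in> {1..n}" for g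
  proof -
    have E: "aval (Cell ''f0'' (Var ''g'')) r = fn i"
      if "i \<in> {1..n}" "agree {''g'', ''f1''} s r" "r ''g'' 0 = i" "r ''f1'' i = s ''f1'' i" for i r
      using that(3) agreeD[OF that(2)] f0 by simp
    show ?thesis
      unfolding s1_def by (rule run_fill(1)[where s=s and m=n and A="\<lambda>i. i" and E=fn])
        (rule env2D(1)[OF e], simp, simp, fact E, simp, fact g)
  qed
  have s2f: "s2 ''f1'' = (s1 ''f1'')(x := y)" using x y fr1 by (simp add: s2_def)
  have f2: "s2 ''f1'' g = (fn(x := y)) g" if "g \<in> {1..n}" for g
    using f1[OF that] by (simp add: s2f)
  have sel: "fn(x := y) \<in> sel" using fn y by (intro sel_upd)
  have v3: "vec s3 = defect (fn(x := y))"
    by (rule run_DEFECT[OF e2 _ _ f2 sel s3_def]) simp_all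
  have dV: "defect (fn(x := y)) \<in> carrier E.V" "defect fn \<in> carrier E.V" using sel fn by (simp_all add: defect_V)
  have v4: "vec s4 = (\<lambda>l\<in>{1..N}. defect (fn(x := y)) l \<otimes>\<^bsub>T\<^esub> inv\<^bsub>T\<^esub> defect fn l)"
  proof (rule run_vec[OF _ _ s4_def[unfolded SUBZ_def]])
    show "s3 ''N'' 0 = N" by (rule env2D(2)[OF e3])
    fix l r assume l: "l \<in> {1..N}" and r: "agree {''l'', ''v''} s3 r" "r ''l'' 0 = l" "r ''v'' l = s3 ''v'' l"
    have k: "defect (fn(x := y)) l \<in> ker" "defect fn l \<in> ker" using V_range dV l by auto
    have inv: "inv\<^bsub>T\<^esub> defect fn l \<in> {1..n}" using H.inv_closed ker_carrier[OF k(2)] unfolding carT .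
    have "s3 ''v'' l = defect (fn(x := y)) l" using fun_cong[OF v3, of l] l by (simp add: vec_def)
    moreover have "r ''z'' l = defect fn l" using agreeD[OF r(1)] fr1 fr2 fr3 z[OF l] by simp
    ultimately show "aval (at2 ''T'' (Cell ''v'' (Var ''l'')) (Cell ''iv'' (Cell ''z'' (Var ''l'')))) r =
        defect (fn(x := y)) l \<otimes>\<^bsub>T\<^esub> inv\<^bsub>T\<^esub> defect fn l"
      using r(2,3) agreeD[OF r(1)] env2D(3)[OF e3 kerD(2)[OF k(1)]] env2D(11)[OF e3 kerD(1)[OF k(2)]]
        env2D(5)[OF e3 kerD(1)[OF k(1)] inv] by simp
  qed
  have wV: "w fn (x, y) \<in> carrier E.V" using dV by (simp add: w_def)
  have v4': "vec s4 = w fn (x, y)"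
    unfolding v4
  proof (rule V_ext[OF wV])
    fix l assume l: "l \<in> {1..N}"
    have "defect fn l \<in> ker" using V_range dV l by auto
    then show "w fn (x, y) l = defect (fn(x := y)) l \<otimes>\<^bsub>T\<^esub> inv\<^bsub>T\<^esub> defect fn l"
      using l dV by (simp add: w_def inv_K)
  qed
  have st4: "st fn s4" "table_of s4 = table_of s" by (rule st_cong[OF s], simp add: fr)+
  show "st fn s'" "table_of s' = E.insert_vec (table_of s) (w fn (x, y))"
    using run_INSERT_st[OF st4(1) v4' wV s'4] st4(2) by simp_all
qed

lemma run_GENS:
  assumes s: "st fn s" and fn: "fn \<in> sel" and s': "s' = run GENS s"
  shows "st fn s' \<and> (\<exists>xs. set xs = {(x, y). x \<in> {1..n} \<and> c x y} \<and>
      table_of s' = fold (\<lambda>x T. E.insert_vec T (w fn x)) xs (table_of s))"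
proof -
  let ?g = "\<lambda>X r. st fn r \<and> (\<exists>xs. set xs = X \<and> table_of r = fold (\<lambda>x T. E.insert_vec T (w fn x)) xs (table_of s))"
  have crange: "y \<in> {1..n}" if "x \<in> {1..n}" "c x y" for x y using row[of x y] that carS carT by simp
  have "?g {(x, y). x \<in> {1..n} \<and> c x y} s'"
    unfolding s' GENS_def
  proof (rule run_For_inv[of s "''n''" n "\<lambda>i. ?g {(x, y). x \<in> {1..i} \<and> c x y}"])
    show "s ''n'' 0 = n" using s by (rule st_size)
    have "st fn (set_var s ''x'' 0)" "table_of (set_var s ''x'' 0) = table_of s" by (rule st_cong[OF s], simp)+
    then show "?g {(x, y). x \<in> {1..0} \<and> c x y} (set_var s ''x'' 0)" by (auto intro: exI[of _ "[]"])
  next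
    fix i r assume i: "i < n" and r: "?g {(x, y). x \<in> {1..i} \<and> c x y} r"
    let ?r = "set_var r ''x'' (Suc i)"
    let ?X = "\<lambda>k. {(x, y). x \<in> {1..i} \<and> c x y} \<union> {(x, y). x = Suc i \<and> y \<in> {1..k} \<and> c x y}"
    let ?h = "\<lambda>k q. ?g (?X k) q \<and> q ''x'' 0 = Suc i"
    have r': "st fn ?r" "table_of ?r = table_of r" by (rule st_cong[of fn r], use r in simp, simp)+
    have "?h n (run (For ''y'' ''n'' (If (Equal (at2 ''c'' (Var ''x'') (Var ''y'')) (Lit 1)) GEN Nop)) ?r)"
    proof (rule run_For_inv[of ?r "''n''" n ?h])
      show "?r ''n'' 0 = n" using r'(1) by (rule st_size)
      have "st fn (set_var ?r ''y'' 0)" "table_of (set_var ?r ''y'' 0) = table_of ?r" by (rule st_cong[OF r'(1)], simp)+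
      moreover have "?X 0 = {(x, y). x \<in> {1..i} \<and> c x y}" by auto
      ultimately show "?h 0 (set_var ?r ''y'' 0)" using r r'(2) by simp
    next
      fix k q assume k: "k < n" and q: "?h k q"
      let ?q = "set_var q ''y'' (Suc k)"
      have q': "st fn ?q" "table_of ?q = table_of q" by (rule st_cong[of fn q], use q in simp, simp)+
      obtain xs where xs: "set xs = ?X k" "table_of q = fold (\<lambda>x T. E.insert_vec T (w fn x)) xs (table_of s)"
        using q by blast
      have e: "env2 ?q" using q'(1) by (simp add: st_def)
      have iN: "Suc i \<le> N" "Suc i \<in> {1..n}" "Suc k \<in> {1..n}" using i k nN by auto
      have qx: "?q ''x'' 0 = Suc i" "?q ''y'' 0 = Suc k" using q by simp_all
      have cond: "bval (Equal (at2 ''c'' (Var ''x'') (Var ''y'')) (Lit 1)) ?q \<longleftrightarrow> c (Suc i) (Suc k)"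
        using env2D(3)[OF e iN(1)] env2D(9)[OF e iN(2,3)] qx by simp
      have X: "?X (Suc k) = (if c (Suc i) (Suc k) then insert (Suc i, Suc k) (?X k) else ?X k)"
        by (auto simp: le_Suc_eq)
      show "?h (Suc k) (run (If (Equal (at2 ''c'' (Var ''x'') (Var ''y'')) (Lit 1)) GEN Nop) ?q)"
      proof (cases "c (Suc i) (Suc k)")
        case True
        then have eq: "run (If (Equal (at2 ''c'' (Var ''x'') (Var ''y'')) (Lit 1)) GEN Nop) ?q = run GEN ?q"
          using cond by (simp only: run.simps(4) if_True)
        note g = run_GEN[OF q'(1) fn qx(1) iN(2) qx(2) True refl]
        have "run GEN ?q ''x'' 0 = Suc i"
          using run_frame[of "''x''" GEN ?q] qx by (simp add: writes_GEN)
        moreover have "table_of (run GEN ?q) = fold (\<lambda>x T. E.insert_vec T (w fn x)) (xs @ [(Suc i, Suc k)]) (table_of s)"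
        proof -
          have "table_of (run GEN ?q) = E.insert_vec (table_of ?q) (w fn (Suc i, Suc k))" by (rule g(2))
          then show ?thesis unfolding q'(2) xs(2) by simp
        qed
        moreover have "set (xs @ [(Suc i, Suc k)]) = ?X (Suc k)" unfolding X using True xs(1) by simp
        ultimately show ?thesis unfolding eq using g(1) by blast
      next
        case False
        then have eq: "run (If (Equal (at2 ''c'' (Var ''x'') (Var ''y'')) (Lit 1)) GEN Nop) ?q = ?q"
          using cond by (simp only: run.simps(4) if_False run.simps(1))
        have X': "?X (Suc k) = ?X k" unfolding X using False by (rule if_not_P)
        show ?thesis
          unfolding eq X' by (intro conjI exI[of _ xs] q'(1) xs(1) qx(1) trans[OF q'(2) xs(2)])
      qed
    qed
    moreover have "?X n = {(x, y). x \<in> {1..Suc i} \<and> c x y}"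
      using crange[of "Suc i"] i by (auto simp: le_Suc_eq)
    ultimately show "?g {(x, y). x \<in> {1..Suc i} \<and> c x y}
      (run (For ''y'' ''n'' (If (Equal (at2 ''c'' (Var ''x'') (Var ''y'')) (Lit 1)) GEN Nop)) ?r)"
      by simp
  qed
  then show ?thesis .
qed

lemma run_PASS:
  assumes s: "st fn s"
  shows "st fn (run PASS s)" "table_of (run PASS s) = E.pass [1..<Suc n] (table_of s)"
proof -
  let ?R = "\<lambda>r Tb. st fn r \<and> table_of r = Tb"
  have "?R (run PASS s) (E.pass [1..<Suc n] (table_of s))"
    unfolding PASS_def E.pass_def
  proof (rule run_For_refine[where R="?R"])
    show "s ''N'' 0 = N" using s by (rule st_size)
    show "?R (set_var s ''jj'' 0) (table_of s)" by (intro conjI st_cong[OF s]) simp_all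
  next
    fix j r Tb assume j: "j \<in> {1..N}" and r: "?R r Tb"
    define J where "J = (\<lambda>r Tb. ?R r Tb \<and> r ''jj'' 0 = j)"
    have "J (run (For ''aa'' ''n'' (For ''bb'' ''n''
     (If (Conj (Equal (at2 ''sl'' (Var ''jj'') (Var ''aa'')) (Lit 1)) (Equal (at2 ''sl'' (Var ''jj'') (Var ''bb'')) (Lit 1)))
       (PRODUCT ;; INSERT) Nop))) (set_var r ''jj'' j))
       (fold (\<lambda>a. fold (E.close_step j a) [1..<Suc n]) [1..<Suc n] Tb)"
    proof (rule run_For_refine[where R=J])
      show "set_var r ''jj'' j ''n'' 0 = n" using r st_size(1)[of fn r] by simp
      have "st fn (set_var (set_var r ''jj'' j) ''aa'' 0)" "table_of (set_var (set_var r ''jj'' j) ''aa'' 0) = table_of r"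
        by (rule st_cong[of fn r], use r in simp, simp)+
      then show "J (set_var (set_var r ''jj'' j) ''aa'' 0) Tb" using r by (simp add: J_def)
    next
      fix a q Tb assume a: "a \<in> {1..n}" and q: "J q Tb"
      define A where "A = (\<lambda>q Tb. J q Tb \<and> q ''aa'' 0 = a)"
      have "A (run (For ''bb'' ''n''
     (If (Conj (Equal (at2 ''sl'' (Var ''jj'') (Var ''aa'')) (Lit 1)) (Equal (at2 ''sl'' (Var ''jj'') (Var ''bb'')) (Lit 1)))
       (PRODUCT ;; INSERT) Nop)) (set_var q ''aa'' a)) (fold (E.close_step j a) [1..<Suc n] Tb)"
      proof (rule run_For_refine[where R=A])
        show "set_var q ''aa'' a ''n'' 0 = n" using q st_size(1)[of fn q] by (simp add: J_def)
        have "st fn (set_var (set_var q ''aa'' a) ''bb'' 0)" "table_of (set_var (set_var q ''aa'' a) ''bb'' 0) = table_of q"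
          by (rule st_cong[of fn q], use q in \<open>simp add: J_def\<close>, simp)+
        then show "A (set_var (set_var q ''aa'' a) ''bb'' 0) Tb" using q by (simp add: J_def A_def)
      next
        fix b p Tb assume b: "b \<in> {1..n}" and p: "A p Tb"
        let ?p = "set_var p ''bb'' b"
        have p': "st fn ?p" "table_of ?p = table_of p"
          by (rule st_cong[of fn p], use p in \<open>simp add: J_def A_def\<close>, simp)+
        have pT: "table_of p = Tb" and px: "?p ''jj'' 0 = j" "?p ''aa'' 0 = a" "?p ''bb'' 0 = b"
          using p by (simp_all add: J_def A_def)
        have e: "env2 ?p" and tvp: "tv Tb" using p' pT by (simp_all add: st_def)
        have jN: "j \<le> N" "a \<le> N" "b \<le> N" using j a b nN by auto
        have slot: "?p ''sl'' (j * N + k) = 1 \<longleftrightarrow> Tb (j, k) \<noteq> None" if "k \<in> {1..n}" for k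
        proof -
          have "table_of ?p (j, k) \<noteq> None \<longleftrightarrow> ?p ''sl'' (ad2 j k) = 1" using that j by (simp add: table_of_def)
          then show ?thesis using p'(2) pT by (simp add: ad2_def)
        qed
        have cond: "bval (Conj (Equal (at2 ''sl'' (Var ''jj'') (Var ''aa'')) (Lit 1)) (Equal (at2 ''sl'' (Var ''jj'') (Var ''bb'')) (Lit 1))) ?p
          \<longleftrightarrow> Tb (j, a) \<noteq> None \<and> Tb (j, b) \<noteq> None"
          using slot[OF a] slot[OF b] px env2D(3)[OF e jN(1)] by simp
        show "A (run (If (Conj (Equal (at2 ''sl'' (Var ''jj'') (Var ''aa'')) (Lit 1)) (Equal (at2 ''sl'' (Var ''jj'') (Var ''bb'')) (Lit 1)))
            (PRODUCT ;; INSERT) Nop) ?p) (E.close_step j a b Tb)"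
        proof (cases "Tb (j, a) \<noteq> None \<and> Tb (j, b) \<noteq> None")
          case False
          then have eq: "run (If (Conj (Equal (at2 ''sl'' (Var ''jj'') (Var ''aa'')) (Lit 1)) (Equal (at2 ''sl'' (Var ''jj'') (Var ''bb'')) (Lit 1)))
            (PRODUCT ;; INSERT) Nop) ?p = ?p"
            using cond by (simp only: run.simps(4) if_False run.simps(1))
          have "E.close_step j a b Tb = Tb" using False by (auto simp: E.close_step_def split: option.splits)
          then show ?thesis unfolding eq using p' pT px by (simp add: A_def J_def)
        next
          case True
          then have eq: "run (If (Conj (Equal (at2 ''sl'' (Var ''jj'') (Var ''aa'')) (Lit 1)) (Equal (at2 ''sl'' (Var ''jj'') (Var ''bb'')) (Lit 1)))
            (PRODUCT ;; INSERT) Nop) ?p = run INSERT (run PRODUCT ?p)"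
            by (simp only: run.simps(3,4) cond[THEN iffD2, OF True] if_True)
          obtain t t' where t: "Tb (j, a) = Some t" "Tb (j, b) = Some t'" using True by blast
          have tV: "t \<in> carrier E.V" "t' \<in> carrier E.V" using tvp t unfolding tv_def by blast+
          have tb: "?p ''tb'' (ad3 j a l) = t l" "?p ''tb'' (ad3 j b l) = t' l" if "l \<in> {1..N}" for l
            using fun_cong[of "table_of ?p" Tb "(j, a)"] fun_cong[of "table_of ?p" Tb "(j, b)"] p'(2) pT t that
            by (auto simp: table_of_def split: if_splits)
          define q1 where "q1 = run PRODUCT ?p"
          have fr: "q1 x = ?p x" if "x \<notin> {''l'', ''v''}" for x
            unfolding q1_def by (rule run_frame) (use that in \<open>simp add: PRODUCT_def\<close>)
          have st1: "st fn q1" "table_of q1 = Tb"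
          proof -
            have "\<forall>x\<in>{''n'', ''N'', ''row'', ''row2'', ''S'', ''T'', ''P1'', ''P2'', ''c'', ''e'', ''iv'', ''sl'', ''tb'', ''f0'', ''z''}. q1 x = ?p x"
              using fr by (simp del: fun_upd_apply)
            note same = st_cong[OF p'(1) this]
            show "st fn q1" by (rule same(1))
            show "table_of q1 = Tb" by (rule trans[OF same(2) trans[OF p'(2) pT]])
          qed
          have ttV: "t \<otimes>\<^bsub>E.V\<^esub> t' \<in> carrier E.V" using tV by simp
          have "vec q1 = (\<lambda>l\<in>{1..N}. t l \<otimes>\<^bsub>T\<^esub> t' l)"
          proof (rule run_vec[OF _ _ q1_def[unfolded PRODUCT_def]])
            show "?p ''N'' 0 = N" by (rule env2D(2)[OF e])
            fix l q assume l: "l \<in> {1..N}" and q: "agree {''l'', ''v''} ?p q" "q ''l'' 0 = l"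
            have k: "t l \<in> ker" "t' l \<in> ker" using V_range tV l by auto
            have T1: "aval (Cell ''tb'' (adr3 (Var ''jj'') (Var ''aa'') (Var ''l''))) q = t l"
              using agreeD[OF q(1)] q(2) px env2D(3)[OF e jN(2)] env2D(4)[OF e jN(1)] tb(1)[OF l] by (simp add: ad3_def)
            have T2: "aval (Cell ''tb'' (adr3 (Var ''jj'') (Var ''bb'') (Var ''l''))) q = t' l"
              using agreeD[OF q(1)] q(2) px env2D(3)[OF e jN(3)] env2D(4)[OF e jN(1)] tb(2)[OF l] by (simp add: ad3_def)
            have "q ''row'' = ?p ''row''" "q ''T'' = ?p ''T''" by (rule agreeD[OF q(1)], simp)+
            then show "aval (at2 ''T'' (Cell ''tb'' (adr3 (Var ''jj'') (Var ''aa'') (Var ''l'')))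
              (Cell ''tb'' (adr3 (Var ''jj'') (Var ''bb'') (Var ''l'')))) q = t l \<otimes>\<^bsub>T\<^esub> t' l"
              unfolding aval.simps(2)[of "''T''"] aval.simps(3)[of "Cell ''row'' _"] aval.simps(2)[of "''row''"] T1 T2
              using env2D(3)[OF e kerD(2)[OF k(1)]] env2D(5)[OF e kerD(1)[OF k(1)] kerD(1)[OF k(2)]] by simp
          qed
          also have "\<dots> = t \<otimes>\<^bsub>E.V\<^esub> t'" by (rule V_ext[OF ttV]) simp
          finally have v: "vec q1 = t \<otimes>\<^bsub>E.V\<^esub> t'" .
          note ins = run_INSERT_st[OF st1(1) v ttV refl]
          have cs: "E.close_step j a b Tb = E.insert_vec Tb (t \<otimes>\<^bsub>E.V\<^esub> t')" by (simp add: E.close_step_def t)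
          have "run INSERT q1 x = ?p x" if "x \<in> {''jj'', ''aa'', ''bb''}" for x
            using run_frame[of x INSERT q1] fr[of x] that by (auto simp: writes_INSERT)
          then show ?thesis unfolding eq q1_def[symmetric] cs using ins st1(2) px by (simp add: A_def J_def)
        qed
      qed
      then show "J (run (For ''bb'' ''n''
     (If (Conj (Equal (at2 ''sl'' (Var ''jj'') (Var ''aa'')) (Lit 1)) (Equal (at2 ''sl'' (Var ''jj'') (Var ''bb'')) (Lit 1)))
       (PRODUCT ;; INSERT) Nop)) (set_var q ''aa'' a)) (fold (E.close_step j a) [1..<Suc n] Tb)"
        by (simp add: A_def)
    qed
    then show "?R (run (For ''aa'' ''n'' (For ''bb'' ''n''
     (If (Conj (Equal (at2 ''sl'' (Var ''jj'') (Var ''aa'')) (Lit 1)) (Equal (at2 ''sl'' (Var ''jj'') (Var ''bb'')) (Lit 1)))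
       (PRODUCT ;; INSERT) Nop))) (set_var r ''jj'' j))
       (fold (\<lambda>a. fold (E.close_step j a) [1..<Suc n]) [1..<Suc n] Tb)"
      by (simp add: J_def)
  qed
  then show "st fn (run PASS s)" "table_of (run PASS s) = E.pass [1..<Suc n] (table_of s)" by auto
qed

lemma run_CLOSE:
  assumes s: "st fn s"
  shows "st fn (run CLOSE s)" "table_of (run CLOSE s) = (E.pass [1..<Suc n] ^^ (N * N)) (table_of s)"
proof -
  let ?R = "\<lambda>r Tb. st fn r \<and> table_of r = Tb" and ?f = "E.pass [1..<Suc n]"
  have step: "?R (set_var r x i) Tb" if r: "?R r Tb" "x = ''u1'' \<or> x = ''u2''" for r Tb x i
  proof -
    have "\<forall>y\<in>{''n'', ''N'', ''row'', ''row2'', ''S'', ''T'', ''P1'', ''P2'', ''c'', ''e'', ''iv'', ''sl'', ''tb'', ''f0'', ''z''}.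
      set_var r x i y = r y" using r(2) by (elim disjE) simp_all
    then show ?thesis using st_cong[of fn r] r(1) by auto
  qed
  have inner: "?R (run (For ''u2'' ''N'' PASS) r) (fold (\<lambda>_. ?f) [1..<Suc N] Tb)" if "?R r Tb" for r Tb
  proof (rule run_For_refine[where R="?R"])
    show "r ''N'' 0 = N" using that st_size(2)[of fn r] by simp
    show "?R (set_var r ''u2'' 0) Tb" using that by (intro step) auto
    fix i q Tb assume "?R q Tb"
    then have "?R (set_var q ''u2'' i) Tb" by (intro step) auto
    then show "?R (run PASS (set_var q ''u2'' i)) (?f Tb)" using run_PASS[of fn "set_var q ''u2'' i"] by auto
  qed
  have "?R (run CLOSE s) (fold (\<lambda>_. fold (\<lambda>_. ?f) [1..<Suc N]) [1..<Suc N] (table_of s))"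
    unfolding CLOSE_def
  proof (rule run_For_refine[where R="?R"])
    show "s ''N'' 0 = N" using s by (rule st_size)
    show "?R (set_var s ''u1'' 0) (table_of s)" using s by (intro step) auto
    fix i q Tb assume "?R q Tb"
    then have "?R (set_var q ''u1'' i) Tb" by (intro step) auto
    then show "?R (run (For ''u2'' ''N'' PASS) (set_var q ''u1'' i)) (fold (\<lambda>_. ?f) [1..<Suc N] Tb)" by (rule inner)
  qed
  moreover have "fold (\<lambda>_. fold (\<lambda>_. ?f) [1..<Suc N]) [1..<Suc N] = ?f ^^ (N * N)"
    by (simp add: fold_const funpow_mult)
  ultimately show "st fn (run CLOSE s)" "table_of (run CLOSE s) = (?f ^^ (N * N)) (table_of s)" by auto
qed

text \<open>
  Each stage of the program computes what \<open>membership\<close> and \<open>solvable_iff\<close> speak about: the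
  initial table, the defect of \<open>f0\<close>, the generators, the closure and the final insertion.
\<close>

theorem run_EXT:
  assumes env: "env s" and s': "s' = run EXT s"
  shows "s' ''ok'' 0 = (if \<exists>f\<in>homs. \<forall>g\<in>carrier S. c g (f g) then 1 else 0)"
proof -
  define s1 where "s1 = run SELECT (run INVERSES (run IDENTITY s))"
  define body where "body = (CLEAR ;; DEFECT ''f0'' ;; SAVEZ ;; GENS ;; CLOSE ;; TESTZ)"
  have s'1: "s' = (if s1 ''ok'' 0 = 1 then run body s1 else s1)"
    unfolding s' EXT_def s1_def body_def by (simp only: run.simps(1,3,4) bval.simps aval.simps)
  note i1 = run_IDENTITY[OF env refl]
  note i2 = run_INVERSES[OF i1 refl]
  note sel = run_SELECT[OF i2 refl, folded s1_def]
  show ?thesis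
  proof (cases "\<forall>g\<in>{1..n}. \<exists>h. c g h")
    case False
    then have "\<not> (\<exists>f\<in>homs. \<forall>g\<in>carrier S. c g (f g))" using carS by blast
    moreover have "s' ''ok'' 0 = 0" using sel(2) False s'1 by simp
    ultimately show ?thesis by simp
  next
    case True
    define fn where "fn = s1 ''f0''"
    have fn: "fn \<in> sel" using sel(3)[OF True] by (simp add: fn_def)
    have dV: "defect fn \<in> carrier E.V" using fn by (rule defect_V)
    have ok1: "s1 ''ok'' 0 = 1" using sel(2) True by simp
    define s2 where "s2 = run CLEAR s1"
    define s3 where "s3 = run (DEFECT ''f0'') s2"
    define s4 where "s4 = run SAVEZ s3"
    define s5 where "s5 = run GENS s4"
    define s6 where "s6 = run CLOSE s5"
    have s'6: "s' = run TESTZ s6"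
      using s'1 ok1 unfolding body_def s6_def s5_def s4_def s3_def s2_def by (simp only: run.simps(3) if_True refl)
    note cl = run_CLEAR[OF sel(1) s2_def]
    have fr2: "s2 x = s1 x" if "x \<notin> {''j'', ''a1'', ''sl'', ''l'', ''tb''}" for x
      unfolding s2_def by (rule run_frame) (use that in \<open>simp add: CLEAR_def\<close>)
    have fr3: "s3 x = s2 x" if "x \<notin> {''l'', ''v''}" for x
      unfolding s3_def by (rule run_frame) (use that in \<open>simp add: writes_DEFECT\<close>)
    have fr4: "s4 x = s3 x" if "x \<notin> {''l'', ''z''}" for x
      unfolding s4_def by (rule run_frame) (use that in \<open>simp add: SAVEZ_def\<close>)
    have fr5: "s5 x = s4 x" if "x \<notin> {''x'', ''y''} \<union> writes GEN" for x
      unfolding s5_def by (rule run_frame) (use that in \<open>simp add: GENS_def\<close>)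
    have fr6: "s6 x = s5 x" if "x \<notin> writes CLOSE" for x
      unfolding s6_def by (rule run_frame) (use that in simp)
    have e3: "env2 s3" using cl(1) by (subst env2_cong[of _ s2]) (simp_all add: fr3)
    have v3: "vec s3 = defect fn"
      by (rule run_DEFECT[OF cl(1) _ _ _ fn s3_def]) (simp_all add: fr2 fn_def)
    have z4: "s4 ''z'' l = defect fn l" if l: "l \<in> {1..N}" for l
    proof -
      have E: "aval (Cell ''v'' (Var ''l'')) r = vec s3 i"
        if "i \<in> {1..N}" "agree {''l'', ''z''} s3 r" "r ''l'' 0 = i" "r ''z'' i = s3 ''z'' i" for i r
        using that(1,3) agreeD[OF that(2)] by (simp add: vec_def)
      have "s4 ''z'' l = vec s3 l"
        unfolding s4_def SAVEZ_def
        by (rule run_fill(1)[where s=s3 and m=N and A="\<lambda>i. i" and E="vec s3"])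
          (rule env2D(2)[OF e3], simp, simp, fact E, simp, fact l)
      then show ?thesis by (simp add: v3)
    qed
    have e4: "env2 s4" using e3 by (subst env2_cong[of _ s3]) (simp_all add: fr4)
    have t4: "table_of s4 = E.trivial_table"
      using cl(2) table_of_cong[of s4 s2] fr3 fr4 by simp
    have "tv E.trivial_table"
      using E.V.one_closed subgroup.one_closed[OF subgroup_ker]
      by (auto simp: tv_def E.trivial_table_def split: if_splits)
    then have st4: "st fn s4" using e4 t4 z4 fr2 fr3 fr4 by (simp add: st_def fn_def)
    from run_GENS[OF st4 fn s5_def] obtain xs where
      xs: "set xs = {(x, y). x \<in> {1..n} \<and> c x y}" and st5: "st fn s5"
      and t5: "table_of s5 = fold (\<lambda>x T. E.insert_vec T (w fn x)) xs E.trivial_table" using t4 by auto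
    note cl6 = run_CLOSE[OF st5, folded s6_def]
    define s7 where "s7 = run (For ''l'' ''N'' (Do ''v'' (Var ''l'') (Cell ''z'' (Var ''l'')))) s6"
    define s8 where "s8 = run (Do ''added'' (Lit 0) (Lit 0)) s7"
    define s9 where "s9 = run INSERT s8"
    have s'9: "s' = (if s9 ''added'' 0 = 1 then set_var s9 ''ok'' 0 else s9)"
      unfolding s'6 TESTZ_def s9_def s8_def s7_def by (simp only: run.simps(1,2,3,4) bval.simps aval.simps)
    have fr7: "s7 x = s6 x" if "x \<notin> {''l'', ''v''}" for x
      unfolding s7_def by (rule run_frame) (use that in simp)
    have e6: "env2 s6" using cl6(1) by (simp add: st_def)
    have v7: "vec s7 = (\<lambda>l\<in>{1..N}. defect fn l)"
    proof (rule run_vec[OF _ _ s7_def])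
      show "s6 ''N'' 0 = N" by (rule env2D(2)[OF e6])
      fix l r assume l: "l \<in> {1..N}" and r: "agree {''l'', ''v''} s6 r" "r ''l'' 0 = l"
      have "s6 ''z'' l = defect fn l" using cl6(1) l by (simp add: st_def)
      then show "aval (Cell ''z'' (Var ''l'')) r = defect fn l" using agreeD[OF r(1)] r(2) by simp
    qed
    have v8: "vec s8 = defect fn"
      using v7 V_ext[OF dV, of "defect fn"] vec_cong[of s8 s7] by (simp add: s8_def)
    have st8: "st fn s8" "table_of s8 = table_of s6"
      by (rule st_cong[OF cl6(1)], simp add: s8_def fr7)+
    have a8: "s8 ''added'' 0 = 0" by (simp add: s8_def)
    have e8: "env2 s8" "tv (table_of s8)" "vec s8 \<in> carrier E.V" using st8 v8 dV by (simp_all add: st_def)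
    have added: "s9 ''added'' 0 = (if E.insert_vec (table_of s6) (defect fn) = table_of s6 then 0 else 1)"
      using run_INSERT(2,4)[OF e8 s9_def] st8(2) v8 a8 by simp
    have w: "w fn (x, y) = defect (fn(x := y)) \<otimes>\<^bsub>E.V\<^esub> inv\<^bsub>E.V\<^esub> defect fn" for x y by (simp add: w_def)
    have gens: "w fn p \<in> carrier E.V" if "p \<in> set xs" for p
    proof -
      obtain x y where p: "p = (x, y)" by (cases p)
      then have "c x y" using that xs by simp
      then have "defect (fn(x := y)) \<in> carrier E.V" using fn by (intro defect_V sel_upd)
      then show ?thesis using dV by (simp add: p w)
    qed
    have "ker \<subseteq> {1..n}" using kerD(1) by blast
    then have "card ker \<le> N" using card_mono[of "{1..n}" ker] nN by simp
    then have m: "N * card (carrier K) \<le> N * N" by simp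
    have es: "carrier K \<subseteq> set [1..<Suc n]" using \<open>ker \<subseteq> {1..n}\<close> by auto
    have mem: "E.insert_vec (table_of s6) (defect fn) = table_of s6 \<longleftrightarrow> defect fn \<in> generate E.V (w fn ` set xs)"
      by (rule E.membership[OF N1 es m gens dV]) (simp_all add: cl6(2) t5)
    have "set xs = {(x, y). x \<in> carrier S \<and> c x y}" using xs carS by simp
    from solvable_iff[OF fn w this] mem added
    have "s9 ''added'' 0 = (if \<exists>f\<in>homs. \<forall>g\<in>carrier S. c g (f g) then 0 else 1)" by simp
    moreover have "s9 ''ok'' = s1 ''ok''"
    proof -
      have "s9 ''ok'' = s8 ''ok''" unfolding s9_def by (rule run_frame) (simp add: writes_INSERT)
      also have "\<dots> = s6 ''ok''" by (simp add: s8_def fr7)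
      also have "\<dots> = s1 ''ok''" by (simp add: fr6 fr5 fr4 fr3 fr2 writes_CLOSE writes_GEN)
      finally show ?thesis .
    qed
    ultimately show ?thesis using s'9 ok1 by simp
  qed
qed

end

section \<open>Completing a partial map to an isomorphism\<close>

text \<open>In truncated arithmetic this is 1 if the arguments are equal and 0 otherwise.\<close>

abbreviation eqE :: "aexp \<Rightarrow> aexp \<Rightarrow> aexp" where
  "eqE x y \<equiv> Sub (Lit 1) (Add (Sub x y) (Sub y x))"

text \<open>
  If \<open>e\<close> is 0 or 1, the stored value is their conjunction as numbers \<open>x + y - 1\<close>. The second
  number \<open>1 - ((1 - a) - b)\<close> is the disjunction of \<open>a\<close> for \<open>F g = 0\<close>, undefined, and \<open>b\<close> for
  \<open>F g = h\<close>.
\<close>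

definition ROWSET :: "string \<Rightarrow> aexp \<Rightarrow> prog" where
  "ROWSET F e = For ''a1'' ''n'' (For ''b1'' ''n'' (Do ''c'' (adr2 (Var ''a1'') (Var ''b1''))
     (Sub (Add e (Sub (Lit 1) (Sub (Sub (Lit 1) (eqE (Cell F (Var ''a1'')) (Lit 0))) (eqE (Cell F (Var ''a1'')) (Var ''b1''))))) (Lit 1))))"

definition COPY :: "string \<Rightarrow> string \<Rightarrow> prog" where
  "COPY X Y = For ''a1'' ''n'' (For ''b1'' ''n'' (Do X (adr2 (Var ''a1'') (Var ''b1'')) (at2 Y (Var ''a1'') (Var ''b1''))))"

text \<open>One direction of the two-sided test: a homomorphism over \<open>e\<close> that extends \<open>F\<close>.\<close>

definition HALF :: "string \<Rightarrow> string \<Rightarrow> string \<Rightarrow> aexp \<Rightarrow> prog" where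
  "HALF X Y F e = COPY ''S'' X ;; COPY ''T'' Y ;; ROWSET F e ;; EXT"

text \<open>If several elements have the same image under \<open>F\<close>, then one of them is chosen as its preimage.\<close>

definition INVERT :: prog where
  "INVERT = For ''a1'' ''n'' (Do ''Fi'' (Var ''a1'') (Lit 0)) ;;
     For ''a1'' ''n'' (For ''b1'' ''n'' (If (Equal (Cell ''F'' (Var ''b1'')) (Var ''a1'')) (Do ''Fi'' (Var ''a1'') (Var ''b1'')) Nop))"

text \<open>
  After the two directions it is checked that \<open>Fi\<close> really inverts \<open>F\<close>, which fails iff \<open>F\<close> is
  not injective where it is defined.
\<close>

definition TEST :: prog where
  "TEST = HALF ''mG'' ''mH'' ''F'' (at2 ''cp'' (Var ''a1'') (Var ''b1'')) ;; Do ''ok1'' (Lit 0) (Var ''ok'') ;;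
     INVERT ;; HALF ''mH'' ''mG'' ''Fi'' (at2 ''cp'' (Var ''b1'') (Var ''a1'')) ;;
     For ''a1'' ''n'' (If (Conj (Neg (Equal (Cell ''F'' (Var ''a1'')) (Lit 0)))
         (Neg (Equal (Cell ''Fi'' (Cell ''F'' (Var ''a1''))) (Var ''a1'')))) (Do ''ok'' (Lit 0) (Lit 0)) Nop) ;;
     If (Equal (Var ''ok1'') (Lit 1)) Nop (Do ''ok'' (Lit 0) (Lit 0))"

definition TRY :: prog where
  "TRY = Do ''F'' (Var ''ci'') (Var ''ch'') ;; TEST ;; If (Equal (Var ''ok'') (Lit 1)) Nop (Do ''F'' (Var ''ci'') (Lit 0))"

text \<open>
  The greedy search. The last test and the check for undefined values detect that it started
  from a map that does not extend to an isomorphism.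
\<close>

definition COMPLETE :: prog where
  "COMPLETE = For ''ci'' ''n'' (For ''ch'' ''n'' (If (Equal (Cell ''F'' (Var ''ci'')) (Lit 0)) TRY Nop)) ;;
     TEST ;; Do ''res'' (Lit 0) (Var ''ok'') ;;
     For ''ci'' ''n'' (If (Equal (Cell ''F'' (Var ''ci'')) (Lit 0)) (Do ''res'' (Lit 0) (Lit 0)) Nop)"

abbreviation core_names :: "string set" where
  "core_names \<equiv> {''a1'', ''b1'', ''e'', ''iv'', ''f0'', ''ok'', ''j'', ''sl'', ''l'', ''tb'', ''v'', ''z'', ''x'', ''y'',
     ''g'', ''f1'', ''a'', ''added'', ''u1'', ''u2'', ''jj'', ''aa'', ''bb''}"

lemma writes_EXT: "writes EXT = core_names"
  by (auto simp: EXT_def IDENTITY_def INVERSES_def SELECT_def CLEAR_def writes_DEFECT SAVEZ_def GENS_def writes_GEN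
      writes_CLOSE TESTZ_def writes_INSERT)

lemma writes_HALF: "writes (HALF X Y F e) = core_names \<union> {''S'', ''T'', ''c''}"
  by (auto simp: HALF_def COPY_def ROWSET_def writes_EXT)

lemma writes_INVERT: "writes INVERT = {''a1'', ''b1'', ''Fi''}"
  by (auto simp: INVERT_def)

lemma writes_TEST: "writes TEST = core_names \<union> {''S'', ''T'', ''c'', ''ok1'', ''Fi''}"
  by (auto simp: TEST_def writes_HALF writes_INVERT)

lemma writes_TRY: "writes TRY = core_names \<union> {''S'', ''T'', ''c'', ''ok1'', ''Fi'', ''F''}"
  by (auto simp: TRY_def writes_TEST)

lemma writes_COMPLETE: "writes COMPLETE = core_names \<union> {''S'', ''T'', ''c'', ''ok1'', ''Fi'', ''F'', ''res'', ''ci'', ''ch''}"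
  by (auto simp: COMPLETE_def writes_TEST writes_TRY)

context grid
begin

lemma run_COPY:
  assumes s: "ready s" and Y: "tab s Y G" "Y \<notin> {''a1'', ''b1'', X}" and X: "X \<notin> {''a1'', ''b1'', ''row'', ''n''}"
    and s': "s' = run (COPY X Y) s"
  shows "tab s' X G"
proof -
  have n: "s ''n'' 0 = n" by (rule readyD(1)[OF s])
  have A: "aval (adr2 (Var ''a1'') (Var ''b1'')) r = ad2 i k"
    if "i \<in> {1..n}" "k \<in> {1..n}" "agree {''a1'', ''b1'', X} s r" "r ''a1'' 0 = i" "r ''b1'' 0 = k" for i k r
  proof -
    have "r ''row'' = s ''row''" by (rule agreeD[OF that(3)]) (use X in auto)
    then show ?thesis using that(1,4,5) readyD(3)[OF s, of i] nN by (simp add: ad2_def)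
  qed
  have E: "aval (at2 Y (Var ''a1'') (Var ''b1'')) r = i \<otimes>\<^bsub>G\<^esub> k"
    if "i \<in> {1..n}" "k \<in> {1..n}" "agree {''a1'', ''b1'', X} s r" "r ''a1'' 0 = i" "r ''b1'' 0 = k"
      "r X (ad2 i k) = s X (ad2 i k)" for i k r
    using A[OF that(1-5)] agreeD[OF that(3) Y(2)] Y(1) that(1,2) by (simp add: tab_def)
  have inj: "i = i' \<and> k = k'"
    if "i \<in> {1..n}" "k \<in> {1..n}" "i' \<in> {1..n}" "k' \<in> {1..n}" "ad2 i k = ad2 i' k'" for i i' k k'
    using ad2_inj[of i k i' k'] that nN by auto
  have Xn: "''a1'' \<noteq> X" "''b1'' \<noteq> X" "''n'' \<noteq> X" using X by auto
  have "s' X (ad2 i k) = i \<otimes>\<^bsub>G\<^esub> k" if "i \<in> {1..n}" "k \<in> {1..n}" for i k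
    unfolding s' COPY_def
    by (rule run_fill2(1)[where A=ad2 and E="\<lambda>i k. i \<otimes>\<^bsub>G\<^esub> k" and m=n and m'=n])
      (fact n, fact n, fact Xn, fact Xn, simp, simp, fact Xn, simp, fact A, fact E, fact inj, fact that, fact that)
  then show ?thesis by (simp add: tab_def)
qed

end

locale half = grid n N + fibre G H C
  for n N and G :: "nat monoid" and H :: "nat monoid" and C +
  fixes P1 P2 :: "nat \<Rightarrow> nat"
  assumes carG: "carrier G = {1..n}" and carH: "carrier H = {1..n}"
    and P12: "\<And>j. j \<in> {1..N} \<Longrightarrow> P1 j \<in> {1..n} \<and> P2 j \<in> {1..n}"
    and P12_surj: "\<lbrakk>g \<in> {1..n}; g' \<in> {1..n}\<rbrakk> \<Longrightarrow> \<exists>j\<in>{1..N}. P1 j = g \<and> P2 j = g'"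
begin

definition rows :: "(nat \<Rightarrow> nat) \<Rightarrow> nat \<Rightarrow> nat \<Rightarrow> bool" where
  "rows F g h \<longleftrightarrow> h \<in> {1..n} \<and> C g h \<and> (F g = 0 \<or> F g = h)"

text \<open>The elements compatible with \<open>g\<close> form a coset, because \<open>g g\<inverse> g = g\<close>.\<close>

lemma C_heap:
  assumes "g \<in> carrier G" "x \<in> carrier H" "y \<in> carrier H" "z \<in> carrier H" "C g x" "C g y" "C g z"
  shows "C g (x \<otimes>\<^bsub>H\<^esub> inv\<^bsub>H\<^esub> y \<otimes>\<^bsub>H\<^esub> z)"
proof -
  have "C (g \<otimes>\<^bsub>G\<^esub> inv\<^bsub>G\<^esub> g \<otimes>\<^bsub>G\<^esub> g) (x \<otimes>\<^bsub>H\<^esub> inv\<^bsub>H\<^esub> y \<otimes>\<^bsub>H\<^esub> z)"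
    using assms by (intro C_mult C_inv) auto
  then show ?thesis using assms by simp
qed

lemma ext_rows: "ext n N G H C (rows F) P1 P2"
proof unfold_locales
  show "finite (carrier G)" "finite (carrier H)" "carrier G = {1..n}" "carrier H = {1..n}" by (simp_all add: carG carH)
  show "h \<in> carrier H \<and> C g h" if "g \<in> carrier G" "rows F g h" for g h using that by (simp add: rows_def carH)
  show "P1 j \<in> carrier G \<and> P2 j \<in> carrier G" if "j \<in> {1..N}" for j using P12[OF that] by (simp add: carG)
  show "\<exists>j\<in>{1..N}. P1 j = g \<and> P2 j = g'" if "g \<in> carrier G" "g' \<in> carrier G" for g g'
    using that P12_surj by (simp add: carG)
  fix g x y z assume a: "g \<in> carrier G" "rows F g x" "rows F g y" "rows F g z"
  then have xyz: "x \<in> carrier H" "y \<in> carrier H" "z \<in> carrier H" "C g x" "C g y" "C g z" by (auto simp: rows_def carH)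
  have "C g (x \<otimes>\<^bsub>H\<^esub> inv\<^bsub>H\<^esub> y \<otimes>\<^bsub>H\<^esub> z)" by (rule C_heap[OF a(1) xyz])
  moreover have "x \<otimes>\<^bsub>H\<^esub> inv\<^bsub>H\<^esub> y \<otimes>\<^bsub>H\<^esub> z \<in> {1..n}" using xyz H.m_closed H.inv_closed unfolding carH[symmetric] by blast
  moreover have "F g = x \<otimes>\<^bsub>H\<^esub> inv\<^bsub>H\<^esub> y \<otimes>\<^bsub>H\<^esub> z" if "F g \<noteq> 0"
    using a that xyz by (auto simp: rows_def)
  ultimately show "rows F g (x \<otimes>\<^bsub>H\<^esub> inv\<^bsub>H\<^esub> y \<otimes>\<^bsub>H\<^esub> z)" by (auto simp: rows_def)
qed

lemma run_HALF:
  assumes s: "ready s" and X: "tab s X G" "X \<in> {''mG'', ''mH''}" and Y: "tab s Y H" "Y \<in> {''mG'', ''mH''}"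
    and F: "F \<in> {''F'', ''Fi''}" and P: "\<And>j. j \<in> {1..N} \<Longrightarrow> s ''P1'' j = P1 j \<and> s ''P2'' j = P2 j"
    and e: "\<And>r i k. \<lbrakk>i \<in> {1..n}; k \<in> {1..n}; r ''row'' = s ''row''; r ''cp'' = s ''cp''; r ''a1'' 0 = i; r ''b1'' 0 = k\<rbrakk>
      \<Longrightarrow> aval e r = (if C i k then 1 else 0)"
    and s': "s' = run (HALF X Y F e) s"
  shows "s' ''ok'' 0 = (if \<exists>f\<in>homs. \<forall>g\<in>{1..n}. s F g \<noteq> 0 \<longrightarrow> f g = s F g then 1 else 0)"
proof -
  interpret E: ext n N G H C "rows (s F)" P1 P2 by (rule ext_rows)
  define s1 where "s1 = run (COPY ''S'' X) s"
  define s2 where "s2 = run (COPY ''T'' Y) s1"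
  define s3 where "s3 = run (ROWSET F e) s2"
  have s'3: "s' = run EXT s3" unfolding s' HALF_def s3_def s2_def s1_def by (simp only: run.simps(3))
  have fr1: "s1 x = s x" if "x \<notin> {''a1'', ''b1'', ''S''}" for x
    unfolding s1_def by (rule run_frame) (use that in \<open>simp add: COPY_def\<close>)
  have fr2: "s2 x = s1 x" if "x \<notin> {''a1'', ''b1'', ''T''}" for x
    unfolding s2_def by (rule run_frame) (use that in \<open>simp add: COPY_def\<close>)
  have fr3: "s3 x = s2 x" if "x \<notin> {''a1'', ''b1'', ''c''}" for x
    unfolding s3_def by (rule run_frame) (use that in \<open>simp add: ROWSET_def\<close>)
  have tS: "tab s1 ''S'' G" by (rule run_COPY[OF s X(1) _ _ s1_def]) (use X in auto)
  have r1: "ready s1" using s by (subst ready_cong[of _ s]) (simp_all add: fr1)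
  have Y1: "tab s1 Y H" using Y fr1[of Y] by (auto simp: tab_def)
  have tT: "tab s2 ''T'' H" by (rule run_COPY[OF r1 Y1 _ _ s2_def]) (use Y in auto)
  have r2: "ready s2" using r1 by (subst ready_cong[of _ s1]) (simp_all add: fr2)
  have r3: "ready s3" using r2 by (subst ready_cong[of _ s2]) (simp_all add: fr3)
  have F2: "s2 F = s F" using F fr1[of F] fr2[of F] by auto
  have A: "aval (adr2 (Var ''a1'') (Var ''b1'')) r = ad2 i k"
    if "i \<in> {1..n}" "k \<in> {1..n}" "agree {''a1'', ''b1'', ''c''} s2 r" "r ''a1'' 0 = i" "r ''b1'' 0 = k" for i k r
    using that(1,4,5) agreeD[OF that(3), of "''row''"] readyD(3)[OF r2, of i] nN by (simp add: ad2_def)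
  have Ev: "aval (Sub (Add e (Sub (Lit 1) (Sub (Sub (Lit 1) (eqE (Cell F (Var ''a1'')) (Lit 0))) (eqE (Cell F (Var ''a1'')) (Var ''b1''))))) (Lit 1)) r
      = (if rows (s F) i k then 1 else 0)"
    if "i \<in> {1..n}" "k \<in> {1..n}" "agree {''a1'', ''b1'', ''c''} s2 r" "r ''a1'' 0 = i" "r ''b1'' 0 = k"
      "r ''c'' (ad2 i k) = s2 ''c'' (ad2 i k)" for i k r
  proof -
    have e': "aval e r = (if C i k then 1 else 0)"
      using that(1,2,4,5) agreeD[OF that(3)] fr1 fr2 by (intro e) simp_all
    have "r F = s F" using agreeD[OF that(3), of F] F F2 by auto
    then show ?thesis using e' that(1,2,4,5) by (auto simp: rows_def)
  qed
  have inj: "i = i' \<and> k = k'"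
    if "i \<in> {1..n}" "k \<in> {1..n}" "i' \<in> {1..n}" "k' \<in> {1..n}" "ad2 i k = ad2 i' k'" for i i' k k'
    using ad2_inj[of i k i' k'] that nN by auto
  have n2: "s2 ''n'' 0 = n" by (rule readyD(1)[OF r2])
  have c3: "s3 ''c'' (ad2 i k) = (if rows (s F) i k then 1 else 0)" if "i \<in> {1..n}" "k \<in> {1..n}" for i k
    unfolding s3_def ROWSET_def
    by (rule run_fill2(1)[where A=ad2 and E="\<lambda>i k. if rows (s F) i k then 1 else 0" and m=n and m'=n])
      (fact n2, fact n2, simp, simp, simp, simp, simp, simp, fact A, fact Ev, fact inj, fact that, fact that)
  have "E.env s3"
    unfolding E.env_def
  proof (intro conjI ballI)
    show "ready s3" by fact
    show "tab s3 ''S'' G" using tS fr2[of "''S''"] fr3[of "''S''"] by (simp add: tab_def)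
    show "tab s3 ''T'' H" using tT fr3[of "''T''"] by (simp add: tab_def)
    show "s3 ''P1'' j = P1 j" "s3 ''P2'' j = P2 j" if "j \<in> {1..N}" for j using P[OF that] fr1 fr2 fr3 by simp_all
    show "(s3 ''c'' (ad2 g h) = 1) = rows (s F) g h" if "g \<in> {1..n}" "h \<in> {1..n}" for g h using c3[OF that] by simp
  qed
  from E.run_EXT[OF this s'3]
  have "s' ''ok'' 0 = (if \<exists>f\<in>homs. \<forall>g\<in>{1..n}. rows (s F) g (f g) then 1 else 0)" by (simp add: carG)
  moreover have "(\<forall>g\<in>{1..n}. rows (s F) g (f g)) \<longleftrightarrow> (\<forall>g\<in>{1..n}. s F g \<noteq> 0 \<longrightarrow> f g = s F g)" if "f \<in> homs" for f
    using homsD(1,2)[OF that] by (auto simp: rows_def carG carH)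
  ultimately show ?thesis by (metis (no_types, lifting))
qed

end

locale matching = A: half n N G H C P1 P2 + B: half n N H G "\<lambda>h g. C g h" P1 P2
  for n N and G :: "nat monoid" and H :: "nat monoid" and C P1 P2
begin

definition menv :: "state \<Rightarrow> bool" where
  "menv s \<longleftrightarrow> A.ready s \<and> A.tab s ''mG'' G \<and> A.tab s ''mH'' H \<and>
     (\<forall>j\<in>{1..N}. s ''P1'' j = P1 j \<and> s ''P2'' j = P2 j) \<and>
     (\<forall>g\<in>{1..n}. \<forall>h\<in>{1..n}. s ''cp'' (A.ad2 g h) = (if C g h then 1 else 0))"

lemma menv_cong:
  "\<forall>x\<in>{''n'', ''N'', ''row'', ''row2'', ''mG'', ''mH'', ''P1'', ''P2'', ''cp''}. s' x = s x \<Longrightarrow> menv s' = menv s"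
  using A.ready_cong[of s' s] by (simp add: menv_def A.tab_def)

definition extends :: "(nat \<Rightarrow> nat) \<Rightarrow> (nat \<Rightarrow> nat) \<Rightarrow> bool" where
  "extends f F \<longleftrightarrow> (\<forall>g\<in>{1..n}. F g \<noteq> 0 \<longrightarrow> f g = F g)"

text \<open>The condition of \<open>extension\<close>, for the partial map that is undefined where \<open>F\<close> has the value 0.\<close>

definition two_sided :: "(nat \<Rightarrow> nat) \<Rightarrow> bool" where
  "two_sided F \<longleftrightarrow> (\<exists>f\<in>A.homs. extends f F) \<and> (\<exists>f\<in>B.homs. \<forall>g\<in>{1..n}. F g \<noteq> 0 \<longrightarrow> f (F g) = g)"

definition extendible :: "(nat \<Rightarrow> nat) \<Rightarrow> bool" where
  "extendible F \<longleftrightarrow> (\<exists>\<Phi>\<in>iso_over G H C. extends \<Phi> F)"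

lemma extendible_imp_two_sided:
  assumes "extendible F"
  shows "two_sided F"
proof -
  obtain \<Phi> where P: "\<Phi> \<in> iso G H" "\<And>g. g \<in> {1..n} \<Longrightarrow> C g (\<Phi> g)" "extends \<Phi> F"
    using assms by (auto simp: extendible_def iso_over_def A.carG)
  have hom: "\<Phi> \<in> A.homs" using P by (auto simp: A.homs_def iso_def A.carG)
  define \<Psi> where "\<Psi> = inv_into (carrier G) \<Phi>"
  have iso: "\<Psi> \<in> iso H G" unfolding \<Psi>_def by (rule A.G.iso_set_sym[OF P(1)])
  have inj: "inj_on \<Phi> (carrier G)" and onto: "\<Phi> ` carrier G = carrier H" using P(1) by (auto simp: iso_def bij_betw_def)
  have "C (\<Psi> h) h" if "h \<in> carrier H" for h
  proof -
    have "\<Psi> h \<in> carrier G" "\<Phi> (\<Psi> h) = h" using that onto unfolding \<Psi>_def by (auto simp: inv_into_into f_inv_into_f)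
    then show ?thesis using P(2)[of "\<Psi> h"] by (simp add: A.carG)
  qed
  then have "\<Psi> \<in> B.homs" using iso by (auto simp: B.homs_def iso_def)
  moreover have "\<forall>g\<in>{1..n}. F g \<noteq> 0 \<longrightarrow> \<Psi> (F g) = g"
  proof (intro ballI impI)
    fix g assume g: "g \<in> {1..n}" "F g \<noteq> 0"
    then have "F g = \<Phi> g" using P(3) by (simp add: extends_def)
    then show "\<Psi> (F g) = g" unfolding \<Psi>_def using inv_into_f_f[OF inj, of g] g by (simp add: A.carG)
  qed
  ultimately show ?thesis unfolding two_sided_def using hom P(3) by blast
qed

lemma two_sided_imp_extendible:
  assumes "two_sided F" "iso_over G H C \<noteq> {}"
  shows "extendible F"
proof -
  obtain f f' where f: "f \<in> A.homs" "extends f F" "f' \<in> B.homs" "\<And>g. g \<in> {1..n} \<Longrightarrow> F g \<noteq> 0 \<Longrightarrow> f' (F g) = g"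
    using assms(1) by (auto simp: two_sided_def)
  have "\<exists>\<Phi>\<in>iso_over G H C. \<forall>d\<in>{g\<in>{1..n}. F g \<noteq> 0}. \<Phi> d = F d"
    by (rule extension[OF A.fibre_axioms B.fibre_axioms _ _ assms(2) _ f(1) _ f(3)])
      (use f in \<open>auto simp: A.carG A.carH extends_def\<close>)
  then obtain \<Phi> where "\<Phi> \<in> iso_over G H C" "\<forall>d\<in>{g\<in>{1..n}. F g \<noteq> 0}. \<Phi> d = F d" by (rule bexE)
  then have "\<Phi> \<in> iso_over G H C" "extends \<Phi> F" by (simp_all add: extends_def)
  then show ?thesis unfolding extendible_def by blast
qed

text \<open>
  Here an isomorphism is produced rather than presupposed: a total \<open>F\<close> is itself a homomorphism,
  and it has a left inverse. So the search cannot produce a false solution.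
\<close>

lemma two_sided_total:
  assumes "two_sided F" "\<And>g. g \<in> {1..n} \<Longrightarrow> F g \<noteq> 0"
  shows "extendible F"
proof -
  obtain f f' where f: "f \<in> A.homs" "extends f F" "f' \<in> B.homs" "\<And>g. g \<in> {1..n} \<Longrightarrow> f' (F g) = g"
    using assms by (auto simp: two_sided_def)
  have fF: "f g = F g" if "g \<in> {1..n}" for g using f(2) assms(2) that by (auto simp: extends_def)
  have "inj_on f {1..n}" by (rule inj_on_inverseI[of _ f']) (simp add: fF f(4))
  moreover have "f ` {1..n} \<subseteq> {1..n}" using A.homsD(1)[OF f(1)] by (auto simp: A.carG A.carH)
  ultimately have "bij_betw f {1..n} {1..n}" by (simp add: bij_betw_def endo_inj_surj)
  then have "f \<in> iso_over G H C"
    using f(1) by (auto simp: iso_over_def A.homs_def iso_def A.carG A.carH)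
  then show ?thesis using f(2) by (auto simp: extendible_def)
qed

lemma run_INVERT:
  assumes s: "menv s" and F: "\<And>g. g \<in> {1..n} \<Longrightarrow> s ''F'' g \<le> n" and s': "s' = run INVERT s" and h: "h \<in> {1..n}"
  shows "if \<exists>g\<in>{1..n}. s ''F'' g = h then s' ''Fi'' h \<in> {1..n} \<and> s ''F'' (s' ''Fi'' h) = h else s' ''Fi'' h = 0"
proof -
  define s1 where "s1 = run (For ''a1'' ''n'' (Do ''Fi'' (Var ''a1'') (Lit 0))) s"
  have s'1: "s' = run (For ''a1'' ''n'' (For ''b1'' ''n'' (If (Equal (Cell ''F'' (Var ''b1'')) (Var ''a1'')) (Do ''Fi'' (Var ''a1'') (Var ''b1'')) Nop))) s1"
    unfolding s' INVERT_def s1_def by (simp only: run.simps(3))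
  have fr1: "s1 x = s x" if "x \<notin> {''a1'', ''Fi''}" for x
    unfolding s1_def by (rule run_frame) (use that in simp)
  have n: "s ''n'' 0 = n" using s by (simp add: menv_def A.ready_def)
  have n1: "s1 ''n'' 0 = n" using n fr1 by simp
  have 0: "s1 ''Fi'' h = 0"
    unfolding s1_def by (rule run_fill(1)[where A="\<lambda>i. i" and E="\<lambda>_. 0" and m=n]) (fact n, simp, simp, simp, simp, fact h)
  have C: "bval (Equal (Cell ''F'' (Var ''b1'')) (Var ''a1'')) r \<longleftrightarrow> s ''F'' k = i"
    if "i \<in> {1..n}" "k \<in> {1..n}" "agree {''a1'', ''b1'', ''Fi''} s1 r" "r ''a1'' 0 = i" "r ''b1'' 0 = k" for i k r
    using that(4,5) agreeD[OF that(3)] fr1 by simp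
  show ?thesis
  proof (cases "\<exists>g\<in>{1..n}. s ''F'' g = h")
    case True
    have "s' ''Fi'' h \<in> {1..n} \<and> s ''F'' (s' ''Fi'' h) = h"
      by (rule run_search2(1)[where s=s1 and b="''n''" and b'="''n''" and x="''a1''" and y="''b1''" and X="''Fi''"
        and P="\<lambda>i k. s ''F'' k = i" and m=n and d="Equal (Cell ''F'' (Var ''b1'')) (Var ''a1'')"])
       (fact n1, fact n1, simp, simp, simp, simp, simp, simp, fact C, fact s'1, fact h, fact True)
    then show ?thesis using True by simp
  next
    case False
    have "s' ''Fi'' h = s1 ''Fi'' h"
      by (rule run_search2(2)[where s=s1 and b="''n''" and b'="''n''" and x="''a1''" and y="''b1''" and X="''Fi''"
        and P="\<lambda>i k. s ''F'' k = i" and m=n and m'=n and d="Equal (Cell ''F'' (Var ''b1'')) (Var ''a1'')"])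
       (fact n1, fact n1, simp, simp, simp, simp, simp, simp, fact C, fact s'1, fact h, fact False)
    then show ?thesis using False 0 by (simp only: if_False)
  qed
qed

theorem run_TEST:
  assumes s: "menv s" and F: "\<And>g. g \<in> {1..n} \<Longrightarrow> s ''F'' g \<le> n" and s': "s' = run TEST s"
  shows "s' ''ok'' 0 = (if two_sided (s ''F'') then 1 else 0)"
proof -
  define Fs where "Fs = s ''F''"
  define s1 where "s1 = run (HALF ''mG'' ''mH'' ''F'' (at2 ''cp'' (Var ''a1'') (Var ''b1''))) s"
  define s2 where "s2 = run (Do ''ok1'' (Lit 0) (Var ''ok'')) s1"
  define s3 where "s3 = run INVERT s2"
  define s4 where "s4 = run (HALF ''mH'' ''mG'' ''Fi'' (at2 ''cp'' (Var ''b1'') (Var ''a1''))) s3"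
  define s5 where "s5 = run (For ''a1'' ''n'' (If (Conj (Neg (Equal (Cell ''F'' (Var ''a1'')) (Lit 0)))
         (Neg (Equal (Cell ''Fi'' (Cell ''F'' (Var ''a1''))) (Var ''a1'')))) (Do ''ok'' (Lit 0) (Lit 0)) Nop)) s4"
  have s'5: "s' = (if s5 ''ok1'' 0 = 1 then s5 else set_var s5 ''ok'' 0)"
    unfolding s' TEST_def s5_def s4_def s3_def s2_def s1_def by (simp only: run.simps(1,2,3,4) bval.simps aval.simps)
  have fr1: "s1 x = s x" if "x \<notin> core_names \<union> {''S'', ''T'', ''c''}" for x
    unfolding s1_def by (rule run_frame) (use that in \<open>simp only: writes_HALF not_False_eq_True\<close>)
  have fr2: "s2 x = s1 x" if "x \<noteq> ''ok1''" for x using that by (simp add: s2_def)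
  have fr3: "s3 x = s2 x" if "x \<notin> {''a1'', ''b1'', ''Fi''}" for x
    unfolding s3_def by (rule run_frame) (use that in \<open>simp only: writes_INVERT not_False_eq_True\<close>)
  have fr4: "s4 x = s3 x" if "x \<notin> core_names \<union> {''S'', ''T'', ''c''}" for x
    unfolding s4_def by (rule run_frame) (use that in \<open>simp only: writes_HALF not_False_eq_True\<close>)
  have fr5: "s5 x = s4 x" if "x \<notin> {''a1'', ''ok''}" for x
    unfolding s5_def by (rule run_frame) (use that in simp)
  have rd: "A.ready s" "A.tab s ''mG'' G" "A.tab s ''mH'' H" using s by (simp_all add: menv_def)
  have P: "s ''P1'' j = P1 j \<and> s ''P2'' j = P2 j" if "j \<in> {1..N}" for j using s that by (simp add: menv_def)
  have cp: "s ''cp'' (A.ad2 g h) = (if C g h then 1 else 0)" if "g \<in> {1..n}" "h \<in> {1..n}" for g h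
    using s that by (simp add: menv_def)
  have e1: "aval (at2 ''cp'' (Var ''a1'') (Var ''b1'')) r = (if C i k then 1 else 0)"
    if "i \<in> {1..n}" "k \<in> {1..n}" "r ''row'' = s ''row''" "r ''cp'' = s ''cp''" "r ''a1'' 0 = i" "r ''b1'' 0 = k" for r i k
    using that cp[OF that(1,2)] A.readyD(3)[OF rd(1), of i] A.nN by (simp add: A.ad2_def)
  have ok1: "s1 ''ok'' 0 = (if \<exists>f\<in>A.homs. extends f Fs then 1 else 0)"
    unfolding extends_def Fs_def
    by (rule A.run_HALF[OF rd(1,2) _ rd(3) _ _ P e1 s1_def]) simp_all
  have m2: "menv s2" using s by (subst menv_cong[of _ s]) (simp_all add: fr1 fr2)
  have F2: "s2 ''F'' = Fs" by (simp add: fr1 fr2 Fs_def)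
  have F2n: "s2 ''F'' g \<le> n" if "g \<in> {1..n}" for g using F[OF that] F2 by (simp add: Fs_def)
  define Fi where "Fi = s3 ''Fi''"
  have Fi: "if \<exists>g\<in>{1..n}. Fs g = h then Fi h \<in> {1..n} \<and> Fs (Fi h) = h else Fi h = 0" if "h \<in> {1..n}" for h
    using run_INVERT[OF m2 F2n s3_def that] unfolding F2 Fi_def .
  have m3: "menv s3" using m2 by (subst menv_cong[of _ s2]) (simp_all add: fr3)
  have rd3: "A.ready s3" "A.tab s3 ''mG'' G" "A.tab s3 ''mH'' H" using m3 by (simp_all add: menv_def)
  have P3: "s3 ''P1'' j = P1 j \<and> s3 ''P2'' j = P2 j" if "j \<in> {1..N}" for j using m3 that by (simp add: menv_def)
  have cp3: "s3 ''cp'' (A.ad2 g h) = (if C g h then 1 else 0)" if "g \<in> {1..n}" "h \<in> {1..n}" for g h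
    using m3 that by (simp add: menv_def)
  have e2: "aval (at2 ''cp'' (Var ''b1'') (Var ''a1'')) r = (if C k i then 1 else 0)"
    if "i \<in> {1..n}" "k \<in> {1..n}" "r ''row'' = s3 ''row''" "r ''cp'' = s3 ''cp''" "r ''a1'' 0 = i" "r ''b1'' 0 = k" for r i k
    using that cp3[OF that(2,1)] A.readyD(3)[OF rd3(1), of k] A.nN by (simp add: A.ad2_def)
  have ok2: "s4 ''ok'' 0 = (if \<exists>f\<in>B.homs. \<forall>h\<in>{1..n}. Fi h \<noteq> 0 \<longrightarrow> f h = Fi h then 1 else 0)"
    unfolding Fi_def
    by (rule B.run_HALF[OF rd3(1,3) _ rd3(2) _ _ P3 e2 s4_def]) simp_all
  have n4: "s4 ''n'' 0 = n" using A.readyD(1)[OF rd3(1)] fr4 by simp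
  have F4: "s4 ''F'' = Fs" "s4 ''Fi'' = Fi" using F2 fr3 fr4 by (simp_all add: Fi_def)
  define bad where "bad g \<longleftrightarrow> Fs g \<noteq> 0 \<and> Fi (Fs g) \<noteq> g" for g
  have C5: "bval (Conj (Neg (Equal (Cell ''F'' (Var ''a1'')) (Lit 0)))
         (Neg (Equal (Cell ''Fi'' (Cell ''F'' (Var ''a1''))) (Var ''a1'')))) r \<longleftrightarrow> bad i"
    if "i \<in> {1..n}" "agree {''a1'', ''ok''} s4 r" "r ''a1'' 0 = i" for i r
    using that(3) agreeD[OF that(2)] F4 by (simp add: bad_def)
  have ok5: "s5 ''ok'' 0 = (if \<exists>i\<in>{1..n}. bad i then 0 else s4 ''ok'' 0)"
    by (rule run_flag[where P=bad, OF n4 _ C5 s5_def]) simp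
  have ok15: "s5 ''ok1'' 0 = s1 ''ok'' 0"
  proof -
    have "s5 ''ok1'' 0 = s2 ''ok1'' 0" by (simp add: fr5 fr4 fr3)
    then show ?thesis by (simp add: s2_def)
  qed
  have bwd: "(\<exists>f\<in>B.homs. \<forall>h\<in>{1..n}. Fi h \<noteq> 0 \<longrightarrow> f h = Fi h) \<and> \<not> (\<exists>i\<in>{1..n}. bad i) \<longleftrightarrow>
    (\<exists>f\<in>B.homs. \<forall>g\<in>{1..n}. Fs g \<noteq> 0 \<longrightarrow> f (Fs g) = g)"
  proof
    assume l: "(\<exists>f\<in>B.homs. \<forall>h\<in>{1..n}. Fi h \<noteq> 0 \<longrightarrow> f h = Fi h) \<and> \<not> (\<exists>i\<in>{1..n}. bad i)"
    then obtain f where f: "f \<in> B.homs" "\<And>h. h \<in> {1..n} \<Longrightarrow> Fi h \<noteq> 0 \<Longrightarrow> f h = Fi h" by blast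
    have "f (Fs g) = g" if g: "g \<in> {1..n}" "Fs g \<noteq> 0" for g
    proof -
      have "\<not> bad g" using l g by blast
      then have "Fi (Fs g) = g" using g by (simp add: bad_def)
      moreover have "Fs g \<in> {1..n}" using F[OF g(1)] g(2) by (simp add: Fs_def)
      ultimately show ?thesis using f(2)[of "Fs g"] g by simp
    qed
    then show "\<exists>f\<in>B.homs. \<forall>g\<in>{1..n}. Fs g \<noteq> 0 \<longrightarrow> f (Fs g) = g" using f(1) by blast
  next
    assume "\<exists>f\<in>B.homs. \<forall>g\<in>{1..n}. Fs g \<noteq> 0 \<longrightarrow> f (Fs g) = g"
    then obtain f where f: "f \<in> B.homs" "\<And>g. g \<in> {1..n} \<Longrightarrow> Fs g \<noteq> 0 \<Longrightarrow> f (Fs g) = g" by blast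
    have fi: "f h = Fi h" if "h \<in> {1..n}" "Fi h \<noteq> 0" for h
    proof -
      have "Fi h \<in> {1..n}" "Fs (Fi h) = h" using Fi[OF that(1)] that(2) by (auto split: if_splits)
      then show ?thesis using f(2)[of "Fi h"] that(1) by simp
    qed
    have "\<not> bad i" if i: "i \<in> {1..n}" for i
    proof
      assume b: "bad i"
      then have Fsi: "Fs i \<in> {1..n}" "Fs i \<noteq> 0" using F[OF i] by (auto simp: bad_def Fs_def)
      then have "Fi (Fs i) \<in> {1..n}" using Fi[OF Fsi(1)] i by (auto split: if_splits)
      then have "f (Fs i) = Fi (Fs i)" using fi[OF Fsi(1)] by simp
      then show False using f(2)[OF i Fsi(2)] b by (simp add: bad_def)
    qed
    then show "(\<exists>f\<in>B.homs. \<forall>h\<in>{1..n}. Fi h \<noteq> 0 \<longrightarrow> f h = Fi h) \<and> \<not> (\<exists>i\<in>{1..n}. bad i)"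
      using f(1) fi by blast
  qed
  have "s' ''ok'' 0 = (if p \<and> (q \<and> \<not> d) then 1 else 0)"
    if "s1 ''ok'' 0 = (if p then 1 else 0)" "s4 ''ok'' 0 = (if q then 1 else 0)"
      "s5 ''ok'' 0 = (if d then 0 else s4 ''ok'' 0)" for p q d
    using s'5 ok15 that by (simp split: if_splits)
  from this[OF ok1 ok2 ok5] have "s' ''ok'' 0 = (if (\<exists>f\<in>A.homs. extends f Fs) \<and>
     ((\<exists>f\<in>B.homs. \<forall>h\<in>{1..n}. Fi h \<noteq> 0 \<longrightarrow> f h = Fi h) \<and> \<not> (\<exists>i\<in>{1..n}. bad i)) then 1 else 0)" .
  then show ?thesis unfolding bwd two_sided_def Fs_def .
qed

text \<open>
  If the initial map \<open>F0\<close> extends to an isomorphism over \<open>C\<close>, there is one, and the test is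
  equivalent to extendibility. So the current map stays extendible, and each element gets a
  value at the latest when its image under an isomorphism extending the current map is tried.
\<close>

theorem run_COMPLETE:
  assumes s: "menv s" and F: "\<And>g. g \<in> {1..n} \<Longrightarrow> s ''F'' g \<le> n" and s': "s' = run COMPLETE s"
  shows "menv s'"
    and "extendible (s ''F'') \<Longrightarrow> s' ''res'' 0 = 1 \<and>
      (\<exists>\<Phi>\<in>iso_over G H C. extends \<Phi> (s ''F'') \<and> (\<forall>g\<in>{1..n}. s' ''F'' g = \<Phi> g))"
    and "\<not> extendible (s ''F'') \<Longrightarrow> s' ''res'' 0 = 0"
proof -
  define F0 where "F0 = s ''F''"
  define I where "I i r \<longleftrightarrow> menv r \<and> (\<forall>g\<in>{1..n}. r ''F'' g \<le> n) \<and> (\<forall>g\<in>{1..n}. F0 g \<noteq> 0 \<longrightarrow> r ''F'' g = F0 g) \<and>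
     (extendible F0 \<longrightarrow> extendible (r ''F'') \<and> (\<forall>g\<in>{1..i}. r ''F'' g \<noteq> 0))" for i r
  have I_cong: "I i r'" if "I i r" "\<And>x. x \<in> {''n'', ''N'', ''row'', ''row2'', ''mG'', ''mH'', ''P1'', ''P2'', ''cp'', ''F''} \<Longrightarrow> r' x = r x" for i r r'
  proof -
    have "menv r'" using that(1) by (subst menv_cong[of _ r]) (use that(2) in \<open>auto simp: I_def\<close>)
    moreover have "r' ''F'' = r ''F''" by (rule that(2)) simp
    ultimately show ?thesis using that(1) by (simp add: I_def)
  qed
  define s1 where "s1 = run (For ''ci'' ''n'' (For ''ch'' ''n'' (If (Equal (Cell ''F'' (Var ''ci'')) (Lit 0)) TRY Nop))) s"
  have n: "r ''n'' 0 = n" if "menv r" for r using that by (simp add: menv_def A.ready_def)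
  have I1: "I n s1"
    unfolding s1_def
  proof (rule run_For_inv[of s "''n''" n I])
    show "s ''n'' 0 = n" using n s .
    have "I 0 s" using s F by (auto simp: I_def F0_def One_nat_def)
    then show "I 0 (set_var s ''ci'' 0)" by (rule I_cong) auto
  next
    fix i r assume i: "i < n" and r: "I i r"
    \<comment> \<open>within the inner loop: while element \<open>Suc i\<close> has no value, all images up to \<open>k\<close>
      have been refuted for the current map\<close>
    define J where "J k q \<longleftrightarrow> I i q \<and> q ''ci'' 0 = Suc i \<and>
      (extendible F0 \<longrightarrow> q ''F'' (Suc i) \<noteq> 0 \<or> (\<forall>h\<in>{1..k}. \<not> extendible ((q ''F'')(Suc i := h))))" for k q
    have "J n (run (For ''ch'' ''n'' (If (Equal (Cell ''F'' (Var ''ci'')) (Lit 0)) TRY Nop)) (set_var r ''ci'' (Suc i)))"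
    proof (rule run_For_inv[of _ "''n''" n J])
      show "set_var r ''ci'' (Suc i) ''n'' 0 = n" using r n by (simp add: I_def)
      have "I i (set_var (set_var r ''ci'' (Suc i)) ''ch'' 0)" by (rule I_cong[OF r]) auto
      then show "J 0 (set_var (set_var r ''ci'' (Suc i)) ''ch'' 0)" by (auto simp: J_def One_nat_def)
    next
      fix k q assume k: "k < n" and q: "J k q"
      let ?q = "set_var q ''ch'' (Suc k)"
      have Iq: "I i ?q" by (rule I_cong[of i q]) (use q in \<open>auto simp: J_def\<close>)
      have ci: "?q ''ci'' 0 = Suc i" "?q ''ch'' 0 = Suc k" "?q ''F'' = q ''F''" using q by (simp_all add: J_def)
      show "J (Suc k) (run (If (Equal (Cell ''F'' (Var ''ci'')) (Lit 0)) TRY Nop) ?q)"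
      proof (cases "q ''F'' (Suc i) = 0")
        case False
        then have "run (If (Equal (Cell ''F'' (Var ''ci'')) (Lit 0)) TRY Nop) ?q = ?q" using ci by simp
        then show ?thesis using Iq ci False by (simp add: J_def)
      next
        case True
        define F1 where "F1 = (q ''F'')(Suc i := Suc k)"
        define t1 where "t1 = run (Do ''F'' (Var ''ci'') (Var ''ch'')) ?q"
        define t2 where "t2 = run TEST t1"
        define t3 where "t3 = run (If (Equal (Cell ''F'' (Var ''ci'')) (Lit 0)) TRY Nop) ?q"
        have t3: "t3 = (if t2 ''ok'' 0 = 1 then t2 else t2(''F'' := (t2 ''F'')(t2 ''ci'' 0 := 0)))"
          using True ci unfolding t3_def t2_def t1_def TRY_def
          by (simp del: run.simps(2) fun_upd_apply add: run.simps(2)[of "''F''" "Var ''ci''" "Lit 0"])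
        have t1: "t1 = ?q(''F'' := F1)" using ci by (simp add: t1_def F1_def)
        have Iq': "menv ?q" "\<And>g. g \<in> {1..n} \<Longrightarrow> q ''F'' g \<le> n"
          "\<And>g. g \<in> {1..n} \<Longrightarrow> F0 g \<noteq> 0 \<Longrightarrow> q ''F'' g = F0 g" using Iq ci by (auto simp: I_def)
        have m1: "menv t1" using Iq'(1) by (subst menv_cong[of _ ?q]) (simp_all add: t1)
        have F1n: "t1 ''F'' g \<le> n" if "g \<in> {1..n}" for g using Iq'(2)[OF that] k by (simp add: t1 F1_def)
        have ok: "t2 ''ok'' 0 = (if two_sided F1 then 1 else 0)" using run_TEST[OF m1 F1n t2_def] by (simp add: t1)
        have fr: "t2 x = t1 x" if "x \<notin> core_names \<union> {''S'', ''T'', ''c'', ''ok1'', ''Fi''}" for x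
          unfolding t2_def by (rule run_frame) (use that in \<open>simp only: writes_TEST not_False_eq_True\<close>)
        have F2: "t2 ''F'' = F1" "t2 ''ci'' 0 = Suc i" using fr ci by (simp_all add: t1)
        have m2: "menv t2" using m1 by (subst menv_cong[of _ t1]) (simp_all add: fr)
        have si: "Suc i \<in> {1..n}" using i by simp
        have F0i: "F0 (Suc i) = 0" using Iq'(3)[OF si] True by auto
        have iso: "iso_over G H C \<noteq> {}" if "extendible F0" using that by (auto simp: extendible_def)
        have "J (Suc k) t3"
        proof (cases "two_sided F1")
          case True2: True
          then have t3': "t3 = t2" using t3 ok by simp
          have "I i t2"
            unfolding I_def F2
          proof (intro conjI impI ballI)
            show "menv t2" by fact
            show "F1 g \<le> n" if "g \<in> {1..n}" for g using F1n[OF that] by (simp add: t1)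
            show "F1 g = F0 g" if "g \<in> {1..n}" "F0 g \<noteq> 0" for g using Iq'(3)[OF that] that F0i by (auto simp: F1_def)
            show "extendible F1" if "extendible F0" using two_sided_imp_extendible[OF True2 iso[OF that]] .
            show "F1 g \<noteq> 0" if "extendible F0" "g \<in> {1..i}" for g
              using Iq that ci by (auto simp: I_def F1_def)
          qed
          then show ?thesis using F2 by (simp add: J_def t3' F1_def)
        next
          case False
          then have t3': "t3 = t2(''F'' := F1(Suc i := 0))" using t3 ok F2 by simp
          have restore: "F1(Suc i := 0) = q ''F''" using True by (auto simp: F1_def fun_eq_iff)
          have F3: "t3 ''F'' = q ''F''" "t3 ''ci'' 0 = Suc i" using F2 by (simp_all add: t3' restore)
          have m3: "menv t3" using m2 by (subst menv_cong[of _ t2]) (simp_all add: t3')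
          have "I i t3" using Iq m3 F3 ci by (simp add: I_def)
          moreover have "\<not> extendible ((q ''F'')(Suc i := h))" if "extendible F0" "h \<in> {1..Suc k}" for h
          proof (cases "h = Suc k")
            case True
            then show ?thesis using False extendible_imp_two_sided[of F1] by (auto simp: F1_def)
          next
            case False
            then have "h \<in> {1..k}" using that by simp
            then show ?thesis using q True that(1) by (auto simp: J_def)
          qed
          ultimately show ?thesis using F3 by (auto simp: J_def)
        qed
        then show ?thesis by (simp add: t3_def)
      qed
    qed
    then show "I (Suc i) (run (For ''ch'' ''n'' (If (Equal (Cell ''F'' (Var ''ci'')) (Lit 0)) TRY Nop)) (set_var r ''ci'' (Suc i)))"
    proof -
      fix q assume "J n q"
      have "q ''F'' (Suc i) \<noteq> 0" if e: "extendible F0"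
      proof (rule ccontr)
        assume 0: "\<not> q ''F'' (Suc i) \<noteq> 0"
        have "extendible (q ''F'')" using \<open>J n q\<close> e by (simp add: J_def I_def)
        then obtain \<Phi> where P: "\<Phi> \<in> iso_over G H C" "extends \<Phi> (q ''F'')" by (auto simp: extendible_def)
        have si: "Suc i \<in> {1..n}" using i by simp
        have "\<Phi> (Suc i) \<in> {1..n}"
          using P(1) si by (auto simp: iso_over_def iso_def hom_def A.carG A.carH)
        moreover have "extends \<Phi> ((q ''F'')(Suc i := \<Phi> (Suc i)))" using P(2) by (auto simp: extends_def)
        then have "extendible ((q ''F'')(Suc i := \<Phi> (Suc i)))" using P(1) by (auto simp: extendible_def)
        ultimately show False using \<open>J n q\<close> e 0 by (auto simp: J_def)
      qed
      then show "I (Suc i) q" using \<open>J n q\<close> by (auto simp: J_def I_def le_Suc_eq)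
    qed
  qed
  define s2 where "s2 = run TEST s1"
  define s3 where "s3 = set_var s2 ''res'' (s2 ''ok'' 0)"
  have s'3: "s' = run (For ''ci'' ''n'' (If (Equal (Cell ''F'' (Var ''ci'')) (Lit 0)) (Do ''res'' (Lit 0) (Lit 0)) Nop)) s3"
    unfolding s' COMPLETE_def s3_def s2_def s1_def by (simp only: run.simps(2,3) aval.simps)
  have fr2: "s2 x = s1 x" if "x \<notin> core_names \<union> {''S'', ''T'', ''c'', ''ok1'', ''Fi''}" for x
    unfolding s2_def by (rule run_frame) (use that in \<open>simp only: writes_TEST not_False_eq_True\<close>)
  have fr3: "s' x = s3 x" if "x \<notin> {''ci'', ''res''}" for x
    unfolding s'3 by (rule run_frame) (use that in simp)
  have m1: "menv s1" and F1: "\<And>g. g \<in> {1..n} \<Longrightarrow> s1 ''F'' g \<le> n"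
    and keep: "\<And>g. g \<in> {1..n} \<Longrightarrow> F0 g \<noteq> 0 \<Longrightarrow> s1 ''F'' g = F0 g"
    and ext: "extendible F0 \<Longrightarrow> extendible (s1 ''F'') \<and> (\<forall>g\<in>{1..n}. s1 ''F'' g \<noteq> 0)"
    using I1 by (auto simp: I_def)
  have ok2: "s2 ''ok'' 0 = (if two_sided (s1 ''F'') then 1 else 0)" by (rule run_TEST[OF m1 F1 s2_def])
  have m3: "menv s3" using m1 by (subst menv_cong[of _ s1]) (simp_all add: s3_def fr2)
  show "menv s'" using m3 by (subst menv_cong[of _ s3]) (simp_all add: fr3)
  have F3: "s3 ''F'' = s1 ''F''" "s' ''F'' = s1 ''F''" using fr2 fr3 by (simp_all add: s3_def)
  have C3: "bval (Equal (Cell ''F'' (Var ''ci'')) (Lit 0)) r \<longleftrightarrow> s1 ''F'' i = 0"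
    if "i \<in> {1..n}" "agree {''ci'', ''res''} s3 r" "r ''ci'' 0 = i" for i r
    using that(3) agreeD[OF that(2)] F3 by simp
  have "s' ''res'' 0 = (if \<exists>i\<in>{1..n}. s1 ''F'' i = 0 then 0 else s3 ''res'' 0)"
    by (rule run_flag[where P="\<lambda>i. s1 ''F'' i = 0", OF n[OF m3] _ C3 s'3]) simp
  then have res: "s' ''res'' 0 = (if (\<exists>i\<in>{1..n}. s1 ''F'' i = 0) \<or> \<not> two_sided (s1 ''F'') then 0 else 1)"
    using ok2 by (simp add: s3_def)
  show "s' ''res'' 0 = 1 \<and>
      (\<exists>\<Phi>\<in>iso_over G H C. extends \<Phi> (s ''F'') \<and> (\<forall>g\<in>{1..n}. s' ''F'' g = \<Phi> g))" if "extendible (s ''F'')"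
  proof -
    have e: "extendible (s1 ''F'')" "\<And>g. g \<in> {1..n} \<Longrightarrow> s1 ''F'' g \<noteq> 0" using ext that by (auto simp: F0_def)
    have "s' ''res'' 0 = 1" using res e extendible_imp_two_sided[OF e(1)] by auto
    moreover obtain \<Phi> where P: "\<Phi> \<in> iso_over G H C" "extends \<Phi> (s1 ''F'')" using e(1) by (auto simp: extendible_def)
    have "\<forall>g\<in>{1..n}. s' ''F'' g = \<Phi> g" using P(2) e(2) F3 by (auto simp: extends_def)
    moreover have "extends \<Phi> (s ''F'')" using P(2) keep unfolding extends_def F0_def by metis
    ultimately show ?thesis using P(1) by blast
  qed
  show "s' ''res'' 0 = 0" if "\<not> extendible (s ''F'')"
  proof (rule ccontr)
    assume "s' ''res'' 0 \<noteq> 0"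
    then have t: "two_sided (s1 ''F'')" "\<And>g. g \<in> {1..n} \<Longrightarrow> s1 ''F'' g \<noteq> 0" using res by (auto split: if_splits)
    from two_sided_total[OF t] obtain \<Phi> where P: "\<Phi> \<in> iso_over G H C" "extends \<Phi> (s1 ''F'')" by (auto simp: extendible_def)
    have "extends \<Phi> (s ''F'')" using P(2) keep unfolding extends_def F0_def by metis
    then show False using P(1) that by (auto simp: extendible_def)
  qed
qed

end

section \<open>Isomorphisms that induce a given map of the quotients\<close>

locale extension_pair =
  fixes G :: "nat monoid" and H :: "nat monoid" and A B :: "nat set" and \<psi> :: "nat set \<Rightarrow> nat set"
  assumes A: "A \<lhd> G" and B: "B \<lhd> H"
    and commA: "comm_group (G\<lparr>carrier := A\<rparr>)" and commB: "comm_group (H\<lparr>carrier := B\<rparr>)"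
    and psi: "\<psi> \<in> iso (G Mod A) (H Mod B)"
begin

sublocale NA: normal A G by (rule A)
sublocale NB: normal B H by (rule B)

definition C :: "nat \<Rightarrow> nat \<Rightarrow> bool" where
  "C g h \<longleftrightarrow> \<psi> (g <#\<^bsub>G\<^esub> A) = h <#\<^bsub>H\<^esub> B"

lemma lA: "g \<in> carrier G \<Longrightarrow> g <#\<^bsub>G\<^esub> A = A #>\<^bsub>G\<^esub> g" using NA.coset_eq by simp
lemma lB: "h \<in> carrier H \<Longrightarrow> h <#\<^bsub>H\<^esub> B = B #>\<^bsub>H\<^esub> h" using NB.coset_eq by simp

lemma C_iff: "g \<in> carrier G \<Longrightarrow> h \<in> carrier H \<Longrightarrow> C g h \<longleftrightarrow> \<psi> (A #>\<^bsub>G\<^esub> g) = B #>\<^bsub>H\<^esub> h"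
  by (simp add: C_def lA lB)

lemma cosA: "g \<in> carrier G \<Longrightarrow> A #>\<^bsub>G\<^esub> g \<in> carrier (G Mod A)"
  by (auto simp: FactGroup_def RCOSETS_def)
lemma cosB: "h \<in> carrier H \<Longrightarrow> B #>\<^bsub>H\<^esub> h \<in> carrier (H Mod B)"
  by (auto simp: FactGroup_def RCOSETS_def)

lemma cosA_E: "X \<in> carrier (G Mod A) \<Longrightarrow> \<exists>g\<in>carrier G. X = A #>\<^bsub>G\<^esub> g"
  by (auto simp: FactGroup_def RCOSETS_def)
lemma cosB_E: "X \<in> carrier (H Mod B) \<Longrightarrow> \<exists>h\<in>carrier H. X = B #>\<^bsub>H\<^esub> h"
  by (auto simp: FactGroup_def RCOSETS_def)

sublocale hom: group_hom "G Mod A" "H Mod B" \<psi>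
  using psi NA.factorgroup_is_group NB.factorgroup_is_group
  by (intro group_hom.intro group_hom_axioms.intro) (auto simp: iso_def)

lemma psi_mult: "\<lbrakk>g \<in> carrier G; g' \<in> carrier G\<rbrakk> \<Longrightarrow>
  \<psi> (A #>\<^bsub>G\<^esub> (g \<otimes>\<^bsub>G\<^esub> g')) = \<psi> (A #>\<^bsub>G\<^esub> g) <#>\<^bsub>H\<^esub> \<psi> (A #>\<^bsub>G\<^esub> g')"
  using hom.hom_mult[OF cosA cosA, of g g'] by (simp add: FactGroup_def NA.rcos_sum)

lemma psi_one: "\<psi> A = B"
  using hom.hom_one by (simp add: FactGroup_def)

lemma psi_inv: "\<lbrakk>g \<in> carrier G; h \<in> carrier H; \<psi> (A #>\<^bsub>G\<^esub> g) = B #>\<^bsub>H\<^esub> h\<rbrakk> \<Longrightarrow>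
  \<psi> (A #>\<^bsub>G\<^esub> inv\<^bsub>G\<^esub> g) = B #>\<^bsub>H\<^esub> inv\<^bsub>H\<^esub> h"
  using hom.hom_inv[OF cosA, of g] cosA[of g] cosB[of h]
  by (simp add: NA.inv_FactGroup NB.inv_FactGroup NA.rcos_inv NB.rcos_inv)

lemma psi_inj: "\<lbrakk>X \<in> carrier (G Mod A); Y \<in> carrier (G Mod A); \<psi> X = \<psi> Y\<rbrakk> \<Longrightarrow> X = Y"
  using psi by (auto simp: iso_def bij_betw_def inj_on_def)

lemma C_one_iff: "h \<in> carrier H \<Longrightarrow> C \<one>\<^bsub>G\<^esub> h \<longleftrightarrow> h \<in> B"
proof -
  assume h: "h \<in> carrier H"
  have "C \<one>\<^bsub>G\<^esub> h \<longleftrightarrow> B = B #>\<^bsub>H\<^esub> h"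
    using h NA.subset by (simp add: C_iff psi_one)
  also have "\<dots> \<longleftrightarrow> h \<in> B"
    using h NB.rcos_self[OF h] NB.subgroup_axioms NB.coset_join2[OF h NB.subgroup_axioms] by auto
  finally show ?thesis .
qed

lemma C_one_iff': "g \<in> carrier G \<Longrightarrow> C g \<one>\<^bsub>H\<^esub> \<longleftrightarrow> g \<in> A"
proof -
  assume g: "g \<in> carrier G"
  have one: "A \<in> carrier (G Mod A)" using cosA[OF NA.one_closed] NA.subset by simp
  have "C g \<one>\<^bsub>H\<^esub> \<longleftrightarrow> \<psi> (A #>\<^bsub>G\<^esub> g) = \<psi> A"
    using g NB.subset by (simp add: C_iff psi_one)
  also have "\<dots> \<longleftrightarrow> A #>\<^bsub>G\<^esub> g = A" using psi_inj[OF cosA[OF g] one] by auto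
  also have "\<dots> \<longleftrightarrow> g \<in> A"
    using NA.rcos_self[OF g] NA.subgroup_axioms NA.coset_join2[OF g NA.subgroup_axioms] by auto
  finally show ?thesis .
qed

lemma C_mult: "\<lbrakk>g \<in> carrier G; g' \<in> carrier G; h \<in> carrier H; h' \<in> carrier H; C g h; C g' h'\<rbrakk>
  \<Longrightarrow> C (g \<otimes>\<^bsub>G\<^esub> g') (h \<otimes>\<^bsub>H\<^esub> h')"
  by (simp add: C_iff psi_mult NB.rcos_sum)

lemma C_inv: "\<lbrakk>g \<in> carrier G; h \<in> carrier H; C g h\<rbrakk> \<Longrightarrow> C (inv\<^bsub>G\<^esub> g) (inv\<^bsub>H\<^esub> h)"
  by (simp add: C_iff psi_inv)

lemma comm_sub: "comm_group (K\<lparr>carrier := X\<rparr>) \<Longrightarrow> x \<in> X \<Longrightarrow> y \<in> X \<Longrightarrow> x \<otimes>\<^bsub>K\<^esub> y = y \<otimes>\<^bsub>K\<^esub> x"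
  using comm_monoid.m_comm[of "K\<lparr>carrier := X\<rparr>" x y] by (simp add: comm_group_def)

lemma total: "g \<in> carrier G \<Longrightarrow> \<exists>h\<in>carrier H. C g h"
  using cosB_E[OF hom.hom_closed[OF cosA]] by (auto simp: C_iff)

lemma total': "h \<in> carrier H \<Longrightarrow> \<exists>g\<in>carrier G. C g h"
proof -
  assume h: "h \<in> carrier H"
  have "\<psi> ` carrier (G Mod A) = carrier (H Mod B)" using psi by (auto simp: iso_def bij_betw_def)
  then obtain X where X: "X \<in> carrier (G Mod A)" "\<psi> X = B #>\<^bsub>H\<^esub> h" using cosB[OF h] by (metis imageE)
  then show ?thesis using cosA_E[OF X(1)] h by (auto simp: C_iff)
qed

lemma fibre: "fibre G H C"
proof unfold_locales
  show "C \<one>\<^bsub>G\<^esub> \<one>\<^bsub>H\<^esub>" by (simp add: C_one_iff)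
qed (use C_mult C_inv total C_one_iff comm_sub[OF commB] in auto)

lemma fibre': "fibre H G (\<lambda>h g. C g h)"
proof unfold_locales
  show "C \<one>\<^bsub>G\<^esub> \<one>\<^bsub>H\<^esub>" by (simp add: C_one_iff)
qed (use C_mult C_inv total' C_one_iff' comm_sub[OF commA] in auto)

text \<open>
  That \<open>\<Phi>\<close> maps \<open>A\<close> onto \<open>B\<close> follows from compatibility: \<open>A\<close> and \<open>B\<close> consist of the elements
  compatible with \<open>\<one>\<close>.
\<close>

lemma inducing_isos_eq: "inducing_isos G H A B \<psi> = iso_over G H C"
proof -
  have img: "\<Phi> ` A = B" if P: "\<Phi> \<in> iso G H" "\<And>g. g \<in> carrier G \<Longrightarrow> C g (\<Phi> g)" for \<Phi>
  proof -
    have bij: "\<Phi> ` carrier G = carrier H" using P(1) by (auto simp: iso_def bij_betw_def)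
    have cl: "\<Phi> g \<in> carrier H" if "g \<in> carrier G" for g using bij that by blast
    have iff: "\<Phi> g \<in> B \<longleftrightarrow> g \<in> A" if g: "g \<in> carrier G" for g
    proof
      assume "\<Phi> g \<in> B"
      then have "C \<one>\<^bsub>G\<^esub> (\<Phi> g)" using C_one_iff cl g by blast
      then have "C (g \<otimes>\<^bsub>G\<^esub> inv\<^bsub>G\<^esub> \<one>\<^bsub>G\<^esub>) (\<Phi> g \<otimes>\<^bsub>H\<^esub> inv\<^bsub>H\<^esub> \<Phi> g)"
        using P(2)[OF g] g cl by (intro C_mult C_inv) auto
      then show "g \<in> A" using g cl C_one_iff' by simp
    next
      assume "g \<in> A"
      then have "C g \<one>\<^bsub>H\<^esub>" using C_one_iff' g by blast
      then have "C (inv\<^bsub>G\<^esub> g \<otimes>\<^bsub>G\<^esub> g) (inv\<^bsub>H\<^esub> \<one>\<^bsub>H\<^esub> \<otimes>\<^bsub>H\<^esub> \<Phi> g)"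
        using P(2)[OF g] g cl by (intro C_mult C_inv) auto
      then show "\<Phi> g \<in> B" using g cl C_one_iff by simp
    qed
    show ?thesis
    proof
      show "\<Phi> ` A \<subseteq> B" using iff NA.subset by blast
      show "B \<subseteq> \<Phi> ` A"
      proof
        fix h assume h: "h \<in> B"
        then have "h \<in> carrier H" using NB.subset by blast
        then obtain g where "g \<in> carrier G" "h = \<Phi> g" using bij by blast
        then show "h \<in> \<Phi> ` A" using iff h by blast
      qed
    qed
  qed
  have "C g h \<longleftrightarrow> h <#\<^bsub>H\<^esub> B = \<psi> (g <#\<^bsub>G\<^esub> A)" for g h by (auto simp: C_def)
  then show ?thesis unfolding inducing_isos_def iso_over_def using img by blast
qed

end

text \<open>The group \<open>Aut0 G A\<close> is the special case in which both groups are \<open>G\<close> and \<open>\<psi>\<close> is the identity.\<close>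

locale kernel_automorphisms =
  fixes G :: "nat monoid" and A :: "nat set" and n :: nat
  assumes A: "A \<lhd> G" and commA: "comm_group (G\<lparr>carrier := A\<rparr>)" and carG: "carrier G = {1..n}"
begin

sublocale NA: normal A G by (rule A)

sublocale P: extension_pair G G A A "\<lambda>X. X"
  by (rule extension_pair.intro[OF A A commA commA]) (simp add: iso_set_refl)

lemma Aut0_eq: "Aut0 G A = iso_over G G P.C \<inter> extensional (carrier G)"
proof -
  have "Aut0 G A = inducing_isos G G A A (\<lambda>X. X) \<inter> extensional (carrier G)"
    by (auto simp: Aut0_def inducing_isos_def auto_def Bij_def iso_def)
  then show ?thesis by (simp add: P.inducing_isos_eq)
qed

lemma Aut0_auto: "\<alpha> \<in> Aut0 G A \<Longrightarrow> \<alpha> \<in> auto G"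
  by (simp add: Aut0_def)

lemma auto_closed: "\<alpha> \<in> auto G \<Longrightarrow> g \<in> carrier G \<Longrightarrow> \<alpha> g \<in> carrier G"
  by (auto simp: auto_def hom_def)

lemma Aut_mult: "\<lbrakk>\<alpha> \<in> auto G; \<beta> \<in> auto G\<rbrakk> \<Longrightarrow> \<alpha> \<otimes>\<^bsub>AutoGroup G\<^esub> \<beta> = compose (carrier G) \<alpha> \<beta>"
  by (auto simp: AutoGroup_def BijGroup_def auto_def)

lemma Aut_one: "\<one>\<^bsub>AutoGroup G\<^esub> = (\<lambda>x\<in>carrier G. x)"
  by (simp add: AutoGroup_def BijGroup_def)

lemma Aut_carrier: "carrier (AutoGroup G) = auto G"
  by (simp add: AutoGroup_def)

lemma group_Aut: "group (AutoGroup G)"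
  by (rule NA.AutoGroup)

lemma in_Aut0I: "\<lbrakk>\<alpha> \<in> auto G; \<And>g. g \<in> carrier G \<Longrightarrow> P.C g (\<alpha> g)\<rbrakk> \<Longrightarrow> \<alpha> \<in> Aut0 G A"
  by (auto simp: Aut0_eq iso_over_def auto_def Bij_def iso_def)

lemma Aut0_C: "\<alpha> \<in> Aut0 G A \<Longrightarrow> g \<in> carrier G \<Longrightarrow> P.C g (\<alpha> g)"
  by (auto simp: Aut0_eq iso_over_def)

lemma subgroup_Aut0: "subgroup (Aut0 G A) (AutoGroup G)"
proof -
  interpret Au: group "AutoGroup G" by (rule group_Aut)
  show ?thesis
  proof (rule Au.subgroupI)
    show "Aut0 G A \<subseteq> carrier (AutoGroup G)" by (auto simp: Aut_carrier Aut0_auto)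
    have one: "\<one>\<^bsub>AutoGroup G\<^esub> \<in> auto G" using Au.one_closed by (simp add: Aut_carrier)
    have "\<one>\<^bsub>AutoGroup G\<^esub> \<in> Aut0 G A"
      by (rule in_Aut0I[OF one]) (simp add: Aut_one P.C_def)
    then show "Aut0 G A \<noteq> {}" by blast
  next
    fix \<alpha> assume a: "\<alpha> \<in> Aut0 G A"
    let ?i = "inv\<^bsub>AutoGroup G\<^esub> \<alpha>"
    have aa: "\<alpha> \<in> auto G" using a by (rule Aut0_auto)
    have i: "?i \<in> auto G" using Au.inv_closed aa by (simp add: Aut_carrier)
    show "?i \<in> Aut0 G A"
    proof (rule in_Aut0I[OF i])
      fix g assume g: "g \<in> carrier G"
      have "compose (carrier G) \<alpha> ?i = (\<lambda>x\<in>carrier G. x)"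
        using Au.r_inv[of \<alpha>] aa by (simp add: Aut_carrier Aut_one Aut_mult[OF aa i])
      from fun_cong[OF this, of g] have "\<alpha> (?i g) = g" using g by (simp add: compose_def)
      then show "P.C g (?i g)" using Aut0_C[OF a auto_closed[OF i g]] by (simp add: P.C_def)
    qed
  next
    fix \<alpha> \<beta> assume ab: "\<alpha> \<in> Aut0 G A" "\<beta> \<in> Aut0 G A"
    have a: "\<alpha> \<in> auto G" "\<beta> \<in> auto G" using ab by (simp_all add: Aut0_auto)
    have m: "\<alpha> \<otimes>\<^bsub>AutoGroup G\<^esub> \<beta> \<in> auto G" using Au.m_closed a by (simp add: Aut_carrier)
    show "\<alpha> \<otimes>\<^bsub>AutoGroup G\<^esub> \<beta> \<in> Aut0 G A"
    proof (rule in_Aut0I[OF m])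
      fix g assume g: "g \<in> carrier G"
      show "P.C g ((\<alpha> \<otimes>\<^bsub>AutoGroup G\<^esub> \<beta>) g)"
        using Aut0_C[OF ab(2) g] Aut0_C[OF ab(1) auto_closed[OF a(2) g]] g
        by (simp add: Aut_mult[OF a] compose_def P.C_def)
    qed
  qed
qed

text \<open>
  A strong generating set: if \<open>\<Phi>\<close> fixes \<open>1, \<dots>, i - 1\<close>, some \<open>\<alpha> \<in> L\<close> does so too and has the same
  value at \<open>i\<close>. Then \<open>\<alpha>\<inverse> \<Phi>\<close> fixes one point more, and after \<open>n\<close> such steps only the identity is
  left.
\<close>

theorem generate_Aut0:
  assumes L: "L \<subseteq> Aut0 G A"
    and trans: "\<And>i \<Phi>. i \<in> {1..n} \<Longrightarrow> \<Phi> \<in> Aut0 G A \<Longrightarrow> (\<And>g. g \<in> {1..<i} \<Longrightarrow> \<Phi> g = g) \<Longrightarrow>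
      \<exists>\<alpha>\<in>L. (\<forall>g\<in>{1..<i}. \<alpha> g = g) \<and> \<alpha> i = \<Phi> i"
  shows "generate (AutoGroup G) L = Aut0 G A"
proof
  interpret Au: group "AutoGroup G" by (rule group_Aut)
  show "generate (AutoGroup G) L \<subseteq> Aut0 G A"
    by (rule Au.generate_subgroup_incl[OF L subgroup_Aut0])
  have step: "\<Phi> \<in> generate (AutoGroup G) L"
    if "\<Phi> \<in> Aut0 G A" "\<And>g. g \<in> {1..<i} \<Longrightarrow> \<Phi> g = g" "1 \<le> i" for i \<Phi>
    using that
  proof (induction "Suc n - i" arbitrary: i \<Phi>)
    case 0
    have "\<Phi> = (\<lambda>x\<in>carrier G. x)"
    proof (rule extensionalityI[of _ "carrier G"])
      show "\<Phi> \<in> extensional (carrier G)" using 0 by (simp add: Aut0_eq)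
      show "\<Phi> x = (\<lambda>x\<in>carrier G. x) x" if "x \<in> carrier G" for x
        using 0 that by (simp add: carG)
    qed simp
    then show ?case using generate.one[of "AutoGroup G" L] by (simp only: Aut_one)
  next
    case (Suc k)
    then have i: "i \<in> {1..n}" by auto
    obtain \<alpha> where al: "\<alpha> \<in> L" "\<And>g. g \<in> {1..<i} \<Longrightarrow> \<alpha> g = g" "\<alpha> i = \<Phi> i"
      using trans[OF i Suc.prems(1,2)] by blast
    have a0: "\<alpha> \<in> Aut0 G A" using al(1) L by blast
    have aa: "\<alpha> \<in> auto G" "\<Phi> \<in> auto G" using a0 Suc.prems(1) by (simp_all add: Aut0_auto)
    let ?i = "inv\<^bsub>AutoGroup G\<^esub> \<alpha>"
    have ia: "?i \<in> auto G" using Au.inv_closed aa(1) by (simp add: Aut_carrier)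
    let ?g = "?i \<otimes>\<^bsub>AutoGroup G\<^esub> \<Phi>"
    have g0: "?g \<in> Aut0 G A"
      using subgroup.m_closed[OF subgroup_Aut0 subgroup.m_inv_closed[OF subgroup_Aut0 a0] Suc.prems(1)] .
    have comp: "compose (carrier G) ?i \<alpha> = (\<lambda>x\<in>carrier G. x)"
      using Au.l_inv[of \<alpha>] aa(1) by (simp add: Aut_carrier Aut_one Aut_mult[OF ia aa(1)])
    have inv: "?i (\<alpha> x) = x" if "x \<in> carrier G" for x
      using fun_cong[OF comp, of x] that by (simp add: compose_def)
    have fix_: "?g x = x" if x: "x \<in> {1..<Suc i}" for x
    proof -
      have xc: "x \<in> carrier G" using x i by (simp add: carG)
      have "\<Phi> x = \<alpha> x" using x al(2,3) Suc.prems(2) by (cases "x = i") auto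
      then show ?thesis using inv[OF xc] xc by (simp add: Aut_mult[OF ia aa(2)] compose_def)
    qed
    have "?g \<in> generate (AutoGroup G) L"
      by (rule Suc.hyps(1)[of "Suc i"]) (use Suc.hyps(2) g0 fix_ in auto)
    then have "\<alpha> \<otimes>\<^bsub>AutoGroup G\<^esub> ?g \<in> generate (AutoGroup G) L"
      using generate.eng[OF generate.incl[OF al(1)]] by blast
    moreover have "\<alpha> \<otimes>\<^bsub>AutoGroup G\<^esub> ?g = \<Phi>"
      using aa ia by (simp add: Aut_carrier flip: Au.m_assoc)
    ultimately show ?case by simp
  qed
  show "Aut0 G A \<subseteq> generate (AutoGroup G) L"
    using step[of _ 1] by auto
qed

end

section \<open>Reading the input and writing the output\<close>

text \<open>The scalar \<open>p\<close> is the position of the last letter that has been read.\<close>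

definition READ :: "string \<Rightarrow> aexp \<Rightarrow> prog" where
  "READ X a = Do ''p'' (Lit 0) (Add (Var ''p'') (Lit 1)) ;; Do X a (Cell ''input'' (Var ''p''))"

definition TABLE :: "string \<Rightarrow> prog" where
  "TABLE X = For ''i'' ''n'' (For ''i2'' ''n'' (READ X (adr2 (Var ''i'') (Var ''i2''))))"

definition SKIP_LIST :: prog where
  "SKIP_LIST = READ ''m'' (Lit 0) ;; Do ''p'' (Lit 0) (Add (Var ''p'') (Var ''m''))"

text \<open>
  The loop runs up to \<open>n\<close> with a guard, because \<open>m\<close> depends on the input word and cannot serve
  as a loop bound; as \<open>m \<le> n\<close>, the pointer is advanced \<open>m\<close> times by \<open>m\<close>.
\<close>

definition SKIP_TABLE :: prog where
  "SKIP_TABLE = READ ''m'' (Lit 0) ;;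
     For ''i'' ''n'' (If (Less (Var ''m'') (Var ''i'')) Nop (Do ''p'' (Lit 0) (Add (Var ''p'') (Var ''m''))))"

definition PAIRS :: "string \<Rightarrow> prog" where
  "PAIRS X = READ ''m'' (Lit 0) ;;
     For ''i'' ''n'' (If (Less (Var ''m'') (Var ''i'')) Nop (READ ''t'' (Lit 0) ;; READ X (Var ''t'')))"

text \<open>
  The two maps to the quotients and the map between the quotients are all that is kept besides
  the two multiplication tables: they determine compatibility.
\<close>

definition PARSE :: prog where
  "PARSE = TABLE ''mG'' ;; READ ''m'' (Lit 0) ;; TABLE ''mH'' ;; SKIP_LIST ;; SKIP_LIST ;;
     SKIP_TABLE ;; PAIRS ''pi'' ;; SKIP_TABLE ;; PAIRS ''pi0'' ;; PAIRS ''psi''"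

text \<open>The part of the input that has not been read begins with \<open>ys\<close>.\<close>

definition rest :: "state \<Rightarrow> nat list \<Rightarrow> bool" where
  "rest s ys \<longleftrightarrow> (\<forall>i<length ys. s ''input'' (Suc (s ''p'' 0) + i) = ys ! i)"

lemma rest_cong: "s' ''input'' = s ''input'' \<Longrightarrow> s' ''p'' 0 = s ''p'' 0 \<Longrightarrow> rest s' ys = rest s ys"
  by (simp add: rest_def)

lemma rest_skip:
  assumes "rest s (xs @ ys)" "s' ''input'' = s ''input''" "s' ''p'' 0 = s ''p'' 0 + length xs"
  shows "rest s' ys"
  unfolding rest_def
proof (intro allI impI)
  fix i assume i: "i < length ys"
  have "s ''input'' (Suc (s ''p'' 0) + (length xs + i)) = (xs @ ys) ! (length xs + i)"
    using assms(1) i unfolding rest_def by (metis add_less_cancel_left length_append)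
  then show "s' ''input'' (Suc (s' ''p'' 0) + i) = ys ! i"
    using assms(2,3) by (simp add: add.assoc)
qed

lemma run_READ:
  assumes r: "rest s (y # ys)" and X: "X \<noteq> ''p''" "X \<noteq> ''input''"
    and a: "aval a (set_var s ''p'' (s ''p'' 0 + 1)) = k" and s': "s' = run (READ X a) s"
  shows "s' X = (s X)(k := y)" "rest s' ys" "z \<noteq> ''p'' \<Longrightarrow> z \<noteq> X \<Longrightarrow> s' z = s z"
proof -
  have y: "s ''input'' (s ''p'' 0 + 1) = y" using r[unfolded rest_def, THEN spec[of _ 0]] by (simp add: Suc_eq_plus1)
  have eq: "s' = (set_var s ''p'' (s ''p'' 0 + 1))(X := (s X)(k := y))"
    unfolding s' READ_def using a X y by simp
  show "s' X = (s X)(k := y)" by (simp add: eq)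
  show "z \<noteq> ''p'' \<Longrightarrow> z \<noteq> X \<Longrightarrow> s' z = s z" by (simp add: eq)
  show "rest s' ys"
    by (rule rest_skip[of s "[y]"]) (use r X in \<open>simp_all add: eq\<close>)
qed

context grid
begin

lemma run_TABLE:
  assumes s: "ready s" and r: "rest s (concat (map (\<lambda>i. map (f i) [1..<Suc n]) [1..<Suc n]) @ ys)"
    and X: "X \<notin> {''n'', ''N'', ''row'', ''row2'', ''p'', ''input'', ''i'', ''i2''}" and s': "s' = run (TABLE X) s"
  shows "rest s' ys" "i \<in> {1..n} \<Longrightarrow> j \<in> {1..n} \<Longrightarrow> s' X (ad2 i j) = f i j"
proof -
  define R where "R k = concat (map (\<lambda>i. map (f i) [1..<Suc n]) [Suc k..<Suc n]) @ ys" for k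
  have upt: "[Suc k..<Suc n] = Suc k # [Suc (Suc k)..<Suc n]" if "k < n" for k
    using that by (simp add: upt_conv_Cons)
  define I where "I k r \<longleftrightarrow> rest r (R k) \<and> ready r \<and> (\<forall>i\<in>{1..k}. \<forall>j\<in>{1..n}. r X (ad2 i j) = f i j)" for k r
  have rdX: "ready (r(X := v))" if "ready r" for r v using that X by (subst ready_cong[of _ r]) auto
  have "I n s'"
    unfolding s' TABLE_def
  proof (rule run_For_inv[of s "''n''" n I])
    show "s ''n'' 0 = n" by (rule readyD(1)[OF s])
    have "ready (set_var s ''i'' 0)" using s by (subst ready_cong[of _ s]) auto
    moreover have "rest (set_var s ''i'' 0) (R 0)" using r by (subst rest_cong[of _ s]) (auto simp: R_def One_nat_def)
    ultimately show "I 0 (set_var s ''i'' 0)" by (simp add: I_def)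
  next
    fix k q assume k: "k < n" and q: "I k q"
    define J where "J l r \<longleftrightarrow> rest r (map (f (Suc k)) [Suc l..<Suc n] @ R (Suc k)) \<and> ready r \<and> r ''i'' 0 = Suc k \<and>
      (\<forall>i\<in>{1..k}. \<forall>j\<in>{1..n}. r X (ad2 i j) = f i j) \<and> (\<forall>j\<in>{1..l}. r X (ad2 (Suc k) j) = f (Suc k) j)" for l r
    have "J n (run (For ''i2'' ''n'' (READ X (adr2 (Var ''i'') (Var ''i2'')))) (set_var q ''i'' (Suc k)))"
    proof (rule run_For_inv[of _ "''n''" n J])
      let ?q = "set_var (set_var q ''i'' (Suc k)) ''i2'' 0"
      have rd: "ready q" using q by (simp add: I_def)
      show "set_var q ''i'' (Suc k) ''n'' 0 = n" using readyD(1)[OF rd] by simp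
      have "ready ?q" using rd by (subst ready_cong[of _ q]) auto
      moreover have "rest ?q (map (f (Suc k)) [Suc 0..<Suc n] @ R (Suc k))"
      proof -
        have "R k = map (f (Suc k)) [Suc 0..<Suc n] @ R (Suc k)" unfolding R_def upt[OF k] by (simp add: One_nat_def)
        then have "rest q (map (f (Suc k)) [Suc 0..<Suc n] @ R (Suc k))" using q by (simp add: I_def)
        then show ?thesis by (subst rest_cong[of _ q]) auto
      qed
      ultimately show "J 0 ?q" using q X by (simp add: J_def I_def)
    next
      fix l p assume l: "l < n" and p: "J l p"
      let ?p = "set_var p ''i2'' (Suc l)"
      define p' where "p' = run (READ X (adr2 (Var ''i'') (Var ''i2''))) ?p"
      have rd: "ready p" using p by (simp add: J_def)
      have rp: "rest ?p (f (Suc k) (Suc l) # map (f (Suc k)) [Suc (Suc l)..<Suc n] @ R (Suc k))"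
        using p unfolding J_def upt[OF l] by (subst rest_cong[of _ p]) auto
      have row: "p ''row'' (Suc k) = Suc k * N" using readyD(3)[OF rd, of "Suc k"] k nN by simp
      have a: "aval (adr2 (Var ''i'') (Var ''i2'')) (set_var ?p ''p'' (?p ''p'' 0 + 1)) = ad2 (Suc k) (Suc l)"
        using p row by (simp add: J_def ad2_def)
      have X': "X \<noteq> ''p''" "X \<noteq> ''input''" using X by auto
      note rr = run_READ[OF rp X' a p'_def]
      have pX: "p' X = (p X)(ad2 (Suc k) (Suc l) := f (Suc k) (Suc l))" using rr(1) X by simp
      have fr: "p' z = p z" if "z \<notin> {''p'', X, ''i2''}" for z using rr(3)[of z] that by simp
      have old: "p' X (ad2 i j) = p X (ad2 i j)" if "i \<noteq> Suc k \<or> j \<noteq> Suc l" "j \<in> {1..n}" for i j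
        using that ad2_inj[of i j "Suc k" "Suc l"] l nN by (auto simp: pX)
      have "\<forall>z\<in>{''n'', ''N'', ''row'', ''row2''}. p' z = p z" by (intro ballI fr) (use X in auto)
      then have "ready p'" using rd by (subst ready_cong[of _ p])
      moreover have "p' ''i'' = p ''i''" by (rule fr) (use X in auto)
      then have "p' ''i'' 0 = Suc k" using p by (simp add: J_def)
      moreover have "\<forall>i\<in>{1..k}. \<forall>j\<in>{1..n}. p' X (ad2 i j) = f i j"
      proof (intro ballI)
        fix i j assume "i \<in> {1..k}" "j \<in> {1..n}"
        then show "p' X (ad2 i j) = f i j" using old[of i j] p by (simp add: J_def)
      qed
      moreover have "p' X (ad2 (Suc k) j) = f (Suc k) j" if "j \<in> {1..Suc l}" for j
      proof (cases "j = Suc l")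
        case True
        then show ?thesis by (simp add: pX)
      next
        case False
        then show ?thesis using old[of "Suc k" j] that p l by (simp add: J_def)
      qed
      ultimately show "J (Suc l) (run (READ X (adr2 (Var ''i'') (Var ''i2''))) ?p)"
        using rr(2) by (simp add: J_def p'_def[symmetric])
    qed
    then show "I (Suc k) (run (For ''i2'' ''n'' (READ X (adr2 (Var ''i'') (Var ''i2'')))) (set_var q ''i'' (Suc k)))"
      unfolding J_def I_def by (simp add: le_Suc_eq) (auto simp: le_Suc_eq)
  qed
  then show "rest s' ys" "i \<in> {1..n} \<Longrightarrow> j \<in> {1..n} \<Longrightarrow> s' X (ad2 i j) = f i j"
    by (auto simp: I_def R_def)
qed

end

lemma run_SKIP_LIST:
  assumes "rest s (list_word xs @ ys)" "s' = run SKIP_LIST s"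
  shows "rest s' ys"
proof -
  define s1 where "s1 = run (READ ''m'' (Lit 0)) s"
  have s': "s' = run (Do ''p'' (Lit 0) (Add (Var ''p'') (Var ''m''))) s1"
    unfolding assms(2) SKIP_LIST_def s1_def by (simp only: run.simps(3))
  have r: "rest s (length xs # xs @ ys)" using assms(1) by (simp add: list_word_def)
  have r1: "rest s1 (xs @ ys)" "s1 ''m'' 0 = length xs"
    using run_READ(1,2)[OF r _ _ _ s1_def, where k=0] by simp_all
  show ?thesis by (rule rest_skip[OF r1(1)]) (simp_all add: s' r1(2))
qed

lemma run_SKIP_TABLE:
  assumes n: "s ''n'' 0 = n" and Q: "card (carrier Q) \<le> n" and r: "rest s (cayley_word Q @ ys)" and s': "s' = run SKIP_TABLE s"
  shows "rest s' ys"
proof -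
  define m where "m = card (carrier Q)"
  define row where "row i = map (\<lambda>j. i \<otimes>\<^bsub>Q\<^esub> j) [1..<Suc m]" for i
  define s1 where "s1 = run (READ ''m'' (Lit 0)) s"
  have s'1: "s' = run (For ''i'' ''n'' (If (Less (Var ''m'') (Var ''i'')) Nop (Do ''p'' (Lit 0) (Add (Var ''p'') (Var ''m''))))) s1"
    unfolding s' SKIP_TABLE_def s1_def by (simp only: run.simps(3))
  have "cayley_word Q = m # concat (map row [1..<Suc m])"
    by (simp add: cayley_word_def m_def row_def[abs_def] Let_def)
  then have r0: "rest s (m # concat (map row [1..<Suc m]) @ ys)" using r by simp
  have r1: "rest s1 (concat (map row [1..<Suc m]) @ ys)" "s1 ''m'' 0 = m" "s1 ''n'' 0 = n"
    using run_READ[OF r0 _ _ _ s1_def, where k=0] n by simp_all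
  define I where "I k r \<longleftrightarrow> rest r (concat (map row [Suc (min k m)..<Suc m]) @ ys) \<and> r ''m'' 0 = m" for k r
  have "I n s'"
    unfolding s'1
  proof (rule run_For_inv[of s1 "''n''" n I])
    show "s1 ''n'' 0 = n" by (rule r1(3))
    have "rest (set_var s1 ''i'' 0) (concat (map row [1..<Suc m]) @ ys)" using r1(1) by (subst rest_cong[of _ s1]) auto
    then show "I 0 (set_var s1 ''i'' 0)" using r1(2) by (simp add: I_def One_nat_def)
  next
    fix k q assume k: "k < n" and q: "I k q"
    let ?q = "set_var q ''i'' (Suc k)" and ?b = "If (Less (Var ''m'') (Var ''i'')) Nop (Do ''p'' (Lit 0) (Add (Var ''p'') (Var ''m'')))"
    show "I (Suc k) (run ?b ?q)"
    proof (cases "m < Suc k")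
      case True
      then have "run ?b ?q = ?q" using q by (simp add: I_def)
      moreover have "min (Suc k) m = min k m" using True by simp
      moreover have "rest ?q (concat (map row [Suc (min k m)..<Suc m]) @ ys)" using q by (subst rest_cong[of _ q]) (auto simp: I_def)
      ultimately show ?thesis using q by (simp add: I_def)
    next
      case False
      then have km: "k < m" "min k m = k" "min (Suc k) m = Suc k" by auto
      have b: "run ?b ?q = set_var ?q ''p'' (q ''p'' 0 + m)" using q False by (simp add: I_def)
      have up: "[Suc k..<Suc m] = Suc k # [Suc (Suc k)..<Suc m]" using km(1) by (simp add: upt_conv_Cons)
      have "rest q (row (Suc k) @ concat (map row [Suc (Suc k)..<Suc m]) @ ys)"
        using q unfolding I_def km(2) up by simp
      then have "rest (set_var ?q ''p'' (q ''p'' 0 + m)) (concat (map row [Suc (Suc k)..<Suc m]) @ ys)"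
        by (rule rest_skip) (simp_all add: row_def)
      then show ?thesis unfolding b I_def km using q by (simp add: I_def)
    qed
  qed
  then show ?thesis using Q by (simp add: I_def m_def)
qed

lemma run_PAIRS:
  assumes n: "s ''n'' 0 = n" and len: "length ps \<le> n" and r: "rest s (pairs_word ps @ ys)"
    and d: "distinct (map fst ps)" and X: "X \<notin> {''n'', ''m'', ''t'', ''i'', ''p'', ''input''}" and s': "s' = run (PAIRS X) s"
  shows "rest s' ys" "(x, y) \<in> set ps \<Longrightarrow> s' X x = y"
proof -
  define m where "m = length ps"
  define w where "w ps = concat (map (\<lambda>(x, y). [x, y]) ps)" for ps :: "(nat \<times> nat) list"
  define s1 where "s1 = run (READ ''m'' (Lit 0)) s"
  define b where "b = If (Less (Var ''m'') (Var ''i'')) Nop (READ ''t'' (Lit 0) ;; READ X (Var ''t''))"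
  have s'1: "s' = run (For ''i'' ''n'' b) s1"
    unfolding s' PAIRS_def s1_def b_def by (simp only: run.simps(3))
  have r0: "rest s (m # w ps @ ys)" using r by (simp add: pairs_word_def m_def w_def)
  have r1: "rest s1 (w ps @ ys)" "s1 ''m'' 0 = m" "s1 ''n'' 0 = n"
    using run_READ[OF r0 _ _ _ s1_def, where k=0] n by simp_all
  define I where "I k r \<longleftrightarrow> rest r (w (drop k ps) @ ys) \<and> r ''m'' 0 = m \<and> (\<forall>(x, y)\<in>set (take k ps). r X x = y)" for k r
  have "I n s'"
    unfolding s'1
  proof (rule run_For_inv[of s1 "''n''" n I])
    show "s1 ''n'' 0 = n" by (rule r1(3))
    have "rest (set_var s1 ''i'' 0) (w ps @ ys)" using r1(1) by (subst rest_cong[of _ s1]) auto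
    then show "I 0 (set_var s1 ''i'' 0)" using r1(2) by (simp add: I_def)
  next
    fix k q assume k: "k < n" and q: "I k q"
    let ?q = "set_var q ''i'' (Suc k)"
    show "I (Suc k) (run b ?q)"
    proof (cases "m < Suc k")
      case True
      then have "run b ?q = ?q" using q by (simp add: I_def b_def)
      moreover have "drop (Suc k) ps = drop k ps" "take (Suc k) ps = take k ps" using True by (simp_all add: m_def)
      moreover have "rest ?q (w (drop k ps) @ ys)" using q by (subst rest_cong[of _ q]) (auto simp: I_def)
      ultimately show ?thesis using q X by (simp add: I_def)
    next
      case False
      then have km: "k < length ps" by (simp add: m_def)
      obtain x y where xy: "ps ! k = (x, y)" by (cases "ps ! k")
      have dr: "drop k ps = (x, y) # drop (Suc k) ps" using km xy by (simp flip: Cons_nth_drop_Suc)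
      have tk: "take (Suc k) ps = take k ps @ [(x, y)]" using km xy by (simp add: take_Suc_conv_app_nth)
      have rq: "rest ?q (x # y # w (drop (Suc k) ps) @ ys)"
        using q unfolding I_def dr by (subst rest_cong[of _ q]) (auto simp: w_def)
      define q1 where "q1 = run (READ ''t'' (Lit 0)) ?q"
      define q2 where "q2 = run (READ X (Var ''t'')) q1"
      have b: "run b ?q = q2" using q False by (simp add: I_def b_def q1_def q2_def)
      note a1 = run_READ[OF rq _ _ _ q1_def, where k=0]
      have q1: "rest q1 (y # w (drop (Suc k) ps) @ ys)" "q1 ''t'' 0 = x" "\<And>z. z \<notin> {''p'', ''t'', ''i''} \<Longrightarrow> q1 z = q z"
        using a1 by simp_all
      have X': "X \<noteq> ''p''" "X \<noteq> ''input''" "''t'' \<noteq> ''p''" using X by auto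
      have a: "aval (Var ''t'') (set_var q1 ''p'' (q1 ''p'' 0 + 1)) = x" using q1(2) by simp
      note a2 = run_READ[OF q1(1) X'(1,2) a q2_def]
      have q2X: "q2 X = (q X)(x := y)" using a2(1) q1(3)[of X] X by auto
      have new: "x \<noteq> x'" if "(x', y') \<in> set (take k ps)" for x' y'
      proof -
        have "distinct (map fst (take (Suc k) ps))" using d by (simp add: take_map[symmetric])
        then have "x \<notin> fst ` set (take k ps)" by (simp add: tk)
        then show ?thesis using that by force
      qed
      have "q2 ''m'' 0 = m" using a2(3)[of "''m''"] q1(3)[of "''m''"] X q by (auto simp: I_def)
      moreover have "\<forall>(x', y')\<in>set (take (Suc k) ps). q2 X x' = y'"
      proof (clarify)
        fix x' y' assume "(x', y') \<in> set (take (Suc k) ps)"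
        then consider "(x', y') \<in> set (take k ps)" | "x' = x" "y' = y" unfolding tk by auto
        then show "q2 X x' = y'"
        proof cases
          case 1
          have "\<forall>(x, y)\<in>set (take k ps). q X x = y" using q by (simp add: I_def)
          from bspec[OF this 1] have "q X x' = y'" by simp
          then show ?thesis using new[OF 1] by (simp add: q2X)
        next
          case 2
          then show ?thesis by (simp add: q2X)
        qed
      qed
      ultimately show ?thesis unfolding b using a2(2) by (simp add: I_def)
    qed
  qed
  then show "rest s' ys" "(x, y) \<in> set ps \<Longrightarrow> s' X x = y" using len by (auto simp: I_def w_def)
qed

definition EMIT :: "aexp \<Rightarrow> prog" where
  "EMIT e = Do ''output'' (Lit 0) (Add (Var ''output'') (Lit 1)) ;; Do ''output'' (Var ''output'') e"

definition EMIT_MAP :: prog where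
  "EMIT_MAP = EMIT (Var ''n'') ;; For ''o'' ''n'' (EMIT (Var ''o'') ;; EMIT (Cell ''F'' (Var ''o'')))"

lemma output_word_cong: "s' ''output'' = s ''output'' \<Longrightarrow> output_word s' = output_word s"
  by (simp add: output_word_def)

lemma run_EMIT:
  assumes e: "aval e (set_var s ''output'' (s ''output'' 0 + 1)) = v" and s': "s' = run (EMIT e) s"
  shows "output_word s' = output_word s @ [v]" "z \<noteq> ''output'' \<Longrightarrow> s' z = s z"
proof -
  let ?k = "s ''output'' 0 + 1"
  have eq: "s' = s(''output'' := (s ''output'')(0 := ?k, ?k := v))"
    unfolding s' EMIT_def using e by simp
  then show "z \<noteq> ''output'' \<Longrightarrow> s' z = s z" by simp
  have "map ((s ''output'')(0 := ?k, ?k := v)) [1..<Suc (s ''output'' 0)] = map (s ''output'') [1..<Suc (s ''output'' 0)]"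
    by (rule map_cong) auto
  moreover have "[1..<Suc ?k] = [1..<Suc (s ''output'' 0)] @ [?k]"
    unfolding Suc_eq_plus1[symmetric] by (rule upt_Suc_append) simp
  ultimately show "output_word s' = output_word s @ [v]"
    by (simp add: output_word_def eq)
qed

definition graph :: "nat \<Rightarrow> (nat \<Rightarrow> nat) \<Rightarrow> (nat \<times> nat) list" where
  "graph n f = map (\<lambda>g. (g, f g)) [1..<Suc n]"

lemma run_EMIT_MAP:
  assumes n: "s ''n'' 0 = n" and s': "s' = run EMIT_MAP s"
  shows "output_word s' = output_word s @ pairs_word (graph n (s ''F''))"
proof -
  define s1 where "s1 = run (EMIT (Var ''n'')) s"
  have s'1: "s' = run (For ''o'' ''n'' (EMIT (Var ''o'') ;; EMIT (Cell ''F'' (Var ''o'')))) s1"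
    unfolding s' EMIT_MAP_def s1_def by (simp only: run.simps(3))
  have o1: "output_word s1 = output_word s @ [n]" by (rule run_EMIT(1)[OF _ s1_def]) (simp add: n)
  have fr1: "s1 z = s z" if "z \<noteq> ''output''" for z by (rule run_EMIT(2)[OF refl s1_def that])
  define I where "I k r \<longleftrightarrow> r ''F'' = s ''F'' \<and>
    output_word r = output_word s @ n # concat (map (\<lambda>g. [g, s ''F'' g]) [1..<Suc k])" for k r
  have "I n s'"
    unfolding s'1
  proof (rule run_For_inv[of s1 "''n''" n I])
    show "s1 ''n'' 0 = n" using n fr1 by simp
    have "output_word (set_var s1 ''o'' 0) = output_word s1" by (rule output_word_cong) simp
    then show "I 0 (set_var s1 ''o'' 0)" unfolding I_def o1 using fr1 by simp
  next
    fix k q assume q: "I k q"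
    let ?q = "set_var q ''o'' (Suc k)"
    define q1 where "q1 = run (EMIT (Var ''o'')) ?q"
    define q2 where "q2 = run (EMIT (Cell ''F'' (Var ''o''))) q1"
    have o1: "output_word q1 = output_word ?q @ [Suc k]" by (rule run_EMIT(1)[OF _ q1_def]) simp
    have o0: "output_word ?q = output_word q" by (rule output_word_cong) simp
    have fr: "q1 z = ?q z" if "z \<noteq> ''output''" for z by (rule run_EMIT(2)[OF refl q1_def that])
    have o2: "output_word q2 = output_word q1 @ [s ''F'' (Suc k)]"
      by (rule run_EMIT(1)[OF _ q2_def]) (use q fr in \<open>simp add: I_def\<close>)
    have "q2 ''F'' = q1 ''F''" by (rule run_EMIT(2)[OF refl q2_def]) simp
    then have F2: "q2 ''F'' = s ''F''" using q fr[of "''F''"] by (simp add: I_def)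
    have oq: "output_word q = output_word s @ n # concat (map (\<lambda>g. [g, s ''F'' g]) [1..<Suc k])" using q by (simp add: I_def)
    have up: "[1..<Suc (Suc k)] = [1..<Suc k] @ [Suc k]" by (rule upt_Suc_append) simp
    have "I (Suc k) q2" unfolding I_def o2 o1 o0 oq up using F2 by simp
    then show "I (Suc k) (run (EMIT (Var ''o'') ;; EMIT (Cell ''F'' (Var ''o''))) ?q)"
      unfolding q2_def q1_def by (simp only: run.simps(3))
  qed
  then show ?thesis by (simp add: I_def pairs_word_def graph_def comp_def)
qed

section \<open>The algorithm\<close>

definition SIZE :: prog where
  "SIZE = Do ''n'' (Lit 0) (Cell ''input'' (Lit 1)) ;; Do ''p'' (Lit 0) (Lit 1)"

definition SQUARE :: prog where
  "SQUARE = For ''i'' ''n'' (Do ''N'' (Lit 0) (Add (Var ''N'') (Var ''n'')))"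

definition ROWS :: prog where
  "ROWS = For ''i'' ''N'' (Do ''row'' (Var ''i'') (Add (Cell ''row'' (Sub (Var ''i'') (Lit 1))) (Var ''N''))) ;;
     For ''i'' ''N'' (Do ''row2'' (Var ''i'') (Add (Cell ''row2'' (Sub (Var ''i'') (Lit 1))) (Cell ''row'' (Var ''N''))))"

definition ENUMERATE :: prog where
  "ENUMERATE = For ''i'' ''n'' (For ''i2'' ''n'' (Do ''q'' (Lit 0) (Add (Var ''q'') (Lit 1)) ;;
     Do ''P1'' (Var ''q'') (Var ''i'') ;; Do ''P2'' (Var ''q'') (Var ''i2'')))"

definition COMPATIBLE :: "aexp \<Rightarrow> aexp \<Rightarrow> prog" where
  "COMPATIBLE e1 e2 = For ''a1'' ''n'' (For ''b1'' ''n'' (Do ''cp'' (adr2 (Var ''a1'') (Var ''b1'')) (eqE e1 e2)))"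

text \<open>
  The entry of \<open>row\<close> is \<open>row 0 = 0\<close> if \<open>a1 < gi\<close> and \<open>row 1 = N\<close> otherwise. In the second case
  the truncated difference is 0, so exactly the elements before \<open>gi\<close> are fixed and the others
  are undefined.
\<close>

definition PREFIX :: prog where
  "PREFIX = For ''a1'' ''n'' (Do ''F'' (Var ''a1'')
       (Sub (Var ''a1'') (Cell ''row'' (Sub (Lit 1) (Sub (Var ''gi'') (Var ''a1'')))))) ;;
     Do ''F'' (Var ''gi'') (Var ''gh'')"

text \<open>
  If the prefix does not extend to an automorphism, the identity takes its place. So the number
  of generators is \<open>N\<close> in all cases and can be written before they are known.
\<close>

definition GENERATOR :: prog where
  "GENERATOR = PREFIX ;; COMPLETE ;;
     If (Equal (Var ''res'') (Lit 1)) Nop (For ''a1'' ''n'' (Do ''F'' (Var ''a1'') (Var ''a1''))) ;; EMIT_MAP"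

definition GENERATORS :: prog where
  "GENERATORS = For ''gi'' ''n'' (For ''gh'' ''n'' GENERATOR)"

definition AUTOMORPHISMS :: prog where
  "AUTOMORPHISMS = EMIT (Lit 1) ;; EMIT_MAP ;; EMIT (Var ''N'') ;; COPY ''mH'' ''mG'' ;;
     COMPATIBLE (Cell ''pi'' (Var ''a1'')) (Cell ''pi'' (Var ''b1'')) ;; GENERATORS"

text \<open>
  The elements \<open>g\<close> and \<open>h\<close> are compatible iff the number of the image of the coset of \<open>g\<close> is the
  number of the coset of \<open>h\<close>.
\<close>

definition SOLVE :: prog where
  "SOLVE = COMPATIBLE (Cell ''psi'' (Cell ''pi'' (Var ''a1''))) (Cell ''pi0'' (Var ''b1'')) ;;
     For ''a1'' ''n'' (Do ''F'' (Var ''a1'') (Lit 0)) ;; COMPLETE ;;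
     If (Equal (Var ''res'') (Lit 1)) AUTOMORPHISMS (EMIT (Lit 0))"

definition MAIN :: prog where
  "MAIN = ROWS ;; ENUMERATE ;; PARSE ;; SOLVE"

lemma run_SQUARE:
  assumes "s ''n'' 0 = n" "s ''N'' 0 = 0" "s' = run SQUARE s"
  shows "s' ''N'' 0 = n * n"
proof -
  define I where "I k r \<longleftrightarrow> r ''n'' 0 = n \<and> r ''N'' 0 = k * n" for k and r :: state
  have "I n s'"
    unfolding assms(3) SQUARE_def by (rule run_For_inv) (use assms(1,2) in \<open>simp_all add: I_def\<close>)
  then show ?thesis by (simp add: I_def)
qed

context grid
begin

lemma run_ROWS:
  assumes s: "s ''n'' 0 = n" "s ''N'' 0 = N" "s ''row'' 0 = 0" "s ''row2'' 0 = 0" and s': "s' = run ROWS s"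
  shows "ready s'"
proof -
  define s1 where "s1 = run (For ''i'' ''N'' (Do ''row'' (Var ''i'') (Add (Cell ''row'' (Sub (Var ''i'') (Lit 1))) (Var ''N'')))) s"
  have s'1: "s' = run (For ''i'' ''N'' (Do ''row2'' (Var ''i'') (Add (Cell ''row2'' (Sub (Var ''i'') (Lit 1))) (Cell ''row'' (Var ''N''))))) s1"
    unfolding s' ROWS_def s1_def by (simp only: run.simps(3))
  define I where "I k r \<longleftrightarrow> r ''N'' 0 = N \<and> (\<forall>i\<le>k. r ''row'' i = i * N)" for k and r :: state
  have "I N s1"
    unfolding s1_def
    by (rule run_For_inv[of s "''N''" N I]) (use s in \<open>simp_all add: I_def le_Suc_eq\<close>)
  then have row: "s1 ''row'' i = i * N" if "i \<le> N" for i using that by (simp add: I_def)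
  have fr1: "s1 z = s z" if "z \<notin> {''i'', ''row''}" for z
    unfolding s1_def by (rule run_frame) (use that in simp)
  define J where "J k r \<longleftrightarrow> r ''N'' 0 = N \<and> r ''row'' = s1 ''row'' \<and> (\<forall>i\<le>k. r ''row2'' i = i * N * N)" for k and r :: state
  have "J N s'"
    unfolding s'1
    by (rule run_For_inv[of s1 "''N''" N J]) (use s fr1 row in \<open>simp_all add: J_def le_Suc_eq add_mult_distrib\<close>)
  moreover have "s' ''n'' 0 = n"
    using run_frame[of "''n''" ROWS s] s by (simp add: s' ROWS_def del: run.simps)
  ultimately show ?thesis using row by (simp add: ready_def J_def)
qed

lemma run_ENUMERATE:
  assumes s: "s ''n'' 0 = n" "s ''q'' 0 = 0" and s': "s' = run ENUMERATE s"
  shows "j \<in> {1..N} \<Longrightarrow> s' ''P1'' j \<in> {1..n} \<and> s' ''P2'' j \<in> {1..n}"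
    and "\<lbrakk>g \<in> {1..n}; h \<in> {1..n}\<rbrakk> \<Longrightarrow> \<exists>j\<in>{1..N}. s' ''P1'' j = g \<and> s' ''P2'' j = h"
proof -
  define b where "b = (Do ''q'' (Lit 0) (Add (Var ''q'') (Lit 1)) ;; Do ''P1'' (Var ''q'') (Var ''i'') ;; Do ''P2'' (Var ''q'') (Var ''i2''))"
  define R where "R m D r \<longleftrightarrow> r ''n'' 0 = n \<and> r ''q'' 0 = m \<and>
    (\<forall>j\<in>{1..m}. r ''P1'' j \<in> {1..n} \<and> r ''P2'' j \<in> {1..n}) \<and>
    (\<forall>g h. (g, h) \<in> D \<longrightarrow> (\<exists>j\<in>{1..m}. r ''P1'' j = g \<and> r ''P2'' j = h))" for m D and r :: state
  have Rcong: "R m D r'" if "R m D r" "\<forall>z\<in>{''n'', ''q'', ''P1'', ''P2''}. r' z = r z" for m D r r'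
    using that by (simp add: R_def)
  have "R (n * n) ({1..n} \<times> {1..n}) s'"
    unfolding s' ENUMERATE_def b_def[symmetric]
  proof (rule run_For_inv[of s "''n''" n "\<lambda>k. R (k * n) ({1..k} \<times> {1..n})"])
    show "s ''n'' 0 = n" by (rule s(1))
    show "R (0 * n) ({1..0} \<times> {1..n}) (set_var s ''i'' 0)" using s by (simp add: R_def)
  next
    fix k r assume k: "k < n" and r: "R (k * n) ({1..k} \<times> {1..n}) r"
    define J where "J l r \<longleftrightarrow> R (k * n + l) ({1..k} \<times> {1..n} \<union> {Suc k} \<times> {1..l}) r \<and> r ''i'' 0 = Suc k" for l r
    have "J n (run (For ''i2'' ''n'' b) (set_var r ''i'' (Suc k)))"
    proof (rule run_For_inv[of _ "''n''" n J])
      show "set_var r ''i'' (Suc k) ''n'' 0 = n" using r by (simp add: R_def)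
      have "R (k * n) ({1..k} \<times> {1..n}) (set_var (set_var r ''i'' (Suc k)) ''i2'' 0)" by (rule Rcong[OF r]) simp
      then show "J 0 (set_var (set_var r ''i'' (Suc k)) ''i2'' 0)" by (simp add: J_def)
    next
      fix l p assume l: "l < n" and p: "J l p"
      let ?p = "set_var p ''i2'' (Suc l)" and ?m = "k * n + l"
      have Rp: "R ?m ({1..k} \<times> {1..n} \<union> {Suc k} \<times> {1..l}) p" and ip: "p ''i'' 0 = Suc k" using p by (simp_all add: J_def)
      define p' where "p' = run b ?p"
      have q: "p' ''q'' 0 = Suc ?m" "p' ''P1'' = (p ''P1'')(Suc ?m := Suc k)" "p' ''P2'' = (p ''P2'')(Suc ?m := Suc l)"
        "p' ''n'' = p ''n''" "p' ''i'' = p ''i''"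
        using Rp ip by (simp_all add: p'_def b_def R_def Suc_eq_plus1)
      have set: "{1..Suc ?m} = insert (Suc ?m) {1..?m}" by auto
      have D: "{1..k} \<times> {1..n} \<union> {Suc k} \<times> {1..Suc l} = insert (Suc k, Suc l) ({1..k} \<times> {1..n} \<union> {Suc k} \<times> {1..l})"
        by auto
      have pts: "p' ''P1'' j = p ''P1'' j" "p' ''P2'' j = p ''P2'' j" if "j \<in> {1..?m}" for j using that by (auto simp: q)
      have "R (Suc ?m) ({1..k} \<times> {1..n} \<union> {Suc k} \<times> {1..Suc l}) p'"
        unfolding R_def
      proof (intro conjI)
        show "p' ''n'' 0 = n" using Rp q(4) by (simp add: R_def)
        show "p' ''q'' 0 = Suc ?m" by (rule q(1))
        show "\<forall>j\<in>{1..Suc ?m}. p' ''P1'' j \<in> {1..n} \<and> p' ''P2'' j \<in> {1..n}"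
        proof
          fix j assume "j \<in> {1..Suc ?m}"
          then consider "j = Suc ?m" | "j \<in> {1..?m}" unfolding set by blast
          then show "p' ''P1'' j \<in> {1..n} \<and> p' ''P2'' j \<in> {1..n}"
          proof cases
            case 1
            then show ?thesis using k l by (simp add: q)
          next
            case 2
            then show ?thesis using Rp pts[OF 2] by (simp add: R_def)
          qed
        qed
        show "\<forall>g h. (g, h) \<in> {1..k} \<times> {1..n} \<union> {Suc k} \<times> {1..Suc l} \<longrightarrow> (\<exists>j\<in>{1..Suc ?m}. p' ''P1'' j = g \<and> p' ''P2'' j = h)"
          unfolding D
        proof (intro allI impI)
          fix g h assume "(g, h) \<in> insert (Suc k, Suc l) ({1..k} \<times> {1..n} \<union> {Suc k} \<times> {1..l})"
          then consider "g = Suc k" "h = Suc l" | "(g, h) \<in> {1..k} \<times> {1..n} \<union> {Suc k} \<times> {1..l}" by blast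
          then show "\<exists>j\<in>{1..Suc ?m}. p' ''P1'' j = g \<and> p' ''P2'' j = h"
          proof cases
            case 1
            then show ?thesis by (intro bexI[of _ "Suc ?m"]) (simp_all add: q)
          next
            case 2
            then obtain j where j: "j \<in> {1..?m}" "p ''P1'' j = g" "p ''P2'' j = h" using Rp unfolding R_def by blast
            then show ?thesis using pts[OF j(1)] by (intro bexI[of _ j]) simp_all
          qed
        qed
      qed
      then show "J (Suc l) (run b ?p)" using q(5) ip by (simp add: J_def flip: p'_def)
    qed
    moreover have "k * n + n = Suc k * n" "{1..k} \<times> {1..n} \<union> {Suc k} \<times> {1..n} = {1..Suc k} \<times> {1..n}" by auto
    ultimately show "R (Suc k * n) ({1..Suc k} \<times> {1..n}) (run (For ''i2'' ''n'' b) (set_var r ''i'' (Suc k)))"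
      by (simp only: J_def)
  qed
  then have R: "\<forall>j\<in>{1..N}. s' ''P1'' j \<in> {1..n} \<and> s' ''P2'' j \<in> {1..n}"
    "\<forall>g h. (g, h) \<in> {1..n} \<times> {1..n} \<longrightarrow> (\<exists>j\<in>{1..N}. s' ''P1'' j = g \<and> s' ''P2'' j = h)"
    unfolding R_def N by blast+
  show "j \<in> {1..N} \<Longrightarrow> s' ''P1'' j \<in> {1..n} \<and> s' ''P2'' j \<in> {1..n}" by (rule bspec[OF R(1)])
  show "\<lbrakk>g \<in> {1..n}; h \<in> {1..n}\<rbrakk> \<Longrightarrow> \<exists>j\<in>{1..N}. s' ''P1'' j = g \<and> s' ''P2'' j = h"
    using R(2) by simp
qed

lemma run_COMPATIBLE:
  assumes s: "ready s"
    and e1: "\<And>i k r. \<lbrakk>i \<in> {1..n}; k \<in> {1..n}; agree {''a1'', ''b1'', ''cp''} s r; r ''a1'' 0 = i; r ''b1'' 0 = k\<rbrakk> \<Longrightarrow> aval e1 r = u i"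
    and e2: "\<And>i k r. \<lbrakk>i \<in> {1..n}; k \<in> {1..n}; agree {''a1'', ''b1'', ''cp''} s r; r ''a1'' 0 = i; r ''b1'' 0 = k\<rbrakk> \<Longrightarrow> aval e2 r = v k"
    and s': "s' = run (COMPATIBLE e1 e2) s" and ik: "i \<in> {1..n}" "k \<in> {1..n}"
  shows "s' ''cp'' (ad2 i k) = (if u i = v k then 1 else 0)"
proof -
  have A: "aval (adr2 (Var ''a1'') (Var ''b1'')) r = ad2 i k"
    if "i \<in> {1..n}" "k \<in> {1..n}" "agree {''a1'', ''b1'', ''cp''} s r" "r ''a1'' 0 = i" "r ''b1'' 0 = k" for i k r
    using that(1,4,5) agreeD[OF that(3), of "''row''"] readyD(3)[OF s, of i] nN by (simp add: ad2_def)
  have E: "aval (eqE e1 e2) r = (if u i = v k then 1 else 0)"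
    if "i \<in> {1..n}" "k \<in> {1..n}" "agree {''a1'', ''b1'', ''cp''} s r" "r ''a1'' 0 = i" "r ''b1'' 0 = k"
      "r ''cp'' (ad2 i k) = s ''cp'' (ad2 i k)" for i k r
    using e1[OF that(1-5)] e2[OF that(1-5)] by auto
  have inj: "i = i' \<and> k = k'"
    if "i \<in> {1..n}" "k \<in> {1..n}" "i' \<in> {1..n}" "k' \<in> {1..n}" "ad2 i k = ad2 i' k'" for i i' k k'
    using ad2_inj[of i k i' k'] that nN by auto
  have n: "s ''n'' 0 = n" by (rule readyD(1)[OF s])
  show ?thesis
    unfolding s' COMPATIBLE_def
    by (rule run_fill2(1)[where A=ad2 and E="\<lambda>i k. if u i = v k then 1 else 0" and m=n and m'=n])
      (fact n, fact n, simp, simp, simp, simp, simp, simp, fact A, fact E, fact inj, fact ik, fact ik)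
qed

end

lemma writes_EMIT: "writes (EMIT e) = {''output''}"
  by (simp add: EMIT_def)

lemma writes_EMIT_MAP: "writes EMIT_MAP = {''output'', ''o''}"
  by (auto simp: EMIT_MAP_def writes_EMIT)

context matching
begin

definition pre :: "nat \<Rightarrow> nat \<Rightarrow> nat \<Rightarrow> nat" where
  "pre i h g = (if g < i then g else if g = i then h else 0)"

lemma extends_cong: "(\<And>g. g \<in> {1..n} \<Longrightarrow> F g = F' g) \<Longrightarrow> extends f F = extends f F'"
  by (simp add: extends_def)

lemma extendible_cong: "(\<And>g. g \<in> {1..n} \<Longrightarrow> F g = F' g) \<Longrightarrow> extendible F = extendible F'"
  using extends_cong[of F F'] by (simp add: extendible_def)

lemma graph_cong: "(\<And>g. g \<in> {1..n} \<Longrightarrow> f g = f' g) \<Longrightarrow> graph n f = graph n f'"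
  by (auto simp: graph_def)

lemma run_GENERATOR:
  assumes id: "(\<lambda>x. x) \<in> iso_over G H C" and s: "menv s"
    and i: "i \<in> {1..n}" "s ''gi'' 0 = i" and h: "h \<in> {1..n}" "s ''gh'' 0 = h" and s': "s' = run GENERATOR s"
  shows "menv s' \<and> (\<exists>\<Phi>\<in>iso_over G H C. output_word s' = output_word s @ pairs_word (graph n \<Phi>) \<and>
      (extendible (pre i h) \<longrightarrow> extends \<Phi> (pre i h)))"
proof -
  define s0 where "s0 = run (For ''a1'' ''n'' (Do ''F'' (Var ''a1'')
       (Sub (Var ''a1'') (Cell ''row'' (Sub (Lit 1) (Sub (Var ''gi'') (Var ''a1''))))))) s"
  define s1 where "s1 = run (Do ''F'' (Var ''gi'') (Var ''gh'')) s0"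
  define s2 where "s2 = run COMPLETE s1"
  define b where "b = For ''a1'' ''n'' (Do ''F'' (Var ''a1'') (Var ''a1''))"
  define s3 where "s3 = run (If (Equal (Var ''res'') (Lit 1)) Nop b) s2"
  have s'3: "s' = run EMIT_MAP s3"
    unfolding s' GENERATOR_def PREFIX_def s3_def b_def s2_def s1_def s0_def by (simp only: run.simps(3))
  have rd: "A.ready s" and n: "s ''n'' 0 = n" using s by (simp_all add: menv_def A.ready_def)
  have fr0: "s0 z = s z" if "z \<notin> {''a1'', ''F''}" for z
    unfolding s0_def by (rule run_frame) (use that in simp)
  have fr1: "s1 z = s0 z" if "z \<noteq> ''F''" for z using that by (simp add: s1_def)
  have fr2: "s2 z = s1 z" if "z \<notin> core_names \<union> {''S'', ''T'', ''c'', ''ok1'', ''Fi'', ''F'', ''res'', ''ci'', ''ch''}" for z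
    unfolding s2_def by (rule run_frame) (use that in \<open>simp only: writes_COMPLETE not_False_eq_True\<close>)
  have fr3: "s3 z = s2 z" if "z \<notin> {''a1'', ''F''}" for z
    unfolding s3_def by (rule run_frame) (use that in \<open>simp add: b_def\<close>)
  have fr4: "s' z = s3 z" if "z \<notin> {''output'', ''o''}" for z
    unfolding s'3 by (rule run_frame) (use that in \<open>simp add: writes_EMIT_MAP\<close>)
  have F0: "s0 ''F'' g = (if g < i then g else 0)" if g: "g \<in> {1..n}" for g
  proof -
    have E: "aval (Sub (Var ''a1'') (Cell ''row'' (Sub (Lit 1) (Sub (Var ''gi'') (Var ''a1''))))) r = (if k < i then k else 0)"
      if "k \<in> {1..n}" "agree {''a1'', ''F''} s r" "r ''a1'' 0 = k" "r ''F'' k = s ''F'' k" for k r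
    proof (cases "k < i")
      case True
      then have "1 - (i - k) = 0" by simp
      then show ?thesis using True that(3) agreeD[OF that(2)] A.readyD(3)[OF rd, of 0] i(2) by simp
    next
      case False
      then have "1 - (i - k) = 1" by simp
      then show ?thesis using False that(1,3) agreeD[OF that(2)] A.readyD(3)[OF rd, of 1] i(2) A.nN A.N1 by simp
    qed
    show ?thesis
      unfolding s0_def by (rule run_fill(1)[where A="\<lambda>k. k" and E="\<lambda>k. if k < i then k else 0" and m=n])
        (fact n, simp, simp, fact E, simp, fact g)
  qed
  have F1: "s1 ''F'' g = pre i h g" if "g \<in> {1..n}" for g
    using F0[OF that] i h fr0 by (simp add: s1_def pre_def)
  have m1: "menv s1" using s by (subst menv_cong[of _ s]) (simp_all add: fr0 fr1)
  have F1n: "s1 ''F'' g \<le> n" if "g \<in> {1..n}" for g using F1[OF that] that h by (simp add: pre_def)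
  note compl = run_COMPLETE[OF m1 F1n s2_def]
  have ex: "extendible (s1 ''F'') = extendible (pre i h)" by (rule extendible_cong) (rule F1)
  have m3: "menv s3" using compl(1) by (subst menv_cong[of _ s2]) (simp_all add: fr3)
  have m': "menv s'" using m3 by (subst menv_cong[of _ s3]) (simp_all add: fr4)
  have n3: "s3 ''n'' 0 = n" using m3 by (simp add: menv_def A.ready_def)
  have out: "output_word s' = output_word s @ pairs_word (graph n (s3 ''F''))"
  proof -
    have "output_word s3 = output_word s" by (rule output_word_cong) (simp add: fr3 fr2 fr1 fr0)
    then show ?thesis using run_EMIT_MAP[OF n3 s'3] by simp
  qed
  have "\<exists>\<Phi>\<in>iso_over G H C. (\<forall>g\<in>{1..n}. s3 ''F'' g = \<Phi> g) \<and> (extendible (pre i h) \<longrightarrow> extends \<Phi> (pre i h))"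
  proof (cases "extendible (pre i h)")
    case True
    then obtain \<Phi> where P: "s2 ''res'' 0 = 1" "\<Phi> \<in> iso_over G H C" "extends \<Phi> (s1 ''F'')" "\<forall>g\<in>{1..n}. s2 ''F'' g = \<Phi> g"
      using compl(2) ex by blast
    have "s3 = s2" using P(1) by (simp add: s3_def)
    moreover have "extends \<Phi> (s1 ''F'') = extends \<Phi> (pre i h)" by (rule extends_cong) (rule F1)
    then have "extends \<Phi> (pre i h)" using P(3) by simp
    ultimately show ?thesis using P(2,4) by blast
  next
    case False
    then have "s2 ''res'' 0 = 0" using compl(3) ex by blast
    then have s3: "s3 = run b s2" by (simp add: s3_def)
    have n2: "s2 ''n'' 0 = n" using compl(1) by (simp add: menv_def A.ready_def)
    have F3: "s3 ''F'' g = g" if "g \<in> {1..n}" for g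
      unfolding s3 b_def by (rule run_fill(1)[where A="\<lambda>k. k" and E="\<lambda>k. k" and m=n]) (use n2 that in simp_all)
    show ?thesis by (rule bexI[OF _ id]) (use F3 False in simp)
  qed
  then obtain \<Phi> where P: "\<Phi> \<in> iso_over G H C" "\<And>g. g \<in> {1..n} \<Longrightarrow> s3 ''F'' g = \<Phi> g"
    "extendible (pre i h) \<longrightarrow> extends \<Phi> (pre i h)" by blast
  have "graph n (s3 ''F'') = graph n \<Phi>" by (rule graph_cong) (rule P(2))
  then show ?thesis using m' out P(1,3) by auto
qed

lemma writes_GENERATOR: "''gi'' \<notin> writes GENERATOR" "''gh'' \<notin> writes GENERATOR"
  by (simp_all add: GENERATOR_def PREFIX_def writes_COMPLETE writes_EMIT_MAP)

lemma run_GENERATORS: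
  assumes id: "(\<lambda>x. x) \<in> iso_over G H C" and s: "menv s" and s': "s' = run GENERATORS s"
  shows "\<exists>L. length L = N \<and> set L \<subseteq> iso_over G H C \<and>
    output_word s' = output_word s @ concat (map (\<lambda>\<alpha>. pairs_word (graph n \<alpha>)) L) \<and>
    (\<forall>i\<in>{1..n}. \<forall>h\<in>{1..n}. extendible (pre i h) \<longrightarrow> (\<exists>\<alpha>\<in>set L. extends \<alpha> (pre i h)))"
proof -
  define R where "R m D r \<longleftrightarrow> menv r \<and> (\<exists>L. length L = m \<and> set L \<subseteq> iso_over G H C \<and>
    output_word r = output_word s @ concat (map (\<lambda>\<alpha>. pairs_word (graph n \<alpha>)) L) \<and>
    (\<forall>i h. (i, h) \<in> D \<longrightarrow> extendible (pre i h) \<longrightarrow> (\<exists>\<alpha>\<in>set L. extends \<alpha> (pre i h))))" for m D r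
  have Rcong: "R m D (set_var r x v)" if "R m D r" "x = ''gi'' \<or> x = ''gh''" for m D r x v
  proof -
    have "menv (set_var r x v)" using that by (subst menv_cong[of _ r]) (auto simp: R_def)
    moreover have "output_word (set_var r x v) = output_word r" by (rule output_word_cong) (use that in auto)
    ultimately show ?thesis using that(1) unfolding R_def by metis
  qed
  have n: "r ''n'' 0 = n" if "R m D r" for m D r using that by (simp add: R_def menv_def A.ready_def)
  have "R (n * n) ({1..n} \<times> {1..n}) s'"
    unfolding s' GENERATORS_def
  proof (rule run_For_inv[of s "''n''" n "\<lambda>k. R (k * n) ({1..k} \<times> {1..n})"])
    have R0: "R 0 {} s" using s by (simp add: R_def)
    show "s ''n'' 0 = n" by (rule n[OF R0])
    have "R 0 {} (set_var s ''gi'' 0)" by (rule Rcong[OF R0]) simp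
    then show "R (0 * n) ({1..0} \<times> {1..n}) (set_var s ''gi'' 0)" by simp
  next
    fix k r assume k: "k < n" and r: "R (k * n) ({1..k} \<times> {1..n}) r"
    define J where "J l r \<longleftrightarrow> R (k * n + l) ({1..k} \<times> {1..n} \<union> {Suc k} \<times> {1..l}) r \<and> r ''gi'' 0 = Suc k" for l r
    have r1: "R (k * n) ({1..k} \<times> {1..n}) (set_var r ''gi'' (Suc k))" by (rule Rcong[OF r]) simp
    have "J n (run (For ''gh'' ''n'' GENERATOR) (set_var r ''gi'' (Suc k)))"
    proof (rule run_For_inv[of _ "''n''" n J])
      show "set_var r ''gi'' (Suc k) ''n'' 0 = n" by (rule n[OF r1])
      have "R (k * n) ({1..k} \<times> {1..n}) (set_var (set_var r ''gi'' (Suc k)) ''gh'' 0)" by (rule Rcong[OF r1]) simp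
      then show "J 0 (set_var (set_var r ''gi'' (Suc k)) ''gh'' 0)" by (simp add: J_def)
    next
      fix l p assume l: "l < n" and p: "J l p"
      let ?p = "set_var p ''gh'' (Suc l)" and ?D = "{1..k} \<times> {1..n} \<union> {Suc k} \<times> {1..l}"
      have Rp: "R (k * n + l) ?D ?p" by (rule Rcong) (use p in \<open>simp_all add: J_def\<close>)
      have gi: "?p ''gi'' 0 = Suc k" "?p ''gh'' 0 = Suc l" using p by (simp_all add: J_def)
      have kl: "Suc k \<in> {1..n}" "Suc l \<in> {1..n}" using k l by auto
      have mp: "menv ?p" using Rp unfolding R_def by blast
      obtain L where L: "length L = k * n + l" "set L \<subseteq> iso_over G H C"
        "output_word ?p = output_word s @ concat (map (\<lambda>\<alpha>. pairs_word (graph n \<alpha>)) L)"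
        "\<forall>i h. (i, h) \<in> ?D \<longrightarrow> extendible (pre i h) \<longrightarrow> (\<exists>\<alpha>\<in>set L. extends \<alpha> (pre i h))"
        using Rp unfolding R_def by blast
      define p' where "p' = run GENERATOR ?p"
      obtain \<Phi> where m': "menv p'" and P: "\<Phi> \<in> iso_over G H C"
        "output_word p' = output_word ?p @ pairs_word (graph n \<Phi>)"
        "extendible (pre (Suc k) (Suc l)) \<longrightarrow> extends \<Phi> (pre (Suc k) (Suc l))"
        using run_GENERATOR[OF id mp kl(1) gi(1) kl(2) gi(2) p'_def] by blast
      have D: "{1..k} \<times> {1..n} \<union> {Suc k} \<times> {1..Suc l} = insert (Suc k, Suc l) ?D" by auto
      have "R (k * n + Suc l) ({1..k} \<times> {1..n} \<union> {Suc k} \<times> {1..Suc l}) p'"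
        unfolding R_def D
      proof (intro conjI exI[of _ "L @ [\<Phi>]"])
        show "menv p'" by (rule m')
        show "length (L @ [\<Phi>]) = k * n + Suc l" using L(1) by simp
        show "set (L @ [\<Phi>]) \<subseteq> iso_over G H C" using L(2) P(1) by simp
        show "output_word p' = output_word s @ concat (map (\<lambda>\<alpha>. pairs_word (graph n \<alpha>)) (L @ [\<Phi>]))"
          unfolding P(2) L(3) by simp
        show "\<forall>i h. (i, h) \<in> insert (Suc k, Suc l) ?D \<longrightarrow> extendible (pre i h) \<longrightarrow> (\<exists>\<alpha>\<in>set (L @ [\<Phi>]). extends \<alpha> (pre i h))"
        proof (intro allI impI)
          fix i h assume ih: "(i, h) \<in> insert (Suc k, Suc l) ?D" and e: "extendible (pre i h)"
          consider "i = Suc k" "h = Suc l" | "(i, h) \<in> ?D" using ih by blast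
          then show "\<exists>\<alpha>\<in>set (L @ [\<Phi>]). extends \<alpha> (pre i h)"
          proof cases
            case 1
            then show ?thesis using P(3) e by simp
          next
            case 2
            then obtain \<alpha> where "\<alpha> \<in> set L" "extends \<alpha> (pre i h)" using L(4) e by blast
            then show ?thesis by auto
          qed
        qed
      qed
      moreover have "p' ''gi'' 0 = Suc k"
        using run_frame[OF writes_GENERATOR(1), of ?p] gi(1) by (simp add: p'_def)
      ultimately show "J (Suc l) (run GENERATOR ?p)" by (simp add: J_def p'_def)
    qed
    moreover have "k * n + n = Suc k * n" "{1..k} \<times> {1..n} \<union> {Suc k} \<times> {1..n} = {1..Suc k} \<times> {1..n}" by auto
    ultimately show "R (Suc k * n) ({1..Suc k} \<times> {1..n}) (run (For ''gh'' ''n'' GENERATOR) (set_var r ''gi'' (Suc k)))"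
      by (simp only: J_def)
  qed
  then obtain L where L: "length L = n * n" "set L \<subseteq> iso_over G H C"
        "output_word s' = output_word s @ concat (map (\<lambda>\<alpha>. pairs_word (graph n \<alpha>)) L)"
        "\<forall>i h. (i, h) \<in> {1..n} \<times> {1..n} \<longrightarrow> extendible (pre i h) \<longrightarrow> (\<exists>\<alpha>\<in>set L. extends \<alpha> (pre i h))"
    unfolding R_def by blast
  have "\<forall>i\<in>{1..n}. \<forall>h\<in>{1..n}. extendible (pre i h) \<longrightarrow> (\<exists>\<alpha>\<in>set L. extends \<alpha> (pre i h))"
    using L(4) by blast
  then show ?thesis using L(1-3) A.N by blast
qed

end

lemma writes_TABLE: "writes (TABLE X) = {''i'', ''i2'', ''p'', X}"
  by (auto simp: TABLE_def READ_def)
lemma writes_PAIRS: "writes (PAIRS X) = {''i'', ''m'', ''t'', ''p'', X}"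
  by (auto simp: PAIRS_def READ_def)
lemma writes_SKIP_LIST: "writes SKIP_LIST = {''m'', ''p''}"
  by (auto simp: SKIP_LIST_def READ_def)
lemma writes_SKIP_TABLE: "writes SKIP_TABLE = {''i'', ''m'', ''p''}"
  by (auto simp: SKIP_TABLE_def READ_def)
lemma writes_READ: "writes (READ X a) = {''p'', X}"
  by (auto simp: READ_def)

lemma writes_PARSE: "writes PARSE = {''i'', ''i2'', ''p'', ''m'', ''t'', ''mG'', ''mH'', ''pi'', ''pi0'', ''psi''}"
  by (auto simp: PARSE_def writes_TABLE writes_PAIRS writes_SKIP_LIST writes_SKIP_TABLE writes_READ)

lemma writes_COMPATIBLE: "writes (COMPATIBLE e1 e2) = {''a1'', ''b1'', ''cp''}"
  by (auto simp: COMPATIBLE_def)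
lemma writes_ROWS: "writes ROWS = {''i'', ''row'', ''row2''}"
  by (auto simp: ROWS_def)
lemma writes_ENUMERATE: "writes ENUMERATE = {''i'', ''i2'', ''q'', ''P1'', ''P2''}"
  by (auto simp: ENUMERATE_def)
lemma writes_GENERATOR_eq: "writes GENERATOR = core_names \<union> {''S'', ''T'', ''c'', ''ok1'', ''Fi'', ''F'', ''res'', ''ci'', ''ch'', ''output'', ''o''}"
  by (auto simp: GENERATOR_def PREFIX_def writes_COMPLETE writes_EMIT_MAP)
lemma writes_SOLVE: "writes SOLVE = core_names \<union> {''S'', ''T'', ''c'', ''ok1'', ''Fi'', ''F'', ''res'', ''ci'', ''ch'', ''output'', ''o'', ''gi'', ''gh'', ''cp'', ''mH''}"
  by (auto simp: SOLVE_def AUTOMORPHISMS_def GENERATORS_def writes_COMPLETE writes_EMIT_MAP writes_EMIT writes_COMPATIBLE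
      COPY_def writes_GENERATOR_eq)

context grid
begin

lemma run_PARSE:
  assumes s: "ready s"
    and r: "rest s (concat (map (\<lambda>i. map (f i) [1..<Suc n]) [1..<Suc n]) @ n #
      concat (map (\<lambda>i. map (f' i) [1..<Suc n]) [1..<Suc n]) @ list_word as @ list_word as' @
      cayley_word Q @ pairs_word ps1 @ cayley_word Q' @ pairs_word ps2 @ pairs_word ps3)"
    and small: "card (carrier Q) \<le> n" "card (carrier Q') \<le> n" "length ps1 \<le> n" "length ps2 \<le> n" "length ps3 \<le> n"
    and d: "distinct (map fst ps1)" "distinct (map fst ps2)" "distinct (map fst ps3)"
    and s': "s' = run PARSE s"
  shows "i \<in> {1..n} \<Longrightarrow> j \<in> {1..n} \<Longrightarrow> s' ''mG'' (ad2 i j) = f i j"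
    "i \<in> {1..n} \<Longrightarrow> j \<in> {1..n} \<Longrightarrow> s' ''mH'' (ad2 i j) = f' i j"
    "(x, y) \<in> set ps1 \<Longrightarrow> s' ''pi'' x = y" "(x, y) \<in> set ps2 \<Longrightarrow> s' ''pi0'' x = y" "(x, y) \<in> set ps3 \<Longrightarrow> s' ''psi'' x = y"
proof -
  define s1 where "s1 = run (TABLE ''mG'') s"
  define s2 where "s2 = run (READ ''m'' (Lit 0)) s1"
  define s3 where "s3 = run (TABLE ''mH'') s2"
  define s4 where "s4 = run SKIP_LIST s3"
  define s5 where "s5 = run SKIP_LIST s4"
  define s6 where "s6 = run SKIP_TABLE s5"
  define s7 where "s7 = run (PAIRS ''pi'') s6"
  define s8 where "s8 = run SKIP_TABLE s7"
  define s9 where "s9 = run (PAIRS ''pi0'') s8"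
  have s'9: "s' = run (PAIRS ''psi'') s9"
    unfolding s' PARSE_def s9_def s8_def s7_def s6_def s5_def s4_def s3_def s2_def s1_def by (simp only: run.simps(3))
  have f1: "s1 z = s z" if "z \<notin> {''i'', ''i2'', ''p'', ''mG''}" for z
    unfolding s1_def by (rule run_frame) (use that in \<open>simp only: writes_TABLE not_False_eq_True\<close>)
  have f2: "s2 z = s1 z" if "z \<notin> {''p'', ''m''}" for z
    unfolding s2_def by (rule run_frame) (use that in \<open>simp only: writes_READ not_False_eq_True\<close>)
  have f3: "s3 z = s2 z" if "z \<notin> {''i'', ''i2'', ''p'', ''mH''}" for z
    unfolding s3_def by (rule run_frame) (use that in \<open>simp only: writes_TABLE not_False_eq_True\<close>)
  have f4: "s4 z = s3 z" if "z \<notin> {''m'', ''p''}" for z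
    unfolding s4_def by (rule run_frame) (use that in \<open>simp only: writes_SKIP_LIST not_False_eq_True\<close>)
  have f5: "s5 z = s4 z" if "z \<notin> {''m'', ''p''}" for z
    unfolding s5_def by (rule run_frame) (use that in \<open>simp only: writes_SKIP_LIST not_False_eq_True\<close>)
  have f6: "s6 z = s5 z" if "z \<notin> {''i'', ''m'', ''p''}" for z
    unfolding s6_def by (rule run_frame) (use that in \<open>simp only: writes_SKIP_TABLE not_False_eq_True\<close>)
  have f7: "s7 z = s6 z" if "z \<notin> {''i'', ''m'', ''t'', ''p'', ''pi''}" for z
    unfolding s7_def by (rule run_frame) (use that in \<open>simp only: writes_PAIRS not_False_eq_True\<close>)
  have f8: "s8 z = s7 z" if "z \<notin> {''i'', ''m'', ''p''}" for z
    unfolding s8_def by (rule run_frame) (use that in \<open>simp only: writes_SKIP_TABLE not_False_eq_True\<close>)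
  have f9: "s9 z = s8 z" if "z \<notin> {''i'', ''m'', ''t'', ''p'', ''pi0''}" for z
    unfolding s9_def by (rule run_frame) (use that in \<open>simp only: writes_PAIRS not_False_eq_True\<close>)
  have f10: "s' z = s9 z" if "z \<notin> {''i'', ''m'', ''t'', ''p'', ''psi''}" for z
    unfolding s'9 by (rule run_frame) (use that in \<open>simp only: writes_PAIRS not_False_eq_True\<close>)
  note t1 = run_TABLE[OF s r _ s1_def, simplified]
  have r2: "rest s2 (concat (map (\<lambda>i. map (f' i) [1..<Suc n]) [1..<Suc n]) @ list_word as @ list_word as' @
      cayley_word Q @ pairs_word ps1 @ cayley_word Q' @ pairs_word ps2 @ pairs_word ps3)"
    by (rule run_READ(2)[OF t1(1) _ _ _ s2_def, where k=0]) simp_all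
  have rd2: "ready s2" using s by (subst ready_cong[of _ s]) (simp_all add: f1 f2)
  have n: "s ''n'' 0 = n" by (rule readyD(1)[OF s])
  note t3 = run_TABLE[OF rd2 r2 _ s3_def, simplified]
  note r4 = run_SKIP_LIST[OF t3(1) s4_def]
  note r5 = run_SKIP_LIST[OF r4 s5_def]
  have n5: "s5 ''n'' 0 = n" using n by (simp add: f1 f2 f3 f4 f5)
  have n6: "s6 ''n'' 0 = n" using n5 by (simp add: f6)
  have n7: "s7 ''n'' 0 = n" using n6 by (simp add: f7)
  have n8: "s8 ''n'' 0 = n" using n7 by (simp add: f8)
  have n9: "s9 ''n'' 0 = n" using n8 by (simp add: f9)
  note r6 = run_SKIP_TABLE[OF n5 small(1) r5 s6_def]
  note p7 = run_PAIRS[OF n6 small(3) r6 d(1) _ s7_def, simplified]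
  note r8 = run_SKIP_TABLE[OF n7 small(2) p7(1) s8_def]
  note p9 = run_PAIRS[OF n8 small(4) r8 d(2) _ s9_def, simplified]
  have r9: "rest s9 (pairs_word ps3 @ [])" using p9(1) by simp
  show "i \<in> {1..n} \<Longrightarrow> j \<in> {1..n} \<Longrightarrow> s' ''mG'' (ad2 i j) = f i j"
    using t1(2) by (simp add: f2 f3 f4 f5 f6 f7 f8 f9 f10)
  show "i \<in> {1..n} \<Longrightarrow> j \<in> {1..n} \<Longrightarrow> s' ''mH'' (ad2 i j) = f' i j"
    using t3(2) by (simp add: f4 f5 f6 f7 f8 f9 f10)
  show "(x, y) \<in> set ps1 \<Longrightarrow> s' ''pi'' x = y" using p7(2) by (simp add: f8 f9 f10)
  show "(x, y) \<in> set ps2 \<Longrightarrow> s' ''pi0'' x = y" using p9(2) by (simp add: f10)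
  show "(x, y) \<in> set ps3 \<Longrightarrow> s' ''psi'' x = y"
    by (rule run_PAIRS(2)[OF n9 small(5) r9 d(3) _ s'9]) simp_all
qed

end

text \<open>
  The two instances of the search: between \<open>G\<close> and \<open>H\<close> for the first isomorphism and on \<open>G\<close> for
  the automorphisms.
\<close>

locale solver = M: matching n N G H C P1 P2 + M': matching n N G G C' P1 P2
  for n N and G :: "nat monoid" and H :: "nat monoid" and C C' P1 P2 +
  assumes id: "(\<lambda>x. x) \<in> iso_over G G C'"
begin

theorem run_SOLVE:
  assumes s: "M.A.ready s" "M.A.tab s ''mG'' G" "M.A.tab s ''mH'' H"
    and P: "\<And>j. j \<in> {1..N} \<Longrightarrow> s ''P1'' j = P1 j \<and> s ''P2'' j = P2 j"
    and C: "\<And>g h. \<lbrakk>g \<in> {1..n}; h \<in> {1..n}\<rbrakk> \<Longrightarrow> C g h \<longleftrightarrow> s ''psi'' (s ''pi'' g) = s ''pi0'' h"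
    and C': "\<And>g h. \<lbrakk>g \<in> {1..n}; h \<in> {1..n}\<rbrakk> \<Longrightarrow> C' g h \<longleftrightarrow> s ''pi'' g = s ''pi'' h"
    and out: "output_word s = []" and s': "s' = run SOLVE s"
  shows "iso_over G H C = {} \<Longrightarrow> output_word s' = [0]"
    and "iso_over G H C \<noteq> {} \<Longrightarrow> \<exists>\<Phi>\<in>iso_over G H C. \<exists>L. length L = N \<and> set L \<subseteq> iso_over G G C' \<and>
      output_word s' = 1 # pairs_word (graph n \<Phi>) @ N # concat (map (\<lambda>\<alpha>. pairs_word (graph n \<alpha>)) L) \<and>
      (\<forall>i\<in>{1..n}. \<forall>h\<in>{1..n}. M'.extendible (M'.pre i h) \<longrightarrow>
         (\<exists>\<alpha>\<in>set L. M'.extends \<alpha> (M'.pre i h)))"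
proof -
  define s1 where "s1 = run (COMPATIBLE (Cell ''psi'' (Cell ''pi'' (Var ''a1''))) (Cell ''pi0'' (Var ''b1''))) s"
  define s2 where "s2 = run (For ''a1'' ''n'' (Do ''F'' (Var ''a1'') (Lit 0))) s1"
  define s3 where "s3 = run COMPLETE s2"
  have s'3: "s' = run (If (Equal (Var ''res'') (Lit 1)) AUTOMORPHISMS (EMIT (Lit 0))) s3"
    unfolding s' SOLVE_def s3_def s2_def s1_def by (simp only: run.simps(3))
  have f1: "s1 z = s z" if "z \<notin> {''a1'', ''b1'', ''cp''}" for z
    unfolding s1_def by (rule run_frame) (use that in \<open>simp only: writes_COMPATIBLE not_False_eq_True\<close>)
  have f2: "s2 z = s1 z" if "z \<notin> {''a1'', ''F''}" for z
    unfolding s2_def by (rule run_frame) (use that in simp)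
  have f3: "s3 z = s2 z" if "z \<notin> core_names \<union> {''S'', ''T'', ''c'', ''ok1'', ''Fi'', ''F'', ''res'', ''ci'', ''ch''}" for z
    unfolding s3_def by (rule run_frame) (use that in \<open>simp only: writes_COMPLETE not_False_eq_True\<close>)
  have cp1: "s1 ''cp'' (M.A.ad2 i k) = (if C i k then 1 else 0)" if ik: "i \<in> {1..n}" "k \<in> {1..n}" for i k
  proof -
    have e1: "aval (Cell ''psi'' (Cell ''pi'' (Var ''a1''))) r = s ''psi'' (s ''pi'' i)"
      if "i \<in> {1..n}" "k \<in> {1..n}" "agree {''a1'', ''b1'', ''cp''} s r" "r ''a1'' 0 = i" "r ''b1'' 0 = k" for i k r
      using that(4) agreeD[OF that(3)] by simp
    have e2: "aval (Cell ''pi0'' (Var ''b1'')) r = s ''pi0'' k"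
      if "i \<in> {1..n}" "k \<in> {1..n}" "agree {''a1'', ''b1'', ''cp''} s r" "r ''a1'' 0 = i" "r ''b1'' 0 = k" for i k r
      using that(5) agreeD[OF that(3)] by simp
    have "s1 ''cp'' (M.A.ad2 i k) = (if s ''psi'' (s ''pi'' i) = s ''pi0'' k then 1 else 0)"
      by (rule M.A.run_COMPATIBLE[where u="\<lambda>i. s ''psi'' (s ''pi'' i)" and v="s ''pi0''", OF s(1) _ _ s1_def ik])
        (fact e1, fact e2)
    then show ?thesis using C[OF ik] by simp
  qed
  have m1: "M.menv s1"
  proof -
    have "M.A.ready s1" using s(1) by (subst M.A.ready_cong[of _ s]) (simp_all add: f1)
    moreover have "M.A.tab s1 ''mG'' G" "M.A.tab s1 ''mH'' H" using s(2,3) by (simp_all add: M.A.tab_def f1)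
    ultimately show ?thesis using cp1 P by (simp add: M.menv_def f1)
  qed
  have m2: "M.menv s2" using m1 by (subst M.menv_cong[of _ s1]) (simp_all add: f2)
  have n1: "s1 ''n'' 0 = n" using m1 by (simp add: M.menv_def M.A.ready_def)
  have F2: "s2 ''F'' g = 0" if g: "g \<in> {1..n}" for g
    unfolding s2_def by (rule run_fill(1)[where A="\<lambda>k. k" and E="\<lambda>_. 0" and m=n]) (use n1 g in simp_all)
  have F2n: "s2 ''F'' g \<le> n" if "g \<in> {1..n}" for g using F2[OF that] by simp
  note compl = M.run_COMPLETE[OF m2 F2n s3_def]
  have ex: "M.extendible (s2 ''F'') \<longleftrightarrow> iso_over G H C \<noteq> {}"
    using F2 by (auto simp: M.extendible_def M.extends_def)
  have out3: "output_word s3 = []"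
    using output_word_cong[of s3 s] out by (simp add: f1 f2 f3)
  show "output_word s' = [0]" if "iso_over G H C = {}"
  proof -
    have "s3 ''res'' 0 = 0" using compl(3) ex that by blast
    then have "s' = run (EMIT (Lit 0)) s3" by (simp add: s'3)
    from run_EMIT(1)[OF _ this] show ?thesis by (simp add: out3)
  qed
  assume "iso_over G H C \<noteq> {}"
  then obtain \<Phi> where res: "s3 ''res'' 0 = 1" and Phi: "\<Phi> \<in> iso_over G H C" "\<forall>g\<in>{1..n}. s3 ''F'' g = \<Phi> g"
    using compl(2) ex by blast
  define s4 where "s4 = run (EMIT (Lit 1)) s3"
  define s5 where "s5 = run EMIT_MAP s4"
  define s6 where "s6 = run (EMIT (Var ''N'')) s5"
  define s7 where "s7 = run (COPY ''mH'' ''mG'') s6"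
  define s8 where "s8 = run (COMPATIBLE (Cell ''pi'' (Var ''a1'')) (Cell ''pi'' (Var ''b1''))) s7"
  have s'8: "s' = run GENERATORS s8"
    using res unfolding s'3 AUTOMORPHISMS_def s8_def s7_def s6_def s5_def s4_def
    by (simp only: run.simps(3,4) bval.simps aval.simps if_True refl)
  have f4: "s4 z = s3 z" if "z \<noteq> ''output''" for z by (rule run_EMIT(2)[OF refl s4_def that])
  have f5: "s5 z = s4 z" if "z \<notin> {''output'', ''o''}" for z
    unfolding s5_def by (rule run_frame) (use that in \<open>simp only: writes_EMIT_MAP not_False_eq_True\<close>)
  have f6: "s6 z = s5 z" if "z \<noteq> ''output''" for z by (rule run_EMIT(2)[OF refl s6_def that])
  have f7: "s7 z = s6 z" if "z \<notin> {''a1'', ''b1'', ''mH''}" for z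
    unfolding s7_def by (rule run_frame) (use that in \<open>simp add: COPY_def\<close>)
  have f8: "s8 z = s7 z" if "z \<notin> {''a1'', ''b1'', ''cp''}" for z
    unfolding s8_def by (rule run_frame) (use that in \<open>simp only: writes_COMPATIBLE not_False_eq_True\<close>)
  have m3: "M.menv s3" by (rule compl(1))
  have m6: "M.menv s6" using m3 by (subst M.menv_cong[of _ s3]) (simp_all add: f4 f5 f6)
  have rd6: "M.A.ready s6" "M.A.tab s6 ''mG'' G" using m6 by (simp_all add: M.menv_def)
  have n4: "s4 ''n'' 0 = n" using m3 f4 by (simp add: M.menv_def M.A.ready_def)
  have N5: "s5 ''N'' 0 = N" using m3 f4 f5 by (simp add: M.menv_def M.A.ready_def)
  have o4: "output_word s4 = [1]" using run_EMIT(1)[OF _ s4_def] by (simp add: out3)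
  have "graph n (s4 ''F'') = graph n \<Phi>" by (rule M.graph_cong) (use Phi(2) f4 in simp)
  then have o5: "output_word s5 = 1 # pairs_word (graph n \<Phi>)" using run_EMIT_MAP[OF n4 s5_def] o4 by simp
  have "output_word s6 = output_word s5 @ [N]" by (rule run_EMIT(1)[OF _ s6_def]) (simp add: N5)
  then have o6: "output_word s6 = 1 # pairs_word (graph n \<Phi>) @ [N]" using o5 by simp
  have o8: "output_word s8 = output_word s6" by (rule output_word_cong) (simp add: f7 f8)
  have tH: "M.A.tab s7 ''mH'' G" by (rule M.A.run_COPY[OF rd6(1,2) _ _ s7_def]) simp_all
  have rd7: "M.A.ready s7" using rd6(1) by (subst M.A.ready_cong[of _ s6]) (simp_all add: f7)
  have pi7: "s7 ''pi'' = s ''pi''" by (simp add: f1 f2 f3 f4 f5 f6 f7)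
  have cp8: "s8 ''cp'' (M.A.ad2 i k) = (if C' i k then 1 else 0)" if ik: "i \<in> {1..n}" "k \<in> {1..n}" for i k
  proof -
    have e1: "aval (Cell ''pi'' (Var ''a1'')) r = s ''pi'' i"
      if "i \<in> {1..n}" "k \<in> {1..n}" "agree {''a1'', ''b1'', ''cp''} s7 r" "r ''a1'' 0 = i" "r ''b1'' 0 = k" for i k r
      using that(4) agreeD[OF that(3)] pi7 by simp
    have e2: "aval (Cell ''pi'' (Var ''b1'')) r = s ''pi'' k"
      if "i \<in> {1..n}" "k \<in> {1..n}" "agree {''a1'', ''b1'', ''cp''} s7 r" "r ''a1'' 0 = i" "r ''b1'' 0 = k" for i k r
      using that(5) agreeD[OF that(3)] pi7 by simp
    have "s8 ''cp'' (M.A.ad2 i k) = (if s ''pi'' i = s ''pi'' k then 1 else 0)"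
      by (rule M.A.run_COMPATIBLE[where u="s ''pi''" and v="s ''pi''", OF rd7 _ _ s8_def ik])
        (fact e1, fact e2)
    then show ?thesis using C'[OF ik] by simp
  qed
  have m8: "M'.menv s8"
  proof -
    have "M.A.ready s8" using rd7 by (subst M.A.ready_cong[of _ s7]) (simp_all add: f8)
    moreover have "M.A.tab s8 ''mG'' G" "M.A.tab s8 ''mH'' G" using rd6(2) tH by (simp_all add: M.A.tab_def f7 f8)
    moreover have "s8 ''P1'' j = P1 j \<and> s8 ''P2'' j = P2 j" if "j \<in> {1..N}" for j
      using m6 that by (simp add: M.menv_def f7 f8)
    ultimately show ?thesis using cp8 by (simp add: M'.menv_def)
  qed
  obtain L where L: "length L = N" "set L \<subseteq> iso_over G G C'"
    "output_word s' = output_word s8 @ concat (map (\<lambda>\<alpha>. pairs_word (graph n \<alpha>)) L)"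
    "\<forall>i\<in>{1..n}. \<forall>h\<in>{1..n}. M'.extendible (M'.pre i h) \<longrightarrow> (\<exists>\<alpha>\<in>set L. M'.extends \<alpha> (M'.pre i h))"
    using M'.run_GENERATORS[OF id m8 s'8] by blast
  have "output_word s' = 1 # pairs_word (graph n \<Phi>) @ N # concat (map (\<lambda>\<alpha>. pairs_word (graph n \<alpha>)) L)"
    unfolding L(3) o8 o6 by simp
  then show "\<exists>\<Phi>\<in>iso_over G H C. \<exists>L. length L = N \<and> set L \<subseteq> iso_over G G C' \<and>
      output_word s' = 1 # pairs_word (graph n \<Phi>) @ N # concat (map (\<lambda>\<alpha>. pairs_word (graph n \<alpha>)) L) \<and>
      (\<forall>i\<in>{1..n}. \<forall>h\<in>{1..n}. M'.extendible (M'.pre i h) \<longrightarrow>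
         (\<exists>\<alpha>\<in>set L. M'.extends \<alpha> (M'.pre i h)))"
    using Phi(1) L(1,2,4) by (intro bexI[of _ \<Phi>] exI[of _ L] conjI)
qed

end

section \<open>Running time and correctness\<close>

text \<open>
  Only \<open>n\<close> and \<open>N\<close> bound loops, and the main part of the program does not write them, as
  \<open>exec_compile\<close> demands.
\<close>

lemma bounds_core:
  "bounds INSERT = {''N''}" "bounds (DEFECT f) = {''N''}" "bounds SUBZ = {''N''}" "bounds IDENTITY = {''n''}"
  "bounds INVERSES = {''n''}" "bounds SELECT = {''n''}" "bounds CLEAR = {''n'', ''N''}" "bounds SAVEZ = {''N''}"
  "bounds PRODUCT = {''N''}"
  by (auto simp: INSERT_def DEFECT_def SUBZ_def IDENTITY_def INVERSES_def SELECT_def CLEAR_def SAVEZ_def PRODUCT_def)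

lemma bounds_EXT: "bounds EXT = {''n'', ''N''}"
  by (auto simp: EXT_def GENS_def GEN_def CLOSE_def PASS_def TESTZ_def bounds_core)

lemma bounds_COMPLETE: "bounds TEST = {''n'', ''N''}" "bounds COMPLETE = {''n'', ''N''}"
  by (auto simp: COMPLETE_def TRY_def TEST_def HALF_def COPY_def ROWSET_def INVERT_def bounds_EXT)

lemma bounds_MAIN: "bounds MAIN \<subseteq> {''n'', ''N''}"
  by (auto simp: MAIN_def ROWS_def ENUMERATE_def PARSE_def TABLE_def READ_def SKIP_LIST_def SKIP_TABLE_def PAIRS_def
      SOLVE_def COMPATIBLE_def AUTOMORPHISMS_def GENERATORS_def GENERATOR_def PREFIX_def EMIT_def EMIT_MAP_def COPY_def
      bounds_COMPLETE)

lemma wf_core: "wf INSERT" "wf (DEFECT f)" "wf SUBZ" "wf IDENTITY" "wf INVERSES" "wf SELECT" "wf CLEAR" "wf SAVEZ" "wf PRODUCT"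
  by (simp_all add: INSERT_def DEFECT_def SUBZ_def IDENTITY_def INVERSES_def SELECT_def CLEAR_def SAVEZ_def PRODUCT_def)

lemma wf_GENS: "wf GENS"
  by (simp add: GENS_def GEN_def wf_core writes_INSERT writes_DEFECT bounds_core SUBZ_def)

lemma wf_CLOSE: "wf CLOSE"
  by (simp add: CLOSE_def PASS_def wf_core writes_INSERT bounds_core PRODUCT_def)

lemma wf_EXT: "wf EXT"
  by (simp add: EXT_def TESTZ_def wf_core wf_GENS wf_CLOSE)

lemma wf_TEST: "wf TEST"
  by (simp add: TEST_def HALF_def COPY_def ROWSET_def INVERT_def wf_EXT)

lemma wf_COMPLETE: "wf COMPLETE"
  by (simp add: COMPLETE_def TRY_def wf_TEST writes_TEST bounds_COMPLETE)

lemma wf_MAIN: "wf MAIN"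
  by (simp add: MAIN_def ROWS_def ENUMERATE_def PARSE_def TABLE_def READ_def SKIP_LIST_def SKIP_TABLE_def PAIRS_def
      SOLVE_def COMPATIBLE_def AUTOMORPHISMS_def GENERATORS_def GENERATOR_def PREFIX_def EMIT_def EMIT_MAP_def COPY_def
      bounds_COMPLETE wf_COMPLETE writes_COMPLETE)

lemma writes_MAIN: "''n'' \<notin> writes MAIN" "''N'' \<notin> writes MAIN"
  by (simp_all add: MAIN_def writes_ROWS writes_ENUMERATE writes_PARSE writes_SOLVE)

text \<open>
  The two parts that compute the loop bounds \<open>n\<close> and \<open>N\<close> come first and are compiled separately,
  since they write what bounds the later loops.
\<close>

definition PROGRAM :: com where
  "PROGRAM = Seq (compile SIZE) (Seq (compile SQUARE) (compile MAIN))"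

lemma poly_mono_nat: "x \<le> y \<Longrightarrow> poly p x \<le> poly p y" for p :: "nat poly" and x y :: nat
  by (induction p) (auto intro!: add_mono mult_mono)

theorem exec_PROGRAM:
  assumes n: "1 \<le> n" and s0: "s0 ''input'' 1 = n" "s0 ''N'' 0 = 0"
  shows "\<exists>t \<le> poly (time SIZE + (time SQUARE + time MAIN)) (n * n).
    exec PROGRAM s0 t (run MAIN (run SQUARE (run SIZE s0)))"
proof -
  define s1 where "s1 = run SIZE s0"
  define s2 where "s2 = run SQUARE s1"
  have nn: "n \<le> n * n" using n by simp
  have n1: "s1 ''n'' 0 = n" "s1 ''N'' 0 = 0" using s0 by (simp_all add: s1_def SIZE_def)
  have n2: "s2 ''n'' 0 = n" using run_frame[of "''n''" SQUARE s1] n1 by (simp add: s2_def SQUARE_def del: run.simps)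
  have N2: "s2 ''N'' 0 = n * n" by (rule run_SQUARE[OF n1 s2_def])
  have "\<exists>t \<le> poly (time SIZE) (n * n). exec (compile SIZE) s0 t s1"
    unfolding s1_def by (rule exec_compile) (simp_all add: SIZE_def)
  then obtain t1 where t1: "t1 \<le> poly (time SIZE) (n * n)" "exec (compile SIZE) s0 t1 s1" by blast
  have "\<exists>t \<le> poly (time SQUARE) (n * n). exec (compile SQUARE) s1 t s2"
    unfolding s2_def by (rule exec_compile) (use n1 nn in \<open>simp_all add: SQUARE_def\<close>)
  then obtain t2 where t2: "t2 \<le> poly (time SQUARE) (n * n)" "exec (compile SQUARE) s1 t2 s2" by blast
  have "\<exists>t \<le> poly (time MAIN) (n * n). exec (compile MAIN) s2 t (run MAIN s2)"
  proof (rule exec_compile[OF wf_MAIN])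
    fix b assume "b \<in> bounds MAIN"
    then have "b = ''n'' \<or> b = ''N''" using bounds_MAIN by blast
    then show "b \<notin> writes MAIN \<and> s2 b 0 \<le> n * n" using writes_MAIN n2 N2 nn by auto
  qed
  then obtain t3 where t3: "t3 \<le> poly (time MAIN) (n * n)" "exec (compile MAIN) s2 t3 (run MAIN s2)" by blast
  have "exec PROGRAM s0 (t1 + (t2 + t3)) (run MAIN s2)"
    unfolding PROGRAM_def by (rule exec.Seq[OF t1(2) exec.Seq[OF t2(2) t3(2)]])
  moreover have "t1 + (t2 + t3) \<le> poly (time SIZE + (time SQUARE + time MAIN)) (n * n)"
    using t1(1) t2(1) t3(1) by (simp add: add_mono)
  ultimately show ?thesis unfolding s2_def s1_def by blast
qed

lemma lists_map_graph:
  assumes "D = {1..n}" "\<And>g. g \<in> {1..n} \<Longrightarrow> f g = f' g"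
  shows "lists_map (graph n f) D f'"
proof -
  have "distinct (graph n f)" by (auto simp: graph_def distinct_map inj_on_def)
  moreover have "set (graph n f) = (\<lambda>x. (x, f' x)) ` D" using assms by (auto simp: graph_def image_def)
  ultimately show ?thesis by (simp add: lists_map_def lists_set_def)
qed

lemma lists_set_graph_pairs:
  assumes "lists_set ps ((\<lambda>x. (u x, v x)) ` D)" "inj_on u D" "finite D"
  shows "distinct (map fst ps)" "length ps = card D" "x \<in> D \<Longrightarrow> (u x, v x) \<in> set ps"
proof -
  have ps: "distinct ps" "set ps = (\<lambda>x. (u x, v x)) ` D" using assms(1) by (simp_all add: lists_set_def)
  have "inj_on fst (set ps)" unfolding ps(2) using assms(2) by (auto simp: inj_on_def)
  then show "distinct (map fst ps)" using ps(1) by (simp add: distinct_map)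
  have "inj_on (\<lambda>x. (u x, v x)) D" using assms(2) by (auto simp: inj_on_def)
  then show "length ps = card D" using ps by (simp add: card_image flip: distinct_card)
  show "x \<in> D \<Longrightarrow> (u x, v x) \<in> set ps" using ps(2) by simp
qed

text \<open>
  The input yields tables of the two groups and of compatibility. These are what \<open>run_SOLVE\<close>
  needs; its answer is translated back with \<open>inducing_isos_eq\<close> and \<open>generate_Aut0\<close>.
\<close>

theorem PROGRAM_correct:
  assumes G: "group G" "carrier G = {1..n}" and H: "group H" "carrier H = {1..n}"
    and A: "A \<lhd> G" "comm_group (G\<lparr>carrier := A\<rparr>)" and B: "B \<lhd> H" "comm_group (H\<lparr>carrier := B\<rparr>)"
    and psi: "\<psi> \<in> iso (G Mod A) (H Mod B)" and inst: "instance_given_by G H A B \<psi> w"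
  shows "1 \<le> n" "input_state w ''input'' 1 = n"
    "correct_output G H A B \<psi> (output_word (run MAIN (run SQUARE (run SIZE (input_state w)))))"
proof -
  interpret G: group G by fact
  interpret X: extension_pair G H A B \<psi> by (rule extension_pair.intro) fact+
  interpret Y: kernel_automorphisms G A n by (rule kernel_automorphisms.intro) fact+
  show n: "1 \<le> n" using G.one_closed G(2) by auto
  interpret gr: grid n "n * n" by unfold_locales (use n in auto)
  from inst obtain as as' \<nu> \<nu>' q q' ps3 where
    q: "quotient_given_by G A \<nu> q" "quotient_given_by H B \<nu>' q'"
    and ps3: "lists_set ps3 ((\<lambda>C. (\<nu> C, \<nu>' (\<psi> C))) ` carrier (G Mod A))"
    and w: "w = cayley_word G @ cayley_word H @ list_word as @ list_word as' @ q @ q' @ pairs_word ps3"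
    unfolding instance_given_by_def by blast
  from q(1) obtain Q ps1 where Q: "carrier Q = {1..card (carrier (G Mod A))}" "\<nu> \<in> iso (G Mod A) Q"
      "lists_map ps1 (carrier G) (\<lambda>g. \<nu> (g <#\<^bsub>G\<^esub> A))" "q = cayley_word Q @ pairs_word ps1"
    unfolding quotient_given_by_def by blast
  from q(2) obtain Q' ps2 where Q': "carrier Q' = {1..card (carrier (H Mod B))}" "\<nu>' \<in> iso (H Mod B) Q'"
      "lists_map ps2 (carrier H) (\<lambda>h. \<nu>' (h <#\<^bsub>H\<^esub> B))" "q' = cayley_word Q' @ pairs_word ps2"
    unfolding quotient_given_by_def by blast
  have finA: "finite (carrier (G Mod A))" "card (carrier (G Mod A)) \<le> n"
  proof -
    have eq: "carrier (G Mod A) = (\<lambda>g. A #>\<^bsub>G\<^esub> g) ` carrier G" by (auto simp: FactGroup_def RCOSETS_def)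
    show "finite (carrier (G Mod A))" unfolding eq G(2) by simp
    show "card (carrier (G Mod A)) \<le> n" unfolding eq G(2) using card_image_le[of "{1..n}"] by simp
  qed
  have cardB: "card (carrier (H Mod B)) \<le> n"
  proof -
    have eq: "carrier (H Mod B) = (\<lambda>g. B #>\<^bsub>H\<^esub> g) ` carrier H" by (auto simp: FactGroup_def RCOSETS_def)
    show ?thesis unfolding eq H(2) using card_image_le[of "{1..n}"] by simp
  qed
  have inj\<nu>: "inj_on \<nu> (carrier (G Mod A))" "inj_on \<nu>' (carrier (H Mod B))"
    using Q(2) Q'(2) by (auto simp: iso_def bij_betw_def)
  note ps1 = lists_set_graph_pairs[OF Q(3)[unfolded lists_map_def], unfolded G(2), simplified]
  note ps2 = lists_set_graph_pairs[OF Q'(3)[unfolded lists_map_def], unfolded H(2), simplified]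
  note ps3 = lists_set_graph_pairs[OF ps3 inj\<nu>(1) finA(1)]
  define tabw where "tabw K = concat (map (\<lambda>i. map (\<lambda>j. i \<otimes>\<^bsub>K\<^esub> j) [1..<Suc n]) [1..<Suc n])" for K :: "nat monoid"
  have cw: "cayley_word G = n # tabw G" "cayley_word H = n # tabw H"
    by (simp_all add: cayley_word_def tabw_def G(2) H(2) Let_def)
  define tl where "tl = tabw G @ n # tabw H @ list_word as @ list_word as' @ cayley_word Q @ pairs_word ps1 @
    cayley_word Q' @ pairs_word ps2 @ pairs_word ps3"
  have wtl: "w = n # tl" by (simp add: w cw(1) cw(2) tl_def Q(4) Q'(4))
  define s0 where "s0 = input_state w"
  have in0: "s0 ''input'' (Suc i) = w ! i" if "i < length w" for i
    using that by (simp add: s0_def input_state_def)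
  have zero: "s0 z i = 0" if "z \<noteq> ''input''" for z i using that by (simp add: s0_def input_state_def)
  have i1: "s0 ''input'' 1 = n" using in0[of 0] by (simp add: wtl One_nat_def)
  then show "input_state w ''input'' 1 = n" by (simp add: s0_def)
  define s1 where "s1 = run SIZE s0"
  define s2 where "s2 = run SQUARE s1"
  define s3 where "s3 = run ROWS s2"
  define s4 where "s4 = run ENUMERATE s3"
  define s5 where "s5 = run PARSE s4"
  define s' where "s' = run SOLVE s5"
  have main: "run MAIN s2 = s'" unfolding MAIN_def s'_def s5_def s4_def s3_def by (simp only: run.simps(3))
  have s1: "s1 = set_var (set_var s0 ''n'' n) ''p'' 1" using i1 by (simp add: s1_def SIZE_def)
  have f2: "s2 z = s1 z" if "z \<notin> {''i'', ''N''}" for z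
    unfolding s2_def by (rule run_frame) (use that in \<open>simp add: SQUARE_def\<close>)
  have f3: "s3 z = s2 z" if "z \<notin> {''i'', ''row'', ''row2''}" for z
    unfolding s3_def by (rule run_frame) (use that in \<open>simp only: writes_ROWS not_False_eq_True\<close>)
  have f4: "s4 z = s3 z" if "z \<notin> {''i'', ''i2'', ''q'', ''P1'', ''P2''}" for z
    unfolding s4_def by (rule run_frame) (use that in \<open>simp only: writes_ENUMERATE not_False_eq_True\<close>)
  have f5: "s5 z = s4 z" if "z \<notin> {''i'', ''i2'', ''p'', ''m'', ''t'', ''mG'', ''mH'', ''pi'', ''pi0'', ''psi''}" for z
    unfolding s5_def by (rule run_frame) (use that in \<open>simp only: writes_PARSE not_False_eq_True\<close>)
  have n1: "s1 ''n'' 0 = n" "s1 ''N'' 0 = 0" by (simp_all add: s1 zero)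
  have n2: "s2 ''n'' 0 = n" using n1(1) f2 by simp
  have N2: "s2 ''N'' 0 = n * n" by (rule run_SQUARE[OF n1 s2_def])
  have rd3: "gr.ready s3" by (rule gr.run_ROWS[OF n2 N2 _ _ s3_def]) (simp_all add: f2 s1 zero)
  have n3: "s3 ''n'' 0 = n" by (rule gr.readyD(1)[OF rd3])
  have q3: "s3 ''q'' 0 = 0" by (simp add: f3 f2 s1 zero)
  note enum = gr.run_ENUMERATE[OF n3 q3 s4_def]
  have rd4: "gr.ready s4" using rd3 by (subst gr.ready_cong[of _ s3]) (simp_all add: f4)
  have rest4: "rest s4 tl"
  proof -
    have "s4 ''input'' (Suc (s4 ''p'' 0) + i) = tl ! i" if i: "i < length tl" for i
    proof -
      have "s4 ''input'' = s0 ''input''" "s4 ''p'' 0 = 1" by (simp_all add: f4 f3 f2 s1)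
      then show ?thesis using in0[of "Suc i"] i by (simp add: wtl Suc_eq_plus1)
    qed
    then show ?thesis by (simp add: rest_def)
  qed
  have cQ: "card (carrier Q) \<le> n" "card (carrier Q') \<le> n" using Q(1) Q'(1) finA(2) cardB by simp_all
  have lens: "length ps1 \<le> n" "length ps2 \<le> n" "length ps3 \<le> n" using ps1(2) ps2(2) ps3(2) finA(2) by simp_all
  note parse = gr.run_PARSE[OF rd4 rest4[unfolded tl_def tabw_def] cQ lens ps1(1) ps2(1) ps3(1) s5_def]
  have rd5: "gr.ready s5" using rd4 by (subst gr.ready_cong[of _ s4]) (simp_all add: f5)
  define P1 P2 where "P1 = s4 ''P1''" and "P2 = s4 ''P2''"
  have P5: "s5 ''P1'' j = P1 j \<and> s5 ''P2'' j = P2 j" for j by (simp add: P1_def P2_def f5)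
  have halves: "half n (n * n) K L D P1 P2" if "fibre K L D" "carrier K = {1..n}" "carrier L = {1..n}" for K L D
    by (intro half.intro half_axioms.intro that gr.grid_axioms) (use enum that in \<open>auto simp: P1_def P2_def\<close>)
  have idin: "(\<lambda>x. x) \<in> iso_over G G Y.P.C" by (simp add: iso_over_def Y.P.C_def iso_set_refl)
  interpret S: solver n "n * n" G H X.C Y.P.C P1 P2
    by (intro solver.intro solver_axioms.intro matching.intro halves X.fibre X.fibre' Y.P.fibre Y.P.fibre' G(2) H(2) idin)
  have lc: "g <#\<^bsub>G\<^esub> A \<in> carrier (G Mod A)" if "g \<in> {1..n}" for g
    using X.cosA[of g] X.lA[of g] that G(2) by simp
  have lc': "h <#\<^bsub>H\<^esub> B \<in> carrier (H Mod B)" if "h \<in> {1..n}" for h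
    using X.cosB[of h] X.lB[of h] that H(2) by simp
  have pi: "s5 ''pi'' g = \<nu> (g <#\<^bsub>G\<^esub> A)" if "g \<in> {1..n}" for g
    by (rule parse(3)) (use ps1(3)[of g] that in simp)
  have pi0: "s5 ''pi0'' h = \<nu>' (h <#\<^bsub>H\<^esub> B)" if "h \<in> {1..n}" for h
    by (rule parse(4)) (use ps2(3)[of h] that in simp)
  have ps: "s5 ''psi'' (\<nu> X) = \<nu>' (\<psi> X)" if "X \<in> carrier (G Mod A)" for X
    by (rule parse(5)) (rule ps3(3)[OF that])
  have C: "X.C g h \<longleftrightarrow> s5 ''psi'' (s5 ''pi'' g) = s5 ''pi0'' h" if gh: "g \<in> {1..n}" "h \<in> {1..n}" for g h
  proof -
    have "\<psi> (g <#\<^bsub>G\<^esub> A) \<in> carrier (H Mod B)" using X.hom.hom_closed lc[OF gh(1)] by blast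
    then show ?thesis
      using inj_on_eq_iff[OF inj\<nu>(2) _ lc'[OF gh(2)]] by (simp add: X.C_def pi[OF gh(1)] pi0[OF gh(2)] ps[OF lc[OF gh(1)]])
  qed
  have C': "Y.P.C g h \<longleftrightarrow> s5 ''pi'' g = s5 ''pi'' h" if gh: "g \<in> {1..n}" "h \<in> {1..n}" for g h
    using inj_on_eq_iff[OF inj\<nu>(1) lc[OF gh(1)] lc[OF gh(2)]] unfolding Y.P.C_def pi[OF gh(1)] pi[OF gh(2)] by simp
  have out5: "output_word s5 = []" by (simp add: output_word_def f5 f4 f3 f2 s1 zero One_nat_def)
  have tabs: "gr.tab s5 ''mG'' G" "gr.tab s5 ''mH'' H" using parse(1,2) by (simp_all add: gr.tab_def)
  have solve: "iso_over G H X.C = {} \<Longrightarrow> output_word s' = [0]"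
    "iso_over G H X.C \<noteq> {} \<Longrightarrow> \<exists>\<Phi>\<in>iso_over G H X.C. \<exists>L. length L = n * n \<and> set L \<subseteq> iso_over G G Y.P.C \<and>
      output_word s' = 1 # pairs_word (graph n \<Phi>) @ (n * n) # concat (map (\<lambda>\<alpha>. pairs_word (graph n \<alpha>)) L) \<and>
      (\<forall>i\<in>{1..n}. \<forall>h\<in>{1..n}. S.M'.extendible (S.M'.pre i h) \<longrightarrow>
         (\<exists>\<alpha>\<in>set L. S.M'.extends \<alpha> (S.M'.pre i h)))"
    subgoal by (rule S.run_SOLVE(1)[OF rd5 tabs]) (rule P5 C C' out5 s'_def; assumption)+
    subgoal by (rule S.run_SOLVE(2)[OF rd5 tabs]) (rule P5 C C' out5 s'_def; assumption)+
    done
  have "correct_output G H A B \<psi> (output_word s')"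
  proof (cases "iso_over G H X.C = {}")
    case True
    then show ?thesis using solve(1) by (simp add: correct_output_def X.inducing_isos_eq)
  next
    case False
    obtain \<Phi> L where Phi: "\<Phi> \<in> iso_over G H X.C" and L: "set L \<subseteq> iso_over G G Y.P.C" "length L = n * n"
      and out: "output_word s' = 1 # pairs_word (graph n \<Phi>) @ (n * n) # concat (map (\<lambda>\<alpha>. pairs_word (graph n \<alpha>)) L)"
      and gen: "\<And>i h. \<lbrakk>i \<in> {1..n}; h \<in> {1..n}; S.M'.extendible (S.M'.pre i h)\<rbrakk> \<Longrightarrow> \<exists>\<alpha>\<in>set L. S.M'.extends \<alpha> (S.M'.pre i h)"
      using solve(2)[OF False] by blast
    \<comment> \<open>members of \<open>Aut0\<close> are undefined outside \<open>G\<close>, so the automorphisms found are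
      restricted to it\<close>
    define \<alpha>s where "\<alpha>s = map (\<lambda>\<alpha>. restrict \<alpha> (carrier G)) L"
    have sub: "set \<alpha>s \<subseteq> Aut0 G A"
    proof
      fix \<beta> assume "\<beta> \<in> set \<alpha>s"
      then obtain \<alpha> where a: "\<alpha> \<in> iso_over G G Y.P.C" "\<beta> = restrict \<alpha> (carrier G)" using L(1) by (auto simp: \<alpha>s_def)
      then have a': "\<alpha> \<in> iso G G" by (simp add: iso_over_def)
      have "\<beta> \<in> hom G G" using a' G.m_closed unfolding a(2) iso_def by (auto simp: hom_def)
      moreover have "bij_betw \<beta> (carrier G) (carrier G)"
        using a' unfolding a(2) iso_def by (simp cong: bij_betw_cong)
      ultimately have "\<beta> \<in> iso G G" by (simp add: iso_def)
      moreover have "\<forall>g\<in>carrier G. Y.P.C g (\<beta> g)" using a by (auto simp: iso_over_def)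
      ultimately show "\<beta> \<in> Aut0 G A" using a(2) by (simp add: Y.Aut0_eq iso_over_def)
    qed
    have gen_eq: "generate (AutoGroup G) (set \<alpha>s) = Aut0 G A"
    proof (rule Y.generate_Aut0[OF sub])
      fix i \<Theta> assume i: "i \<in> {1..n}" and T: "\<Theta> \<in> Aut0 G A" and fixes_: "\<And>g. g \<in> {1..<i} \<Longrightarrow> \<Theta> g = g"
      have Ti: "\<Theta> i \<in> {1..n}" using Y.auto_closed[OF Y.Aut0_auto[OF T], of i] i G(2) by simp
      have To: "\<Theta> \<in> iso_over G G Y.P.C" using T by (simp add: Y.Aut0_eq)
      have "S.M'.extends \<Theta> (S.M'.pre i (\<Theta> i))"
        unfolding S.M'.extends_def S.M'.pre_def using fixes_ by auto
      then have "S.M'.extendible (S.M'.pre i (\<Theta> i))" using To by (auto simp: S.M'.extendible_def)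
      from gen[OF i Ti this] obtain \<alpha> where a: "\<alpha> \<in> set L" "S.M'.extends \<alpha> (S.M'.pre i (\<Theta> i))" by blast
      have a1: "\<alpha> g = g" if g: "g \<in> {1..<i}" for g
      proof -
        have "g \<in> {1..n}" "S.M'.pre i (\<Theta> i) g = g" using g i by (auto simp: S.M'.pre_def)
        then show ?thesis using a(2) g unfolding S.M'.extends_def by fastforce
      qed
      have a2: "\<alpha> i = \<Theta> i"
      proof -
        have "S.M'.pre i (\<Theta> i) i = \<Theta> i" by (simp add: S.M'.pre_def)
        then show ?thesis using a(2) i Ti unfolding S.M'.extends_def by fastforce
      qed
      have "restrict \<alpha> (carrier G) \<in> set \<alpha>s" using a(1) by (simp add: \<alpha>s_def)
      moreover have "\<forall>g\<in>{1..<i}. restrict \<alpha> (carrier G) g = g" using a1 i G(2) by auto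
      moreover have "restrict \<alpha> (carrier G) i = \<Theta> i" using a2 i G(2) by simp
      ultimately show "\<exists>\<alpha>\<in>set \<alpha>s. (\<forall>g\<in>{1..<i}. \<alpha> g = g) \<and> \<alpha> i = \<Theta> i" by blast
    qed
    have all2: "list_all2 (\<lambda>\<alpha> qs. lists_map qs (carrier G) \<alpha>) \<alpha>s (map (graph n) L)"
      unfolding \<alpha>s_def list_all2_map1 list_all2_map2
      by (rule list.rel_refl_strong) (rule lists_map_graph, simp_all add: G(2))
    have "iso_coset_given_by G H A B \<psi> (output_word s')"
      unfolding iso_coset_given_by_def
    proof (intro exI conjI)
      show "\<Phi> \<in> inducing_isos G H A B \<psi>" using Phi by (simp add: X.inducing_isos_eq)
      show "lists_map (graph n \<Phi>) (carrier G) \<Phi>" by (rule lists_map_graph[OF G(2)]) simp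
      show "generate (AutoGroup G) (set \<alpha>s) = Aut0 G A" by (rule gen_eq)
      show "list_all2 (\<lambda>\<alpha> qs. lists_map qs (carrier G) \<alpha>) \<alpha>s (map (graph n) L)" by (rule all2)
      show "output_word s' = 1 # pairs_word (graph n \<Phi>) @ length (map (graph n) L) # concat (map pairs_word (map (graph n) L))"
        unfolding out by (simp add: L(2) comp_def)
    qed
    then show ?thesis using False by (simp add: correct_output_def X.inducing_isos_eq)
  qed
  then show "correct_output G H A B \<psi> (output_word (run MAIN (run SQUARE (run SIZE (input_state w)))))"
    using main by (simp add: s2_def s1_def s0_def)
qed

theorem theorem1p1:
  shows "\<exists>p :: nat poly. \<forall>k::nat. k \<ge> 1 \<longrightarrow> (\<exists>P :: com.
    \<forall>(n::nat) (G :: nat monoid) (G\<^sub>0 :: nat monoid) (A :: nat set) (A\<^sub>0 :: nat set)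
      (\<psi> :: nat set \<Rightarrow> nat set) (w :: nat list).
      group G \<and> carrier G = {1..n} \<and> group G\<^sub>0 \<and> carrier G\<^sub>0 = {1..n} \<and>
      A \<lhd> G \<and> comm_group (G\<lparr>carrier := A\<rparr>) \<and>
      A\<^sub>0 \<lhd> G\<^sub>0 \<and> comm_group (G\<^sub>0\<lparr>carrier := A\<^sub>0\<rparr>) \<and>
      \<psi> \<in> iso (G Mod A) (G\<^sub>0 Mod A\<^sub>0) \<and> k_generated k (G Mod A) \<and>
      instance_given_by G G\<^sub>0 A A\<^sub>0 \<psi> w \<longrightarrow>
      (\<exists>t s. exec P (input_state w) t s \<and> t \<le> poly p (n ^ k) \<and>
        correct_output G G\<^sub>0 A A\<^sub>0 \<psi> (output_word s)))"
proof -
  let ?q = "time SIZE + (time SQUARE + time MAIN)"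
  \<comment> \<open>the time is bounded in terms of \<open>N = n * n\<close>, hence the substitution of the square\<close>
  let ?p = "pcompose ?q [:0, 0, 1:]"
  have "\<exists>t s. exec PROGRAM (input_state w) t s \<and> t \<le> poly ?p (n ^ k) \<and> correct_output G G\<^sub>0 A A\<^sub>0 \<psi> (output_word s)"
    if k: "1 \<le> k" and inst: "group G \<and> carrier G = {1..n} \<and> group G\<^sub>0 \<and> carrier G\<^sub>0 = {1..n} \<and>
      A \<lhd> G \<and> comm_group (G\<lparr>carrier := A\<rparr>) \<and>
      A\<^sub>0 \<lhd> G\<^sub>0 \<and> comm_group (G\<^sub>0\<lparr>carrier := A\<^sub>0\<rparr>) \<and>
      \<psi> \<in> iso (G Mod A) (G\<^sub>0 Mod A\<^sub>0) \<and> k_generated k (G Mod A) \<and>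
      instance_given_by G G\<^sub>0 A A\<^sub>0 \<psi> w"
    for k n :: nat and G G\<^sub>0 :: "nat monoid" and A A\<^sub>0 :: "nat set" and \<psi> :: "nat set \<Rightarrow> nat set" and w :: "nat list"
  proof -
    from inst have hyps: "group G" "carrier G = {1..n}" "group G\<^sub>0" "carrier G\<^sub>0 = {1..n}" "A \<lhd> G" "comm_group (G\<lparr>carrier := A\<rparr>)"
        "A\<^sub>0 \<lhd> G\<^sub>0" "comm_group (G\<^sub>0\<lparr>carrier := A\<^sub>0\<rparr>)" "\<psi> \<in> iso (G Mod A) (G\<^sub>0 Mod A\<^sub>0)"
        "instance_given_by G G\<^sub>0 A A\<^sub>0 \<psi> w" by blast+
    note correct = PROGRAM_correct[OF hyps]
    have N0: "input_state w ''N'' 0 = 0" by (simp add: input_state_def)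
    obtain t where t: "t \<le> poly ?q (n * n)"
      "exec PROGRAM (input_state w) t (run MAIN (run SQUARE (run SIZE (input_state w))))"
      using exec_PROGRAM[OF correct(1,2) N0] by blast
    have nk: "n \<le> n ^ k" using correct(1) k by (simp add: self_le_power)
    have "poly ?q (n * n) \<le> poly ?q (n ^ k * n ^ k)" by (intro poly_mono_nat mult_le_mono nk)
    also have "\<dots> = poly ?p (n ^ k)" by (simp add: poly_pcompose)
    finally have "t \<le> poly ?p (n ^ k)" using t(1) by simp
    then show ?thesis using t(2) correct(3) by blast
  qed
  then show ?thesis by blast
qed

end
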